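(* Let $t>0$. The Segal–Bargmann transform $f\mapsto H(t)f$, where \[H(t)f(z)=\sum_{\lambda\in\Lambda^+}r_\lambda e^{-\theta_\lambda t}\widehat f(\lambda)R_\lambda(z),\quad z\in\mathfrak a_{\mathbb C},\] is a unitary isomorphism from $L^2(A_0,w_m)$ onto the Hilbert space $\mathcal H_t$.
   Context: Let $\mathfrak a$ be a finite-dimensional real Euclidean space with inner product $\langle\cdot,\cdot\rangle$ (extended complex-bilinearly to $\mathfrak a_{\mathbb C}$), identified with its dual. Let $\Sigma\subset\mathfrak a$ be a (not necessarily reduced) root system with Weyl group $W$, positive subsystem $\Sigma^+$, coroot lattice $Q^\vee=\mathbb Z.\{2\alpha/\langle\alpha,\alpha\rangle\}$ and affine Weyl group $W_{\mathrm{aff}}=\pi Q^\vee\rtimes W$. Let $m:\Sigma\to[0,\infty)$ be $W$-invariant, $\rho=\frac12\sum_{\alpha\in\Sigma^+}m_\alpha\alpha$, $\lambda_\alpha=\langle\lambda,\alpha\rangle/\langle\alpha,\alpha\rangle$, $\Lambda^+=\{\lambda\in\mathfrak a:\lambda_\alpha\in\mathbb Z_{\ge0}\ \forall\alpha\in\Sigma^+\}$, $\mu\preceq\lambda$ iff $\lambda-\mu\in\mathbb Z_{\ge0}.\Sigma^+$. Let $w_m(x)=\prod_{\alpha\in\Sigma^+}|e^{i\langle\alpha,x\rangle}-e^{-i\langle\alpha,x\rangle}|^{m_\alpha}$, $A_0=\{x\in\mathfrak a:0\le\langle\alpha,x\rangle\le\pi\ \forall\alpha\in\Sigma^+\}$,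 $\langle f,g\rangle_m=\int_{A_0}f\bar g\,w_m\,dx$. Heckman–Opdam polynomials: $P_\lambda=\sum_{\mu\in\Lambda^+,\mu\preceq\lambda}c_{\lambda\mu}M_\mu$, $M_\mu=\sum_{\nu\in W\mu}e^{i\langle\nu,\cdot\rangle}$, $c_{\lambda\lambda}=1$, $\langle P_\lambda,M_\mu\rangle_m=0$ for $\mu\preceq\lambda$, $\mu\ne\lambda$; $R_\lambda=P_\lambda/P_\lambda(0)$ (entire on $\mathfrak a_{\mathbb C}$), $r_\lambda=1/\langle R_\lambda,R_\lambda\rangle_m$, $\theta_\lambda=\langle\lambda,\lambda+2\rho\rangle$. Fourier coefficients: $\widehat F(\lambda)=\int_{A_0}F(x)R_\lambda(-x)w_m(x)\,dx$. $\mathcal H_t$ is the space of holomorphic $F$ on $\mathfrak a_{\mathbb C}$ which are $W_{\mathrm{aff}}$-invariant in the real part of their argument and satisfy $\|F\|_{\mathcal H_t}<\infty$, with inner product $\langle F,G\rangle_{\mathcal H_t}=\sum_{\lambda\in\Lambda^+}r_\lambda\widehat F(\lambda)\overline{\widehat G(\lambda)}e^{2t\theta_\lambda}$. (The series defining $H(t)f$ converges normally on compact subsets of $\mathfrak a_{\mathbb C}$; on $A_0$ it coincides with $\int_{A_0}\Gamma_m(\cdot,y,t)f(y)w_m(y)dy$ for the heat kernel $\Gamma_m(x,y,t)=\sum_\lambda r_\lambda e^{-\theta_\lambda t}R_\lambda(x)R_\lambda(-y)$.) *)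

theory Defs
  imports "HOL-Analysis.Analysis"
begin

definition refl_root :: "'a::euclidean_space \<Rightarrow> 'a \<Rightarrow> 'a" where
  "refl_root \<alpha> x = x - (2 * (x \<bullet> \<alpha>) / (\<alpha> \<bullet> \<alpha>)) *\<^sub>R \<alpha>"

definition root_system :: "'a::euclidean_space set \<Rightarrow> bool" where
  "root_system R \<longleftrightarrow> finite R \<and> 0 \<notin> R \<and> span R = UNIV \<and>
     (\<forall>\<alpha>\<in>R. \<forall>\<beta>\<in>R. refl_root \<alpha> \<beta> \<in> R) \<and>
     (\<forall>\<alpha>\<in>R. \<forall>\<beta>\<in>R. 2 * (\<beta> \<bullet> \<alpha>) / (\<alpha> \<bullet> \<alpha>) \<in> \<int>)"

definition positive_subsystem :: "'a::euclidean_space set \<Rightarrow> 'a set \<Rightarrow> bool" where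
  "positive_subsystem R Rp \<longleftrightarrow>
     (\<exists>\<xi>. (\<forall>\<alpha>\<in>R. \<alpha> \<bullet> \<xi> \<noteq> 0) \<and> Rp = {\<alpha>\<in>R. \<alpha> \<bullet> \<xi> > 0})"

inductive_set weyl_group :: "'a::euclidean_space set \<Rightarrow> ('a \<Rightarrow> 'a) set" for R where
  wid: "id \<in> weyl_group R"
| wstep: "\<alpha> \<in> R \<Longrightarrow> w \<in> weyl_group R \<Longrightarrow> refl_root \<alpha> \<circ> w \<in> weyl_group R"

definition coroot_lattice :: "'a::euclidean_space set \<Rightarrow> 'a set" where
  "coroot_lattice R = {(\<Sum>\<alpha>\<in>R. of_int (k \<alpha>) *\<^sub>R ((2 / (\<alpha> \<bullet> \<alpha>)) *\<^sub>R \<alpha>)) | k. True}"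

definition root_coeff :: "'a::euclidean_space \<Rightarrow> 'a \<Rightarrow> real" where
  "root_coeff lam \<alpha> = (lam \<bullet> \<alpha>) / (\<alpha> \<bullet> \<alpha>)"

definition dominant :: "'a::euclidean_space set \<Rightarrow> 'a set" where
  "dominant Rp = {lam. \<forall>\<alpha>\<in>Rp. \<exists>n::nat. root_coeff lam \<alpha> = real n}"

definition root_prec :: "'a::euclidean_space set \<Rightarrow> 'a \<Rightarrow> 'a \<Rightarrow> bool" where
  "root_prec Rp \<mu> lam \<longleftrightarrow> (\<exists>k::'a \<Rightarrow> nat. lam - \<mu> = (\<Sum>\<alpha>\<in>Rp. real (k \<alpha>) *\<^sub>R \<alpha>))"

definition lower_set :: "'a::euclidean_space set \<Rightarrow> 'a \<Rightarrow> 'a set" where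
  "lower_set Rp lam = {\<mu> \<in> dominant Rp. root_prec Rp \<mu> lam}"

definition rho :: "'a::euclidean_space set \<Rightarrow> ('a \<Rightarrow> real) \<Rightarrow> 'a" where
  "rho Rp m = (1/2) *\<^sub>R (\<Sum>\<alpha>\<in>Rp. m \<alpha> *\<^sub>R \<alpha>)"

definition theta :: "'a::euclidean_space set \<Rightarrow> ('a \<Rightarrow> real) \<Rightarrow> 'a \<Rightarrow> real" where
  "theta Rp m lam = lam \<bullet> (lam + 2 *\<^sub>R rho Rp m)"

section \<open>Complexification: z = x + iy is represented by the pair (x, y)\<close>

definition cinner :: "'a::euclidean_space \<Rightarrow> 'a \<times> 'a \<Rightarrow> complex" where
  "cinner \<nu> z = Complex (\<nu> \<bullet> fst z) (\<nu> \<bullet> snd z)"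

text \<open>Holomorphy on the complexification: real-differentiable with complex-linear derivative
  (multiplication by i on (x,y) is (-y,x)).\<close>
definition holomorphic_C :: "('a::euclidean_space \<times> 'a \<Rightarrow> complex) \<Rightarrow> bool" where
  "holomorphic_C F \<longleftrightarrow> (\<forall>z. \<exists>D. (F has_derivative D) (at z) \<and>
       (\<forall>u v. D (- v, u) = \<i> * D (u, v)))"

definition waff_invariant :: "'a::euclidean_space set \<Rightarrow> ('a \<times> 'a \<Rightarrow> complex) \<Rightarrow> bool" where
  "waff_invariant R F \<longleftrightarrow> (\<forall>w\<in>weyl_group R. \<forall>q\<in>coroot_lattice R. \<forall>x y.
       F (w x + pi *\<^sub>R q, w y) = F (x, y))"

definition pow0 :: "real \<Rightarrow> real \<Rightarrow> real" where
  "pow0 a e = (if e = 0 then 1 else a powr e)"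

definition weight :: "'a::euclidean_space set \<Rightarrow> ('a \<Rightarrow> real) \<Rightarrow> 'a \<Rightarrow> real" where
  "weight Rp m x = (\<Prod>\<alpha>\<in>Rp. pow0 (cmod (exp (\<i> * of_real (\<alpha> \<bullet> x)) - exp (- \<i> * of_real (\<alpha> \<bullet> x)))) (m \<alpha>))"

definition alcove :: "'a::euclidean_space set \<Rightarrow> 'a set" where
  "alcove Rp = {x. \<forall>\<alpha>\<in>Rp. 0 \<le> \<alpha> \<bullet> x \<and> \<alpha> \<bullet> x \<le> pi}"

definition ip_m :: "'a::euclidean_space set \<Rightarrow> ('a \<Rightarrow> real) \<Rightarrow> ('a \<Rightarrow> complex) \<Rightarrow> ('a \<Rightarrow> complex) \<Rightarrow> complex" where
  "ip_m Rp m f g = (LINT x:alcove Rp|lebesgue. f x * cnj (g x) * of_real (weight Rp m x))"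

definition L2_m :: "'a::euclidean_space set \<Rightarrow> ('a \<Rightarrow> real) \<Rightarrow> ('a \<Rightarrow> complex) set" where
  "L2_m Rp m = {f. set_borel_measurable lebesgue (alcove Rp) f \<and>
      set_integrable lebesgue (alcove Rp) (\<lambda>x. (cmod (f x))\<^sup>2 * weight Rp m x)}"

definition orbit_sum :: "'a::euclidean_space set \<Rightarrow> 'a \<Rightarrow> 'a \<times> 'a \<Rightarrow> complex" where
  "orbit_sum R \<mu> z = (\<Sum>\<nu>\<in>(\<lambda>w. w \<mu>) ` weyl_group R. exp (\<i> * cinner \<nu> z))"

definition HO_coeffs :: "'a::euclidean_space set \<Rightarrow> 'a set \<Rightarrow> ('a \<Rightarrow> real) \<Rightarrow> 'a \<Rightarrow> ('a \<Rightarrow> complex) \<Rightarrow> bool" where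
  "HO_coeffs R Rp m lam c \<longleftrightarrow> (\<forall>\<mu>. \<mu> \<notin> lower_set Rp lam \<longrightarrow> c \<mu> = 0) \<and> c lam = 1 \<and>
     (\<forall>\<mu>\<in>lower_set Rp lam. \<mu> \<noteq> lam \<longrightarrow>
        ip_m Rp m (\<lambda>x. \<Sum>\<nu>\<in>lower_set Rp lam. c \<nu> * orbit_sum R \<nu> (x, 0))
                  (\<lambda>x. orbit_sum R \<mu> (x, 0)) = 0)"

definition HO_P :: "'a::euclidean_space set \<Rightarrow> 'a set \<Rightarrow> ('a \<Rightarrow> real) \<Rightarrow> 'a \<Rightarrow> 'a \<times> 'a \<Rightarrow> complex" where
  "HO_P R Rp m lam z = (\<Sum>\<nu>\<in>lower_set Rp lam. (THE c. HO_coeffs R Rp m lam c) \<nu> * orbit_sum R \<nu> z)"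

definition HO_R :: "'a::euclidean_space set \<Rightarrow> 'a set \<Rightarrow> ('a \<Rightarrow> real) \<Rightarrow> 'a \<Rightarrow> 'a \<times> 'a \<Rightarrow> complex" where
  "HO_R R Rp m lam z = HO_P R Rp m lam z / HO_P R Rp m lam (0, 0)"

definition r_coef :: "'a::euclidean_space set \<Rightarrow> 'a set \<Rightarrow> ('a \<Rightarrow> real) \<Rightarrow> 'a \<Rightarrow> real" where
  "r_coef R Rp m lam = 1 / Re (ip_m Rp m (\<lambda>x. HO_R R Rp m lam (x, 0)) (\<lambda>x. HO_R R Rp m lam (x, 0)))"

definition fourier :: "'a::euclidean_space set \<Rightarrow> 'a set \<Rightarrow> ('a \<Rightarrow> real) \<Rightarrow> ('a \<Rightarrow> complex) \<Rightarrow> 'a \<Rightarrow> complex" where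
  "fourier R Rp m f lam = (LINT x:alcove Rp|lebesgue. f x * HO_R R Rp m lam (- x, 0) * of_real (weight Rp m x))"

definition Ht_space :: "'a::euclidean_space set \<Rightarrow> 'a set \<Rightarrow> ('a \<Rightarrow> real) \<Rightarrow> real \<Rightarrow> ('a \<times> 'a \<Rightarrow> complex) set" where
  "Ht_space R Rp m t = {F. holomorphic_C F \<and> waff_invariant R F \<and>
     (\<lambda>lam. r_coef R Rp m lam * (cmod (fourier R Rp m (\<lambda>x. F (x, 0)) lam))\<^sup>2 * exp (2 * t * theta Rp m lam))
        summable_on dominant Rp}"

definition Ht_inner :: "'a::euclidean_space set \<Rightarrow> 'a set \<Rightarrow> ('a \<Rightarrow> real) \<Rightarrow> real \<Rightarrow> ('a \<times> 'a \<Rightarrow> complex) \<Rightarrow> ('a \<times> 'a \<Rightarrow> complex) \<Rightarrow> complex" where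
  "Ht_inner R Rp m t F G = (\<Sum>\<^sub>\<infinity>lam\<in>dominant Rp.
     of_real (r_coef R Rp m lam) * fourier R Rp m (\<lambda>x. F (x, 0)) lam *
     cnj (fourier R Rp m (\<lambda>x. G (x, 0)) lam) * of_real (exp (2 * t * theta Rp m lam)))"

definition segal_bargmann :: "'a::euclidean_space set \<Rightarrow> 'a set \<Rightarrow> ('a \<Rightarrow> real) \<Rightarrow> real \<Rightarrow> ('a \<Rightarrow> complex) \<Rightarrow> 'a \<times> 'a \<Rightarrow> complex" where
  "segal_bargmann R Rp m t f z = (\<Sum>\<^sub>\<infinity>lam\<in>dominant Rp.
     of_real (r_coef R Rp m lam * exp (- theta Rp m lam * t)) * fourier R Rp m f lam * HO_R R Rp m lam z)"

end

theory Submission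
  imports Defs "HOL-Complex_Analysis.Complex_Analysis"
begin

text \<open>
  The transform multiplies the Fourier coefficient at \<open>lam\<close> by \<open>exp (- theta lam * t)\<close>, so unitarity
  is Parseval's identity for the polynomials \<open>R\<close>, and surjectivity is the Riesz--Fischer theorem
  combined with the identity principle for entire functions. Three facts about the polynomials carry this.

  Orthogonality: the Cherednik operators are symmetric and triangular, with joint eigenvalues that
  separate the dominant weights. Symmetry is integration by parts, which rests on the translation
  invariance of means of periodic functions over the Weyl images of the alcove; the latter uses that
  the alcove is a fundamental domain of the affine Weyl group.

  Growth: the invariant second order operator acts on orbit sums triangularly with nonnegative
  off-diagonal coefficients. Hence the polynomials have nonnegative coefficients, \<open>R lam\<close> is an average of
  exponentials with frequencies of length at most \<open>norm lam\<close>, and all series converge.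

  Completeness: invariant trigonometric polynomials separate the points of the alcove, so
  Stone--Weierstrass applies.
\<close>

section \<open>Locally finite affine reflection groups\<close>

text \<open>Two obstacles shape the proof. The multiplicities are arbitrary nonnegative reals, so
  the weight need not be differentiable on the walls. Derivatives are therefore taken of a
  regularized weight \<open>wfun eps\<close>, whose logarithmic derivative involves
  \<open>kreg eps\<close> in place of the cotangent, and eps tends to 0 by dominated convergence.
  Secondly, theta need not separate dominant weights that are incomparable, so the second order
  operator yields orthogonality only along the dominance order. Incomparable weights need the first
  order operators, which in general do not preserve invariant functions. Hence the inner product
  \<open>wip\<close> lives on all trigonometric polynomials and sums over the Weyl images of the
  alcove; \<open>wip_ip_m\<close> returns to the alcove at the end. Crude growth bounds suffice:
  r_lambda is at most a constant times exp |lambda|, R_lambda(z) is at most exp (|lambda| |Im z|),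
  and theta_lambda >= |lambda|^2 beats both.\<close>

definition aff_refl :: "'a::euclidean_space => real => 'a => 'a" where
  "aff_refl n c x = x - (2 * (n \<bullet> x - c) / (n \<bullet> n)) *\<^sub>R n"

text \<open>Encodes that the mirror of t lies strictly between a and b. Using distances alone makes
  the notion invariant under isometries (\<open>separates_conj\<close>) and independent of the
  normal n and offset c that represent t.\<close>

definition separates :: "('a::euclidean_space => 'a) => 'a => 'a => bool" where
  "separates t a b \<longleftrightarrow> dist a (t b) < dist a b"

lemma dist_aff_refl_sq:
  assumes "n ~= 0"
  shows "(dist a (aff_refl n c b))^2 = (dist a b)^2 + 4 * ((n \<bullet> a - c) * (n \<bullet> b - c)) / (n \<bullet> n)"
proof -
  define k where "k = 2 * (n \<bullet> b - c) / (n \<bullet> n)"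
  have k: "k * (n \<bullet> n) = 2 * (n \<bullet> b - c)"
    using assms by (simp add: k_def)
  have "(dist a (aff_refl n c b))^2 = (norm ((a - b) + k *\<^sub>R n))^2"
    by (simp add: dist_norm aff_refl_def k_def algebra_simps)
  also have "... = (norm (a - b))^2 + 2 * k * (n \<bullet> (a - b)) + k * (k * (n \<bullet> n))"
    unfolding power2_norm_eq_inner
    by (simp add: inner_add_left inner_add_right inner_commute algebra_simps)
  also have "... = (norm (a - b))^2 + 2 * k * (n \<bullet> a - c)"
    unfolding k by (simp add: inner_diff_right algebra_simps)
  also have "2 * k * (n \<bullet> a - c) = 4 * ((n \<bullet> a - c) * (n \<bullet> b - c)) / (n \<bullet> n)"
    by (simp add: k_def)
  finally show ?thesis by (simp add: dist_norm)
qed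

lemma separates_aff_refl:
  assumes "n ~= 0"
  shows "separates (aff_refl n c) a b \<longleftrightarrow> (n \<bullet> a - c) * (n \<bullet> b - c) < 0"
proof -
  have "separates (aff_refl n c) a b \<longleftrightarrow> (dist a (aff_refl n c b))^2 < (dist a b)^2"
    unfolding separates_def
    by (metis power_less_imp_less_base power_strict_mono zero_le_dist zero_less_numeral)
  also have "... \<longleftrightarrow> (n \<bullet> a - c) * (n \<bullet> b - c) < 0"
    unfolding dist_aff_refl_sq[OF assms] using assms inner_gt_zero_iff[of n] by (auto simp: divide_less_0_iff simp del: inner_gt_zero_iff)
  finally show ?thesis .
qed

lemma aff_refl_fixed: "n ~= 0 ==> aff_refl n c x = x \<longleftrightarrow> n \<bullet> x = c"
  by (simp add: aff_refl_def)

lemma inner_aff_refl: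
  "n' \<bullet> aff_refl n c x - c' = (n' \<bullet> x - c') - 2 * ((n' \<bullet> n) / (n \<bullet> n)) * (n \<bullet> x - c)"
  by (simp add: aff_refl_def inner_diff_right algebra_simps)

lemma aff_refl_aff_refl: "n ~= 0 ==> aff_refl n c (aff_refl n c x) = x"
proof -
  assume n: "n ~= 0"
  have "n \<bullet> aff_refl n c x - c = - (n \<bullet> x - c)"
    using n by (simp add: inner_aff_refl)
  then show ?thesis
    unfolding aff_refl_def[of n c "aff_refl n c x"]
    by (simp only: mult_minus_right minus_divide_left[symmetric] scaleR_minus_left) (simp add: aff_refl_def)
qed

lemma dist_aff_refl: "n ~= 0 ==> dist (aff_refl n c x) (aff_refl n c y) = dist x y"
proof -
  assume n: "n ~= 0"
  have "(dist (aff_refl n c x) (aff_refl n c y))^2 = (dist x y)^2"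
    using dist_aff_refl_sq[OF n, of "aff_refl n c x" c y] dist_aff_refl_sq[OF n, of y c x] n
    by (simp add: inner_aff_refl dist_commute add_divide_distrib[symmetric]) (simp add: algebra_simps)
  then show ?thesis by simp
qed

lemma continuous_aff_refl: "continuous_on UNIV (aff_refl n c)"
  unfolding aff_refl_def by (cases "n = 0") (auto intro!: continuous_intros)

lemma aff_refl_scaleR: "k ~= 0 ==> aff_refl (k *\<^sub>R n) (k * c) = aff_refl n c"
proof (rule ext)
  fix x assume k: "k ~= 0"
  have "2 * ((k *\<^sub>R n) \<bullet> x - k * c) / ((k *\<^sub>R n) \<bullet> (k *\<^sub>R n)) * k = 2 * (n \<bullet> x - c) / (n \<bullet> n)"
    using k by (cases "n = 0") (auto simp: field_simps)
  then show "aff_refl (k *\<^sub>R n) (k * c) x = aff_refl n c x"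
    unfolding aff_refl_def scaleR_scaleR by simp
qed

text \<open>Only the set of reflections is given; the group they generate appears later through
  words (\<open>wprod\<close>). Local finiteness bounds the mirrors that meet a ball, so a segment
  crosses finitely many.\<close>

locale reflection_arrangement =
  fixes T :: "('a::euclidean_space => 'a) set"
  assumes refl: "t : T ==> \<exists>n c. n ~= 0 \<and> t = aff_refl n c"
    and conj_closed: "t : T ==> u : T ==> t \<circ> u \<circ> t : T"
    and locally_finite: "finite {t : T. \<exists>x\<in>cball 0 r. t x = x}"
begin

definition regular :: "'a => bool" where
  "regular a \<longleftrightarrow> (\<forall>t\<in>T. t a ~= a)"

lemma invol: "t : T ==> t (t x) = x"
  using refl aff_refl_aff_refl by metis

lemma isometric: "t : T ==> dist (t x) (t y) = dist x y"
  using refl dist_aff_refl by metis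

lemma separates_conj:
  "u : T ==> separates (u \<circ> t \<circ> u) (u a) (u b) \<longleftrightarrow> separates t a b"
  by (simp add: separates_def invol isometric)

lemma separates_sym: "t : T ==> separates t a b \<longleftrightarrow> separates t b a"
  using refl[of t] separates_aff_refl by (metis mult.commute)

lemma separates_xor:
  assumes "t : T" "t a ~= a" "t b ~= b" "t c ~= c"
  shows "separates t a c \<longleftrightarrow> separates t a b ~= separates t b c"
proof -
  obtain n k where n: "n ~= 0" "t = aff_refl n k" using refl assms by blast
  have "n \<bullet> a - k ~= 0" "n \<bullet> b - k ~= 0" "n \<bullet> c - k ~= 0"
    using assms n by (auto simp: aff_refl_fixed)
  then show ?thesis
    unfolding n(2) separates_aff_refl[OF n(1)] mult_less_0_iff by auto
qed

lemma separates_image: "t : T ==> t a ~= a ==> separates t a (t a)"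
  by (simp add: separates_def invol)

lemma regular_image: "regular a ==> t : T ==> regular (t a)"
  unfolding regular_def
proof
  fix u assume "\<forall>t\<in>T. t a ~= a" "t : T" "u : T"
  then have "(t \<circ> u \<circ> t) a ~= a" using conj_closed by blast
  then show "u (t a) ~= t a"
    using invol \<open>t : T\<close> by (metis comp_apply)
qed

lemma separates_crossing:
  assumes "t : T" "separates t a b"
  shows "\<exists>s\<in>{0<..<1}. t (a + s *\<^sub>R (b - a)) = a + s *\<^sub>R (b - a)"
proof -
  obtain n k where n: "n ~= 0" "t = aff_refl n k" using refl assms by blast
  define A B where "A = n \<bullet> a - k" and "B = n \<bullet> b - k"
  have AB: "A * B < 0" using assms n by (simp add: separates_aff_refl A_def B_def)
  define s where "s = A / (A - B)"
  have "A ~= B" using AB by (metis linorder_not_less zero_le_square)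
  have s: "s : {0<..<1}"
    using AB by (auto simp: s_def mult_less_0_iff field_simps)
  have "n \<bullet> (a + s *\<^sub>R (b - a)) - k = A - s * (A - B)"
    by (simp add: A_def B_def algebra_simps inner_add_right inner_diff_right)
  also have "... = 0" using \<open>A ~= B\<close> by (simp add: s_def)
  finally show ?thesis
    using s n by (auto simp: aff_refl_fixed intro!: bexI[of _ s])
qed

lemma no_separation:
  assumes "t : T" "convex C" "a : C" "b : C" "!!x. x : C ==> t x ~= x"
  shows "\<not> separates t a b"
proof
  assume "separates t a b"
  then obtain s where s: "s : {0<..<1}" "t (a + s *\<^sub>R (b - a)) = a + s *\<^sub>R (b - a)"
    using separates_crossing assms by blast
  have "a + s *\<^sub>R (b - a) = (1 - s) *\<^sub>R a + s *\<^sub>R b" by (simp add: algebra_simps)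
  also have "... : C" using assms s by (intro convexD) auto
  finally show False using s assms by blast
qed

lemma finite_separating: "finite {t : T. separates t a b}"
proof (rule finite_subset[OF _ locally_finite[of "norm a + norm b"]], safe)
  fix t assume t: "t : T" "separates t a b"
  show "\<exists>x\<in>cball 0 (norm a + norm b). t x = x"
  proof (rule ccontr)
    assume "\<not> ?thesis"
    with no_separation[OF t(1), of "cball 0 (norm a + norm b)" a b] t show False by auto
  qed
qed

lemma countable_T: "countable T"
proof -
  have "T \<subseteq> (\<Union>r::nat. {t : T. \<exists>x\<in>cball 0 (real r). t x = x})"
  proof
    fix t assume t: "t : T"
    then obtain n k where n: "n ~= 0" "t = aff_refl n k" using refl by blast
    define x where "x = (k / (n \<bullet> n)) *\<^sub>R n"
    have "t x = x" using n by (simp add: aff_refl_fixed x_def)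
    moreover obtain r :: nat where "norm x \<le> real r" using real_arch_simple by blast
    ultimately show "t : (\<Union>r::nat. {t : T. \<exists>x\<in>cball 0 (real r). t x = x})"
      using t by (intro UN_I[of r]) auto
  qed
  moreover have "countable (\<Union>r::nat. {t : T. \<exists>x\<in>cball 0 (real r). t x = x})"
    using locally_finite by (intro countable_UN) (auto intro: countable_finite)
  ultimately show ?thesis by (rule countable_subset)
qed

text \<open>Only mirrors meeting the ball of radius \<open>norm z + 1\<close> about 0 can come
  within distance 1 of z, and these are finitely many.\<close>

lemma ball_avoiding:
  assumes "U \<subseteq> T" "!!u. u : U ==> u z ~= z"
  shows "\<exists>e>0. \<forall>u\<in>U. \<forall>x\<in>ball z e. u x ~= x"
proof -
  define V where "V = {u : U. \<exists>x\<in>cball 0 (norm z + 1). u x = x}"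
  have fV: "finite V"
    unfolding V_def by (rule finite_subset[OF _ locally_finite[of "norm z + 1"]]) (use assms in auto)
  have op: "open {x. u x ~= x}" if "u : V" for u
  proof -
    from that assms obtain n c where "u = aff_refl n c" using refl unfolding V_def by blast
    then show ?thesis using continuous_aff_refl by (auto intro!: open_Collect_neq continuous_intros)
  qed
  have "open ((\<Inter>u\<in>V. {x. u x ~= x}) \<inter> ball z 1)"
    using fV op by (intro open_Int open_INT) auto
  moreover have "z : (\<Inter>u\<in>V. {x. u x ~= x}) \<inter> ball z 1"
    using assms by (auto simp: V_def)
  ultimately obtain e where e: "e > 0" "ball z e \<subseteq> (\<Inter>u\<in>V. {x. u x ~= x}) \<inter> ball z 1"
    unfolding open_contains_ball by blast
  have "u x ~= x" if "u : U" "x : ball z e" for u x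
  proof
    assume "u x = x"
    have "x : ball z 1" using e that by auto
    then have "norm x \<le> norm z + 1"
      using norm_triangle_sub[of x z] by (auto simp: dist_norm norm_minus_commute)
    then have "u : V" using that \<open>u x = x\<close> by (auto simp: V_def)
    then show False using e that \<open>u x = x\<close> by auto
  qed
  then show ?thesis using e by blast
qed

text \<open>For two distinct mirrors, the endpoints b whose line from a runs through the
  intersection of both lie in a hyperplane. There are countably many pairs of mirrors, so these null
  sets do not exhaust an open set.\<close>

lemma generic_endpoint:
  assumes a: "regular a" and B: "open B" "B ~= {}"
  shows "\<exists>b\<in>B. \<forall>t\<in>T. \<forall>u\<in>T. \<forall>s.
           t (a + s *\<^sub>R (b - a)) = a + s *\<^sub>R (b - a) --> u (a + s *\<^sub>R (b - a)) = a + s *\<^sub>R (b - a) --> t = u"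
proof -
  define Bad where "Bad t u = {b. \<exists>s. t (a + s *\<^sub>R (b - a)) = a + s *\<^sub>R (b - a) \<and> u (a + s *\<^sub>R (b - a)) = a + s *\<^sub>R (b - a)}"
    for t u :: "'a => 'a"
  have neg: "negligible (Bad t u)" if tu: "t : T" "u : T" "t ~= u" for t u
  proof -
    obtain n c where n: "n ~= 0" "t = aff_refl n c" using refl tu by blast
    obtain n' c' where n': "n' ~= 0" "u = aff_refl n' c'" using refl tu by blast
    define A A' where "A = n \<bullet> a - c" and "A' = n' \<bullet> a - c'"
    have A: "A ~= 0" "A' ~= 0"
      using a n n' tu by (auto simp: regular_def A_def A'_def aff_refl_fixed)
    \<comment> \<open>At a common point, s (n . (b - a)) = - A and s (n' . (b - a)) = - A'.
      Eliminating s leaves the normal v of the hyperplane of bad endpoints.\<close>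
    define v where "v = A *\<^sub>R n' - A' *\<^sub>R n"
    have "v ~= 0"
    proof
      assume "v = 0"
      then have nn: "n' = (A' / A) *\<^sub>R n"
        using A vector_fraction_eq_iff[of A' A n n'] by (simp add: v_def)
      then have "n' \<bullet> a = (A' / A) * (n \<bullet> a)" by simp
      then have "c' = (A' / A) * c"
        using A by (simp add: A'_def A_def) (simp add: field_simps)
      then have "u = t"
        unfolding n n' using nn aff_refl_scaleR[of "A' / A" n c] A by simp
      then show False using tu by simp
    qed
    have "Bad t u \<subseteq> {b. v \<bullet> b = v \<bullet> a}"
    proof
      fix b assume "b : Bad t u"
      then obtain s where "n \<bullet> (a + s *\<^sub>R (b - a)) = c" "n' \<bullet> (a + s *\<^sub>R (b - a)) = c'"
        using n n' by (auto simp: Bad_def aff_refl_fixed)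
      then have 1: "s * (n \<bullet> (b - a)) = - A" and 2: "s * (n' \<bullet> (b - a)) = - A'"
        by (auto simp: A_def A'_def inner_add_right)
      have "s ~= 0" using 1 A by auto
      have "s * (v \<bullet> (b - a)) = A * (s * (n' \<bullet> (b - a))) - A' * (s * (n \<bullet> (b - a)))"
        by (simp add: v_def inner_diff_left algebra_simps)
      also have "... = 0" unfolding 1 2 by simp
      finally show "b : {b. v \<bullet> b = v \<bullet> a}"
        using \<open>s ~= 0\<close> by (simp add: inner_diff_right)
    qed
    moreover have "negligible {b. v \<bullet> b = v \<bullet> a}"
      using \<open>v ~= 0\<close> by (intro negligible_hyperplane) auto
    ultimately show ?thesis by (rule negligible_subset[rotated])
  qed
  define Z where "Z = (%(t, u). Bad t u) ` {(t, u). t : T \<and> u : T \<and> t ~= u}"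
  have "countable {(t, u). t : T \<and> u : T \<and> t ~= u}"
    by (rule countable_subset[of _ "T \<times> T"]) (auto intro: countable_T)
  then have "negligible (\<Union>Z)"
    using neg by (intro negligible_countable_Union) (auto simp: Z_def)
  then have "\<not> B \<subseteq> \<Union>Z"
    using open_not_negligible[OF B] negligible_subset by blast
  then obtain b where b: "b : B" "b \<notin> \<Union>Z" by blast
  show ?thesis
  proof (rule bexI[OF _ b(1)], intro ballI allI impI, rule ccontr)
    fix t u s assume *: "t : T" "u : T" "t ~= u"
      "t (a + s *\<^sub>R (b - a)) = a + s *\<^sub>R (b - a)" "u (a + s *\<^sub>R (b - a)) = a + s *\<^sub>R (b - a)"
    then have "b : Bad t u" by (auto simp: Bad_def)
    then show False using b(2) * by (auto simp: Z_def)
  qed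
qed

text \<open>The first mirror met on a generic path out of a chamber is a wall of that chamber.\<close>
lemma simple_separator:
  assumes p: "regular p" and q: "regular q" and t: "t : T" "separates t p q"
  shows "\<exists>s\<in>T. separates s p q \<and> {u : T. separates u p (s p)} = {s}"
proof -
  obtain e where e: "e > 0" "\<forall>u\<in>T. \<forall>x\<in>ball q e. u x ~= x"
    using ball_avoiding[of T q] q by (auto simp: regular_def)
  \<comment> \<open>Replacing q by a nearby generic b changes no separation from p, but the mirrors
    are now crossed one at a time.\<close>
  obtain b where b: "b : ball q e" and gen: "!!t u s. t : T ==> u : T ==>
      t (p + s *\<^sub>R (b - p)) = p + s *\<^sub>R (b - p) ==> u (p + s *\<^sub>R (b - p)) = p + s *\<^sub>R (b - p) ==> t = u"
    using generic_endpoint[OF p, of "ball q e"] e by auto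
  have breg: "regular b" using e b by (auto simp: regular_def)
  have bq: "separates u p b \<longleftrightarrow> separates u p q" if "u : T" for u
  proof -
    have "\<not> separates u q b" using that e b by (intro no_separation[of u "ball q e"]) auto
    then show ?thesis using separates_xor[of u p q b] that p q breg by (auto simp: regular_def)
  qed
  define N where "N = {u : T. separates u p b}"
  have "finite N" unfolding N_def by (rule finite_separating)
  have "t : N" using t bq by (simp add: N_def)
  define z where "z s = p + s *\<^sub>R (b - p)" for s
  have "\<forall>u\<in>N. \<exists>s. s : {0<..<1} \<and> u (z s) = z s"
    using separates_crossing unfolding N_def z_def by blast
  then obtain \<sigma> where \<sigma>: "!!u. u : N ==> \<sigma> u : {0<..<1} \<and> u (z (\<sigma> u)) = z (\<sigma> u)" by metis
  obtain s where sN: "s : N" and smin: "!!u. u : N ==> \<sigma> s \<le> \<sigma> u"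
    by (metis (no_types, lifting) emptyE linorder_not_le \<open>finite N\<close> \<open>t : N\<close> arg_min_if_finite)
  have sT: "s : T" using sN by (simp add: N_def)
  have \<sigma>s: "0 < \<sigma> s" "\<sigma> s < 1" "s (z (\<sigma> s)) = z (\<sigma> s)" using \<sigma>[OF sN] by auto
  have before: "u (z r) ~= z r" if uT: "u : T" and "r : {0..<\<sigma> s}" for u r
  proof
    assume fx: "u (z r) = z r"
    obtain n k where n: "n ~= 0" "u = aff_refl n k" using refl uT by blast
    define A D where "A = n \<bullet> p - k" and "D = n \<bullet> (b - p)"
    have zz: "u (z x) = z x \<longleftrightarrow> A + x * D = 0" for x
      unfolding n(2) aff_refl_fixed[OF n(1)] by (auto simp: z_def A_def D_def inner_add_right)
    have A: "A ~= 0" using p uT n by (auto simp: regular_def A_def aff_refl_fixed)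
    have Ar: "A + r * D = 0" using fx zz by blast
    have r: "0 < r" "r < 1" using that \<sigma>s Ar A by (auto simp: less_le)
    have "n \<bullet> b - k = A + D" by (simp add: A_def D_def inner_diff_right)
    also have "A + D = (1 - 1 / r) * A" using Ar r by (simp add: field_simps)
    finally have "(n \<bullet> p - k) * (n \<bullet> b - k) = (1 - 1/r) * A^2"
      by (simp add: A_def power2_eq_square)
    also have "... < 0" using r A by (simp add: mult_less_0_iff)
    finally have "u : N" using n uT by (simp add: N_def separates_aff_refl)
    then have "A + \<sigma> u * D = 0" "\<sigma> s \<le> \<sigma> u" using \<sigma> smin zz by auto
    then have "(\<sigma> u - r) * D = 0" using Ar by (simp only: left_diff_distrib)
    moreover have "\<sigma> u ~= r" using that \<open>\<sigma> s \<le> \<sigma> u\<close> by auto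
    ultimately show False using Ar A by simp
  qed
  obtain \<rho> where \<rho>: "\<rho> > 0" "!!u x. u : T - {s} ==> x : ball (z (\<sigma> s)) \<rho> ==> u x ~= x"
    using ball_avoiding[of "T - {s}" "z (\<sigma> s)"] gen[OF _ sT] \<sigma>s unfolding z_def by blast
  \<comment> \<open>The point y lies on the path just before the first crossing, so close to it that
    y and s y share a ball that no mirror other than that of s meets.\<close>
  define d where "d = min (\<sigma> s / 2) (\<rho> / (2 * (norm (b - p) + 1)))"
  have np: "norm (b - p) + 1 > 0" by (simp add: add_nonneg_pos)
  have d: "0 < d" "d < \<sigma> s" using \<sigma>s \<rho> np by (auto simp: d_def)
  define y where "y = z (\<sigma> s - d)"
  have "dist (z (\<sigma> s)) y = d * norm (b - p)"
    using d by (simp add: y_def z_def dist_norm flip: scaleR_left_diff_distrib)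
  also have "... \<le> d * (norm (b - p) + 1)" using d by simp
  also have "... \<le> \<rho> / (2 * (norm (b - p) + 1)) * (norm (b - p) + 1)"
    using np by (intro mult_right_mono) (auto simp: d_def)
  also have "... = \<rho> / 2" using np by (simp add: field_simps)
  also have "... < \<rho>" using \<rho>(1) by simp
  finally have yb: "y : ball (z (\<sigma> s)) \<rho>" by simp
  have syb: "s y : ball (z (\<sigma> s)) \<rho>"
    using yb isometric[OF sT, of "z (\<sigma> s)" y] \<sigma>s by simp
  have yreg: "regular y"
    using before d by (auto simp: regular_def y_def)
  have py: "\<not> separates u p y" if "u : T" for u
  proof (rule no_separation[OF that, of "z ` {0..<\<sigma> s}"])
    show "convex (z ` {0..<\<sigma> s})"
    proof -
      have "z ` {0..<\<sigma> s} = (+) p ` ((%r. r *\<^sub>R (b - p)) ` {0..<\<sigma> s})"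
        by (auto simp: z_def image_image)
      moreover have "convex ((%r. r *\<^sub>R (b - p)) ` {0..<\<sigma> s})"
        by (intro convex_linear_image linear_scaleR_left) auto
      ultimately show ?thesis by (simp add: convex_translation)
    qed
    show "p : z ` {0..<\<sigma> s}" using \<sigma>s by (auto simp: z_def intro!: image_eqI[of _ _ 0])
    show "y : z ` {0..<\<sigma> s}" using d by (auto simp: y_def)
  qed (use before that in auto)
  \<comment> \<open>Walk from p to y, across to s y, and on to s p. The first leg crosses no mirror,
    the last leg is its image under s, and the middle one crosses only the mirror of s.\<close>
  have "separates u p (s p) \<longleftrightarrow> u = s" if uT: "u : T" for u
  proof -
    have reg: "regular p" "regular y" "regular (s p)" "regular (s y)"
      using p yreg regular_image sT by auto
    have "separates u (s y) (s p) = separates (s \<circ> u \<circ> s) y p"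
      using separates_conj[OF sT, of "s \<circ> u \<circ> s" y p] invol[OF sT] by (simp add: comp_def)
    then have 1: "\<not> separates u (s y) (s p)"
      using py conj_closed[OF sT uT] separates_sym by blast
    have "separates u p (s p) \<longleftrightarrow> separates u p y ~= separates u y (s p)"
      using reg uT by (intro separates_xor) (auto simp: regular_def)
    also have "... \<longleftrightarrow> separates u y (s p)" using py uT by simp
    also have "... \<longleftrightarrow> separates u y (s y) ~= separates u (s y) (s p)"
      using reg uT by (intro separates_xor) (auto simp: regular_def)
    also have "... \<longleftrightarrow> separates u y (s y)" using 1 by simp
    also have "... \<longleftrightarrow> u = s"
    proof (cases "u = s")
      case True
      then show ?thesis using separates_image yreg sT by (auto simp: regular_def)
    next
      case False
      then show ?thesis
        using no_separation[OF uT, of "ball (z (\<sigma> s)) \<rho>" y "s y"] yb syb \<rho> uT by auto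
    qed
    finally show ?thesis .
  qed
  then have "{u : T. separates u p (s p)} = {s}" using sT by blast
  moreover have "separates s p q" using sN bq by (auto simp: N_def)
  ultimately show ?thesis using sT by blast
qed

section \<open>Words in reflections, the exchange condition and simple transitivity on
  chambers\<close>

definition wprod :: "('a => 'a) list => 'a => 'a" where
  "wprod ws = foldr (\<circ>) ws id"

lemma wprod_simps [simp]:
  "wprod [] = id" "wprod (t # ws) = t \<circ> wprod ws" "wprod (us @ ws) = wprod us \<circ> wprod ws"
proof -
  show "wprod [] = id" "wprod (t # ws) = t \<circ> wprod ws" for t ws by (auto simp: wprod_def)
  then show "wprod (us @ ws) = wprod us \<circ> wprod ws"
    by (induction us) (auto simp: fun_eq_iff)
qed

lemma wprod_rev:
  "set ws \<subseteq> T ==> wprod ws (wprod (rev ws) x) = x"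
  "set ws \<subseteq> T ==> wprod (rev ws) (wprod ws x) = x"
  by (induction ws arbitrary: x) (auto simp: invol)

lemma wprod_regular: "set ws \<subseteq> T ==> regular a ==> regular (wprod ws a)"
  by (induction ws) (auto simp: regular_image)

lemma wprod_isometric: "set ws \<subseteq> T ==> dist (wprod ws x) (wprod ws y) = dist x y"
  by (induction ws) (auto simp: isometric)

lemma wprod_conj:
  assumes "set ws \<subseteq> T" "u : T"
  shows "wprod ws \<circ> u \<circ> wprod (rev ws) : T"
  using assms
proof (induction ws)
  case (Cons t ws)
  have "wprod (t # ws) \<circ> u \<circ> wprod (rev (t # ws)) = t \<circ> (wprod ws \<circ> u \<circ> wprod (rev ws)) \<circ> t"
    by (auto simp: fun_eq_iff)
  moreover have "wprod ws \<circ> u \<circ> wprod (rev ws) : T" "t : T" using Cons by (auto simp del: comp_apply)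
  ultimately show ?case using conj_closed by metis
qed simp

lemma wprod_separates:
  assumes "set ws \<subseteq> T"
  shows "separates (wprod ws \<circ> u \<circ> wprod (rev ws)) (wprod ws a) (wprod ws b) \<longleftrightarrow> separates u a b"
  using assms by (simp add: separates_def wprod_rev wprod_isometric)

lemma wprod_rev_conj:
  assumes "set ws \<subseteq> T" "u : T"
  shows "wprod (rev ws) \<circ> u \<circ> wprod ws : T"
    and "separates u (wprod ws a) (wprod ws b) \<longleftrightarrow> separates (wprod (rev ws) \<circ> u \<circ> wprod ws) a b"
proof -
  show "wprod (rev ws) \<circ> u \<circ> wprod ws : T"
    using wprod_conj[of "rev ws" u] assms by simp
  have "wprod ws \<circ> (wprod (rev ws) \<circ> u \<circ> wprod ws) \<circ> wprod (rev ws) = u"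
    using assms by (auto simp: fun_eq_iff wprod_rev)
  then show "separates u (wprod ws a) (wprod ws b) \<longleftrightarrow> separates (wprod (rev ws) \<circ> u \<circ> wprod ws) a b"
    using wprod_separates[OF assms(1), of "wprod (rev ws) \<circ> u \<circ> wprod ws" a b] by simp
qed

text \<open>For regular p these are the reflections in the walls of its chamber: the way from p to s
  p meets no other mirror.\<close>

definition simple :: "'a => ('a => 'a) set" where
  "simple p = {s : T. {u : T. separates u p (s p)} = {s}}"

lemma simpleD: "s : simple p ==> u : T ==> separates u p (s p) \<longleftrightarrow> u = s"
  unfolding simple_def by blast

lemma simple_subset: "simple p \<subseteq> T" by (auto simp: simple_def)

text \<open>Mirrors of commuting reflections coincide or are perpendicular, and in the perpendicular
  case t moves no point across the mirror of s.\<close>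

lemma commuting_separates:
  assumes "s : T" "t : T" "t \<circ> s \<circ> t = s" "separates s p (t p)"
  shows "s = t"
proof -
  obtain n c where n: "n ~= 0" "s = aff_refl n c" using refl assms by blast
  obtain n' c' where n': "n' ~= 0" "t = aff_refl n' c'" using refl assms by blast
  define f f' where "f x = n \<bullet> x - c" and "f' x = n' \<bullet> x - c'" for x
  define k where "k = (n \<bullet> n') / (n' \<bullet> n')"
  have ft: "f (t x) = f x - 2 * k * f' x" for x
    by (simp add: f_def f'_def n'(2) inner_aff_refl k_def)
  \<comment> \<open>As t commutes with s, it preserves the distance from x to s x, hence the
    distance to the mirror of s.\<close>
  have sq: "(f (t x))^2 = (f x)^2" for x
  proof -
    have "s (t x) = t (s x)" using assms(2,3) invol by (metis comp_apply)
    then have "dist (t x) (s (t x)) = dist x (s x)" using isometric assms(2) by simp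
    then show ?thesis
      using dist_aff_refl_sq[OF n(1), of "t x" c "t x"] dist_aff_refl_sq[OF n(1), of x c x] n
      by (simp add: f_def power2_eq_square)
  qed
  have alt: "k * f' x * (k * f' x - f x) = 0" for x
    using sq[of x] unfolding ft by (simp add: power2_eq_square algebra_simps)
  have "f p * f (t p) < 0" using assms(4) n by (simp add: separates_aff_refl f_def)
  then have k: "k ~= 0" using ft[of p] by (auto simp: mult_less_0_iff)
  have off: "f x = k * f' x" if "f' x ~= 0" for x using alt[of x] k that by simp
  have all: "f x = k * f' x" for x
  proof (cases "f' x = 0")
    case True
    \<comment> \<open>On the mirror of t the alternative \<open>alt\<close> says nothing. The
      identity is recovered as the average over x + n' and x - n', where f' does not vanish.\<close>
    have "f' (x + n') ~= 0" "f' (x - n') ~= 0"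
      using True n' by (auto simp: f'_def inner_add_right inner_diff_right)
    then have "f (x + n') + f (x - n') = k * (f' (x + n') + f' (x - n'))"
      using off by (simp add: algebra_simps)
    then show ?thesis by (simp add: f_def f'_def inner_add_right inner_diff_right algebra_simps)
  qed (use off in auto)
  have c: "c = k * c'" using all[of 0] by (simp add: f_def f'_def)
  have "n \<bullet> x = (k *\<^sub>R n') \<bullet> x" for x using all[of x] c by (simp add: f_def f'_def algebra_simps)
  then have "n = k *\<^sub>R n'" by (metis vector_eq_rdot)
  then show ?thesis using n n' c k aff_refl_scaleR by metis
qed

text \<open>Induction on the number of mirrors between p and t p. Unless s = t, conjugating t by a
  wall reflection s that separates p from t p strictly lowers this number.\<close>

lemma reflection_word_simple:
  assumes p: "regular p" and "t : T"
  shows "\<exists>ws. set ws \<subseteq> simple p \<and> wprod ws = t"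
  using assms(2)
proof (induction "card {u : T. separates u p (t p)}" arbitrary: t rule: less_induct)
  case less
  let ?N = "%t. {u : T. separates u p (t p)}"
  have t: "t : T" by fact
  have tp: "separates t p (t p)" using separates_image t p by (auto simp: regular_def)
  obtain s where s: "s : T" "separates s p (t p)" "?N s = {s}"
    using simple_separator[OF p regular_image[OF p t] t tp] by blast
  have ss: "s : simple p" using s by (simp add: simple_def)
  show ?case
  proof (cases "s = t")
    case True
    then show ?thesis using ss by (intro exI[of _ "[s]"]) auto
  next
    case False
    have nc: "t \<circ> s \<circ> t ~= s" using commuting_separates[OF s(1) t _ s(2)] False by blast
    define t' where "t' = s \<circ> t \<circ> s"
    have t': "t' : T" using conj_closed s t by (simp add: t'_def)
    have reg: "regular p" "regular (s p)" "regular (t p)" "regular (t (s p))"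
      using p regular_image s t by auto
    \<comment> \<open>Moving from p to s p toggles only the separation by s, and moving from t p to
      t (s p) only that by t s t. Both of these, distinct by \<open>nc\<close>, separate p from t p,
      so both are lost and no mirror is gained.\<close>
    have key: "separates u p (t p) \<and> u ~= s" if u: "u : T" and a: "separates u (s p) (t (s p))" for u
    proof -
      have 1: "separates u (s p) p \<longleftrightarrow> u = s"
        using simpleD[OF ss u] separates_sym u by simp
      have "separates u (t p) (t (s p)) = separates (t \<circ> u \<circ> t) p (s p)"
        using separates_conj[OF t, of "t \<circ> u \<circ> t" p "s p"] invol[OF t] by (simp add: comp_def)
      also have "... \<longleftrightarrow> t \<circ> u \<circ> t = s" using simpleD[OF ss conj_closed[OF t u]] .
      also have "... \<longleftrightarrow> u = t \<circ> s \<circ> t"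
        unfolding fun_eq_iff comp_apply using invol[OF t] by metis
      finally have 2: "separates u (t p) (t (s p)) \<longleftrightarrow> u = t \<circ> s \<circ> t" .
      have "separates u (s p) (t (s p)) \<longleftrightarrow> separates u (s p) p ~= separates u p (t (s p))"
        "separates u p (t (s p)) \<longleftrightarrow> separates u p (t p) ~= separates u (t p) (t (s p))"
        using reg u by (intro separates_xor; simp add: regular_def)+
      moreover have "separates (t \<circ> s \<circ> t) p (t p)"
        using separates_conj[OF t, of s "t p" p] invol[OF t] s separates_sym by (simp add: comp_def)
      ultimately show "separates u p (t p) \<and> u ~= s" using a 1 2 nc s by metis
    qed
    \<comment> \<open>Conjugation by s turns mirrors between p and t' p into mirrors between s p and
      t (s p), to which \<open>key\<close> applies.\<close>
    have "(%u. s \<circ> u \<circ> s) ` ?N t' \<subseteq> ?N t - {s}"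
    proof (rule image_subsetI)
      fix u assume "u : ?N t'"
      then have u: "u : T" "separates u p (t' p)" by auto
      have "separates (s \<circ> u \<circ> s) (s p) (s (t' p))"
        using u separates_conj[OF s(1)] by simp
      then have "separates (s \<circ> u \<circ> s) (s p) (t (s p))"
        using invol[OF s(1)] by (simp add: t'_def)
      then show "s \<circ> u \<circ> s : ?N t - {s}"
        using key[OF conj_closed[OF s(1) u(1)]] conj_closed[OF s(1) u(1)] by blast
    qed
    moreover have "inj_on (%u. s \<circ> u \<circ> s) (?N t')"
      using invol[OF s(1)] by (intro inj_on_inverseI[of _ "%u. s \<circ> u \<circ> s"]) (auto simp: fun_eq_iff)
    ultimately have "card (?N t') \<le> card (?N t - {s})"
      by (intro card_inj_on_le) (auto intro: finite_separating)
    also have "... < card (?N t)"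
      using s finite_separating by (intro psubset_card_mono) auto
    finally obtain ws where ws: "set ws \<subseteq> simple p" "wprod ws = t'"
      using less.hyps[OF _ t'] by blast
    have "wprod (s # ws @ [s]) = t"
      using invol[OF s(1)] by (auto simp: ws t'_def fun_eq_iff)
    then show ?thesis using ws ss by (intro exI[of _ "s # ws @ [s]"]) auto
  qed
qed

lemma word_simple:
  assumes p: "regular p" and "set ws \<subseteq> T"
  shows "\<exists>us. set us \<subseteq> simple p \<and> wprod us = wprod ws"
  using assms(2)
proof (induction ws)
  case Nil
  then show ?case by (intro exI[of _ "[]"]) auto
next
  case (Cons t ws)
  then obtain us vs where "set us \<subseteq> simple p" "wprod us = wprod ws" "set vs \<subseteq> simple p" "wprod vs = t"
    using reflection_word_simple[OF p] by (metis insert_subset list.simps(15))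
  then show ?case by (intro exI[of _ "vs @ us"]) auto
qed

text \<open>Along the gallery p, u1 p, u1 u2 p, ... the mirror of s is crossed at some step. The
  mirror crossed by adding the letter u after vs is that of vs u vs^-1, so this conjugate equals
  s.\<close>

lemma exchange:
  assumes p: "regular p" and "s : T" "set ws \<subseteq> simple p" "separates s p (wprod ws p)"
  shows "\<exists>vs u us. ws = vs @ u # us \<and> s \<circ> wprod vs = wprod vs \<circ> u"
  using assms(3,4)
proof (induction ws rule: rev_induct)
  case Nil
  then show ?case by (simp add: separates_def)
next
  case (snoc u vs)
  have vs: "set vs \<subseteq> simple p" "set vs \<subseteq> T" and u: "u : simple p" "u : T"
    using snoc simple_subset by auto
  show ?case
  proof (cases "separates s p (wprod vs p)")
    case True
    then obtain vs' u' us where "vs = vs' @ u' # us" "s \<circ> wprod vs' = wprod vs' \<circ> u'"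
      using snoc vs by blast
    then show ?thesis by (metis append.assoc append_Cons)
  next
    case False
    have reg: "regular (wprod vs p)" "regular (wprod vs (u p))"
      using p wprod_regular regular_image vs u by auto
    have "separates s (wprod vs p) (wprod vs (u p))"
      using separates_xor[of s p "wprod vs p" "wprod vs (u p)"] assms(2) False snoc reg p
      by (auto simp: regular_def)
    then have "separates (wprod (rev vs) \<circ> s \<circ> wprod vs) p (u p)"
      using wprod_rev_conj(2)[OF vs(2) assms(2)] by simp
    then have eq: "wprod (rev vs) \<circ> s \<circ> wprod vs = u"
      using simpleD[OF u(1) wprod_rev_conj(1)[OF vs(2) assms(2)]] by simp
    have "s \<circ> wprod vs = wprod vs \<circ> u"
      unfolding eq[symmetric] using wprod_rev(1)[OF vs(2)] by (auto simp: fun_eq_iff)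
    then show ?thesis by (intro exI[of _ vs] exI[of _ u] exI[of _ "[]"]) auto
  qed
qed

definition reduced :: "'a => ('a => 'a) list => bool" where
  "reduced p ws \<longleftrightarrow> set ws \<subseteq> simple p \<and>
     (\<forall>us. set us \<subseteq> simple p --> wprod us = wprod ws --> length ws \<le> length us)"

lemma reduced_exists:
  assumes "regular p" "set ws \<subseteq> T"
  shows "\<exists>us. reduced p us \<and> wprod us = wprod ws"
proof -
  obtain us where "set us \<subseteq> simple p \<and> wprod us = wprod ws" using word_simple[OF assms] by blast
  from ex_has_least_nat[of "%us. set us \<subseteq> simple p \<and> wprod us = wprod ws", OF this, of length]
  show ?thesis unfolding reduced_def by metis
qed

text \<open>Otherwise s separates p from the image under the remaining word, and the exchange
  condition deletes s together with a letter of that word, against minimal length.\<close>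

lemma reduced_hd_separates:
  assumes p: "regular p" and "reduced p (s # ws)"
  shows "separates s p (wprod (s # ws) p)"
proof (rule ccontr)
  assume not: "\<not> ?thesis"
  have sw: "s : simple p" "set ws \<subseteq> simple p" "s : T" "set ws \<subseteq> T"
    using assms simple_subset by (auto simp: reduced_def)
  let ?a = "wprod ws p"
  have reg: "regular ?a" "regular (s p)" "regular (s ?a)" using p sw wprod_regular regular_image by auto
  have "separates s p (s p)" using simpleD[OF sw(1,3)] by simp
  moreover have "separates s p (s ?a) \<longleftrightarrow> separates s p (s p) ~= separates s (s p) (s ?a)"
    using reg p sw by (intro separates_xor) (auto simp: regular_def)
  moreover have "separates s (s p) (s ?a) = separates s p ?a"
    using separates_conj[OF sw(3), of s p ?a] invol[OF sw(3)] by (simp add: comp_def)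
  ultimately have "separates s p ?a" using not by simp
  then obtain vs u us where e: "ws = vs @ u # us" "s \<circ> wprod vs = wprod vs \<circ> u"
    using exchange[OF p sw(3,2)] by blast
  have "u : T" using sw(4) e by auto
  have "wprod (s # ws) = (s \<circ> wprod vs) \<circ> u \<circ> wprod us" by (simp add: e(1) comp_assoc)
  also have "... = wprod (vs @ us)" unfolding e(2) using invol[OF \<open>u : T\<close>] by (auto simp: fun_eq_iff)
  finally have "wprod (vs @ us) = wprod (s # ws)" by (rule sym)
  moreover have "set (vs @ us) \<subseteq> simple p" using sw(2) e(1) by auto
  ultimately have "length (s # ws) \<le> length (vs @ us)"
    using assms(2) unfolding reduced_def by blast
  then show False by (simp add: e(1))
qed

lemma reduced_tl: "reduced p (s # ws) ==> reduced p ws"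
  unfolding reduced_def
proof (intro conjI allI impI)
  fix us
  assume r: "set (s # ws) \<subseteq> simple p \<and> (\<forall>us. set us \<subseteq> simple p --> wprod us = wprod (s # ws) --> length (s # ws) \<le> length us)"
    and us: "set us \<subseteq> simple p" "wprod us = wprod ws"
  then have "length (s # ws) \<le> length (s # us)"
    by (metis insert_subset list.simps(15) wprod_simps(2))
  then show "length ws \<le> length us" by simp
qed auto

theorem stabilizer_trivial:
  assumes p: "regular p" and "set ws \<subseteq> T" "wprod ws p = p"
  shows "wprod ws = id"
proof -
  obtain us where us: "reduced p us" "wprod us = wprod ws" using reduced_exists assms by blast
  show ?thesis
  proof (cases us)
    case (Cons s vs)
    then have "separates s p p" using reduced_hd_separates[OF p, of s vs] us assms by metis
    then show ?thesis by (simp add: separates_def)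
  qed (use us in auto)
qed

theorem chamber_unique:
  assumes p: "regular p" and ws: "set ws \<subseteq> T"
    and x: "!!t. t : T ==> \<not> separates t p x" and y: "!!t. t : T ==> \<not> separates t p (wprod ws x)"
  shows "wprod ws x = x"
proof -
  have "wprod us x = x" if "reduced p us" "!!t. t : T ==> \<not> separates t p (wprod us x)" for us
    using that
  proof (induction us)
    case (Cons s us)
    let ?g = "wprod (s # us)"
    have sub: "set (s # us) \<subseteq> T" "s : T"
      using Cons.prems simple_subset by (auto simp: reduced_def)
    have 1: "separates s p (?g p)" using reduced_hd_separates[OF p Cons.prems(1)] .
    have 2: "\<not> separates s p (?g x)" using Cons.prems(2) sub by blast
    have 3: "\<not> separates s (?g p) (?g x)"
      using wprod_rev_conj[OF sub] x by blast
    obtain n c where n: "n ~= 0" "s = aff_refl n c" using refl sub by blast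
    have "n \<bullet> ?g x = c"
      using 1 2 3 unfolding n(2) separates_aff_refl[OF n(1)]
      by (auto simp: mult_less_0_iff)
    then have "s (?g x) = ?g x" using n by (simp add: aff_refl_fixed)
    then have g: "?g x = wprod us x" using invol[OF sub(2)] by (metis comp_apply wprod_simps(2))
    have "wprod us x = x"
      using Cons.IH reduced_tl[OF Cons.prems(1)] Cons.prems(2) g by metis
    then show ?case using g by simp
  qed simp
  then show ?thesis using reduced_exists[OF p ws] y by metis
qed

end

section \<open>Root systems, Weyl groups and alcoves\<close>

lemma refl_root_eq: "refl_root a = aff_refl a 0"
  by (rule ext) (simp add: refl_root_def aff_refl_def inner_commute)

lemma linear_refl_root: "linear (refl_root a)"
  unfolding refl_root_def
  by (rule linearI) (auto simp: algebra_simps inner_add_left add_divide_distrib)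

lemma refl_root_refl_root: "a ~= 0 ==> refl_root a (refl_root a x) = x"
  by (simp add: refl_root_eq aff_refl_aff_refl)

lemma inner_refl_root: "refl_root a x \<bullet> refl_root a y = x \<bullet> y"
  by (cases "a = 0") (auto simp: refl_root_def inner_diff_left inner_diff_right inner_commute field_simps)

lemma aff_refl_conj:
  assumes "n ~= 0" "n' ~= 0"
  shows "aff_refl n c \<circ> aff_refl n' c' \<circ> aff_refl n c =
         aff_refl (refl_root n n') (c' - 2 * (n' \<bullet> n) / (n \<bullet> n) * c)"
proof (rule ext)
  fix x
  let ?n = "refl_root n n'" and ?c = "c' - 2 * (n' \<bullet> n) / (n \<bullet> n) * c"
  define y where "y = aff_refl n c x"
  have nn: "?n \<bullet> ?n = n' \<bullet> n'" by (rule inner_refl_root)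
  have f: "?n \<bullet> x - ?c = n' \<bullet> y - c'"
    by (simp add: y_def inner_aff_refl refl_root_def inner_diff_left inner_commute algebra_simps diff_divide_distrib)
  define k where "k = 2 * (n' \<bullet> y - c') / (n' \<bullet> n')"
  have "(aff_refl n c \<circ> aff_refl n' c' \<circ> aff_refl n c) x = aff_refl n c (y - k *\<^sub>R n')"
    by (simp add: y_def k_def aff_refl_def[of n' c'])
  also have "... = aff_refl n c y - k *\<^sub>R refl_root n n'"
    by (simp add: aff_refl_def refl_root_def inner_diff_right algebra_simps inner_commute
        diff_divide_distrib add_divide_distrib)
  also have "aff_refl n c y = x" using assms by (simp add: y_def aff_refl_aff_refl)
  also have "x - k *\<^sub>R refl_root n n' = aff_refl ?n ?c x"
    unfolding aff_refl_def[of ?n] nn f k_def by simp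
  finally show "(aff_refl n c \<circ> aff_refl n' c' \<circ> aff_refl n c) x = aff_refl ?n ?c x" .
qed

text \<open>Collecting positive and negative coefficients of a vanishing combination writes one
  vector v in two ways. Obtuseness gives v . v <= 0, and pairing v = 0 with xi forces all
  coefficients to vanish.\<close>

lemma obtuse_independent:
  fixes D :: "'a::euclidean_space set"
  assumes "finite D" and pos: "!!d. d : D ==> d \<bullet> \<xi> > 0"
    and obt: "!!d d'. d : D ==> d' : D ==> d ~= d' ==> d \<bullet> d' \<le> 0"
  shows "independent D"
proof (rule independent_if_scalars_zero[OF assms(1)])
  fix c d assume sum0: "(\<Sum>x\<in>D. c x *\<^sub>R x) = 0" and d: "d : D"
  define A B where "A = {x : D. c x > 0}" and "B = {x : D. c x < 0}"
  have fin: "finite A" "finite B" using assms by (auto simp: A_def B_def)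
  define v where "v = (\<Sum>x\<in>A. c x *\<^sub>R x)"
  have "(\<Sum>x\<in>D. c x *\<^sub>R x) = (\<Sum>x\<in>A \<union> B. c x *\<^sub>R x)"
    using assms(1) by (intro sum.mono_neutral_right) (auto simp: A_def B_def not_less le_less)
  also have "... = v + (\<Sum>x\<in>B. c x *\<^sub>R x)"
    unfolding v_def using fin by (intro sum.union_disjoint) (auto simp: A_def B_def)
  finally have v2: "v = (\<Sum>x\<in>B. (- c x) *\<^sub>R x)"
    using sum0 by (simp add: sum_negf eq_neg_iff_add_eq_0)
  have "v \<bullet> v = (\<Sum>x\<in>A. \<Sum>y\<in>B. c x * (- c y) * (x \<bullet> y))"
  proof -
    have "v \<bullet> v = (\<Sum>x\<in>A. c x *\<^sub>R x) \<bullet> (\<Sum>y\<in>B. (- c y) *\<^sub>R y)"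
      using v_def v2 by metis
    also have "... = (\<Sum>x\<in>A. \<Sum>y\<in>B. (c x *\<^sub>R x) \<bullet> ((- c y) *\<^sub>R y))"
      unfolding inner_sum_left inner_sum_right by (subst sum.swap) simp
    finally show ?thesis by (simp add: algebra_simps)
  qed
  also have "... \<le> 0"
    by (intro sum_nonpos mult_nonneg_nonpos mult_nonneg_nonneg)
       (auto simp: A_def B_def intro!: obt)
  finally have "v = 0" by (metis inner_eq_zero_iff inner_ge_zero order_antisym)
  then have "(\<Sum>x\<in>A. c x * (x \<bullet> \<xi>)) = 0" "(\<Sum>x\<in>B. (- c x) * (x \<bullet> \<xi>)) = 0"
  proof -
    have "(\<Sum>x\<in>A. c x *\<^sub>R x) \<bullet> \<xi> = 0" "(\<Sum>x\<in>B. (- c x) *\<^sub>R x) \<bullet> \<xi> = 0"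
      using v_def v2 \<open>v = 0\<close> by (metis inner_zero_left)+
    then show "(\<Sum>x\<in>A. c x * (x \<bullet> \<xi>)) = 0" "(\<Sum>x\<in>B. (- c x) * (x \<bullet> \<xi>)) = 0"
      by (simp_all add: inner_sum_left sum_negf)
  qed
  moreover have "c x * (x \<bullet> \<xi>) \<ge> 0" if "x : A" for x
    using that pos[of x] by (intro mult_nonneg_nonneg) (auto simp: A_def)
  moreover have "(- c x) * (x \<bullet> \<xi>) \<ge> 0" if "x : B" for x
    using that pos[of x] by (intro mult_nonneg_nonneg) (auto simp: B_def)
  ultimately have "\<forall>x\<in>A. c x * (x \<bullet> \<xi>) = 0" "\<forall>x\<in>B. (- c x) * (x \<bullet> \<xi>) = 0"
    using sum_nonneg_eq_0_iff[OF fin(1), of "%x. c x * (x \<bullet> \<xi>)"]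
      sum_nonneg_eq_0_iff[OF fin(2), of "%x. (- c x) * (x \<bullet> \<xi>)"] by blast+
  then have "A = {}" "B = {}" using pos by (auto simp: A_def B_def less_le)
  then show "c d = 0" using d by (auto simp: A_def B_def not_less intro: antisym)
qed

definition coroot :: "'a::euclidean_space => 'a" where
  "coroot al = (2 / (al \<bullet> al)) *\<^sub>R al"

locale positive_roots =
  fixes R Rp :: "'a::euclidean_space set"
  assumes rs: "root_system R" and ps: "positive_subsystem R Rp"
begin

abbreviation "W \<equiv> weyl_group R"
abbreviation "A0 \<equiv> alcove Rp"
abbreviation "Dom \<equiv> dominant Rp"
abbreviation "low \<equiv> lower_set Rp"
abbreviation "Q \<equiv> coroot_lattice R"

lemma finite_R: "finite R" and zero_notin_R: "0 \<notin> R" and span_R: "span R = UNIV"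
  and refl_R: "a : R ==> b : R ==> refl_root a b : R"
  and int_R: "a : R ==> b : R ==> 2 * (b \<bullet> a) / (a \<bullet> a) : \<int>"
  using rs unfolding root_system_def by auto

definition xi0 :: 'a where "xi0 = (SOME \<xi>. (\<forall>al\<in>R. al \<bullet> \<xi> ~= 0) \<and> Rp = {al\<in>R. al \<bullet> \<xi> > 0})"

lemma xi0: "a : R ==> a \<bullet> xi0 ~= 0" and Rp_iff: "a : Rp \<longleftrightarrow> a : R \<and> a \<bullet> xi0 > 0"
proof -
  have "(\<forall>a\<in>R. a \<bullet> xi0 ~= 0) \<and> Rp = {a\<in>R. a \<bullet> xi0 > 0}"
    using ps unfolding positive_subsystem_def xi0_def by (rule someI_ex)
  then show "a : R ==> a \<bullet> xi0 ~= 0" "a : Rp \<longleftrightarrow> a : R \<and> a \<bullet> xi0 > 0" by auto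
qed

lemma Rp_subset: "Rp \<subseteq> R" and finite_Rp: "finite Rp"
  using Rp_iff finite_R by (auto intro: finite_subset[of Rp R])

lemma Rp_R: "a : Rp ==> a : R" and Rp_nonzero: "a : Rp ==> a ~= 0"
  and R_nonzero: "a : R ==> a ~= 0"
  using Rp_iff zero_notin_R by auto

lemma neg_R: "a : R ==> - a : R"
proof -
  assume "a : R"
  moreover have "refl_root a a = - a" using R_nonzero[OF \<open>a : R\<close>] by (simp add: refl_root_def scaleR_2)
  ultimately show ?thesis using refl_R by metis
qed

lemma R_cases: "a : R ==> a : Rp \<or> - a : Rp"
  using xi0[of a] neg_R[of a] by (auto simp: Rp_iff)

lemma R_split: "R = Rp \<union> uminus ` Rp" "Rp \<inter> uminus ` Rp = {}"
proof -
  show "R = Rp \<union> uminus ` Rp"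
    using R_cases Rp_R neg_R by (auto simp: image_iff) (metis minus_minus)
  show "Rp \<inter> uminus ` Rp = {}" by (auto simp: Rp_iff)
qed

lemma sum_R:
  fixes f :: "'a => 'b::real_vector"
  assumes "!!a. f (- a) = f a"
  shows "(\<Sum>a\<in>R. f a) = 2 *\<^sub>R (\<Sum>a\<in>Rp. f a)"
proof -
  have "(\<Sum>a\<in>R. f a) = (\<Sum>a\<in>Rp. f a) + (\<Sum>a\<in>uminus ` Rp. f a)"
    using R_split finite_Rp by (metis finite_imageI sum.union_disjoint)
  also have "(\<Sum>a\<in>uminus ` Rp. f a) = (\<Sum>a\<in>Rp. f a)"
    by (subst sum.reindex) (auto simp: assms inj_on_def)
  finally show ?thesis by (simp add: scaleR_2)
qed

lemma prod_R:
  fixes f :: "'a => real"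
  assumes "!!a. f (- a) = f a"
  shows "(\<Prod>a\<in>R. f a) = (\<Prod>a\<in>Rp. f a)^2"
proof -
  have "(\<Prod>a\<in>R. f a) = (\<Prod>a\<in>Rp. f a) * (\<Prod>a\<in>uminus ` Rp. f a)"
    using R_split finite_Rp by (metis finite_imageI prod.union_disjoint)
  also have "(\<Prod>a\<in>uminus ` Rp. f a) = (\<Prod>a\<in>Rp. f a)"
    by (subst prod.reindex) (auto simp: assms inj_on_def)
  finally show ?thesis by (simp add: power2_eq_square)
qed

lemma weyl_linear: "w : W ==> linear w"
proof (induction rule: weyl_group.induct)
  case (wstep a w)
  then show ?case using linear_compose[OF _ linear_refl_root] by blast
qed (rule linear_id)

lemma weyl_inner: "w : W ==> w x \<bullet> w y = x \<bullet> y"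
  by (induction rule: weyl_group.induct) (auto simp: inner_refl_root)

lemma weyl_norm: "w : W ==> norm (w x) = norm x"
  by (simp add: norm_eq_sqrt_inner weyl_inner)

lemma weyl_R: "w : W ==> a : R ==> w a : R"
  by (induction rule: weyl_group.induct) (auto simp: refl_R)

lemma weyl_refl: "a : R ==> refl_root a : W"
  using weyl_group.wstep[OF _ weyl_group.wid] by fastforce

lemma weyl_comp: "w : W ==> v : W ==> w \<circ> v : W"
  by (induction rule: weyl_group.induct) (auto simp: comp_assoc intro: weyl_group.wstep)

lemma weyl_ex_inv: "w : W ==> \<exists>v\<in>W. v \<circ> w = id \<and> w \<circ> v = id"
proof (induction rule: weyl_group.induct)
  case wid
  then show ?case using weyl_group.wid by (metis comp_id)
next
  case (wstep a w)
  then obtain v where v: "v : W" "v \<circ> w = id" "w \<circ> v = id" by blast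
  have rr: "refl_root a \<circ> refl_root a = id"
    using refl_root_refl_root R_nonzero wstep by (auto simp: fun_eq_iff)
  have "(v \<circ> refl_root a) \<circ> (refl_root a \<circ> w) = v \<circ> (refl_root a \<circ> refl_root a) \<circ> w"
    "(refl_root a \<circ> w) \<circ> (v \<circ> refl_root a) = refl_root a \<circ> (w \<circ> v) \<circ> refl_root a"
    by (simp_all add: comp_assoc)
  then show ?case
    using v rr weyl_comp[OF v(1) weyl_refl[OF wstep(1)]] by (metis comp_id id_comp)
qed

lemma weyl_bij: "w : W ==> bij w"
  using weyl_ex_inv o_bij by metis

lemma weyl_inv: "w : W ==> inv w : W"
  using weyl_ex_inv inv_unique_comp by metis

lemma weyl_inv_simps [simp]: "w : W ==> w (inv w x) = x" "w : W ==> inv w (w x) = x"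
  using weyl_bij by (auto simp: bij_def surj_f_inv_f)

lemma weyl_inner_inv: "w : W ==> w x \<bullet> y = x \<bullet> inv w y"
  using weyl_inner[of w x "inv w y"] by simp

lemma weyl_add: "w : W ==> w (x + y) = w x + w y"
  and weyl_diff: "w : W ==> w (x - y) = w x - w y"
  and weyl_scale: "w : W ==> w (c *\<^sub>R x) = c *\<^sub>R w x"
  and weyl_zero: "w : W ==> w 0 = 0"
  and weyl_neg: "w : W ==> w (- x) = - w x"
  using weyl_linear linear_add linear_diff linear_cmul linear_0 linear_neg by metis+

lemma weyl_image_R: "w : W ==> w ` R = R"
  using weyl_R weyl_inv by (auto simp: image_iff) (metis weyl_inv_simps(1))

lemma weyl_bij_R: "w : W ==> bij_betw w R R"
  using weyl_image_R weyl_bij by (auto simp: bij_betw_def bij_def inj_on_def)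

text \<open>A Weyl group element is linear and maps the finite spanning set R into itself, so its
  restriction to R determines it.\<close>

lemma finite_W: "finite W"
proof -
  have "inj_on (%w. restrict w R) W"
  proof (rule inj_onI)
    fix v w assume vw: "v : W" "w : W" and eq: "restrict v R = restrict w R"
    have "v x = w x" for x
    proof (rule linear_eq_on[OF weyl_linear weyl_linear, of v w x R])
      show "x : span R" by (simp add: span_R)
      show "v a = w a" if "a : R" for a using fun_cong[OF eq, of a] that by simp
    qed (use vw in auto)
    then show "v = w" by blast
  qed
  moreover have "(%w. restrict w R) ` W \<subseteq> PiE R (%_. R)" using weyl_R by auto
  moreover have "finite (PiE R (%_. R))" using finite_R by (intro finite_PiE) auto
  ultimately show ?thesis using finite_imageD finite_subset by blast
qed

lemma id_W: "id : W" by (rule weyl_group.wid)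

lemma orth_R_zero: "(!!a. a : R ==> a \<bullet> x = 0) ==> x = 0"
proof -
  assume *: "!!a. a : R ==> a \<bullet> x = 0"
  have "\<forall>y\<in>span R. orthogonal x y"
  proof
    fix y assume y: "y : span R"
    show "orthogonal x y" by (rule orthogonal_to_span[OF y]) (use * in \<open>simp add: orthogonal_def inner_commute\<close>)
  qed
  then show ?thesis unfolding span_R by (auto simp: orthogonal_def)
qed

text \<open>The sum of the |a . x| vanishes only at 0 because R spans; its minimum on the unit
  sphere is the constant. This bounds the alcove.\<close>

lemma root_norm_bound: "\<exists>c>0. \<forall>x. c * norm x \<le> (\<Sum>a\<in>R. \<bar>a \<bullet> x\<bar>)"
proof -
  define N where "N x = (\<Sum>a\<in>R. \<bar>a \<bullet> x\<bar>)" for x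
  have "continuous_on (sphere 0 1) N" unfolding N_def by (intro continuous_intros)
  moreover have "(SOME b. b : Basis) : (sphere 0 1 :: 'a set)"
    by (metis mem_sphere_0 norm_Basis SOME_Basis)
  ultimately obtain x0 where x0: "x0 : sphere 0 1" "!!x. x : sphere 0 1 ==> N x0 \<le> N x"
    using continuous_attains_inf[OF compact_sphere, of 0 1 N] by blast
  have "N x0 > 0"
  proof (rule ccontr)
    assume "\<not> N x0 > 0"
    then have "N x0 = 0" by (metis N_def abs_ge_zero not_less_iff_gr_or_eq sum_nonneg leD)
    then have "x0 = 0"
      using finite_R by (intro orth_R_zero) (auto simp: N_def sum_nonneg_eq_0_iff)
    then show False using x0 by simp
  qed
  moreover have "N x0 * norm x \<le> N x" for x
  proof (cases "x = 0")
    case False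
    have "N x0 \<le> N ((1 / norm x) *\<^sub>R x)" using False by (intro x0) auto
    also have "... = N x / norm x"
      unfolding N_def by (simp add: sum_divide_distrib abs_mult)
    finally show ?thesis using False by (simp add: field_simps)
  qed (simp add: N_def)
  ultimately show ?thesis unfolding N_def by blast
qed

subsection \<open>Weights and the coroot lattice\<close>

text \<open>Twice the usual weight lattice: \<open>root_coeff\<close> is half of the usual pairing
  with the coroot. This normalization makes exp (i nu . x) periodic under pi Q (see
  \<open>weights_inner_Q\<close>).\<close>

definition weights :: "'a set" where
  "weights = {\<nu>. \<forall>al\<in>R. root_coeff \<nu> al : \<int>}"

lemma root_coeff_arith:
  "root_coeff (x + y) a = root_coeff x a + root_coeff y a"
  "root_coeff (x - y) a = root_coeff x a - root_coeff y a"
  "root_coeff (- x) a = - root_coeff x a"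
  "root_coeff x (- a) = - root_coeff x a"
  "root_coeff (c *\<^sub>R x) a = c * root_coeff x a"
  "root_coeff 0 a = 0"
  by (simp_all add: root_coeff_def inner_add_left inner_diff_left add_divide_distrib diff_divide_distrib)

lemma weights_arith:
  "0 : weights" "x : weights ==> y : weights ==> x + y : weights"
  "x : weights ==> y : weights ==> x - y : weights" "x : weights ==> - x : weights"
  by (auto simp: weights_def root_coeff_arith)

lemma weights_of_int: "x : weights ==> of_int k *\<^sub>R x : weights"
  by (auto simp: weights_def root_coeff_arith)

lemma root_coeff_weyl: "w : W ==> root_coeff (w n) a = root_coeff n (inv w a)"
  using weyl_inner[OF weyl_inv, of w a a] by (simp add: root_coeff_def weyl_inner_inv)

lemma weights_weyl: "w : W ==> n : weights ==> w n : weights"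
  using weyl_R[OF weyl_inv] by (auto simp: weights_def root_coeff_weyl)

lemma refl_root_coeff: "refl_root a n = n - (2 * root_coeff n a) *\<^sub>R a"
  by (simp add: refl_root_def root_coeff_def)

lemma two_root_weight: "a : R ==> 2 *\<^sub>R a : weights"
  using int_R by (auto simp: weights_def root_coeff_def)

lemma dominant_iff: "\<nu> : Dom \<longleftrightarrow> \<nu> : weights \<and> (\<forall>a\<in>Rp. \<nu> \<bullet> a \<ge> 0)"
proof
  assume d: "\<nu> : Dom"
  have "root_coeff \<nu> a : \<int>" if "a : R" for a
    using R_cases[OF that]
  proof
    assume "a : Rp" then show ?thesis using d by (auto simp: dominant_def)
  next
    assume "- a : Rp"
    then obtain n :: nat where "- root_coeff \<nu> a = real n" using d by (auto simp: dominant_def root_coeff_arith)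
    then show ?thesis by (metis Ints_minus Ints_of_nat minus_minus)
  qed
  moreover have "\<nu> \<bullet> a \<ge> 0" if "a : Rp" for a
  proof -
    have "root_coeff \<nu> a \<ge> 0" using d that by (auto simp: dominant_def)
    moreover have "a \<bullet> a > 0" using Rp_nonzero that by simp
    ultimately show ?thesis unfolding root_coeff_def by (metis divide_neg_pos not_less)
  qed
  ultimately show "\<nu> : weights \<and> (\<forall>a\<in>Rp. \<nu> \<bullet> a \<ge> 0)" by (auto simp: weights_def)
next
  assume *: "\<nu> : weights \<and> (\<forall>a\<in>Rp. \<nu> \<bullet> a \<ge> 0)"
  have "\<exists>n::nat. root_coeff \<nu> a = real n" if "a : Rp" for a
  proof -
    have "root_coeff \<nu> a : \<int>" using * that Rp_R by (auto simp: weights_def)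
    moreover have "root_coeff \<nu> a \<ge> 0" using * that by (simp add: root_coeff_def)
    ultimately show ?thesis by (metis Ints_cases of_int_0_le_iff of_nat_nat of_int_of_nat_eq)
  qed
  then show "\<nu> : Dom" by (auto simp: dominant_def)
qed

lemma Q_def': "Q = {\<Sum>a\<in>R. of_int (k a) *\<^sub>R coroot a | k. True}"
  by (simp add: coroot_lattice_def coroot_def)

lemma Q_arith: "0 : Q" "x : Q ==> y : Q ==> x + y : Q" "x : Q ==> - x : Q" "x : Q ==> y : Q ==> x - y : Q"
proof -
  show 1: "0 : Q" unfolding Q_def' by (rule CollectI, rule exI[of _ "%_. 0"]) simp
  show 2: "x : Q ==> y : Q ==> x + y : Q" for x y
  proof -
    assume "x : Q" "y : Q"
    then obtain k l where "x = (\<Sum>a\<in>R. of_int (k a) *\<^sub>R coroot a)" "y = (\<Sum>a\<in>R. of_int (l a) *\<^sub>R coroot a)"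
      unfolding Q_def' by auto
    then have "x + y = (\<Sum>a\<in>R. of_int (k a + l a) *\<^sub>R coroot a)"
      by (simp add: sum.distrib scaleR_left_distrib)
    then show ?thesis unfolding Q_def' by (intro CollectI exI[of _ "%a. k a + l a"]) simp
  qed
  show 3: "x : Q ==> - x : Q" for x
  proof -
    assume "x : Q"
    then obtain k where "x = (\<Sum>a\<in>R. of_int (k a) *\<^sub>R coroot a)" unfolding Q_def' by auto
    then have "- x = (\<Sum>a\<in>R. of_int (- k a) *\<^sub>R coroot a)" by (simp add: sum_negf)
    then show ?thesis unfolding Q_def' by (intro CollectI exI[of _ "%a. - k a"]) simp
  qed
  show "x : Q ==> y : Q ==> x - y : Q" using 2 3 by (metis diff_conv_add_uminus)
qed

lemma Q_weyl: "w : W ==> q : Q ==> w q : Q"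
proof -
  assume w: "w : W" and "q : Q"
  then obtain k where q: "q = (\<Sum>a\<in>R. of_int (k a) *\<^sub>R coroot a)" unfolding Q_def' by auto
  have cw: "w (coroot a) = coroot (w a)" for a using w by (simp add: coroot_def weyl_scale weyl_inner)
  have "w q = (\<Sum>a\<in>R. of_int (k (inv w (w a))) *\<^sub>R coroot (w a))"
    using w by (simp add: q linear_sum[OF weyl_linear] weyl_scale cw)
  also have "... = (\<Sum>a\<in>R. of_int (k (inv w a)) *\<^sub>R coroot a)"
    by (rule sum.reindex_bij_betw[OF weyl_bij_R[OF w], of "%a. of_int (k (inv w a)) *\<^sub>R coroot a"])
  finally show ?thesis unfolding Q_def' by (intro CollectI exI[of _ "%a. k (inv w a)"]) simp
qed

lemma weights_inner_Q:
  assumes "n : weights" "q : Q" shows "\<exists>k::int. n \<bullet> q = 2 * of_int k"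
proof -
  obtain k where q: "q = (\<Sum>a\<in>R. of_int (k a) *\<^sub>R coroot a)" using assms unfolding Q_def' by auto
  have "\<forall>a\<in>R. \<exists>j::int. root_coeff n a = of_int j" using assms by (auto simp: weights_def Ints_def)
  then obtain j where j: "\<forall>a\<in>R. root_coeff n a = of_int (j a)" by metis
  have "n \<bullet> q = (\<Sum>a\<in>R. of_int (k a) * (2 * root_coeff n a))"
    by (simp add: q inner_sum_right coroot_def root_coeff_def mult.assoc)
  also have "... = 2 * of_int (\<Sum>a\<in>R. k a * j a)"
    using j by (simp add: sum_distrib_left algebra_simps)
  finally show ?thesis by blast
qed

lemma R_inner_Q: "a : R ==> q : Q ==> a \<bullet> q : \<int>"
  using weights_inner_Q[OF two_root_weight, of a q] by auto

lemma lattice_separated: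
  assumes "!!x. x : X ==> x ~= 0 ==> \<exists>a\<in>R. \<bar>a \<bullet> x\<bar> \<ge> d" "d > 0"
  shows "\<exists>e>0. \<forall>x\<in>X. x ~= 0 --> norm x \<ge> e"
proof -
  define M where "M = Max (insert 1 (norm ` R))"
  have M: "M \<ge> 1" "!!a. a : R ==> norm a \<le> M" unfolding M_def using finite_R by auto
  have "norm x \<ge> d / M" if x: "x : X" "x ~= 0" for x
  proof -
    obtain a where "a : R" "d \<le> \<bar>a \<bullet> x\<bar>" using assms(1)[OF x] by auto
    then have "d \<le> norm a * norm x" using Cauchy_Schwarz_ineq2[of a x] by linarith
    also have "... \<le> M * norm x" using M(2) \<open>a : R\<close> by (intro mult_right_mono) auto
    finally show ?thesis using M by (simp add: field_simps)
  qed
  then show ?thesis using assms(2) M by (intro exI[of _ "d / M"]) auto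
qed

lemma Q_separated: "\<exists>e>0. \<forall>x\<in>Q. x ~= 0 --> norm x \<ge> e"
proof (rule lattice_separated[of _ 1])
  fix x assume x: "x : Q" "x ~= 0"
  then obtain a where "a : R" "a \<bullet> x ~= 0" using orth_R_zero by blast
  then show "\<exists>a\<in>R. 1 \<le> \<bar>a \<bullet> x\<bar>" using R_inner_Q x by (metis Ints_nonzero_abs_ge1)
qed simp

lemma weights_separated: "\<exists>e>0. \<forall>x\<in>weights. x ~= 0 --> norm x \<ge> e"
proof -
  define d where "d = Min (insert 1 ((%al. al \<bullet> al) ` R))"
  have d: "d > 0" "!!al. al : R ==> d \<le> al \<bullet> al"
    unfolding d_def using finite_R R_nonzero by (auto simp: Min_gr_iff)
  show ?thesis
  proof (rule lattice_separated[OF _ d(1)])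
    fix x assume x: "x : weights" "x ~= 0"
    then obtain al where a: "al : R" "al \<bullet> x ~= 0" using orth_R_zero by blast
    then have "root_coeff x al : \<int>" "root_coeff x al ~= 0"
      using x R_nonzero by (auto simp: weights_def root_coeff_def inner_commute)
    then have "1 \<le> \<bar>root_coeff x al\<bar>" by (rule Ints_nonzero_abs_ge1)
    then have "al \<bullet> al \<le> \<bar>al \<bullet> x\<bar>"
      using R_nonzero[OF a(1)] by (simp add: root_coeff_def field_simps inner_commute)
    then show "\<exists>al\<in>R. d \<le> \<bar>al \<bullet> x\<bar>" using a d(2) by force
  qed
qed

subsection \<open>Simple roots and duality\<close>

definition simple_roots :: "'a set" where
  "simple_roots = {al : Rp. \<not> (\<exists>be\<in>Rp. \<exists>\<gamma>\<in>Rp. al = be + \<gamma>)}"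

text \<open>If al . be > 0, both Cartan integers are positive. If one of them is 1, a reflection
  shows that al - be or its negative is a root, which makes al or be decomposable. If both are at
  least 2, then |al - be|^2 <= 0.\<close>

lemma simple_roots_obtuse:
  assumes "al : simple_roots" "be : simple_roots" "al ~= be"
  shows "al \<bullet> be \<le> 0"
proof (rule ccontr)
  assume "\<not> ?thesis"
  then have pos: "al \<bullet> be > 0" by simp
  have ab: "al : R" "be : R" "al ~= 0" "be ~= 0" using assms Rp_R R_nonzero by (auto simp: simple_roots_def)
  have nodiff: "al - be \<notin> R"
  proof
    assume "al - be : R"
    then consider "al - be : Rp" | "be - al : Rp" using R_cases[of "al - be"] by auto
    then show False
    proof cases
      case 1
      then have "al = (al - be) + be" "be : Rp" using assms by (auto simp: simple_roots_def)
      then show False using assms(1) 1 unfolding simple_roots_def by blast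
    next
      case 2
      then have "be = (be - al) + al" "al : Rp" using assms by (auto simp: simple_roots_def)
      then show False using assms(2) 2 unfolding simple_roots_def by blast
    qed
  qed
  obtain a b :: int where a: "2 * (al \<bullet> be) / (be \<bullet> be) = of_int a" and b: "2 * (be \<bullet> al) / (al \<bullet> al) = of_int b"
    using int_R ab by (metis Ints_cases)
  have aa: "al \<bullet> al > 0" "be \<bullet> be > 0" using ab by auto
  have posi: "a > 0" "b > 0"
  proof -
    have "of_int a > (0::real)" "of_int b > (0::real)"
      unfolding a[symmetric] b[symmetric] using pos aa by (auto simp: inner_commute)
    then show "a > 0" "b > 0" by simp_all
  qed
  have "a ~= 1"
  proof
    assume "a = 1"
    then have "refl_root be al = al - be" unfolding refl_root_def a by simp
    then show False using nodiff refl_R ab by metis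
  qed
  moreover have "b ~= 1"
  proof
    assume "b = 1"
    then have "refl_root al be = be - al" unfolding refl_root_def b by simp
    then have "be - al : R" using refl_R ab by metis
    then show False using nodiff neg_R by (metis minus_diff_eq)
  qed
  ultimately have "a \<ge> 2" "b \<ge> 2" using posi by auto
  then have "2 * (al \<bullet> be) / (be \<bullet> be) \<ge> 2" "2 * (be \<bullet> al) / (al \<bullet> al) \<ge> 2" unfolding a b by simp_all
  then have "al \<bullet> be \<ge> be \<bullet> be" "al \<bullet> be \<ge> al \<bullet> al" using aa by (auto simp: field_simps inner_commute)
  then have "(al - be) \<bullet> (al - be) \<le> 0" by (simp add: inner_diff_left inner_diff_right inner_commute)
  then show False using assms(3) by (metis inner_gt_zero_iff not_le right_minus_eq)
qed

lemma simple_roots_independent: "independent simple_roots"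
proof (rule obtuse_independent[where \<xi> = xi0])
  show "finite simple_roots" using finite_Rp by (simp add: simple_roots_def)
  show "d \<bullet> xi0 > 0" if "d : simple_roots" for d using that Rp_iff by (simp add: simple_roots_def)
qed (rule simple_roots_obtuse)

lemma positive_root_combination:
  "a : Rp ==> \<exists>k::'a => nat. a = (\<Sum>\<delta>\<in>simple_roots. real (k \<delta>) *\<^sub>R \<delta>)"
proof (induction "card {b : Rp. b \<bullet> xi0 < a \<bullet> xi0}" arbitrary: a rule: less_induct)
  case less
  have fin: "finite simple_roots" using finite_Rp by (auto simp: simple_roots_def)
  show ?case
  proof (cases "a : simple_roots")
    case True
    have "a = (\<Sum>\<delta>\<in>simple_roots. if \<delta> = a then a else 0)" using True fin by simp
    also have "... = (\<Sum>\<delta>\<in>simple_roots. real (if \<delta> = a then 1 else 0) *\<^sub>R \<delta>)"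
      by (intro sum.cong) auto
    finally show ?thesis by (rule exI[of _ "%\<delta>. if \<delta> = a then 1 else 0"])
  next
    case False
    then obtain b \<gamma> where bc: "b : Rp" "\<gamma> : Rp" "a = b + \<gamma>" using less.prems by (auto simp: simple_roots_def)
    have lt: "b \<bullet> xi0 < a \<bullet> xi0" "\<gamma> \<bullet> xi0 < a \<bullet> xi0" using bc Rp_iff by (auto simp: inner_add_left)
    have "card {x : Rp. x \<bullet> xi0 < b \<bullet> xi0} < card {x : Rp. x \<bullet> xi0 < a \<bullet> xi0}"
      "card {x : Rp. x \<bullet> xi0 < \<gamma> \<bullet> xi0} < card {x : Rp. x \<bullet> xi0 < a \<bullet> xi0}"
      using finite_Rp lt bc by (auto intro!: psubset_card_mono)
    from less.hyps[OF this(1) bc(1)] less.hyps[OF this(2) bc(2)]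
    obtain k l :: "'a => nat" where "b = (\<Sum>\<delta>\<in>simple_roots. real (k \<delta>) *\<^sub>R \<delta>)" "\<gamma> = (\<Sum>\<delta>\<in>simple_roots. real (l \<delta>) *\<^sub>R \<delta>)"
      by blast
    then have "a = (\<Sum>\<delta>\<in>simple_roots. real (k \<delta> + l \<delta>) *\<^sub>R \<delta>)"
      using bc(3) by (simp add: sum.distrib scaleR_left_distrib)
    then show ?thesis by (rule exI[of _ "%\<delta>. k \<delta> + l \<delta>"])
  qed
qed

text \<open>The simple roots form a basis in which all roots have integral coordinates. Hence the
  dual basis vectors are admissible test vectors n, and they read off the coordinates of x.\<close>

lemma root_lattice_bidual:
  assumes x: "!!n. (!!a. a : R ==> n \<bullet> a : \<int>) ==> n \<bullet> x : \<int>"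
  shows "\<exists>k::'a => int. x = (\<Sum>a\<in>R. of_int (k a) *\<^sub>R a)"
proof -
  let ?D = simple_roots
  have fin: "finite ?D" and sub: "?D \<subseteq> R" using finite_Rp Rp_R by (auto simp: simple_roots_def)
  have "R \<subseteq> span ?D"
  proof
    fix a assume "a : R"
    moreover have "b : span ?D" if "b : Rp" for b
    proof -
      obtain k :: "'a => nat" where "b = (\<Sum>\<delta>\<in>?D. real (k \<delta>) *\<^sub>R \<delta>)"
        using positive_root_combination[OF \<open>b : Rp\<close>] by blast
      then show ?thesis by (metis (no_types, lifting) span_base span_scale span_sum)
    qed
    ultimately show "a : span ?D" using R_cases span_neg by (metis minus_minus)
  qed
  then have "span ?D = UNIV" using span_R by (metis span_mono span_span top.extremum_unique)
  then have "x : span ?D" by simp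
  then obtain r where r: "x = (\<Sum>\<delta>\<in>?D. r \<delta> *\<^sub>R \<delta>)" using span_finite[OF fin] by auto
  have "r \<delta> : \<int>" if d: "\<delta> : ?D" for \<delta>
  proof -
    obtain g :: "'a => real" where g: "linear g" "!!y. y : ?D ==> g y = (if y = \<delta> then 1 else 0)"
      using linear_independent_extend[OF simple_roots_independent, of "%y. if y = \<delta> then 1 else 0"] by auto
    define n where "n = adjoint g 1"
    have gn: "g y = n \<bullet> y" for y
      using adjoint_works[OF g(1), of y 1] by (simp add: n_def inner_commute)
    have "n \<bullet> b : \<int>" if "b : Rp" for b
    proof -
      obtain k :: "'a => nat" where k: "b = (\<Sum>\<delta>\<in>?D. real (k \<delta>) *\<^sub>R \<delta>)"
        using positive_root_combination[OF \<open>b : Rp\<close>] by blast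
      have "n \<bullet> b = (\<Sum>y\<in>?D. real (k y) * g y)" by (simp add: k inner_sum_right gn)
      also have "... : \<int>" using g by (intro Ints_sum Ints_mult) auto
      finally show ?thesis .
    qed
    then have "n \<bullet> a : \<int>" if "a : R" for a
      using R_cases[OF that] by (metis Ints_minus inner_minus_right minus_minus)
    then have "n \<bullet> x : \<int>" by (rule x)
    moreover have "n \<bullet> x = (\<Sum>y\<in>?D. if y = \<delta> then r y else 0)"
      unfolding r inner_sum_right inner_scaleR_right gn[symmetric] using g(2) by (intro sum.cong) auto
    ultimately show ?thesis using d fin by simp
  qed
  then have "\<forall>\<delta>\<in>?D. \<exists>k::int. r \<delta> = of_int k" by (auto simp: Ints_def)
  then obtain k where k: "\<forall>\<delta>\<in>?D. r \<delta> = of_int (k \<delta>)" by metis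
  define k' where "k' a = (if a : ?D then k a else 0)" for a
  have "x = (\<Sum>\<delta>\<in>?D. of_int (k' \<delta>) *\<^sub>R \<delta>)" using k by (simp add: r k'_def)
  also have "... = (\<Sum>a\<in>R. of_int (k' a) *\<^sub>R a)"
    using finite_R sub by (intro sum.mono_neutral_left) (auto simp: k'_def)
  finally show ?thesis by blast
qed

end

lemma coroot_inner: "coroot a \<bullet> coroot b = 4 * (a \<bullet> b) / ((a \<bullet> a) * (b \<bullet> b))"
  by (simp add: coroot_def)

lemma refl_root_coroot: "a ~= 0 ==> refl_root (coroot a) = refl_root a"
  unfolding refl_root_eq coroot_def using aff_refl_scaleR[of "2 / (a \<bullet> a)" a 0] by simp

lemma coroot_coroot: "a ~= 0 ==> coroot (coroot a) = a"
  by (simp add: coroot_def)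

context positive_roots
begin

lemma coroot_nonzero: "a : R ==> coroot a ~= 0"
  using R_nonzero by (simp add: coroot_def)

text \<open>Makes statements about roots available for coroots. The same xi0 selects the positive
  ones, since a coroot is a positive multiple of its root.\<close>

lemma dual_positive_roots: "positive_roots (coroot ` R) (coroot ` Rp)"
proof
  show "root_system (coroot ` R)"
    unfolding root_system_def
  proof (intro conjI ballI)
    show "finite (coroot ` R)" using finite_R by simp
    show "0 \<notin> coroot ` R" using coroot_nonzero by (auto simp: image_iff)
    have "R \<subseteq> span (coroot ` R)"
    proof
      fix al assume a: "al : R"
      have "al = ((al \<bullet> al) / 2) *\<^sub>R coroot al" using R_nonzero[OF a] by (simp add: coroot_def)
      also have "... : span (coroot ` R)" using a by (intro span_scale span_base) auto
      finally show "al : span (coroot ` R)" .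
    qed
    then show "span (coroot ` R) = UNIV" using span_R by (metis span_mono span_span top.extremum_unique)
    fix a b assume "a : coroot ` R" "b : coroot ` R"
    then obtain al be where ab: "al : R" "be : R" "a = coroot al" "b = coroot be" by auto
    have "refl_root a b = refl_root al (coroot be)" using ab R_nonzero refl_root_coroot by metis
    also have "... = coroot (refl_root al be)"
      by (simp add: coroot_def inner_refl_root linear_cmul[OF linear_refl_root])
    finally show "refl_root a b : coroot ` R" using ab refl_R by auto
    have "2 * (b \<bullet> a) / (a \<bullet> a) = 2 * (al \<bullet> be) / (be \<bullet> be)"
      using R_nonzero[OF ab(1)] R_nonzero[OF ab(2)] ab(3,4) by (simp add: coroot_inner inner_commute field_simps)
    then show "2 * (b \<bullet> a) / (a \<bullet> a) : \<int>" using int_R[OF ab(2,1)] by simp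
  qed
  show "positive_subsystem (coroot ` R) (coroot ` Rp)"
    unfolding positive_subsystem_def
  proof (intro exI[of _ xi0] conjI ballI)
    have sg: "coroot al \<bullet> xi0 > 0 \<longleftrightarrow> al \<bullet> xi0 > 0" "coroot al \<bullet> xi0 ~= 0 \<longleftrightarrow> al \<bullet> xi0 ~= 0" if "al : R" for al
      using R_nonzero[OF that] inner_gt_zero_iff[of al]
      by (auto simp: coroot_def zero_less_mult_iff zero_less_divide_iff simp del: inner_gt_zero_iff)
    fix a assume "a : coroot ` R" then show "a \<bullet> xi0 ~= 0" using sg xi0 by auto
  next
    have sg: "coroot al \<bullet> xi0 > 0 \<longleftrightarrow> al \<bullet> xi0 > 0" if "al : R" for al
      using R_nonzero[OF that] inner_gt_zero_iff[of al]
      by (auto simp: coroot_def zero_less_mult_iff zero_less_divide_iff simp del: inner_gt_zero_iff)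
    then show "coroot ` Rp = {al : coroot ` R. 0 < al \<bullet> xi0}" using Rp_iff by auto
  qed
qed

text \<open>This is \<open>root_lattice_bidual\<close> for the coroots: a vector with integral
  pairings with all coroots becomes a weight when doubled. It is the reason why exponentials
  separate points modulo pi Q.\<close>

lemma weights_bidual:
  assumes x: "!!\<nu>. \<nu> : weights ==> \<exists>k::int. \<nu> \<bullet> x = 2 * of_int k * pi"
  shows "\<exists>q\<in>Q. x = pi *\<^sub>R q"
proof -
  interpret dual: positive_roots "coroot ` R" "coroot ` Rp" by (rule dual_positive_roots)
  have inj: "inj_on coroot R" using coroot_coroot R_nonzero by (metis inj_onI)
  have "\<exists>k::'a => int. (1/pi) *\<^sub>R x = (\<Sum>a\<in>coroot ` R. of_int (k a) *\<^sub>R a)"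
  proof (rule dual.root_lattice_bidual)
    fix \<nu> assume n: "!!a. a : coroot ` R ==> \<nu> \<bullet> a : \<int>"
    have "2 *\<^sub>R \<nu> : weights"
      unfolding weights_def root_coeff_def using n[OF imageI] by (simp add: coroot_def)
    then obtain k :: int where "(2 *\<^sub>R \<nu>) \<bullet> x = 2 * of_int k * pi" using x by blast
    then have "\<nu> \<bullet> ((1/pi) *\<^sub>R x) = of_int k" by simp
    then show "\<nu> \<bullet> ((1/pi) *\<^sub>R x) : \<int>" by simp
  qed
  then obtain k :: "'a => int" where k: "(1/pi) *\<^sub>R x = (\<Sum>a\<in>coroot ` R. of_int (k a) *\<^sub>R a)" by blast
  also have "... = (\<Sum>a\<in>R. of_int (k (coroot a)) *\<^sub>R coroot a)"
    using inj by (simp add: sum.reindex)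
  finally have "(1/pi) *\<^sub>R x : Q" unfolding Q_def' by (intro CollectI exI[of _ "%a. k (coroot a)"]) simp
  moreover have "x = pi *\<^sub>R ((1/pi) *\<^sub>R x)" by simp
  ultimately show ?thesis by metis
qed

end

section \<open>Uniformly discrete sets\<close>

lemma power_le_fact_exp: "0 \<le> (y::real) ==> y ^ n \<le> fact n * exp y"
proof -
  assume y: "0 \<le> y"
  have "(\<Sum>k\<in>{n}. y ^ k /\<^sub>R fact k) \<le> (\<Sum>k. y ^ k /\<^sub>R fact k)"
    using y by (intro sum_le_suminf summable_exp_generic) auto
  then have "y ^ n / fact n \<le> exp y" by (simp add: exp_def divide_inverse mult.commute)
  then show ?thesis by (simp add: field_simps)
qed

context
  fixes X :: "'a::euclidean_space set" and e :: real
  assumes e: "e > 0" and sep: "!!x y. x : X ==> y : X ==> x ~= y ==> dist x y \<ge> e"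
begin

text \<open>Packing: the balls of radius e/2 about the points of F are disjoint and lie in the ball
  of radius r + e/2, so volumes can be compared.\<close>

lemma separated_card_bound:
  assumes F: "finite F" "F \<subseteq> X \<inter> cball 0 r" and r: "r \<ge> 0"
  shows "real (card F) \<le> ((r + e/2) / (e/2)) ^ DIM('a)"
proof -
  have disj: "disjoint_family_on (%x. ball x (e/2)) F"
    unfolding disjoint_family_on_def
  proof (intro ballI impI)
    fix x y assume "x : F" "y : F" "x ~= y"
    then have "dist x y \<ge> e" using F by (intro sep) auto
    then show "ball x (e/2) \<inter> ball y (e/2) = {}"
      by (intro disjoint_ballI) simp
  qed
  have "real (card F) * (unit_ball_vol DIM('a) * (e/2) ^ DIM('a)) = (\<Sum>x\<in>F. measure lebesgue (ball x (e/2)))"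
    using e by (simp add: content_ball)
  also have "... = measure lebesgue (\<Union>x\<in>F. ball x (e/2))"
    using F disj by (intro measure_finite_Union[symmetric]) (auto intro!: fmeasurableD2 lmeasurable_ball simp del: emeasure_completion)
  also have "... \<le> measure lebesgue (ball (0::'a) (r + e/2))"
  proof (rule measure_mono_fmeasurable)
    show "(\<Union>x\<in>F. ball x (e/2)) \<subseteq> ball 0 (r + e/2)"
    proof safe
      fix x y assume "x : F" "y : ball x (e/2)"
      then have "norm x \<le> r" "norm (y - x) < e/2" using F by (auto simp: dist_norm norm_minus_commute)
      then show "y : ball 0 (r + e/2)" using norm_triangle_sub[of y x] by auto
    qed
  qed (use F in auto)
  also have "... = unit_ball_vol DIM('a) * (r + e/2) ^ DIM('a)" using e r by (simp add: content_ball)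
  finally have "real (card F) * (e/2) ^ DIM('a) \<le> (r + e/2) ^ DIM('a)"
    using unit_ball_vol_pos[of "DIM('a)"] by (simp add: mult.left_commute)
  then show ?thesis using e unfolding power_divide by (subst pos_le_divide_eq) auto
qed

lemma separated_finite: "finite (X \<inter> cball 0 r)"
proof (cases "r \<ge> 0")
  case True
  show ?thesis
  proof (rule ccontr)
    assume inf: "infinite (X \<inter> cball 0 r)"
    define K where "K = nat \<lceil>((r + e/2) / (e/2)) ^ DIM('a)\<rceil>"
    obtain F where F: "F \<subseteq> X \<inter> cball 0 r" "finite F" "card F = Suc K"
      using infinite_arbitrarily_large[OF inf] by metis
    have "real (card F) \<le> ((r + e/2) / (e/2)) ^ DIM('a)" by (rule separated_card_bound) (use F True in auto)
    also have "... \<le> real K" unfolding K_def by linarith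
    finally show False using F by simp
  qed
qed auto

lemma separated_countable: "countable X"
proof -
  have "X \<subseteq> (\<Union>n::nat. X \<inter> cball 0 (real n))"
    using real_arch_simple by (auto simp: image_iff)
  then show ?thesis
    using countable_subset countable_UN[of UNIV "%n::nat. X \<inter> cball 0 (real n)"] countable_finite[OF separated_finite]
    by (metis countableI_type)
qed

lemma separated_summable:
  assumes c: "c > 0"
  shows "(%x. exp (- c * norm x)) summable_on X"
proof (rule nonneg_bdd_above_summable_on)
  define n where "n = DIM('a)"
  \<comment> \<open>In the shell with integer part k the number of points is bounded by the packing
    bound at radius k + 1. By \<open>power_le_fact_exp\<close> this costs exp (c/2 * (k + 1 + e/2)),
    and exp (- c/2)^k of the decay remains.\<close>
  define C where "C = (4 / (c * e)) ^ n * fact n * exp (c/2 * (1 + e/2))"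
  have bound: "(\<Sum>x\<in>F. exp (- c * norm x)) \<le> (\<Sum>k. C * exp (- c/2) ^ k)" if F: "F \<subseteq> X" "finite F" for F
  proof -
    define h where "h x = nat \<lfloor>norm x\<rfloor>" for x :: 'a
    have h: "real (h x) \<le> norm x" "norm x \<le> real (h x) + 1" for x :: 'a
      unfolding h_def by (simp_all add: le_floor_iff)
    have "(\<Sum>x\<in>F. exp (- c * norm x)) = (\<Sum>k\<in>h ` F. \<Sum>x\<in>{x\<in>F. h x = k}. exp (- c * norm x))"
      by (rule sum.image_gen[OF F(2)])
    also have "... \<le> (\<Sum>k\<in>h ` F. C * exp (- c/2) ^ k)"
    proof (rule sum_mono)
      fix k
      let ?F = "{x\<in>F. h x = k}"
      have "(\<Sum>x\<in>?F. exp (- c * norm x)) \<le> (\<Sum>x\<in>?F. exp (- c * real k))"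
        using c h by (intro sum_mono) auto
      also have "... = real (card ?F) * exp (- c * real k)" by simp
      also have "... \<le> ((real k + 1 + e/2) / (e/2)) ^ n * exp (- c * real k)"
        unfolding n_def using F h(2) by (intro mult_right_mono separated_card_bound) auto
      also have "(real k + 1 + e/2) / (e/2) = 4 / (c * e) * (c/2 * (real k + 1 + e/2))"
        using c e by (simp add: field_simps)
      also have "(4 / (c * e) * (c/2 * (real k + 1 + e/2))) ^ n = (4 / (c * e)) ^ n * (c/2 * (real k + 1 + e/2)) ^ n"
        by (rule power_mult_distrib)
      also have "... \<le> (4 / (c * e)) ^ n * (fact n * exp (c/2 * (real k + 1 + e/2)))"
        using c e by (intro mult_left_mono power_le_fact_exp) auto
      finally have "(\<Sum>x\<in>?F. exp (- c * norm x)) \<le> (4 / (c * e)) ^ n * (fact n * exp (c/2 * (real k + 1 + e/2))) * exp (- c * real k)"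
        by simp
      also have "... = C * exp (- c/2) ^ k"
        by (simp add: C_def exp_of_nat_mult[symmetric] mult_exp_exp algebra_simps)
      finally show "(\<Sum>x\<in>?F. exp (- c * norm x)) \<le> C * exp (- c/2) ^ k" .
    qed
    also have "... \<le> (\<Sum>k. C * exp (- c/2) ^ k)"
      using c e F by (intro sum_le_suminf summable_mult summable_geometric) (auto simp: C_def)
    finally show ?thesis .
  qed
  show "bdd_above (sum (%x. exp (- c * norm x)) ` {F. F \<subseteq> X \<and> finite F})"
    by (rule bdd_aboveI2[of _ _ "\<Sum>k. C * exp (- c/2) ^ k"]) (use bound in auto)
qed auto

end

section \<open>Orthogonal invariance of Lebesgue measure\<close>

lemma nn_integral_lborel_translate:
  fixes f :: "'a::euclidean_space => ennreal"
  assumes "f : borel_measurable borel"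
  shows "(\<integral>\<^sup>+x. f (x + v) \<partial>lborel) = (\<integral>\<^sup>+x. f x \<partial>lborel)"
proof -
  have "(\<integral>\<^sup>+x. f x \<partial>lborel) = (\<integral>\<^sup>+x. f x \<partial>distr lborel borel ((+) v))"
    by (simp add: lborel_distr_plus)
  also have "... = (\<integral>\<^sup>+x. f (v + x) \<partial>lborel)" using assms by (subst nn_integral_distr) auto
  finally show ?thesis by (simp add: add.commute)
qed

text \<open>The image of Lebesgue measure under an isometry is translation invariant; convolving with the
  unit ball shows that it is Lebesgue measure.\<close>
lemma nn_integral_lborel_isometry:
  fixes f :: "'a::euclidean_space => ennreal" and w :: "'a => 'a"
  assumes f[measurable]: "f : borel_measurable borel" and w: "linear w" "!!x. norm (w x) = norm x"
  shows "(\<integral>\<^sup>+x. f (w x) \<partial>lborel) = (\<integral>\<^sup>+x. f x \<partial>lborel)"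
proof -
  have inj: "inj w" using w by (metis linear_injective_0 norm_eq_zero)
  have surj: "surj w" using linear_injective_imp_surjective[OF w(1) inj] by simp
  have [measurable]: "w : borel_measurable borel"
    using w(1) by (intro borel_measurable_continuous_onI linear_continuous_on linear_conv_bounded_linear[THEN iffD1])
  define g :: "'a => ennreal" where "g = indicator (ball 0 1)"
  have [measurable]: "g : borel_measurable borel" unfolding g_def by (intro borel_measurable_indicator) auto
  define c where "c = (\<integral>\<^sup>+x. g x \<partial>lborel)"
  have c: "c = ennreal (unit_ball_vol DIM('a))" by (simp add: c_def g_def emeasure_ball)
  have gw: "g (w y) = g y" for y by (simp add: g_def indicator_def w)
  have gm: "g (- y) = g y" for y by (simp add: g_def indicator_def)
  \<comment> \<open>Both integrals times the volume c of the unit ball equal the double integral of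
    f (x + w y) g y. Integrating over x first gives the integral of f; shifting y by the preimage u
    of x and then integrating over x gives that of f o w.\<close>
  have "c * (\<integral>\<^sup>+x. f x \<partial>lborel) = (\<integral>\<^sup>+y. (\<integral>\<^sup>+x. f x \<partial>lborel) * g y \<partial>lborel)"
    unfolding c_def by (subst nn_integral_cmult) (auto simp: mult.commute)
  also have "... = (\<integral>\<^sup>+y. (\<integral>\<^sup>+x. f (x + w y) * g y \<partial>lborel) \<partial>lborel)"
    by (rule nn_integral_cong) (simp add: nn_integral_multc nn_integral_lborel_translate)
  also have "... = (\<integral>\<^sup>+x. (\<integral>\<^sup>+y. f (x + w y) * g y \<partial>lborel) \<partial>lborel)"
    by (rule lborel_pair.Fubini'[symmetric]) measurable
  also have "... = (\<integral>\<^sup>+x. (\<integral>\<^sup>+y. f (w y) * g (w y - x) \<partial>lborel) \<partial>lborel)"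
  proof (rule nn_integral_cong)
    fix x
    obtain u where u: "w u = x" using surj by (metis surjD)
    have "(\<integral>\<^sup>+y. f (x + w y) * g y \<partial>lborel) = (\<integral>\<^sup>+y. f (w (y + u)) * g (w (y + u) - x) \<partial>lborel)"
      using w(1) u by (intro nn_integral_cong) (simp add: linear_add gw add.commute)
    also have "... = (\<integral>\<^sup>+y. f (w y) * g (w y - x) \<partial>lborel)"
      by (rule nn_integral_lborel_translate[of "%y. f (w y) * g (w y - x)"]) measurable
    finally show "(\<integral>\<^sup>+y. f (x + w y) * g y \<partial>lborel) = (\<integral>\<^sup>+y. f (w y) * g (w y - x) \<partial>lborel)" .
  qed
  also have "... = (\<integral>\<^sup>+y. (\<integral>\<^sup>+x. f (w y) * g (w y - x) \<partial>lborel) \<partial>lborel)"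
    by (rule lborel_pair.Fubini'[symmetric]) measurable
  also have "... = (\<integral>\<^sup>+y. f (w y) * c \<partial>lborel)"
  proof (rule nn_integral_cong)
    fix y
    have "(\<integral>\<^sup>+x. f (w y) * g (w y - x) \<partial>lborel) = f (w y) * (\<integral>\<^sup>+x. g (x + (- w y)) \<partial>lborel)"
      using gm[of "w y - _"] by (simp add: nn_integral_cmult)
    also have "(\<integral>\<^sup>+x. g (x + (- w y)) \<partial>lborel) = c"
      unfolding c_def by (rule nn_integral_lborel_translate) measurable
    finally show "(\<integral>\<^sup>+x. f (w y) * g (w y - x) \<partial>lborel) = f (w y) * c" .
  qed
  also have "... = c * (\<integral>\<^sup>+y. f (w y) \<partial>lborel)" by (subst nn_integral_multc) (auto simp: mult.commute)
  finally have "c * (\<integral>\<^sup>+x. f x \<partial>lborel) = c * (\<integral>\<^sup>+y. f (w y) \<partial>lborel)" .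
  moreover have "unit_ball_vol (real DIM('a)) > 0" by simp
  then have "c ~= 0" "c ~= top" unfolding c by (metis ennreal_eq_0_iff not_le) simp
  ultimately show ?thesis by (auto simp: ennreal_mult_cancel_left)
qed

section \<open>The affine Weyl group and its fundamental alcove\<close>

context positive_roots
begin

definition affT :: "('a => 'a) set" where
  "affT = {aff_refl al (of_int k * pi) | al k. al : R}"

lemma reflection_arrangement_affT: "reflection_arrangement affT"
proof
  show "\<exists>n c. n ~= 0 \<and> t = aff_refl n c" if "t : affT" for t
    using that R_nonzero by (auto simp: affT_def)
next
  fix t u assume "t : affT" "u : affT"
  then obtain al k b l where ab: "al : R" "b : R" "t = aff_refl al (of_int k * pi)" "u = aff_refl b (of_int l * pi)"
    by (auto simp: affT_def)
  obtain j :: int where j: "2 * (b \<bullet> al) / (al \<bullet> al) = of_int j" using int_R[OF ab(1,2)] by (auto simp: Ints_def)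
  have "t \<circ> u \<circ> t = aff_refl (refl_root al b) (of_int l * pi - of_int j * (of_int k * pi))"
    unfolding ab(3,4) using R_nonzero ab by (subst aff_refl_conj) (auto simp: j)
  also have "of_int l * pi - of_int j * (of_int k * pi) = of_int (l - j * k) * pi"
    by (simp add: algebra_simps)
  finally show "t \<circ> u \<circ> t : affT" using refl_R ab unfolding affT_def by blast
next
  fix r :: real
  define M where "M = Max (insert 1 (norm ` R))"
  have M: "M \<ge> 1" "!!al. al : R ==> norm al \<le> M" unfolding M_def using finite_R by auto
  define K where "K = \<lceil>M * \<bar>r\<bar>\<rceil>"
  have "{t : affT. \<exists>x\<in>cball 0 r. t x = x} \<subseteq> (%(al, k). aff_refl al (of_int k * pi)) ` (R \<times> {-K..K})"
  proof
    fix t assume "t : {t : affT. \<exists>x\<in>cball 0 r. t x = x}"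
    then obtain al k x where a: "al : R" "t = aff_refl al (of_int k * pi)" "norm x \<le> r" "t x = x"
      by (auto simp: affT_def)
    then have "al \<bullet> x = of_int k * pi" using R_nonzero by (simp add: aff_refl_fixed)
    then have "\<bar>of_int k * pi\<bar> \<le> norm al * norm x" by (metis Cauchy_Schwarz_ineq2)
    also have "... \<le> M * \<bar>r\<bar>" using a M by (intro mult_mono) auto
    finally have "\<bar>of_int k\<bar> * pi \<le> M * \<bar>r\<bar>" by (simp add: abs_mult)
    moreover have "\<bar>real_of_int k\<bar> * 1 \<le> \<bar>of_int k\<bar> * pi" using pi_gt3 by (intro mult_left_mono) auto
    ultimately have "\<bar>real_of_int k\<bar> \<le> M * \<bar>r\<bar>" by simp
    then have "k : {-K..K}" unfolding K_def by (auto simp: abs_le_iff le_ceiling_iff) linarith+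
    then show "t : (%(al, k). aff_refl al (of_int k * pi)) ` (R \<times> {-K..K})" using a by auto
  qed
  then show "finite {t : affT. \<exists>x\<in>cball 0 r. t x = x}"
    by (rule finite_subset) (use finite_R in simp)
qed

sublocale aff: reflection_arrangement affT by (rule reflection_arrangement_affT)

lemma weyl_word: "w : W ==> \<exists>ws. set ws \<subseteq> affT \<and> aff.wprod ws = w"
proof (induction rule: weyl_group.induct)
  case wid
  then show ?case by (intro exI[of _ "[]"]) auto
next
  case (wstep a w)
  then obtain ws where ws: "set ws \<subseteq> affT" "aff.wprod ws = w" by blast
  have "aff_refl a (of_int 0 * pi) : affT" unfolding affT_def using wstep by blast
  then have "refl_root a : affT" by (simp add: refl_root_eq)
  then show ?case using ws by (intro exI[of _ "refl_root a # ws"]) (auto simp del: comp_apply)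
qed

definition transl :: "'a set" where
  "transl = {v. \<exists>ws. set ws \<subseteq> affT \<and> aff.wprod ws = (%x. x + v)}"

lemma transl_add: "u : transl ==> v : transl ==> u + v : transl"
proof -
  assume "u : transl" "v : transl"
  then obtain us vs where "set us \<subseteq> affT" "aff.wprod us = (%x. x + u)" "set vs \<subseteq> affT" "aff.wprod vs = (%x. x + v)"
    by (auto simp: transl_def)
  then show ?thesis unfolding transl_def
    by (intro CollectI exI[of _ "us @ vs"]) (auto simp: fun_eq_iff algebra_simps)
qed

lemma transl_zero: "0 : transl"
  unfolding transl_def by (intro CollectI exI[of _ "[]"]) auto

lemma transl_neg: "u : transl ==> - u : transl"
proof -
  assume "u : transl"
  then obtain us where us: "set us \<subseteq> affT" "aff.wprod us = (%x. x + u)" by (auto simp: transl_def)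
  have "aff.wprod (rev us) x = x + - u" for x
    using aff.wprod_rev(2)[OF us(1), of "x - u"] us(2) by simp
  then have "aff.wprod (rev us) = (%x. x + - u)" by blast
  then show ?thesis using us unfolding transl_def by (intro CollectI exI[of _ "rev us"]) auto
qed

lemma transl_of_int: "u : transl ==> of_int k *\<^sub>R u : transl"
proof -
  assume u: "u : transl"
  have n: "real n *\<^sub>R u : transl" for n
    by (induction n) (auto simp: transl_zero scaleR_left_distrib intro: transl_add u)
  show ?thesis
  proof (cases "k \<ge> 0")
    case True then show ?thesis using n[of "nat k"] by simp
  next
    case False then show ?thesis using transl_neg[OF n[of "nat (- k)"]] by simp
  qed
qed

text \<open>The reflection in al . x = 0 followed by that in al . x = pi is the translation by pi
  times the coroot of al.\<close>

lemma Q_transl: "q : Q ==> pi *\<^sub>R q : transl"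
proof -
  assume "q : Q"
  then obtain k where q: "q = (\<Sum>al\<in>R. of_int (k al) *\<^sub>R coroot al)" unfolding Q_def' by auto
  have c: "pi *\<^sub>R coroot al : transl" if a: "al : R" for al
  proof -
    have m: "aff_refl al (of_int 1 * pi) : affT" "aff_refl al (of_int 0 * pi) : affT"
      unfolding affT_def using a by blast+
    have "aff_refl al pi (aff_refl al 0 x) = x + pi *\<^sub>R coroot al" for x
    proof -
      have "al \<bullet> aff_refl al 0 x - pi = - (al \<bullet> x) - pi" using inner_aff_refl[of al al 0 x pi] R_nonzero[OF a] by simp
      then have "aff_refl al pi (aff_refl al 0 x) = aff_refl al 0 x - (2 * (- (al \<bullet> x) - pi) / (al \<bullet> al)) *\<^sub>R al"
        unfolding aff_refl_def[of al pi] by simp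
      also have "... = x + pi *\<^sub>R coroot al"
        by (simp add: aff_refl_def coroot_def diff_divide_distrib algebra_simps)
      finally show ?thesis .
    qed
    then show ?thesis using m unfolding transl_def
      by (intro CollectI exI[of _ "[aff_refl al pi, aff_refl al 0]"]) (auto simp: fun_eq_iff)
  qed
  have "(\<Sum>al\<in>A. of_int (k al) *\<^sub>R (pi *\<^sub>R coroot al)) : transl" if "A \<subseteq> R" for A
    using finite_subset[OF that finite_R] that
    by (induction A rule: finite_induct) (auto simp: transl_zero simp del: scaleR_scaleR intro!: transl_add transl_of_int c)
  from this[of R] show ?thesis by (simp add: q scaleR_sum_right mult.commute)
qed

lemma affine_word: "w : W ==> q : Q ==> \<exists>ws. set ws \<subseteq> affT \<and> aff.wprod ws = (%x. w x + pi *\<^sub>R q)"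
proof -
  assume "w : W" "q : Q"
  then obtain us vs where "set us \<subseteq> affT" "aff.wprod us = w" "set vs \<subseteq> affT" "aff.wprod vs = (%x. x + pi *\<^sub>R q)"
    using weyl_word Q_transl by (auto simp: transl_def) metis
  then show ?thesis by (intro exI[of _ "vs @ us"]) (auto simp: fun_eq_iff)
qed

text \<open>A base point inside the alcove: xi0 is scaled so that every positive root takes a value
  between 0 and 1, hence below pi.\<close>

definition pt0 :: 'a where
  "pt0 = (1 / (1 + (\<Sum>al\<in>Rp. al \<bullet> xi0))) *\<^sub>R xi0"

lemma p0: "al : Rp ==> 0 < al \<bullet> pt0 \<and> al \<bullet> pt0 < pi"
proof -
  assume a: "al : Rp"
  have "al \<bullet> xi0 \<le> (\<Sum>al\<in>Rp. al \<bullet> xi0)"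
    using a finite_Rp by (intro member_le_sum) (auto simp: Rp_iff less_imp_le)
  moreover have "0 < al \<bullet> xi0" using a by (simp add: Rp_iff)
  ultimately have "0 < al \<bullet> pt0" "al \<bullet> pt0 < 1" by (auto simp: pt0_def field_simps)
  then show ?thesis using pi_gt3 by simp
qed

lemma affT_Rp: "affT = {aff_refl a (of_int k * pi) | a k. a : Rp}"
proof -
  have "\<exists>b l. b : Rp \<and> aff_refl a (of_int k * pi) = aff_refl b (of_int l * pi)" if "a : R" for a k
    using R_cases[OF that]
  proof
    assume "- a : Rp"
    moreover have "aff_refl a (of_int k * pi) = aff_refl (- a) (of_int (- k) * pi)"
      using aff_refl_scaleR[of "-1" a "of_int k * pi"] by simp
    ultimately show ?thesis by blast
  qed blast
  then show ?thesis unfolding affT_def using Rp_R by blast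
qed

lemma p0_regular: "aff.regular pt0"
  unfolding aff.regular_def
proof (intro ballI notI)
  fix t assume "t : affT" "t pt0 = pt0"
  then obtain al k where a: "al : Rp" "aff_refl al (of_int k * pi) pt0 = pt0" unfolding affT_Rp by blast
  then have e: "al \<bullet> pt0 = of_int k * pi" using Rp_nonzero by (simp add: aff_refl_fixed)
  then have "0 < of_int k * pi" "of_int k * pi < 1 * pi" using p0[OF a(1)] by auto
  then have "0 < k" "k < 1" by (simp_all add: zero_less_mult_iff)
  then show False by simp
qed

text \<open>Identifies the alcove with the closed chamber of \<open>pt0\<close>, so that the chamber
  theory of the arrangement applies to it.\<close>

lemma alcove_iff: "x : A0 \<longleftrightarrow> (\<forall>t\<in>affT. \<not> separates t pt0 x)"
proof
  assume x: "x : A0"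
  show "\<forall>t\<in>affT. \<not> separates t pt0 x"
    unfolding affT_Rp
  proof safe
    fix al k assume a: "al : Rp" and s: "separates (aff_refl al (of_int k * pi)) pt0 x"
    have xa: "0 \<le> al \<bullet> x" "al \<bullet> x \<le> pi" using x a by (auto simp: alcove_def)
    have neg: "(al \<bullet> pt0 - of_int k * pi) * (al \<bullet> x - of_int k * pi) < 0"
      using s Rp_nonzero[OF a] by (simp add: separates_aff_refl)
    show False
    proof (cases "k \<le> 0")
      case True
      then have "of_int k * pi \<le> 0" by (simp add: mult_nonpos_nonneg)
      then show False using neg p0[OF a] xa by (auto simp: mult_less_0_iff)
    next
      case False
      then have "1 * pi \<le> of_int k * pi" by (intro mult_right_mono) auto
      then have "pi \<le> of_int k * pi" by simp
      then have "al \<bullet> pt0 - of_int k * pi \<le> 0" "al \<bullet> x - of_int k * pi \<le> 0" using p0[OF a] xa by linarith+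
      then show False using neg mult_nonpos_nonpos by (metis not_less)
    qed
  qed
next
  assume *: "\<forall>t\<in>affT. \<not> separates t pt0 x"
  show "x : A0" unfolding alcove_def
  proof (intro CollectI ballI)
    fix al assume a: "al : Rp"
    have "\<not> separates (aff_refl al (of_int 0 * pi)) pt0 x" "\<not> separates (aff_refl al (of_int 1 * pi)) pt0 x"
      using * a unfolding affT_Rp by blast+
    then show "0 \<le> al \<bullet> x \<and> al \<bullet> x \<le> pi"
      using p0[OF a] Rp_nonzero[OF a] by (auto simp: separates_aff_refl mult_less_0_iff not_less)
  qed
qed

lemma alcove_unique:
  assumes "x : A0" "w : W" "q : Q" "w x + pi *\<^sub>R q : A0"
  shows "w x + pi *\<^sub>R q = x"
proof -
  obtain ws where ws: "set ws \<subseteq> affT" "aff.wprod ws = (%x. w x + pi *\<^sub>R q)" using affine_word assms by blast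
  show ?thesis
    using aff.chamber_unique[OF p0_regular ws(1), of x] assms(1,4) unfolding alcove_iff ws(2) by blast
qed

lemma affine_stabilizer:
  assumes "aff.regular x" "w : W" "q : Q" "w x + pi *\<^sub>R q = x"
  shows "w = id" "q = 0"
proof -
  obtain ws where ws: "set ws \<subseteq> affT" "aff.wprod ws = (%x. w x + pi *\<^sub>R q)" using affine_word assms by blast
  have "aff.wprod ws = id" using aff.stabilizer_trivial[OF assms(1) ws(1)] ws(2) assms(4) by simp
  then have e: "w y + pi *\<^sub>R q = y" for y using ws(2) by (metis id_apply)
  then have "pi *\<^sub>R q = 0" using e[of 0] unfolding weyl_zero[OF assms(2)] by simp
  then show "q = 0" by simp
  then show "w = id" using e by auto
qed

lemma Q_sep: "\<exists>e>0. \<forall>x\<in>Q. \<forall>y\<in>Q. x ~= y --> e \<le> dist x y"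
  using Q_separated Q_arith(4) by (metis dist_norm right_minus_eq)

lemma weights_sep: "\<exists>e>0. \<forall>x\<in>weights. \<forall>y\<in>weights. x ~= y --> e \<le> dist x y"
  using weights_separated weights_arith(3) by (metis dist_norm right_minus_eq)

lemma countable_Q: "countable Q" and finite_Q_cball: "finite (Q \<inter> cball 0 r)"
  using Q_sep separated_countable separated_finite by metis+

lemma countable_weights: "countable weights" and finite_weights_cball: "finite (weights \<inter> cball 0 r)"
  using weights_sep separated_countable separated_finite by metis+

lemma summable_weights: "c > 0 ==> (%x. exp (- c * norm x)) summable_on weights"
  using weights_sep separated_summable by metis

lemma summable_Q: "c > 0 ==> (%x. exp (- c * norm x)) summable_on Q"
  using Q_sep separated_summable by metis

text \<open>An orbit point nearest to the base point of the alcove lies in the alcove.\<close>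
lemma alcove_exists: "\<exists>w\<in>W. \<exists>q\<in>Q. w x + pi *\<^sub>R q : A0"
proof -
  define d where "d z = dist pt0 (fst z x + pi *\<^sub>R snd z)" for z :: "('a => 'a) \<times> 'a"
  define r where "r = d (id, 0)"
  \<comment> \<open>The minimum is taken over the orbit points no farther from \<open>pt0\<close>
    than x itself; discreteness of Q makes this set finite.\<close>
  define S where "S = {z : W \<times> Q. d z \<le> r}"
  have "S \<subseteq> W \<times> (Q \<inter> cball 0 ((r + norm pt0 + norm x) / pi))"
  proof
    fix z assume z: "z : S"
    obtain w q where wq: "z = (w, q)" "w : W" "q : Q" "dist pt0 (w x + pi *\<^sub>R q) \<le> r"
      using z by (cases z) (auto simp: S_def d_def)
    have "norm (pi *\<^sub>R q) = norm ((w x + pi *\<^sub>R q - pt0) + pt0 - w x)" by simp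
    also have "... \<le> norm (w x + pi *\<^sub>R q - pt0) + norm pt0 + norm (w x)"
      by (metis norm_triangle_ineq norm_triangle_ineq4 add_right_mono order_trans)
    also have "... \<le> r + norm pt0 + norm x" using wq by (simp add: dist_norm norm_minus_commute weyl_norm)
    finally have "norm q \<le> (r + norm pt0 + norm x) / pi" by (simp add: field_simps)
    then show "z : W \<times> (Q \<inter> cball 0 ((r + norm pt0 + norm x) / pi))" using wq by simp
  qed
  then have fin: "finite S" using finite_W finite_Q_cball by (metis finite_SigmaI finite_subset)
  have "(id, 0) : S" using id_W Q_arith by (auto simp: S_def r_def)
  then obtain z where z: "z : S" "!!y. y : S ==> d z \<le> d y"
    by (metis (no_types, lifting) emptyE linorder_not_le fin arg_min_if_finite)
  obtain w q where wq: "z = (w, q)" "w : W" "q : Q" using z(1) by (cases z) (auto simp: S_def)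
  have "w x + pi *\<^sub>R q : A0"
    unfolding alcove_iff
  proof (intro ballI notI)
    fix t assume t: "t : affT" and s: "separates t pt0 (w x + pi *\<^sub>R q)"
    obtain al k where a: "al : R" "t = aff_refl al (of_int k * pi)" using t by (auto simp: affT_def)
    have ty: "t y = refl_root al y + pi *\<^sub>R (of_int k *\<^sub>R coroot al)" for y
      by (simp add: a(2) aff_refl_def refl_root_def coroot_def inner_commute diff_divide_distrib algebra_simps)
    have k: "of_int k *\<^sub>R coroot al : Q"
    proof -
      have "of_int k *\<^sub>R coroot al = (\<Sum>b\<in>R. of_int (if b = al then k else 0) *\<^sub>R coroot b)"
        using a finite_R by (simp add: if_distrib[of of_int] if_distrib[of "%c. c *\<^sub>R _"] cong: if_cong)
      then show ?thesis unfolding Q_def' by (intro CollectI exI[of _ "%b. if b = al then k else 0"]) simp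
    qed
    define z' where "z' = (refl_root al \<circ> w, refl_root al q + of_int k *\<^sub>R coroot al)"
    have ra: "refl_root al : W" using weyl_refl a by blast
    have "d z' = dist pt0 (t (w x + pi *\<^sub>R q))"
      using ra by (simp add: z'_def d_def ty weyl_add weyl_scale algebra_simps)
    also have "... < d z" using s by (simp add: separates_def d_def wq)
    finally have "d z' < d z" .
    moreover have "z' : W \<times> Q"
      using weyl_comp[OF ra wq(2)] Q_weyl[OF ra wq(3)] Q_arith(2) k by (simp add: z'_def)
    ultimately have "z' : S" using z(1) by (auto simp: S_def)
    then show False using z(2)[of z'] \<open>d z' < d z\<close> by simp
  qed
  then show ?thesis using wq by blast
qed

lemma closed_alcove: "closed (A0)"
proof -
  have "A0 = (\<Inter>a\<in>Rp. {x. 0 \<le> a \<bullet> x} \<inter> {x. a \<bullet> x \<le> pi})" by (auto simp: alcove_def)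
  also have "closed ..."
    by (intro closed_INT ballI closed_Int closed_Collect_le continuous_intros)
  finally show ?thesis .
qed

lemma bounded_alcove: "\<exists>D>0. \<forall>x\<in>A0. norm x \<le> D"
proof -
  obtain c where c: "c > 0" "!!x. c * norm x \<le> (\<Sum>a\<in>R. \<bar>a \<bullet> x\<bar>)" using root_norm_bound by blast
  have "norm x \<le> (real (card R) * pi + 1) / c" if x: "x : A0" for x
  proof -
    have "\<bar>a \<bullet> x\<bar> \<le> pi" if "a : R" for a
      using R_cases[OF that] x by (auto simp: alcove_def abs_le_iff)
    then have "(\<Sum>a\<in>R. \<bar>a \<bullet> x\<bar>) \<le> real (card R) * pi" by (rule sum_bounded_above)
    then show ?thesis using c(1) c(2)[of x] by (simp add: field_simps)
  qed
  moreover have "(real (card R) * pi + 1) / c > 0" using c by (intro divide_pos_pos add_nonneg_pos) auto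
  ultimately show ?thesis by blast
qed

lemma compact_alcove: "compact (A0)"
  using closed_alcove bounded_alcove by (auto simp: compact_eq_bounded_closed bounded_iff)

lemma alcove_borel [measurable]: "A0 : sets borel"
  using closed_alcove by (rule borel_closed)

text \<open>Dividing by M brings x and w x into the alcove, where \<open>alcove_unique\<close>
  applies; linearity of w scales back.\<close>

lemma chamber_unique:
  assumes "w : W" "!!a. a : Rp ==> 0 \<le> a \<bullet> x" "!!a. a : Rp ==> 0 \<le> a \<bullet> w x"
  shows "w x = x"
proof -
  define M where "M = 1 + (\<Sum>a\<in>Rp. a \<bullet> x) + (\<Sum>a\<in>Rp. a \<bullet> w x)"
  have M: "M \<ge> 1" unfolding M_def using assms by (simp add: sum_nonneg)
  have le: "a \<bullet> x \<le> M" "a \<bullet> w x \<le> M" if "a : Rp" for a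
  proof -
    have "a \<bullet> x \<le> (\<Sum>a\<in>Rp. a \<bullet> x)" "a \<bullet> w x \<le> (\<Sum>a\<in>Rp. a \<bullet> w x)"
      using that finite_Rp assms by (auto intro!: member_le_sum)
    moreover have "(\<Sum>a\<in>Rp. a \<bullet> x) \<ge> 0" "(\<Sum>a\<in>Rp. a \<bullet> w x) \<ge> 0" using assms by (simp_all add: sum_nonneg)
    ultimately show "a \<bullet> x \<le> M" "a \<bullet> w x \<le> M" by (auto simp: M_def)
  qed
  have in_alcove: "(1 / M) *\<^sub>R y : A0" if "!!a. a : Rp ==> 0 \<le> a \<bullet> y \<and> a \<bullet> y \<le> M" for y
  proof -
    have "0 \<le> a \<bullet> y / M \<and> a \<bullet> y / M \<le> 1" if "a : Rp" for a using \<open>!!a. a : Rp ==> 0 \<le> a \<bullet> y \<and> a \<bullet> y \<le> M\<close>[OF that] M by simp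
    then show ?thesis using pi_gt3 by (fastforce simp: alcove_def)
  qed
  have "w ((1 / M) *\<^sub>R x) + pi *\<^sub>R 0 = (1 / M) *\<^sub>R x"
    using assms le Q_arith by (intro alcove_unique in_alcove) (auto simp: weyl_scale intro!: in_alcove)
  then show ?thesis using M weyl_scale[OF assms(1)] by simp
qed

end

section \<open>Averaging over the alcove\<close>

context positive_roots
begin

lemma weyl_borel: "w : W ==> w : borel_measurable borel"
  using weyl_linear by (intro borel_measurable_continuous_onI linear_continuous_on linear_conv_bounded_linear[THEN iffD1])

lemma nn_integral_affine:
  fixes f :: "'a => ennreal"
  assumes [measurable]: "f : borel_measurable borel" and w: "w : W"
  shows "(\<integral>\<^sup>+x. f (w x + v) \<partial>lborel) = (\<integral>\<^sup>+x. f x \<partial>lborel)"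
proof -
  have "(\<integral>\<^sup>+x. f (w x + v) \<partial>lborel) = (\<integral>\<^sup>+x. f (x + v) \<partial>lborel)"
    using weyl_linear[OF w] weyl_norm[OF w]
    by (intro nn_integral_lborel_isometry[of "%y. f (y + v)"]) auto
  also have "... = (\<integral>\<^sup>+x. f x \<partial>lborel)" by (rule nn_integral_lborel_translate) measurable
  finally show ?thesis .
qed

lemma AE_regular: "AE x in lborel. aff.regular x"
proof -
  have "AE x in lborel. t x ~= x" if "t : affT" for t
  proof -
    obtain n c where n: "n ~= 0" "t = aff_refl n c" using aff.refl \<open>t : affT\<close> by blast
    have "negligible {x. n \<bullet> x = c}" using n by (intro negligible_hyperplane) auto
    then have "AE x in lebesgue. x \<notin> {x. n \<bullet> x = c}"
      unfolding negligible_iff_null_sets by (rule AE_not_in)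
    then show ?thesis unfolding AE_completion_iff using n by (simp add: aff_refl_fixed)
  qed
  then show ?thesis unfolding aff.regular_def by (simp add: AE_ball_countable aff.countable_T)
qed

abbreviation affmap :: "('a => 'a) \<times> 'a => 'a => 'a" where
  "affmap z x \<equiv> fst z x + pi *\<^sub>R snd z"

text \<open>Existence is \<open>alcove_exists\<close>. Two images of x in the alcove coincide by
  \<open>alcove_unique\<close>, and then the two group elements coincide because a regular point has
  trivial stabilizer.\<close>

lemma tiling_count:
  assumes x: "aff.regular x"
  shows "(\<integral>\<^sup>+z. indicator (A0) (affmap z x) \<partial>count_space (W \<times> Q)) = 1"
proof -
  obtain w q where wq: "w : W" "q : Q" "w x + pi *\<^sub>R q : A0" using alcove_exists by blast
  have uniq: "v = w \<and> r = q" if vr: "v : W" "r : Q" "v x + pi *\<^sub>R r : A0" for v r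
  proof -
    let ?y = "w x + pi *\<^sub>R q"
    have iw: "inv w : W" using weyl_inv wq by blast
    let ?u = "v \<circ> inv w"
    have u: "?u : W" using weyl_comp vr iw by blast
    have "v x + pi *\<^sub>R r = ?u ?y + pi *\<^sub>R (r - ?u q)"
      using wq vr iw u by (simp add: weyl_add weyl_scale weyl_inv_simps algebra_simps)
    moreover have "r - ?u q : Q" using Q_arith(4) vr Q_weyl u wq by blast
    ultimately have "v x + pi *\<^sub>R r = ?y" using alcove_unique[OF wq(3) u] vr by metis
    then have "inv w (v x + pi *\<^sub>R r) - inv w (pi *\<^sub>R q) = x"
      using iw wq weyl_add[OF iw] by simp
    then have "(inv w \<circ> v) x + pi *\<^sub>R (inv w (r - q)) = x"
      using iw by (simp add: weyl_add weyl_scale weyl_diff algebra_simps)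
    moreover have "inv w \<circ> v : W" "inv w (r - q) : Q" using weyl_comp iw vr Q_weyl Q_arith(4) wq by auto
    ultimately have e: "inv w \<circ> v = id" "inv w (r - q) = 0" using affine_stabilizer[OF x] by blast+
    have "v y = w y" for y
    proof -
      have "inv w (v y) = y" using fun_cong[OF e(1), of y] by simp
      then have "w (inv w (v y)) = w y" by simp
      then show ?thesis using wq by simp
    qed
    then have "v = w" by blast
    moreover have "w (inv w (r - q)) = w 0" unfolding e(2) ..
    then have "r - q = 0" unfolding weyl_inv_simps(1)[OF wq(1)] weyl_zero[OF wq(1)] .
    ultimately show ?thesis by (intro conjI) (assumption, simp only: right_minus_eq)
  qed
  have "(\<integral>\<^sup>+z. indicator (A0) (affmap z x) \<partial>count_space (W \<times> Q)) = (\<Sum>z\<in>{(w, q)}. indicator (A0) (affmap z x))"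
  proof (rule nn_integral_count_space')
    fix z assume z: "z : W \<times> Q" "z \<notin> {(w, q)}"
    obtain v r where vr: "z = (v, r)" by (cases z)
    then have "v x + pi *\<^sub>R r \<notin> A0" using uniq[of v r] z by blast
    then show "indicator (A0) (affmap z x) = 0" by (simp add: vr)
  qed (use wq in auto)
  also have "... = 1" using wq by simp
  finally show ?thesis .
qed

lemma countable_WQ: "countable (W \<times> Q)"
  using finite_W countable_Q by (auto intro: countable_finite)

lemma affmap_measurable: "z : W \<times> Q ==> affmap z : borel_measurable borel"
  using weyl_borel by (intro borel_measurable_add) auto

text \<open>Insert the sum of indicators from \<open>tiling_count\<close>, which is 1 almost
  everywhere, exchange sum and integral, substitute the inverse affine map in each term, and reindex
  the group by inversion.\<close>

lemma tiling:
  fixes f :: "'a => ennreal"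
  assumes f[measurable]: "f : borel_measurable borel"
  shows "(\<integral>\<^sup>+x. f x \<partial>lborel) =
         (\<integral>\<^sup>+x. (\<integral>\<^sup>+z. f (affmap z x) \<partial>count_space (W \<times> Q)) * indicator (A0) x \<partial>lborel)"
proof -
  let ?I = "W \<times> Q" and ?A = "indicator (A0) :: 'a => ennreal"
  note [measurable] = affmap_measurable
  have "(\<integral>\<^sup>+x. f x \<partial>lborel) = (\<integral>\<^sup>+x. f x * (\<integral>\<^sup>+z. ?A (affmap z x) \<partial>count_space ?I) \<partial>lborel)"
    using AE_regular by (intro nn_integral_cong_AE) (auto simp: tiling_count)
  also have "... = (\<integral>\<^sup>+x. (\<integral>\<^sup>+z. f x * ?A (affmap z x) \<partial>count_space ?I) \<partial>lborel)"
    by (intro nn_integral_cong nn_integral_cmult[symmetric]) simp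
  also have "... = (\<integral>\<^sup>+z. (\<integral>\<^sup>+x. f x * ?A (affmap z x) \<partial>lborel) \<partial>count_space ?I)"
    by (rule nn_integral_count_space_nn_integral[OF countable_WQ]) measurable
  also have "... = (\<integral>\<^sup>+z. (\<integral>\<^sup>+x. f (affmap (inv (fst z), - inv (fst z) (snd z)) x) * ?A x \<partial>lborel) \<partial>count_space ?I)"
  proof (rule nn_integral_cong)
    fix z assume "z : space (count_space ?I)"
    then obtain w q where z: "z = (w, q)" "w : W" "q : Q" by auto
    have iw: "inv w : W" using weyl_inv z by blast
    define F where "F y = f (inv w y - pi *\<^sub>R inv w q) * ?A y" for y
    have [measurable]: "F : borel_measurable borel" unfolding F_def using weyl_borel[OF iw] by measurable
    have "f x * ?A (w x + pi *\<^sub>R q) = F (w x + pi *\<^sub>R q)" for x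
      using z iw by (simp add: F_def weyl_add weyl_scale)
    then have "(\<integral>\<^sup>+x. f x * ?A (affmap z x) \<partial>lborel) = (\<integral>\<^sup>+x. F (w x + pi *\<^sub>R q) \<partial>lborel)"
      using z by simp
    also have "... = (\<integral>\<^sup>+x. F x \<partial>lborel)" using z by (intro nn_integral_affine) auto
    finally show "(\<integral>\<^sup>+x. f x * ?A (affmap z x) \<partial>lborel) = (\<integral>\<^sup>+x. f (affmap (inv (fst z), - inv (fst z) (snd z)) x) * ?A x \<partial>lborel)"
      by (simp add: F_def z)
  qed
  also have "... = (\<integral>\<^sup>+z. (\<integral>\<^sup>+x. f (affmap z x) * ?A x \<partial>lborel) \<partial>count_space ?I)"
  proof (rule nn_integral_bij_count_space)
    let ?j = "%z. (inv (fst z), - inv (fst z) (snd z))"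
    have jj: "?j (?j z) = z" if zI: "z : ?I" for z
    proof -
      obtain w q where z: "z = (w, q)" "w : W" "q : Q" using zI by auto
      have "inv (inv w) = w" using weyl_bij[OF z(2)] inv_inv_eq by blast
      then show ?thesis using z weyl_neg[OF z(2)] by simp
    qed
    have "?j z : ?I" if "z : ?I" for z
      using that weyl_inv Q_weyl Q_arith(3) by auto
    then show "bij_betw ?j ?I ?I" using jj by (intro bij_betwI[where g = ?j]) auto
  qed
  also have "... = (\<integral>\<^sup>+x. (\<integral>\<^sup>+z. f (affmap z x) * ?A x \<partial>count_space ?I) \<partial>lborel)"
    by (rule nn_integral_count_space_nn_integral[symmetric, OF countable_WQ]) measurable
  also have "... = (\<integral>\<^sup>+x. (\<integral>\<^sup>+z. f (affmap z x) \<partial>count_space ?I) * ?A x \<partial>lborel)"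
    by (intro nn_integral_cong nn_integral_multc) simp
  finally show ?thesis .
qed

lemma nn_integral_WQ_product:
  fixes a :: "'a => ennreal" and b :: "('a => 'a) => ennreal"
  shows "(\<integral>\<^sup>+z. a (snd z) * b (fst z) \<partial>count_space (W \<times> Q)) = (\<integral>\<^sup>+q. a q \<partial>count_space Q) * (\<Sum>w\<in>W. b w)"
proof -
  interpret sQ: sigma_finite_measure "count_space Q"
    using countable_Q by (rule sigma_finite_measure_count_space_countable)
  have cW: "countable W" using finite_W by (rule countable_finite)
  have "(\<integral>\<^sup>+z. a (snd z) * b (fst z) \<partial>count_space (W \<times> Q)) = (\<integral>\<^sup>+z. a (snd z) * b (fst z) \<partial>(count_space W \<Otimes>\<^sub>M count_space Q))"
    by (simp add: pair_measure_countable[OF cW countable_Q])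
  also have "... = (\<integral>\<^sup>+w. (\<integral>\<^sup>+q. a q * b w \<partial>count_space Q) \<partial>count_space W)"
    by (subst sQ.nn_integral_fst[symmetric]) (auto simp: pair_measure_countable[OF cW countable_Q])
  also have "... = (\<integral>\<^sup>+w. (\<integral>\<^sup>+q. a q \<partial>count_space Q) * b w \<partial>count_space W)"
    by (intro nn_integral_cong nn_integral_multc) simp
  also have "... = (\<integral>\<^sup>+q. a q \<partial>count_space Q) * (\<Sum>w\<in>W. b w)"
    by (simp add: nn_integral_count_space_finite[OF finite_W] sum_distrib_left)
  finally show ?thesis .
qed

lemma theta_finite:
  assumes "c > 0"
  shows "(\<integral>\<^sup>+q. ennreal (exp (- c * norm (pi *\<^sub>R q))) \<partial>count_space Q) ~= \<infinity>"
    "(\<integral>\<^sup>+q. ennreal (exp (- c * norm (pi *\<^sub>R q))) \<partial>count_space Q) ~= 0"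
proof -
  have s: "(%q. exp (- (c * pi) * norm q)) summable_on Q" using assms by (intro summable_Q) simp
  then have "(%q. norm (exp (- (c * pi) * norm q))) summable_on Q" by simp
  then have "Infinite_Set_Sum.abs_summable_on (%q. exp (- (c * pi) * norm q)) Q"
    by (rule abs_summable_equivalent[THEN iffD1])
  then have "integrable (count_space Q) (%q. exp (- (c * pi) * norm q))"
    by (simp add: abs_summable_on_def)
  then show "(\<integral>\<^sup>+q. ennreal (exp (- c * norm (pi *\<^sub>R q))) \<partial>count_space Q) ~= \<infinity>"
    by (simp add: integrable_iff_bounded mult.assoc)
  have "ennreal (exp (- c * norm (pi *\<^sub>R (0::'a)))) \<le> (\<integral>\<^sup>+q. ennreal (exp (- c * norm (pi *\<^sub>R q))) \<partial>count_space Q)"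
    by (rule nn_integral_ge_point) (rule Q_arith(1))
  then show "(\<integral>\<^sup>+q. ennreal (exp (- c * norm (pi *\<^sub>R q))) \<partial>count_space Q) ~= 0" by auto
qed

text \<open>The integral over the union of the Weyl images of the alcove, which up to null sets is a
  fundamental domain for the translations by pi Q.\<close>

definition nn_mean :: "('a => ennreal) => ennreal" where
  "nn_mean h = (\<integral>\<^sup>+x. (\<Sum>w\<in>W. h (w x)) * indicator (A0) x \<partial>lborel)"

text \<open>A slowly decaying weight \<open>exp (- c |x|)\<close> is nearly constant on each alcove, so that for
  \<open>c \<rightarrow> 0\<close> the integral over the whole space computes the mean; the former is nearly invariant
  under translations.\<close>
lemma nn_mean_translate_le:
  fixes h :: "'a => ennreal"
  assumes h[measurable]: "h : borel_measurable borel" and per: "!!x q. q : Q ==> h (x + pi *\<^sub>R q) = h x"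
  shows "nn_mean (%x. h (x + v)) \<le> nn_mean h"
proof -
  obtain D where D: "D > 0" "!!x. x : A0 ==> norm x \<le> D" using bounded_alcove by blast
  \<comment> \<open>Passing from the mean to the weighted integral and back costs exp (c * D) each
    time, where D bounds the alcove, and translating the weight costs exp (c * norm v). The product
    of the three tends to 1 with c.\<close>
  have main: "nn_mean (%x. h (x + v)) \<le> ennreal (exp (c * (2 * D + norm v))) * nn_mean h" if c: "c > 0" for c
  proof -
    define \<phi> where "\<phi> x = ennreal (exp (- c * norm x))" for x :: 'a
    have [measurable]: "\<phi> : borel_measurable borel" unfolding \<phi>_def by measurable
    define \<Psi> where "\<Psi> = (\<integral>\<^sup>+q. \<phi> (pi *\<^sub>R q) \<partial>count_space Q)"
    have \<Psi>: "\<Psi> ~= \<infinity>" "\<Psi> ~= 0" using theta_finite[OF c] by (simp_all add: \<Psi>_def \<phi>_def)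
    have \<phi>_le: "\<phi> (x + y) \<le> ennreal (exp (c * norm x)) * \<phi> y" for x y
    proof -
      have "norm y \<le> norm (x + y) + norm x" using norm_triangle_ineq4[of "x + y" x] by simp
      then have "c * norm y \<le> c * (norm (x + y) + norm x)" using c by (intro mult_left_mono) auto
      then have "- c * norm (x + y) \<le> c * norm x + - c * norm y" by (simp add: distrib_left)
      then show ?thesis unfolding \<phi>_def by (simp add: ennreal_mult'[symmetric] mult_exp_exp)
    qed
    define E where "E g = (\<integral>\<^sup>+x. \<phi> x * g x \<partial>lborel)" for g :: "'a => ennreal"
    \<comment> \<open>On the tile of z the weight differs from its value at pi * snd z by at most a
      factor exp (c * D), since the Weyl part keeps the norm below D. So E g is
      \<open>nn_mean g\<close> times the lattice sum \<open>\<Psi>\<close>, up to that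
      factor.\<close>
    have key: "E g \<le> ennreal (exp (c * D)) * \<Psi> * nn_mean g \<and> \<Psi> * nn_mean g \<le> ennreal (exp (c * D)) * E g"
      if g[measurable]: "g : borel_measurable borel" and gper: "!!x q. q : Q ==> g (x + pi *\<^sub>R q) = g x" for g
    proof -
      have gm: "(%x. (\<Sum>w\<in>W. g (w x)) * indicator (A0) x) : borel_measurable lborel"
        using weyl_borel by (auto intro!: borel_measurable_times_ennreal borel_measurable_sum measurable_compose[OF _ g])
      let ?S = "%x. \<integral>\<^sup>+z. \<phi> (affmap z x) * g (affmap z x) \<partial>count_space (W \<times> Q)"
      have ES: "E g = (\<integral>\<^sup>+x. ?S x * indicator (A0) x \<partial>lborel)"
        unfolding E_def by (rule tiling[of "%x. \<phi> x * g x"]) measurable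
      have up: "?S x \<le> ennreal (exp (c * D)) * \<Psi> * (\<Sum>w\<in>W. g (w x))"
        and lo: "\<Psi> * (\<Sum>w\<in>W. g (w x)) \<le> ennreal (exp (c * D)) * ?S x" if x: "x : A0" for x
      proof -
        have prod: "(\<integral>\<^sup>+z. \<phi> (pi *\<^sub>R snd z) * g (fst z x) \<partial>count_space (W \<times> Q)) = \<Psi> * (\<Sum>w\<in>W. g (w x))"
          unfolding \<Psi>_def by (rule nn_integral_WQ_product[of "%q. \<phi> (pi *\<^sub>R q)" "%w. g (w x)"])
        have "?S x \<le> (\<integral>\<^sup>+z. ennreal (exp (c * D)) * (\<phi> (pi *\<^sub>R snd z) * g (fst z x)) \<partial>count_space (W \<times> Q))"
        proof (rule nn_integral_mono)
          fix z assume z: "z : space (count_space (W \<times> Q))"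
          have "\<phi> (affmap z x) \<le> ennreal (exp (c * norm (fst z x))) * \<phi> (pi *\<^sub>R snd z)" by (rule \<phi>_le)
          also have "... \<le> ennreal (exp (c * D)) * \<phi> (pi *\<^sub>R snd z)"
            using z c D(2)[OF x] by (intro mult_right_mono ennreal_leI) (auto simp: weyl_norm)
          finally show "\<phi> (affmap z x) * g (affmap z x) \<le> ennreal (exp (c * D)) * (\<phi> (pi *\<^sub>R snd z) * g (fst z x))"
            using gper z by (auto simp: mult.assoc[symmetric] intro!: mult_right_mono)
        qed
        also have "... = ennreal (exp (c * D)) * \<Psi> * (\<Sum>w\<in>W. g (w x))"
          by (simp add: nn_integral_cmult prod mult.assoc)
        finally show "?S x \<le> ennreal (exp (c * D)) * \<Psi> * (\<Sum>w\<in>W. g (w x))" .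
        have "\<Psi> * (\<Sum>w\<in>W. g (w x)) = (\<integral>\<^sup>+z. \<phi> (pi *\<^sub>R snd z) * g (fst z x) \<partial>count_space (W \<times> Q))"
          by (rule prod[symmetric])
        also have "... \<le> (\<integral>\<^sup>+z. ennreal (exp (c * D)) * (\<phi> (affmap z x) * g (affmap z x)) \<partial>count_space (W \<times> Q))"
        proof (rule nn_integral_mono)
          fix z assume z: "z : space (count_space (W \<times> Q))"
          have "\<phi> (pi *\<^sub>R snd z) = \<phi> (- fst z x + affmap z x)" by simp
          also have "... \<le> ennreal (exp (c * norm (- fst z x))) * \<phi> (affmap z x)" by (rule \<phi>_le)
          also have "... \<le> ennreal (exp (c * D)) * \<phi> (affmap z x)"
            using z c D(2)[OF x] by (intro mult_right_mono ennreal_leI) (auto simp: weyl_norm)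
          finally show "\<phi> (pi *\<^sub>R snd z) * g (fst z x) \<le> ennreal (exp (c * D)) * (\<phi> (affmap z x) * g (affmap z x))"
            using gper z by (auto simp: mult.assoc[symmetric] intro!: mult_right_mono)
        qed
        also have "... = ennreal (exp (c * D)) * ?S x" by (simp add: nn_integral_cmult)
        finally show "\<Psi> * (\<Sum>w\<in>W. g (w x)) \<le> ennreal (exp (c * D)) * ?S x" .
      qed
      have "E g \<le> (\<integral>\<^sup>+x. ennreal (exp (c * D)) * \<Psi> * ((\<Sum>w\<in>W. g (w x)) * indicator (A0) x) \<partial>lborel)"
        unfolding ES using up by (intro nn_integral_mono) (auto simp: indicator_def)
      also have "... = ennreal (exp (c * D)) * \<Psi> * nn_mean g"
        unfolding nn_mean_def using gm by (rule nn_integral_cmult)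
      finally have 1: "E g \<le> ennreal (exp (c * D)) * \<Psi> * nn_mean g" .
      have "\<Psi> * nn_mean g = (\<integral>\<^sup>+x. \<Psi> * ((\<Sum>w\<in>W. g (w x)) * indicator (A0) x) \<partial>lborel)"
        unfolding nn_mean_def using gm by (rule nn_integral_cmult[symmetric])
      also have "... \<le> (\<integral>\<^sup>+x. ennreal (exp (c * D)) * (?S x * indicator (A0) x) \<partial>lborel)"
        using lo by (intro nn_integral_mono) (auto simp: indicator_def)
      also have "... = (\<integral>\<^sup>+x. (\<integral>\<^sup>+z. ennreal (exp (c * D)) * (\<phi> (affmap z x) * g (affmap z x)) \<partial>count_space (W \<times> Q)) * indicator (A0) x \<partial>lborel)"
        by (simp add: nn_integral_cmult mult.assoc)
      also have "... = (\<integral>\<^sup>+x. ennreal (exp (c * D)) * (\<phi> x * g x) \<partial>lborel)"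
        by (rule tiling[symmetric]) measurable
      also have "... = ennreal (exp (c * D)) * E g"
        unfolding E_def by (rule nn_integral_cmult) measurable
      finally show ?thesis using 1 by blast
    qed
    let ?hv = "%x. h (x + v)"
    have hvper: "?hv (x + pi *\<^sub>R q) = ?hv x" if "q : Q" for x q
      using per[OF that, of "x + v"] by (simp add: algebra_simps)
    have "E ?hv = (\<integral>\<^sup>+x. \<phi> ((x + v) - v) * h (x + v) \<partial>lborel)" by (simp add: E_def)
    also have "... = (\<integral>\<^sup>+x. \<phi> (x - v) * h x \<partial>lborel)"
      by (rule nn_integral_lborel_translate[of "%x. \<phi> (x - v) * h x"]) measurable
    also have "... \<le> (\<integral>\<^sup>+x. ennreal (exp (c * norm v)) * (\<phi> x * h x) \<partial>lborel)"
    proof (rule nn_integral_mono)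
      fix x
      have "\<phi> (x - v) \<le> ennreal (exp (c * norm v)) * \<phi> x" using \<phi>_le[of "- v" x] by simp
      then show "\<phi> (x - v) * h x \<le> ennreal (exp (c * norm v)) * (\<phi> x * h x)"
        by (simp add: mult.assoc[symmetric] mult_right_mono)
    qed
    also have "... = ennreal (exp (c * norm v)) * E h"
      unfolding E_def by (rule nn_integral_cmult) measurable
    finally have Ev: "E ?hv \<le> ennreal (exp (c * norm v)) * E h" .
    have "\<Psi> * nn_mean ?hv \<le> ennreal (exp (c * D)) * E ?hv" using key[of ?hv] hvper by simp
    also have "... \<le> ennreal (exp (c * D)) * (ennreal (exp (c * norm v)) * E h)"
      using Ev by (rule mult_left_mono) simp
    also have "... \<le> ennreal (exp (c * D)) * (ennreal (exp (c * norm v)) * (ennreal (exp (c * D)) * \<Psi> * nn_mean h))"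
      using key[OF h per] by (intro mult_left_mono) auto
    also have "... = \<Psi> * (ennreal (exp (c * D)) * ennreal (exp (c * norm v)) * ennreal (exp (c * D)) * nn_mean h)"
      by (simp add: mult_ac)
    also have "ennreal (exp (c * D)) * ennreal (exp (c * norm v)) * ennreal (exp (c * D)) = ennreal (exp (c * (2 * D + norm v)))"
      by (simp add: ennreal_mult'[symmetric] mult_exp_exp algebra_simps)
    finally show ?thesis using \<Psi> by (simp add: ennreal_mult_le_mult_iff)
  qed
  show ?thesis
  proof (cases "nn_mean h = \<infinity>")
    case False
    then obtain H where H: "nn_mean h = ennreal H" "H \<ge> 0" by (cases "nn_mean h") auto
    have "(%n. ennreal (exp (inverse (real (Suc n)) * (2 * D + norm v)) * H)) \<longlonglongrightarrow> ennreal (exp (0 * (2 * D + norm v)) * H)"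
      by (intro tendsto_ennrealI tendsto_intros LIMSEQ_inverse_real_of_nat)
    then have "nn_mean (%x. h (x + v)) \<le> ennreal (exp (0 * (2 * D + norm v)) * H)"
    proof (rule LIMSEQ_le_const, intro exI[of _ 0] allI impI)
      fix n :: nat
      show "nn_mean (%x. h (x + v)) \<le> ennreal (exp (inverse (real (Suc n)) * (2 * D + norm v)) * H)"
        using main[of "inverse (real (Suc n))"] H by (simp add: ennreal_mult')
    qed
    then show ?thesis using H by simp
  qed simp
qed

lemma nn_mean_translate:
  fixes h :: "'a => ennreal"
  assumes h[measurable]: "h : borel_measurable borel" and per: "!!x q. q : Q ==> h (x + pi *\<^sub>R q) = h x"
  shows "nn_mean (%x. h (x + v)) = nn_mean h"
proof (rule antisym)
  show "nn_mean (%x. h (x + v)) \<le> nn_mean h" by (rule nn_mean_translate_le) fact+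
  have "nn_mean (%x. (%y. h (y + v)) (x + - v)) \<le> nn_mean (%y. h (y + v))"
  proof (rule nn_mean_translate_le)
    show "h (x + pi *\<^sub>R q + v) = h (x + v)" if "q : Q" for x q
      using per[OF that, of "x + v"] by (simp add: algebra_simps)
  qed measurable
  then show "nn_mean h \<le> nn_mean (%x. h (x + v))" by simp
qed

end

lemma has_vector_derivative_LIMSEQ:
  fixes f :: "real => complex"
  assumes "(f has_vector_derivative D) (at 0)"
  shows "(%n. of_nat (Suc n) * (f (inverse (real (Suc n))) - f 0)) \<longlonglongrightarrow> D"
proof -
  have fl: "filterlim (%n. inverse (real (Suc n))) (at 0) sequentially"
    unfolding filterlim_at using LIMSEQ_inverse_real_of_nat by (auto intro!: eventuallyI)
  have re: "((%x. Re (f x)) has_field_derivative Re D) (at 0)"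
    and im: "((%x. Im (f x)) has_field_derivative Im D) (at 0)"
    using assms by (auto simp: has_vector_derivative_complex_iff)
  have "(%n. (g (0 + inverse (real (Suc n))) - g 0) / inverse (real (Suc n))) \<longlonglongrightarrow> d"
    if "(g has_field_derivative d) (at 0)" for g :: "real => real" and d
    using that unfolding DERIV_def by (rule filterlim_compose[OF _ fl])
  from this[OF re] this[OF im] show ?thesis
    unfolding tendsto_complex_iff by (simp_all add: divide_inverse mult.commute algebra_simps)
qed

lemma abs_sin_nat_le: fixes t :: real shows "\<bar>sin (real n * t)\<bar> \<le> real n * \<bar>sin t\<bar>"
proof (induction n)
  case (Suc n)
  have "\<bar>sin (real (Suc n) * t)\<bar> = \<bar>sin (real n * t) * cos t + cos (real n * t) * sin t\<bar>"
    by (simp add: algebra_simps sin_add)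
  also have "... \<le> \<bar>sin (real n * t)\<bar> * \<bar>cos t\<bar> + \<bar>cos (real n * t)\<bar> * \<bar>sin t\<bar>"
    by (metis abs_mult abs_triangle_ineq)
  also have "... \<le> \<bar>sin (real n * t)\<bar> * 1 + 1 * \<bar>sin t\<bar>"
    by (intro add_mono mult_mono) auto
  finally show ?case using Suc by (simp add: algebra_simps)
qed simp

lemma abs_sin_int_le: fixes t :: real shows "\<bar>sin (of_int n * t)\<bar> \<le> \<bar>of_int n\<bar> * \<bar>sin t\<bar>"
  using abs_sin_nat_le[of "nat \<bar>n\<bar>" t] by (cases "n \<ge> 0") auto

section \<open>Trigonometric polynomials\<close>

definition E :: "'a::euclidean_space => 'a => complex" where
  "E \<nu> x = exp (\<i> * of_real (\<nu> \<bullet> x))"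

lemma E_simps: "E 0 x = 1" "E n x * E \<mu> x = E (n + \<mu>) x" "cnj (E n x) = E (- n) x" "norm (E n x) = 1"
  "E n (x + y) = E n x * E n y"
  by (simp_all add: E_def exp_add[symmetric] inner_add_left inner_add_right algebra_simps exp_cnj)

lemma continuous_E: "continuous_on S (E n)"
  unfolding E_def by (intro continuous_intros)

lemma E_derivative:
  "((%s. E n (x + s *\<^sub>R \<xi>)) has_vector_derivative (\<i> * of_real (n \<bullet> \<xi>) * E n x)) (at 0)"
proof -
  have "((%z. E n x * exp (z * (\<i> * of_real (n \<bullet> \<xi>)))) has_field_derivative (\<i> * of_real (n \<bullet> \<xi>) * E n x)) (at (of_real 0))"
    by (auto intro!: derivative_eq_intros)
  then have "((%s. E n x * exp (of_real s * (\<i> * of_real (n \<bullet> \<xi>)))) has_vector_derivative (\<i> * of_real (n \<bullet> \<xi>) * E n x)) (at 0)"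
    by (rule has_vector_derivative_real_field)
  then show ?thesis by (simp add: E_def inner_add_right exp_add[symmetric] algebra_simps)
qed

text \<open>The complex span of the exponentials with frequencies in X. Generating it one term at a
  time provides an induction rule for all later linearity arguments.\<close>

inductive_set tspan :: "'a::euclidean_space set => ('a => complex) set" for X where
  tspan_zero: "(%x. 0) : tspan X"
| tspan_step: "f : tspan X ==> n : X ==> (%x. f x + c * E n x) : tspan X"

lemma tspan_scaleE: "n : X ==> (%x. c * E n x) : tspan X"
  using tspan_step[OF tspan_zero, of n X c] by simp

lemma tspan_E: "n : X ==> E n : tspan X"
  using tspan_scaleE[of n X 1] by simp

lemma tspan_add:
  assumes f: "f : tspan X" and g: "g : tspan X" shows "(%x. f x + g x) : tspan X"
  using g
proof induction
  case (tspan_step g n c)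
  then show ?case using tspan.tspan_step[of "%x. f x + g x" X n c] by (simp add: add.assoc)
qed (use f in simp)

lemma tspan_scale: "f : tspan X ==> (%x. a * f x) : tspan X"
proof (induction rule: tspan.induct)
  case (tspan_step f n c)
  then show ?case using tspan.tspan_step[of "%x. a * f x" X n "a * c"] by (simp add: algebra_simps)
qed (simp add: tspan_zero)

lemma tspan_diff: "f : tspan X ==> g : tspan X ==> (%x. f x - g x) : tspan X"
  using tspan_add[of f X "%x. (-1) * g x"] tspan_scale[of g X "-1"] by simp

lemma tspan_sum: "(!!i. i : I ==> f i : tspan X) ==> (%x. \<Sum>i\<in>I. f i x) : tspan X"
  by (induction I rule: infinite_finite_induct) (auto intro: tspan_add tspan_zero)

lemma tspan_mono: assumes "X \<subseteq> Y" "f : tspan X" shows "f : tspan Y"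
  using assms(2)
proof induction
  case (tspan_step f n c)
  then show ?case using assms(1) by (intro tspan.tspan_step) auto
qed (rule tspan_zero)

lemma tspan_cnj: "f : tspan X ==> uminus ` X \<subseteq> Y ==> (%x. cnj (f x)) : tspan Y"
proof (induction rule: tspan.induct)
  case (tspan_step f n c)
  then show ?case using tspan.tspan_step[of "%x. cnj (f x)" Y "- n" "cnj c"] by (auto simp: E_simps)
qed (simp add: tspan_zero)

lemma tspan_mult:
  assumes f: "f : tspan X" and g: "g : tspan Y" and XY: "!!x y. x : X ==> y : Y ==> x + y : Z"
  shows "(%x. f x * g x) : tspan Z"
  using f
proof induction
  case (tspan_step f n c)
  have "(%x. c * E n x * g x) : tspan Z" using g
  proof induction
    case (tspan_step h \<mu> d)
    then show ?case
      using tspan.tspan_step[of "%x. c * E n x * h x" Z "n + \<mu>" "c * d"] XY[OF \<open>n : X\<close>]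
      by (simp add: E_simps(2)[symmetric] algebra_simps)
  qed (simp add: tspan_zero)
  from tspan_add[OF tspan_step.IH this] show ?case by (simp add: distrib_right)
qed (simp add: tspan_zero)

lemma tspan_continuous: "f : tspan X ==> continuous_on S f"
  by (induction rule: tspan.induct) (auto intro!: continuous_intros continuous_E)

lemma tspan_bounded: "f : tspan X ==> \<exists>K. \<forall>x. norm (f x) \<le> K"
proof (induction rule: tspan.induct)
  case (tspan_step f n c)
  then obtain K where K: "!!x. norm (f x) \<le> K" by blast
  have "norm (f x + c * E n x) \<le> K + norm c" for x
    using norm_triangle_ineq[of "f x" "c * E n x"] K[of x] by (simp add: norm_mult E_simps)
  then show ?case by blast
qed auto

definition ddir :: "'a::euclidean_space => ('a => complex) => 'a => complex" where
  "ddir \<xi> f x = vector_derivative (%s. f (x + s *\<^sub>R \<xi>)) (at 0)"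

lemma ddirI: "((%s. f (x + s *\<^sub>R \<xi>)) has_vector_derivative D) (at 0) ==> ddir \<xi> f x = D"
  unfolding ddir_def by (rule vector_derivative_at)

lemma ddir_E: "ddir \<xi> (E n) x = \<i> * of_real (n \<bullet> \<xi>) * E n x"
  by (rule ddirI[OF E_derivative])

lemma tspan_derivative:
  "f : tspan X ==> ddir \<xi> f : tspan X \<and> (\<forall>x. ((%s. f (x + s *\<^sub>R \<xi>)) has_vector_derivative ddir \<xi> f x) (at 0))"
proof (induction rule: tspan.induct)
  case tspan_zero
  have "ddir \<xi> (%x. 0) = (%x. 0)" by (rule ext, rule ddirI) simp
  then show ?case by (simp add: tspan.tspan_zero)
next
  case (tspan_step f n c)
  have D: "((%s. f (x + s *\<^sub>R \<xi>) + c * E n (x + s *\<^sub>R \<xi>)) has_vector_derivative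
        (ddir \<xi> f x + c * (\<i> * of_real (n \<bullet> \<xi>) * E n x))) (at 0)" for x
    using tspan_step by (intro has_vector_derivative_add has_vector_derivative_mult_right E_derivative) auto
  then have eq: "ddir \<xi> (%x. f x + c * E n x) = (%x. ddir \<xi> f x + (c * \<i> * of_real (n \<bullet> \<xi>)) * E n x)"
    by (intro ext ddirI) (simp add: algebra_simps)
  show ?case unfolding eq using tspan_step tspan.tspan_step[of "ddir \<xi> f" X n "c * \<i> * of_real (n \<bullet> \<xi>)"] D
    by (simp add: mult.assoc)
qed

lemma ddir_add: "f : tspan X ==> g : tspan X ==> ddir \<xi> (%x. f x + g x) x = ddir \<xi> f x + ddir \<xi> g x"
  by (intro ddirI has_vector_derivative_add) (auto dest: tspan_derivative)

lemma ddir_mult: "f : tspan X ==> g : tspan Y ==> ddir \<xi> (%x. f x * g x) x = f x * ddir \<xi> g x + ddir \<xi> f x * g x"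
proof (rule ddirI)
  assume "f : tspan X" "g : tspan Y"
  then have "((%s. f (x + s *\<^sub>R \<xi>)) has_vector_derivative ddir \<xi> f x) (at 0)"
    "((%s. g (x + s *\<^sub>R \<xi>)) has_vector_derivative ddir \<xi> g x) (at 0)"
    using tspan_derivative by blast+
  then show "((%s. f (x + s *\<^sub>R \<xi>) * g (x + s *\<^sub>R \<xi>)) has_vector_derivative f x * ddir \<xi> g x + ddir \<xi> f x * g x) (at 0)"
    using has_vector_derivative_mult[of "%s. f (x + s *\<^sub>R \<xi>)" "ddir \<xi> f x" 0 UNIV "%s. g (x + s *\<^sub>R \<xi>)" "ddir \<xi> g x"]
    by simp
qed

lemma ddir_scale: "f : tspan X ==> ddir \<xi> (%x. c * f x) x = c * ddir \<xi> f x"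
  by (intro ddirI has_vector_derivative_mult_right) (auto dest: tspan_derivative)

lemma ddir_sum:
  "(!!i. i : I ==> f i : tspan X) ==> ddir \<xi> (%x. \<Sum>i\<in>I. f i x) x = (\<Sum>i\<in>I. ddir \<xi> (f i) x)"
  by (intro ddirI has_vector_derivative_sum) (use tspan_derivative in blast)

lemma ddir_cnj: "f : tspan X ==> ddir \<xi> (%x. cnj (f x)) x = cnj (ddir \<xi> f x)"
  by (intro ddirI has_vector_derivative_cnj) (auto dest: tspan_derivative)

section \<open>Means of periodic functions\<close>

text \<open>Bounded Borel functions form an algebra and are integrable over the compact alcove, so
  this predicate replaces separate integrability conditions.\<close>

definition good :: "('a::euclidean_space => complex) => bool" where
  "good h \<longleftrightarrow> h : borel_measurable borel \<and> (\<exists>K. \<forall>x. norm (h x) \<le> K)"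

lemma goodI: "h : borel_measurable borel ==> (!!x. norm (h x) \<le> K) ==> good h"
  by (auto simp: good_def)

lemma good_const: "good (%x. c)" by (rule goodI[of _ "norm c"]) auto

lemma good_add: "good f ==> good g ==> good (%x. f x + g x)"
proof -
  assume "good f" "good g"
  then obtain K L where "!!x. norm (f x) \<le> K" "!!x. norm (g x) \<le> L" and [measurable]: "f : borel_measurable borel" "g : borel_measurable borel"
    by (auto simp: good_def)
  then show ?thesis by (intro goodI[of _ "K + L"]) (measurable, metis norm_triangle_mono)
qed

lemma good_mult: "good f ==> good g ==> good (%x. f x * g x)"
proof -
  assume "good f" "good g"
  then obtain K L where K: "!!x. norm (f x) \<le> K" "!!x. norm (g x) \<le> L" and [measurable]: "f : borel_measurable borel" "g : borel_measurable borel"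
    by (auto simp: good_def)
  have "norm (f x * g x) \<le> K * L" for x
    unfolding norm_mult using K[of x] order_trans[OF norm_ge_zero K(1)[of x]] by (intro mult_mono) auto
  then show ?thesis by (intro goodI[of _ "K * L"]) auto
qed

lemma good_scale: "good f ==> good (%x. c * f x)"
  by (intro good_mult good_const)

lemma good_diff: "good f ==> good g ==> good (%x. f x - g x)"
  using good_add[of f "%x. (-1) * g x"] good_scale[of g "-1"] by simp

lemma good_sum: "(!!i. i : I ==> good (f i)) ==> good (%x. \<Sum>i\<in>I. f i x)"
  by (induction I rule: infinite_finite_induct) (auto intro: good_add good_const)

lemma good_cnj: "good f ==> good (%x. cnj (f x))"
  using measurable_compose[OF _ borel_measurable_continuous_onI[of cnj]]
  by (auto simp: good_def intro!: continuous_intros)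

lemma good_tspan: "f : tspan X ==> good f"
  using tspan_bounded[of f X] tspan_continuous[of f X UNIV]
  by (auto simp: good_def intro: borel_measurable_continuous_onI)

context positive_roots
begin

lemma emeasure_alcove: "emeasure lebesgue (A0) < \<infinity>"
  using fmeasurableD2[OF lmeasurable_compact[OF compact_alcove]] by (simp add: less_top)

lemma alcove_lebesgue [measurable]: "A0 : sets lebesgue"
  by (simp add: lebesgue_closedin closed_alcove)

lemma borel_lebesgue: "f : borel_measurable borel ==> f : borel_measurable lebesgue"
  by (simp add: measurable_completion)

lemma set_integrable_alcove:
  fixes h :: "'a => 'b::{banach, second_countable_topology}"
  assumes "h : borel_measurable lebesgue" "!!x. x : A0 ==> norm (h x) \<le> K"
  shows "set_integrable lebesgue (A0) h"
  unfolding set_integrable_def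
  using assms emeasure_alcove by (intro integrableI_bounded_set_indicator[where B = K]) auto

lemma good_weyl: "good h ==> w : W ==> good (%x. h (w x))"
  unfolding good_def using weyl_borel[of w] measurable_compose by blast

lemma good_refl: "good h ==> a : R ==> good (%x. h (refl_root a x))"
  using good_weyl weyl_refl by blast

lemma good_shift: "good h ==> good (%x. h (x + v))"
  unfolding good_def using measurable_compose[of "%x. x + v" borel borel h borel] by auto

lemma good_integrable: "good h ==> set_integrable lebesgue (A0) h"
  unfolding good_def using set_integrable_alcove borel_lebesgue by blast

lemma good_integrable_weyl: "good h ==> w : W ==> set_integrable lebesgue (A0) (%x. h (w x))"
  using good_integrable[OF good_weyl] .

text \<open>Summing over the Weyl group, instead of integrating over the alcove only, gives a
  functional that is invariant under translations of periodic functions even when they are not Weyl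
  invariant.\<close>

definition mean :: "('a => complex) => complex" where
  "mean h = (\<Sum>w\<in>W. LINT x:A0|lebesgue. h (w x))"

lemma mean_add: "good f ==> good g ==> mean (%x. f x + g x) = mean f + mean g"
  unfolding mean_def sum.distrib[symmetric]
  by (rule sum.cong[OF refl], rule set_integral_add(2); rule good_integrable_weyl)

lemma mean_scale: "mean (%x. c * f x) = c * mean f"
  unfolding mean_def by (simp add: sum_distrib_left)

lemma mean_diff: "good f ==> good g ==> mean (%x. f x - g x) = mean f - mean g"
  using mean_add[of f "%x. (-1) * g x"] mean_scale[of "-1" g] good_scale[of g "-1"] by simp

lemma mean_sum: "(!!i. i : I ==> good (f i)) ==> mean (%x. \<Sum>i\<in>I. f i x) = (\<Sum>i\<in>I. mean (f i))"
proof (induction I rule: infinite_finite_induct)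
  case (insert i I)
  then show ?case by (simp add: mean_add good_sum)
qed (simp_all add: mean_def)

lemma bij_betw_weyl_comp_left: "v : W ==> bij_betw (%w. v \<circ> w) W W"
proof (rule bij_betwI[where g = "%w. inv v \<circ> w"])
  assume v: "v : W"
  have "v \<circ> inv v = id" "inv v \<circ> v = id" using v by (auto simp: fun_eq_iff)
  then show "inv v \<circ> (v \<circ> w) = w" "v \<circ> (inv v \<circ> w) = w" for w :: "'a => 'a"
    by (simp_all add: comp_assoc[symmetric])
qed (auto intro: weyl_comp weyl_inv)

lemma mean_weyl: "v : W ==> mean (%x. h (v x)) = mean h"
  unfolding mean_def
  using sum.reindex_bij_betw[OF bij_betw_weyl_comp_left, of v "%w. LINT x:A0|lebesgue. h (w x)"] by simp

lemma mean_cnj: "mean (%x. cnj (h x)) = cnj (mean h)"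
proof -
  have "(LINT x:A0|lebesgue. cnj (h (w x))) = cnj (LINT x:A0|lebesgue. h (w x))" for w
    unfolding set_lebesgue_integral_def by (subst Bochner_Integration.integral_cnj[symmetric]) simp
  then show ?thesis unfolding mean_def by simp
qed

text \<open>Reduces to \<open>nn_mean_translate\<close>: split into real and imaginary parts and add
  the bound K to make each nonnegative.\<close>

lemma mean_translate:
  assumes h: "good h" and per: "!!x q. q : Q ==> h (x + pi *\<^sub>R q) = h x"
  shows "mean (%x. h (x + v)) = mean h"
proof -
  define S where "S g = (\<Sum>w\<in>W. LINT x:A0|lebesgue. (g (w x) :: real))" for g
  have int: "set_integrable lebesgue (A0) (%x. g (w x))"
    if "g : borel_measurable borel" "!!x. \<bar>g x\<bar> \<le> K" "w : W" for g :: "'a => real" and K w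
    using that weyl_borel[of w] measurable_compose[of w borel borel g borel]
    by (intro set_integrable_alcove[where K = K] borel_lebesgue) auto
  have nn: "nn_mean (%x. ennreal (g x)) = ennreal (S g)"
    if g: "g : borel_measurable borel" "!!x. 0 \<le> g x" "!!x. \<bar>g x\<bar> \<le> K" for g :: "'a => real" and K
  proof -
    have gw: "g (w x) \<ge> 0" for w x using g by simp
    have meas: "(%x. ennreal (g (w x)) * indicator (A0) x) : borel_measurable borel" if "w : W" for w
      using g(1) weyl_borel[OF that] by measurable
    have 1: "(\<integral>\<^sup>+x. ennreal (g (w x)) * indicator (A0) x \<partial>lborel) = ennreal (LINT x:A0|lebesgue. g (w x))"
      if w: "w : W" for w
    proof -
      have "(\<integral>\<^sup>+x. ennreal (g (w x)) * indicator (A0) x \<partial>lborel) = (\<integral>\<^sup>+x. ennreal (indicator (A0) x *\<^sub>R g (w x)) \<partial>lebesgue)"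
        unfolding nn_integral_completion by (intro nn_integral_cong) (auto simp: indicator_def)
      also have "... = ennreal (integral\<^sup>L lebesgue (%x. indicator (A0) x *\<^sub>R g (w x)))"
        using int[OF g(1,3) w] gw by (intro nn_integral_eq_integral AE_I2) (auto simp: set_integrable_def indicator_def)
      finally show ?thesis by (simp add: set_lebesgue_integral_def)
    qed
    have "nn_mean (%x. ennreal (g x)) = (\<Sum>w\<in>W. \<integral>\<^sup>+x. ennreal (g (w x)) * indicator (A0) x \<partial>lborel)"
      unfolding nn_mean_def sum_distrib_right using meas by (intro nn_integral_sum) auto
    also have "... = (\<Sum>w\<in>W. ennreal (LINT x:A0|lebesgue. g (w x)))" using 1 by simp
    also have "... = ennreal (S g)"
      unfolding S_def using gw
      by (intro sum_ennreal) (auto simp: set_lebesgue_integral_def intro!: integral_nonneg_AE AE_I2 mult_nonneg_nonneg)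
    finally show ?thesis .
  qed
  have real: "S (%x. g (x + v)) = S g"
    if g[measurable]: "g : borel_measurable borel" and gK: "!!x. \<bar>g x\<bar> \<le> K" and gper: "!!x q. q : Q ==> g (x + pi *\<^sub>R q) = g x"
    for g :: "'a => real" and K
  proof -
    have K0: "g x + K \<ge> 0" "\<bar>g x + K\<bar> \<le> 2 * K" for x using gK[of x] by auto
    have "ennreal (S (%x. g (x + v) + K)) = nn_mean (%x. ennreal (g (x + v) + K))"
      using K0 by (intro nn[symmetric, where K = "2 * K"]) auto
    also have "... = nn_mean (%x. ennreal (g x + K))"
      using gper by (intro nn_mean_translate[of "%x. ennreal (g x + K)"]) auto
    also have "... = ennreal (S (%x. g x + K))" using K0 by (intro nn[where K = "2 * K"]) auto
    finally have "S (%x. g (x + v) + K) = S (%x. g x + K)"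
      using K0 by (subst (asm) ennreal_inj) (auto simp: S_def set_lebesgue_integral_def intro!: sum_nonneg integral_nonneg)
    moreover have "S (%x. f x + K) = S f + S (%x. K)" if "f : borel_measurable borel" "!!x. \<bar>f x\<bar> \<le> K" for f
      unfolding S_def sum.distrib[symmetric]
      using that by (intro sum.cong[OF refl] set_integral_add(2) int[of f K] int[of "%x. K" "\<bar>K\<bar>"]) auto
    from this[of g] this[of "%x. g (x + v)"] have "S (%x. g x + K) = S g + S (%x. K)"
      "S (%x. g (x + v) + K) = S (%x. g (x + v)) + S (%x. K)" using gK by auto
    ultimately show ?thesis by simp
  qed
  obtain K where K: "!!x. norm (h x) \<le> K" and [measurable]: "h : borel_measurable borel" using h by (auto simp: good_def)
  have dec: "mean g = of_real (S (%x. Re (g x))) + \<i> * of_real (S (%x. Im (g x)))"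
    if g: "g : borel_measurable borel" "!!x. norm (g x) \<le> K" for g
  proof -
    have b: "\<bar>Re (g x)\<bar> \<le> K" "\<bar>Im (g x)\<bar> \<le> K" for x
      using g(2)[of x] abs_Re_le_cmod[of "g x"] abs_Im_le_cmod[of "g x"] by linarith+
    have gr: "good (%x. complex_of_real (Re (g x)))" "good (%x. \<i> * complex_of_real (Im (g x)))"
      using g(1) b by (auto intro!: goodI[of _ K] simp: norm_mult)
    have "mean g = mean (%x. complex_of_real (Re (g x)) + \<i> * complex_of_real (Im (g x)))"
      by (simp add: complex_eq[symmetric])
    also have "... = mean (%x. complex_of_real (Re (g x))) + \<i> * mean (%x. complex_of_real (Im (g x)))"
      using mean_add[OF gr] by (simp only: mean_scale)
    finally show ?thesis by (simp add: mean_def S_def set_integral_complex_of_real)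
  qed
  have "S (%x. Re (h (x + v))) = S (%x. Re (h x))" "S (%x. Im (h (x + v))) = S (%x. Im (h x))"
    using K abs_Re_le_cmod abs_Im_le_cmod per
    by (intro real[of "%x. Re (h x)" K] real[of "%x. Im (h x)" K]; force intro: order_trans)+
  then show ?thesis using dec[of h] dec[of "%x. h (x + v)"] K by simp
qed

lemma mean_dominated:
  assumes "!!n. good (h n)" "!!n x. norm (h n x) \<le> K" "!!x. (%n. h n x) \<longlonglongrightarrow> g x"
  shows "(%n. mean (h n)) \<longlonglongrightarrow> mean g"
  unfolding mean_def
proof (rule tendsto_sum)
  fix w assume w: "w : W"
  have m: "(%x. h n (w x)) : borel_measurable lebesgue" for n
    using good_weyl[OF assms(1) w] by (auto simp: good_def borel_lebesgue)
  have g: "(%x. g (w x)) : borel_measurable lebesgue"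
    by (rule borel_measurable_LIMSEQ_metric[OF m]) (rule assms(3))
  show "(%n. LINT x:A0|lebesgue. h n (w x)) \<longlonglongrightarrow> (LINT x:A0|lebesgue. g (w x))"
    unfolding set_lebesgue_integral_def
  proof (rule integral_dominated_convergence[where w = "%x. indicator (A0) x *\<^sub>R K"])
    show "integrable lebesgue (%x. indicator (A0) x *\<^sub>R K)"
      using set_integrable_alcove[of "%x. K" "\<bar>K\<bar>"] by (simp add: set_integrable_def)
    show "AE x in lebesgue. (%n. indicator (A0) x *\<^sub>R h n (w x)) \<longlonglongrightarrow> indicator (A0) x *\<^sub>R g (w x)"
      by (intro AE_I2 tendsto_scaleR tendsto_const assms(3))
    show "AE x in lebesgue. norm (indicator (A0) x *\<^sub>R h n (w x)) \<le> indicator (A0) x *\<^sub>R K" for n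
      using assms(2) by (intro AE_I2) (auto simp: indicator_def)
  qed (use m g in \<open>auto intro!: borel_measurable_scaleR\<close>)
qed

text \<open>Difference quotients have mean zero by translation invariance. The mean value inequality
  bounds them by a bound of h', so dominated convergence passes to the derivative.\<close>

lemma mean_derivative_zero:
  assumes h: "good h" and h': "good h'" and per: "!!x q. q : Q ==> h (x + pi *\<^sub>R q) = h x"
    and D: "!!x. ((%s. h (x + s *\<^sub>R \<xi>)) has_vector_derivative h' x) (at 0)"
  shows "mean h' = 0"
proof -
  obtain K where K: "!!x. norm (h' x) \<le> K" using h' by (auto simp: good_def)
  define d where "d n x = of_nat (Suc n) * (h (x + inverse (real (Suc n)) *\<^sub>R \<xi>) - h x)" for n x
  have D': "((%s. h (x + s *\<^sub>R \<xi>)) has_derivative (%s. s *\<^sub>R h' (x + r *\<^sub>R \<xi>))) (at r)" for x r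
  proof -
    have a: "((%s. s - r) has_vector_derivative 1) (at r)" by (auto intro!: derivative_eq_intros)
    have b: "((%s. h ((x + r *\<^sub>R \<xi>) + s *\<^sub>R \<xi>)) has_vector_derivative h' (x + r *\<^sub>R \<xi>)) (at (r - r))"
      using D[of "x + r *\<^sub>R \<xi>"] by simp
    have "((%s. h (x + s *\<^sub>R \<xi>)) has_vector_derivative h' (x + r *\<^sub>R \<xi>)) (at r)"
      using vector_diff_chain_at[OF a b] by (simp add: comp_def algebra_simps)
    then show ?thesis by (simp add: has_vector_derivative_def)
  qed
  have bound: "norm (d n x) \<le> K" for n x
  proof -
    have "norm (h (x + inverse (real (Suc n)) *\<^sub>R \<xi>) - h (x + 0 *\<^sub>R \<xi>)) \<le> K * norm (inverse (real (Suc n)) - 0)"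
    proof (rule differentiable_bound[of UNIV "%s. h (x + s *\<^sub>R \<xi>)" "%r s. s *\<^sub>R h' (x + r *\<^sub>R \<xi>)"])
      show "onorm (%s. s *\<^sub>R h' (x + r *\<^sub>R \<xi>)) \<le> K" for r
        using K[of "x + r *\<^sub>R \<xi>"] by (intro onorm_le) (simp add: mult.commute[of K] mult_left_mono)
    qed (use D' in auto)
    then have "norm (h (x + inverse (real (Suc n)) *\<^sub>R \<xi>) - h x) \<le> K / real (Suc n)"
      by (simp add: divide_inverse)
    then have "real (Suc n) * norm (h (x + inverse (real (Suc n)) *\<^sub>R \<xi>) - h x) \<le> K"
      by (subst (asm) pos_le_divide_eq) (auto simp: mult.commute)
    then show ?thesis unfolding d_def norm_mult norm_of_nat .
  qed
  have gd: "good (d n)" for n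
    unfolding d_def by (rule good_scale, rule good_diff[OF good_shift[OF h] h])
  have "(%n. mean (d n)) \<longlonglongrightarrow> mean h'"
  proof (rule mean_dominated[OF gd bound])
    show "(%n. d n x) \<longlonglongrightarrow> h' x" for x
      using has_vector_derivative_LIMSEQ[OF D[of x]] by (simp add: d_def)
  qed
  moreover have tr: "mean (%x. h (x + v)) = mean h" for v by (rule mean_translate[OF h]) (rule per)
  have "mean (d n) = 0" for n
    unfolding d_def mean_scale mean_diff[OF good_shift[OF h] h] tr by simp
  ultimately have "(%n::nat. 0) \<longlonglongrightarrow> mean h'" by simp
  then show ?thesis using LIMSEQ_unique tendsto_const by metis
qed

end

section \<open>The weight function and integration by parts\<close>

lemma tspan_ddir: "f : tspan X ==> ddir \<xi> f : tspan X"
  and tspan_hvd: "f : tspan X ==> ((%s. f (x + s *\<^sub>R \<xi>)) has_vector_derivative ddir \<xi> f x) (at 0)"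
  using tspan_derivative by blast+

lemma ddir_sum_Basis:
  fixes f :: "'a::euclidean_space => complex"
  shows "f : tspan X ==> (\<Sum>b\<in>Basis. of_real (v \<bullet> b) * ddir b f x) = ddir v f x"
proof (induction rule: tspan.induct)
  case tspan_zero
  have "ddir \<xi> (%x. 0) x = 0" for \<xi> by (rule ddirI) simp
  then show ?case by simp
next
  case (tspan_step f n c)
  have E: "(%x. c * E n x) : tspan X" "E n : tspan X" using tspan_step by (auto intro: tspan_scaleE tspan_E)
  have d: "ddir \<xi> (%x. f x + c * E n x) x = ddir \<xi> f x + c * (\<i> * of_real (n \<bullet> \<xi>) * E n x)" for \<xi>
    using tspan_step E by (simp add: ddir_add ddir_scale[OF E(2)] ddir_E)
  have "(\<Sum>b\<in>Basis. complex_of_real (v \<bullet> b) * (c * (\<i> * of_real (n \<bullet> b) * E n x)))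
      = c * \<i> * E n x * of_real (\<Sum>b\<in>Basis. (v \<bullet> b) * (n \<bullet> b))"
    by (simp add: sum_distrib_left algebra_simps)
  also have "(\<Sum>b\<in>Basis. (v \<bullet> b) * (n \<bullet> b)) = n \<bullet> v" by (subst (3) inner_commute) (rule euclidean_inner[symmetric])
  finally show ?case unfolding d using tspan_step by (simp add: distrib_left sum.distrib algebra_simps)
qed

text \<open>A cotangent without poles. As eps tends to 0 it tends to cot t everywhere, including the
  zeros of sin, where \<open>cot\<close> is 0 because division by zero gives 0.\<close>

definition kreg :: "real => real => real" where
  "kreg eps t = sin t * cos t / ((sin t)^2 + eps)"

lemma kreg_neg: "kreg ep (- t) = - kreg ep t" by (simp add: kreg_def)

lemma kreg_bound: "ep > 0 ==> \<bar>kreg ep t\<bar> \<le> 1 / ep"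
proof -
  assume e: "ep > 0"
  have "\<bar>sin t * cos t\<bar> \<le> 1" by (simp add: abs_mult mult_le_one)
  moreover have "(sin t)^2 + ep \<ge> ep" "(sin t)^2 + ep > 0" using e by (auto simp: add_nonneg_pos)
  ultimately show ?thesis using e unfolding kreg_def abs_divide by (intro frac_le) auto
qed

lemma kreg_sin: "ep > 0 ==> \<bar>kreg ep t\<bar> * \<bar>sin t\<bar> \<le> 1"
proof -
  assume e: "ep > 0"
  have p: "(sin t)^2 + ep > 0" using e by (auto simp: add_nonneg_pos)
  have "\<bar>kreg ep t\<bar> * \<bar>sin t\<bar> = \<bar>cos t\<bar> * (sin t)^2 / ((sin t)^2 + ep)"
    using p by (simp add: kreg_def abs_mult power2_eq_square)
  also have "... \<le> 1 * (sin t)^2 / ((sin t)^2 + ep)"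
    using p by (intro divide_right_mono mult_right_mono) auto
  also have "... \<le> 1" using p e by simp
  finally show ?thesis .
qed

lemma kreg_LIMSEQ: "(%n. kreg (inverse (real (Suc n))) t) \<longlonglongrightarrow> cot t"
proof (cases "sin t = 0")
  case True
  then show ?thesis by (simp add: kreg_def cot_def)
next
  case False
  have "(%n. kreg (inverse (real (Suc n))) t) \<longlonglongrightarrow> sin t * cos t / ((sin t)^2 + 0)"
    unfolding kreg_def using False by (intro tendsto_intros LIMSEQ_inverse_real_of_nat) auto
  also have "sin t * cos t / ((sin t)^2 + 0) = cot t" using False by (simp add: cot_def power2_eq_square)
  finally show ?thesis .
qed

lemma cmod_exp_diff: "cmod (exp (\<i> * of_real t) - exp (- \<i> * of_real t)) = 2 * \<bar>sin t\<bar>"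
proof -
  have "exp (\<i> * of_real t) - exp (- \<i> * of_real t) = 2 * \<i> * sin (of_real t :: complex)"
    by (simp add: sin_exp_eq)
  then show ?thesis by (simp add: norm_mult sin_of_real)
qed

locale heckman_opdam = positive_roots R Rp for R Rp :: "'a::euclidean_space set" +
  fixes m :: "'a => real"
  assumes m_nonneg: "al : R ==> 0 \<le> m al"
    and m_weyl: "w : weyl_group R ==> al : R ==> m (w al) = m al"
begin

abbreviation "wt \<equiv> weight Rp m"
abbreviation "eig \<equiv> theta Rp m"
abbreviation "rc \<equiv> r_coef R Rp m"
abbreviation "FT \<equiv> fourier R Rp m"
abbreviation "SB \<equiv> segal_bargmann R Rp m"
abbreviation "ipm \<equiv> ip_m Rp m"

lemma m_neg: "a : R ==> m (- a) = m a"
  using m_weyl[OF weyl_refl, of a a] R_nonzero by (simp add: refl_root_def scaleR_2)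

text \<open>The weight with sin^2 replaced by sin^2 + eps, smooth and positive for eps > 0. The case
  m = 0 is split off to agree with \<open>pow0\<close>, because 0 powr 0 is 0.\<close>

definition wfun :: "real => 'a => real" where
  "wfun eps x = (\<Prod>al\<in>Rp. if m al = 0 then 1 else (4 * ((sin (al \<bullet> x))^2 + eps)) powr (m al / 2))"

lemma wfun_zero: "wfun 0 x = wt x"
proof -
  have "(4 * (sin t)^2) powr (a / 2) = (2 * \<bar>sin t\<bar>) powr a" for t a :: real
  proof -
    have "4 * (sin t)^2 = (2 * \<bar>sin t\<bar>) powr 2"
      by (cases "sin t = 0") (simp_all add: powr_numeral power_mult_distrib)
    then have "(4 * (sin t)^2) powr (a / 2) = ((2 * \<bar>sin t\<bar>) powr 2) powr (a / 2)" by (rule arg_cong)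
    then show ?thesis by (simp only: powr_powr) simp
  qed
  then show ?thesis unfolding wfun_def weight_def pow0_def cmod_exp_diff by (intro prod.cong) auto
qed

lemma wfun_nonneg: "wfun ep x \<ge> 0"
  unfolding wfun_def by (intro prod_nonneg) auto

lemma wfun_bounded: "0 \<le> ep ==> ep \<le> 1 ==> wfun ep x \<le> (\<Prod>al\<in>Rp. 8 powr (m al / 2))"
  unfolding wfun_def
proof (rule prod_mono)
  fix al assume a: "0 \<le> ep" "ep \<le> 1" "al : Rp"
  have "(sin (al \<bullet> x))^2 \<le> 1" by (simp add: abs_square_le_1)
  then have "(4 * ((sin (al \<bullet> x))^2 + ep)) powr (m al / 2) \<le> 8 powr (m al / 2)"
    using a m_nonneg[OF Rp_R[OF a(3)]] by (intro powr_mono2) auto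
  then show "0 \<le> (if m al = 0 then 1 else (4 * ((sin (al \<bullet> x))^2 + ep)) powr (m al / 2)) \<and>
      (if m al = 0 then 1 else (4 * ((sin (al \<bullet> x))^2 + ep)) powr (m al / 2)) \<le> 8 powr (m al / 2)" by simp
qed

lemma wfun_periodic: "q : Q ==> wfun ep (x + pi *\<^sub>R q) = wfun ep x"
proof -
  assume q: "q : Q"
  have "(sin (al \<bullet> (x + pi *\<^sub>R q)))^2 = (sin (al \<bullet> x))^2" if a: "al : Rp" for al
  proof -
    obtain k :: int where "al \<bullet> q = of_int k" using R_inner_Q[OF Rp_R[OF a] q] by (auto simp: Ints_def)
    then have "al \<bullet> (x + pi *\<^sub>R q) = al \<bullet> x + of_int k * pi" by (simp add: inner_add_right)
    moreover have s0: "sin (of_int k * pi) = 0" using sin_zero_iff_int2 by blast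
    then have "(cos (of_int k * pi))^2 = 1" using sin_cos_squared_add[of "of_int k * pi"] by simp
    ultimately show ?thesis using s0 by (simp add: sin_add power_mult_distrib)
  qed
  then show ?thesis unfolding wfun_def by (intro prod.cong) auto
qed

lemma wfun_weyl: "w : W ==> wfun ep (w x) = wfun ep x"
proof -
  assume w: "w : W"
  \<comment> \<open>Up to squaring, the product over Rp becomes one over R, which w permutes.
    Setting g to 1 outside R makes it even in al everywhere, as \<open>prod_R\<close>
    demands.\<close>
  define g where "g y al = (if al : R then if m al = 0 then 1 else (4 * ((sin (al \<bullet> y))^2 + ep)) powr (m al / 2) else 1)" for y al
  have gneg: "g y (- al) = g y al" for y al
    using neg_R[of al] neg_R[of "- al"] m_neg[of al] by (auto simp: g_def)
  have sq: "(wfun ep y)^2 = (\<Prod>al\<in>R. g y al)" for y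
  proof -
    have "wfun ep y = (\<Prod>al\<in>Rp. g y al)" unfolding wfun_def g_def using Rp_R by (intro prod.cong) auto
    then show ?thesis using prod_R[of "g y"] gneg by simp
  qed
  have iw: "inv w : W" using weyl_inv w by blast
  have "(\<Prod>al\<in>R. g (w x) al) = (\<Prod>al\<in>R. g x (inv w al))"
  proof (rule prod.cong[OF refl])
    fix al assume a: "al : R"
    have "al \<bullet> w x = inv w al \<bullet> x" using weyl_inner_inv[OF w, of x al] by (simp add: inner_commute)
    then show "g (w x) al = g x (inv w al)" using a weyl_R[OF iw a] m_weyl[OF iw a] by (simp add: g_def)
  qed
  also have "... = (\<Prod>al\<in>R. g x al)" by (rule prod.reindex_bij_betw[OF weyl_bij_R[OF iw]])
  finally have "(wfun ep (w x))^2 = (wfun ep x)^2" by (simp add: sq)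
  then show ?thesis using wfun_nonneg by (simp add: power2_eq_iff_nonneg)
qed

lemma wfun_continuous: "ep \<ge> 0 ==> continuous_on S (wfun ep)"
  unfolding wfun_def
proof (rule continuous_on_prod)
  fix al assume a: "ep \<ge> 0" "al : Rp"
  show "continuous_on S (%x. if m al = 0 then 1 else (4 * ((sin (al \<bullet> x))^2 + ep)) powr (m al / 2))"
  proof (cases "m al = 0")
    case False
    then have p: "m al / 2 > 0" using m_nonneg[OF Rp_R[OF a(2)]] by simp
    have "continuous_on S (%x. (4 * ((sin (al \<bullet> x))^2 + ep)) powr (m al / 2))"
      using a p by (intro continuous_on_powr' ballI) (auto intro!: continuous_intros)
    then show ?thesis using False by simp
  qed simp
qed

lemma wfun_borel: "ep \<ge> 0 ==> wfun ep : borel_measurable borel"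
  using wfun_continuous by (intro borel_measurable_continuous_onI)

lemma wfun_LIMSEQ: "(%n. wfun (inverse (real (Suc n))) x) \<longlonglongrightarrow> wt x"
  unfolding wfun_zero[symmetric] wfun_def
proof (rule tendsto_prod)
  fix al assume a: "al : Rp"
  show "(%n. if m al = 0 then 1 else (4 * ((sin (al \<bullet> x))^2 + inverse (real (Suc n)))) powr (m al / 2)) \<longlonglongrightarrow>
      (if m al = 0 then 1 else (4 * ((sin (al \<bullet> x))^2 + 0)) powr (m al / 2))"
  proof (cases "m al = 0")
    case False
    then have "m al / 2 > 0" using m_nonneg[OF Rp_R[OF a]] by simp
    then have "(%n. (4 * ((sin (al \<bullet> x))^2 + inverse (real (Suc n)))) powr (m al / 2)) \<longlonglongrightarrow> (4 * ((sin (al \<bullet> x))^2 + 0)) powr (m al / 2)"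
      by (intro tendsto_powr' tendsto_intros LIMSEQ_inverse_real_of_nat) (auto intro!: always_eventually)
    then show ?thesis using False by simp
  qed simp
qed

lemma wfun_derivative:
  assumes "ep > 0"
  shows "((%s. wfun ep (x + s *\<^sub>R \<xi>)) has_field_derivative
          wfun ep x * (\<Sum>al\<in>Rp. m al * (al \<bullet> \<xi>) * kreg ep (al \<bullet> x))) (at 0)"
proof -
  have pos: "4 * ((sin t)^2 + ep) > 0" for t :: real using assms by (simp add: add_nonneg_pos)
  have ex: "wfun ep y = exp (\<Sum>al\<in>Rp. m al / 2 * ln (4 * ((sin (al \<bullet> y))^2 + ep)))" for y
    unfolding wfun_def exp_sum[OF finite_Rp]
    using pos by (intro prod.cong refl) (auto simp: powr_def less_imp_neq[symmetric])
  have "((%s. exp (\<Sum>al\<in>Rp. m al / 2 * ln (4 * ((sin (al \<bullet> (x + s *\<^sub>R \<xi>)))^2 + ep)))) has_field_derivative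
      exp (\<Sum>al\<in>Rp. m al / 2 * ln (4 * ((sin (al \<bullet> (x + 0 *\<^sub>R \<xi>)))^2 + ep))) * (\<Sum>al\<in>Rp. m al * (al \<bullet> \<xi>) * kreg ep (al \<bullet> x))) (at 0)"
  proof (rule DERIV_chain2[OF DERIV_exp], rule DERIV_sum)
    fix al
    have "((%s. m al / 2 * ln (4 * ((sin (al \<bullet> x + s * (al \<bullet> \<xi>)))^2 + ep))) has_field_derivative
        m al / 2 * (inverse (4 * ((sin (al \<bullet> x + 0 * (al \<bullet> \<xi>)))^2 + ep)) * (4 * (2 * sin (al \<bullet> x) * (cos (al \<bullet> x) * (al \<bullet> \<xi>)))))) (at 0)"
    proof -
      define a b where "a = al \<bullet> x" and "b = al \<bullet> \<xi>"
      have d: "((%s. 4 * ((sin (a + s * b))^2 + ep)) has_field_derivative 4 * (2 * sin a * (cos a * b))) (at 0)"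
        by (auto intro!: derivative_eq_intros)
      have "((%s. ln (4 * ((sin (a + s * b))^2 + ep))) has_field_derivative
          inverse (4 * ((sin (a + 0 * b))^2 + ep)) * (4 * (2 * sin a * (cos a * b)))) (at 0)"
        by (rule DERIV_chain2[OF DERIV_ln[OF pos] d])
      then show ?thesis unfolding a_def b_def by (rule DERIV_cmult)
    qed
    also have "m al / 2 * (inverse (4 * ((sin (al \<bullet> x + 0 * (al \<bullet> \<xi>)))^2 + ep)) * (4 * (2 * sin (al \<bullet> x) * (cos (al \<bullet> x) * (al \<bullet> \<xi>)))))
        = m al * (al \<bullet> \<xi>) * kreg ep (al \<bullet> x)"
    proof -
      have gen: "c / 2 * (inverse (4 * y) * (4 * (2 * s * (k * b)))) = c * b * (s * k / y)" if "y ~= 0" for c y s k b :: real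
        using that by (simp add: field_simps)
      have "(sin (al \<bullet> x + 0 * (al \<bullet> \<xi>)))^2 + ep ~= 0" using pos[of "al \<bullet> x + 0 * (al \<bullet> \<xi>)"] by (metis mult_zero_right order_less_irrefl)
      then show ?thesis unfolding gen[OF \<open>(sin (al \<bullet> x + 0 * (al \<bullet> \<xi>)))^2 + ep ~= 0\<close>] kreg_def by simp
    qed
    finally show "((%s. m al / 2 * ln (4 * ((sin (al \<bullet> (x + s *\<^sub>R \<xi>)))^2 + ep))) has_field_derivative
        m al * (al \<bullet> \<xi>) * kreg ep (al \<bullet> x)) (at 0)"
      by (simp add: inner_add_right)
  qed
  then show ?thesis by (simp add: ex)
qed

lemma E_periodic: "n : weights ==> q : Q ==> E n (x + pi *\<^sub>R q) = E n x"
proof -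
  assume "n : weights" "q : Q"
  then obtain k :: int where k: "n \<bullet> q = 2 * of_int k" using weights_inner_Q by blast
  have "E n (pi *\<^sub>R q) = 1" unfolding E_def by (rule exp_eq_1[THEN iffD2]) (use k in auto)
  then show ?thesis by (simp add: E_simps(5))
qed

lemma tspan_periodic: "f : tspan weights ==> q : Q ==> f (x + pi *\<^sub>R q) = f x"
  by (induction rule: tspan.induct) (auto simp: E_periodic)

lemma E_weyl: "w : W ==> E n (w x) = E (inv w n) x"
  using weyl_inner_inv[of w x n] by (simp add: E_def inner_commute)

lemma E_refl: "a : R ==> E n (refl_root a x) = E (refl_root a n) x"
  using inner_refl_root[of a n "refl_root a x"] refl_root_refl_root[OF R_nonzero, of a x]
  by (simp add: E_def inner_commute)

lemma tspan_weyl: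
  assumes "w : W" "!!n. n : X ==> inv w n : Y" "f : tspan X"
  shows "(%x. f (w x)) : tspan Y"
  using assms(3)
proof induction
  case (tspan_step f n c)
  then show ?case using tspan.tspan_step[of "%x. f (w x)" Y "inv w n" c] assms by (simp add: E_weyl)
qed (simp add: tspan_zero)

lemma tspan_weights_weyl: "w : W ==> f : tspan weights ==> (%x. f (w x)) : tspan weights"
  using tspan_weyl weights_weyl weyl_inv by metis

lemma tspan_weights_mult: "f : tspan weights ==> g : tspan weights ==> (%x. f x * g x) : tspan weights"
  by (rule tspan_mult) (auto intro: weights_arith)

lemma tspan_weights_cnj: "f : tspan weights ==> (%x. cnj (f x)) : tspan weights"
  by (rule tspan_cnj) (auto intro: weights_arith)

text \<open>For a weight with \<open>root_coeff\<close> n the difference of exponentials is, up to a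
  factor of modulus 1, 2 sin (n t) with t = al . x, and |sin (n t)| <= |n| |sin t|. This zero
  cancels the pole of the cotangent.\<close>

lemma tspan_refl_bound:
  assumes a: "al : R" and f: "f : tspan weights"
  shows "\<exists>C\<ge>0. \<forall>x. norm (f x - f (refl_root al x)) \<le> C * \<bar>sin (al \<bullet> x)\<bar>"
  using f
proof induction
  case (tspan_step f \<nu> c)
  then obtain C where C: "C \<ge> 0" "!!x. norm (f x - f (refl_root al x)) \<le> C * \<bar>sin (al \<bullet> x)\<bar>" by blast
  obtain n :: int where n: "root_coeff \<nu> al = of_int n" using tspan_step a by (auto simp: weights_def Ints_def)
  have "norm (E \<nu> x - E \<nu> (refl_root al x)) \<le> 2 * \<bar>of_int n\<bar> * \<bar>sin (al \<bullet> x)\<bar>" for x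
  proof -
    define t where "t = of_int n * (al \<bullet> x)"
    define y where "y = (of_int n *\<^sub>R al)"
    have "refl_root al \<nu> = (\<nu> - y) - y" by (simp add: refl_root_coeff n y_def scaleR_left_distrib[symmetric] algebra_simps)
    then have "E \<nu> x - E \<nu> (refl_root al x) = E (\<nu> - y) x * (E y x - E (- y) x)"
      unfolding E_refl[OF a] right_diff_distrib E_simps(2) by simp
    also have "norm ... = 2 * \<bar>sin t\<bar>"
      using cmod_exp_diff[of t] by (simp add: norm_mult E_simps(4)) (simp add: E_def t_def y_def)
    also have "... \<le> 2 * (\<bar>of_int n\<bar> * \<bar>sin (al \<bullet> x)\<bar>)" unfolding t_def using abs_sin_int_le[of n "al \<bullet> x"] by simp
    finally show ?thesis by (simp add: mult.assoc)
  qed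
  then have bnd: "norm (c * (E \<nu> x - E \<nu> (refl_root al x))) \<le> norm c * (2 * \<bar>of_int n\<bar> * \<bar>sin (al \<bullet> x)\<bar>)" for x
    unfolding norm_mult by (intro mult_left_mono) auto
  have "norm ((f x + c * E \<nu> x) - (f (refl_root al x) + c * E \<nu> (refl_root al x))) \<le> (C + norm c * (2 * \<bar>of_int n\<bar>)) * \<bar>sin (al \<bullet> x)\<bar>" for x
  proof -
    have eq: "(f x + c * E \<nu> x) - (f (refl_root al x) + c * E \<nu> (refl_root al x))
        = (f x - f (refl_root al x)) + c * (E \<nu> x - E \<nu> (refl_root al x))" by (simp add: algebra_simps)
    show ?thesis unfolding eq
      using norm_triangle_mono[OF C(2)[of x] bnd[of x]]
      by (simp add: distrib_right mult.assoc)
  qed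
  then show ?case using C(1) by (intro exI[of _ "C + norm c * (2 * \<bar>of_int n\<bar>)"]) auto
qed (auto intro!: exI[of _ 0])

text \<open>The difference part of a trigonometric Dunkl operator. It is bounded on trigonometric
  polynomials although the cotangent is not (\<open>good_cotd\<close>).\<close>

definition cotd :: "'a => ('a => complex) => 'a => complex" where
  "cotd al f x = of_real (cot (al \<bullet> x)) * (f x - f (refl_root al x))"

lemma inner_refl_root_neg: "a : R ==> a \<bullet> refl_root a x = - (a \<bullet> x)"
  using R_nonzero by (simp add: refl_root_def inner_diff_right inner_commute)

lemma cot_borel: "(%x. complex_of_real (cot (a \<bullet> x))) : borel_measurable borel" for a :: 'a
  unfolding cot_def by measurable

lemma good_cot_mult:
  fixes a :: 'a
  assumes h: "good h" and C: "!!x. norm (h x) \<le> C * \<bar>sin (a \<bullet> x)\<bar>"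
  shows "good (%x. of_real (cot (a \<bullet> x)) * h x)"
proof (rule goodI[of _ "\<bar>C\<bar>"])
  show "(%x. complex_of_real (cot (a \<bullet> x)) * h x) : borel_measurable borel"
    using h cot_borel by (intro borel_measurable_times) (auto simp: good_def)
  fix x
  have "norm (complex_of_real (cot (a \<bullet> x)) * h x) \<le> \<bar>cot (a \<bullet> x)\<bar> * (C * \<bar>sin (a \<bullet> x)\<bar>)"
    using C by (simp add: norm_mult mult_left_mono)
  also have "... = C * (\<bar>cot (a \<bullet> x)\<bar> * \<bar>sin (a \<bullet> x)\<bar>)" by simp
  also have "... \<le> \<bar>C\<bar> * (\<bar>cot (a \<bullet> x)\<bar> * \<bar>sin (a \<bullet> x)\<bar>)" by (intro mult_right_mono) auto
  also have "... \<le> \<bar>C\<bar> * 1"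
  proof (rule mult_left_mono)
    show "\<bar>cot (a \<bullet> x)\<bar> * \<bar>sin (a \<bullet> x)\<bar> \<le> 1" by (cases "sin (a \<bullet> x) = 0") (auto simp: cot_def)
  qed simp
  finally show "norm (complex_of_real (cot (a \<bullet> x)) * h x) \<le> \<bar>C\<bar>" by simp
qed

lemma good_cotd: "al : R ==> f : tspan weights ==> good (cotd al f)"
proof -
  assume a: "al : R" and f: "f : tspan weights"
  obtain C where C: "!!x. norm (f x - f (refl_root al x)) \<le> C * \<bar>sin (al \<bullet> x)\<bar>" using tspan_refl_bound[OF a f] by blast
  show ?thesis unfolding cotd_def
    by (rule good_cot_mult[OF good_diff[OF good_tspan[OF f] good_refl[OF good_tspan[OF f] a]] C])
qed

lemma good_wfun: "0 \<le> ep ==> ep \<le> 1 ==> good (%x. of_real (wfun ep x))"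
  using wfun_borel[of ep] wfun_bounded[of ep] wfun_nonneg[of ep]
  by (intro goodI[of _ "\<Prod>a\<in>Rp. 8 powr (m a / 2)"]) auto

lemma good_kreg: "ep > 0 ==> good (%x::'a. of_real (kreg ep (a \<bullet> x)))"
proof (rule goodI[of _ "1 / ep"])
  show "(%x. complex_of_real (kreg ep (a \<bullet> x))) : borel_measurable borel" unfolding kreg_def by measurable
  show "ep > 0 ==> norm (complex_of_real (kreg ep (a \<bullet> x))) \<le> 1 / ep" for x
    using kreg_bound by (simp only: norm_of_real)
qed

definition wmean :: "('a => complex) => complex" where
  "wmean h = mean (%x. h x * of_real (wt x))"

lemma good_weight: "good (%x. of_real (wt x))"
  using good_wfun[of 0] by (simp add: wfun_zero)

lemma weight_weyl: "w : W ==> wt (w x) = wt x"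
  using wfun_weyl[of w 0 x] by (simp add: wfun_zero)

text \<open>For eps > 0 the derivative of g times the regularized weight has mean zero. Before eps
  tends to 0 the singular kernel must be tamed: symmetrizing under each reflection replaces g by
  half the difference of g and its reflection, which vanishes on the mirror.\<close>

theorem integration_by_parts:
  assumes g: "g : tspan weights"
  shows "wmean (%x. ddir \<xi> g x + (\<Sum>al\<in>Rp. of_real (m al * (al \<bullet> \<xi>) / 2) * cotd al g x)) = 0"
proof -
  define c where "c al = complex_of_real (m al * (al \<bullet> \<xi>))" for al
  define \<Delta> where "\<Delta> al x = g x - g (refl_root al x)" for al x
  have gg: "good g" "good (ddir \<xi> g)" using g tspan_ddir good_tspan by blast+
  have g\<Delta>: "good (\<Delta> al)" if "al : Rp" for al
    unfolding \<Delta>_def using gg(1) Rp_R[OF that] by (intro good_diff good_refl)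
  define G where "G ep x = (ddir \<xi> g x + (\<Sum>al\<in>Rp. c al / 2 * (of_real (kreg ep (al \<bullet> x)) * \<Delta> al x))) * of_real (wfun ep x)" for ep x
  have G0: "mean (G ep) = 0" and gG: "good (G ep)" if e: "0 < ep" "ep \<le> 1" for ep
  proof -
    have gw: "good (%x. of_real (wfun ep x))" using good_wfun e by simp
    have gk: "good (%x. of_real (kreg ep (al \<bullet> x)))" for al :: 'a using good_kreg e by simp
    let ?u = "%al x. of_real (kreg ep (al \<bullet> x)) * g x * of_real (wfun ep x)"
    let ?v = "%al x. of_real (kreg ep (al \<bullet> x)) * \<Delta> al x * of_real (wfun ep x)"
    have gu: "good (?u al)" for al by (rule good_mult[OF good_mult[OF gk gg(1)] gw])
    have gv: "good (?v al)" if "al : Rp" for al by (rule good_mult[OF good_mult[OF gk g\<Delta>[OF that]] gw])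
    \<comment> \<open>\<open>kreg\<close> is odd and \<open>wfun\<close> even under the reflection,
      so averaging the integrand with its reflected copy replaces g by half of
      \<open>\<Delta> al\<close>.\<close>
    have uv: "mean (?u al) = mean (?v al) / 2" if a: "al : Rp" for al
    proof -
      have aR: "al : R" using Rp_R a .
      have "mean (?u al) = mean (%x. ?u al (refl_root al x))" by (rule mean_weyl[OF weyl_refl[OF aR], symmetric])
      then have "2 * mean (?u al) = mean (%x. ?u al x + ?u al (refl_root al x))"
        by (subst mean_add[OF gu good_refl[OF gu aR]]) simp
      also have "(%x. ?u al x + ?u al (refl_root al x)) = ?v al"
        by (rule ext) (simp add: inner_refl_root_neg[OF aR] kreg_neg wfun_weyl[OF weyl_refl[OF aR]] \<Delta>_def algebra_simps)
      finally show ?thesis by (simp add: field_simps)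
    qed
    define h' where "h' x = ddir \<xi> g x * of_real (wfun ep x) + (\<Sum>al\<in>Rp. c al * ?u al x)" for x
    have gd: "good (%x. ddir \<xi> g x * of_real (wfun ep x))" by (rule good_mult[OF gg(2) gw])
    have gs: "good (%x. \<Sum>al\<in>Rp. c al * ?u al x)" by (rule good_sum) (rule good_scale[OF gu])
    have gs': "good (%x. \<Sum>al\<in>Rp. c al / 2 * ?v al x)" by (rule good_sum) (rule good_scale[OF gv])
    have "mean h' = 0"
    proof (rule mean_derivative_zero[of "%x. g x * of_real (wfun ep x)" _ \<xi>])
      show "good (%x. g x * of_real (wfun ep x))" by (rule good_mult[OF gg(1) gw])
      show "good h'" unfolding h'_def by (rule good_add[OF gd gs])
      show "g (x + pi *\<^sub>R q) * of_real (wfun ep (x + pi *\<^sub>R q)) = g x * of_real (wfun ep x)" if "q : Q" for x q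
        using tspan_periodic[OF g that] wfun_periodic[OF that] by simp
      fix x
      have w: "((%s. complex_of_real (wfun ep (x + s *\<^sub>R \<xi>))) has_vector_derivative
          of_real (wfun ep x * (\<Sum>al\<in>Rp. m al * (al \<bullet> \<xi>) * kreg ep (al \<bullet> x)))) (at 0)"
        using wfun_derivative[OF e(1), of x \<xi>]
        by (intro has_vector_derivative_of_real) (simp add: has_real_derivative_iff_has_vector_derivative)
      have "((%s. g (x + s *\<^sub>R \<xi>) * of_real (wfun ep (x + s *\<^sub>R \<xi>))) has_vector_derivative
          g (x + 0 *\<^sub>R \<xi>) * of_real (wfun ep x * (\<Sum>al\<in>Rp. m al * (al \<bullet> \<xi>) * kreg ep (al \<bullet> x))) +
          ddir \<xi> g x * of_real (wfun ep (x + 0 *\<^sub>R \<xi>))) (at 0)"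
        by (rule has_vector_derivative_mult[OF tspan_hvd[OF g] w])
      moreover have "g x * of_real (wfun ep x * (\<Sum>al\<in>Rp. m al * (al \<bullet> \<xi>) * kreg ep (al \<bullet> x))) = (\<Sum>al\<in>Rp. c al * ?u al x)"
        by (simp add: c_def sum_distrib_left algebra_simps)
      ultimately show "((%s. g (x + s *\<^sub>R \<xi>) * of_real (wfun ep (x + s *\<^sub>R \<xi>))) has_vector_derivative h' x) (at 0)"
        by (simp add: h'_def add.commute)
    qed
    also have "mean h' = mean (%x. ddir \<xi> g x * of_real (wfun ep x)) + (\<Sum>al\<in>Rp. c al * mean (?u al))"
      unfolding h'_def mean_add[OF gd gs] by (subst mean_sum) (auto intro: good_scale[OF gu] simp: mean_scale)
    also have "... = mean (%x. ddir \<xi> g x * of_real (wfun ep x)) + (\<Sum>al\<in>Rp. c al / 2 * mean (?v al))"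
    proof -
      have "c al * mean (?u al) = c al / 2 * mean (?v al)" if "al : Rp" for al unfolding uv[OF that] by simp
      then show ?thesis by (simp only: cong: sum.cong)
    qed
    also have "(\<Sum>al\<in>Rp. c al / 2 * mean (?v al)) = mean (%x. \<Sum>al\<in>Rp. c al / 2 * ?v al x)"
      by (subst mean_sum) (auto intro!: good_scale[OF gv] simp only: mean_scale)
    also have "mean (%x. ddir \<xi> g x * of_real (wfun ep x)) + mean (%x. \<Sum>al\<in>Rp. c al / 2 * ?v al x)
        = mean (%x. ddir \<xi> g x * of_real (wfun ep x) + (\<Sum>al\<in>Rp. c al / 2 * ?v al x))"
      by (rule mean_add[OF gd gs', symmetric])
    also have eq: "(%x. ddir \<xi> g x * of_real (wfun ep x) + (\<Sum>al\<in>Rp. c al / 2 * ?v al x)) = G ep"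
      by (rule ext) (simp add: G_def distrib_right sum_distrib_right mult.assoc)
    finally show "mean (G ep) = 0" by simp
    show "good (G ep)" unfolding eq[symmetric] by (rule good_add[OF gd gs'])
  qed
  have "\<forall>al\<in>Rp. \<exists>C\<ge>0. \<forall>x. norm (\<Delta> al x) \<le> C * \<bar>sin (al \<bullet> x)\<bar>"
    unfolding \<Delta>_def using tspan_refl_bound[OF Rp_R g] by blast
  then obtain C where C: "!!al. al : Rp ==> C al \<ge> 0" "!!al x. al : Rp ==> norm (\<Delta> al x) \<le> C al * \<bar>sin (al \<bullet> x)\<bar>"
    by metis
  obtain A where A: "!!x. norm (ddir \<xi> g x) \<le> A" using gg(2) by (auto simp: good_def)
  define B where "B = (\<Prod>al\<in>Rp. 8 powr (m al / 2))"
  have B: "B \<ge> 0" by (simp add: B_def prod_nonneg)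
  \<comment> \<open>The bound is uniform in eps because |\<open>kreg\<close>| |sin| <= 1 and
    \<open>\<Delta> al\<close> is at most a multiple of |sin|.\<close>
  have bound: "norm (G ep x) \<le> (A + (\<Sum>al\<in>Rp. norm (c al / 2) * C al)) * B" if e: "0 < ep" "ep \<le> 1" for ep x
  proof -
    have k: "norm (c al / 2 * (of_real (kreg ep (al \<bullet> x)) * \<Delta> al x)) \<le> norm (c al / 2) * C al" if a: "al : Rp" for al
    proof -
      have "\<bar>kreg ep (al \<bullet> x)\<bar> * norm (\<Delta> al x) \<le> \<bar>kreg ep (al \<bullet> x)\<bar> * (C al * \<bar>sin (al \<bullet> x)\<bar>)"
        by (intro mult_left_mono C a) auto
      also have "... = C al * (\<bar>kreg ep (al \<bullet> x)\<bar> * \<bar>sin (al \<bullet> x)\<bar>)" by simp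
      also have "... \<le> C al * 1" by (intro mult_left_mono kreg_sin e C a)
      finally have "\<bar>kreg ep (al \<bullet> x)\<bar> * norm (\<Delta> al x) \<le> C al" by simp
      from mult_left_mono[OF this norm_ge_zero[of "c al / 2"]] show ?thesis by (simp only: norm_mult norm_of_real)
    qed
    have "norm (\<Sum>al\<in>Rp. c al / 2 * (of_real (kreg ep (al \<bullet> x)) * \<Delta> al x)) \<le> (\<Sum>al\<in>Rp. norm (c al / 2) * C al)"
      by (rule sum_norm_le) (rule k)
    then have "norm (ddir \<xi> g x + (\<Sum>al\<in>Rp. c al / 2 * (of_real (kreg ep (al \<bullet> x)) * \<Delta> al x))) \<le> A + (\<Sum>al\<in>Rp. norm (c al / 2) * C al)"
      by (rule norm_triangle_mono[OF A])
    moreover have "norm (complex_of_real (wfun ep x)) \<le> B"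
      using wfun_bounded[of ep x] wfun_nonneg[of ep x] e by (simp add: B_def)
    ultimately show ?thesis unfolding G_def norm_mult by (intro mult_mono) (auto intro: order_trans[OF norm_ge_zero])
  qed
  let ?e = "%n. inverse (real (Suc n))"
  have e: "0 < ?e n" "?e n \<le> 1" for n by (auto simp: field_simps)
  have "(%n. mean (G (?e n))) \<longlonglongrightarrow> mean (%x. (ddir \<xi> g x + (\<Sum>al\<in>Rp. c al / 2 * (of_real (cot (al \<bullet> x)) * \<Delta> al x))) * of_real (wt x))"
  proof (rule mean_dominated[where K = "(A + (\<Sum>al\<in>Rp. norm (c al / 2) * C al)) * B"])
    show "(%n. G (?e n) x) \<longlonglongrightarrow> (ddir \<xi> g x + (\<Sum>al\<in>Rp. c al / 2 * (of_real (cot (al \<bullet> x)) * \<Delta> al x))) * of_real (wt x)" for x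
      unfolding G_def by (intro tendsto_intros tendsto_of_real kreg_LIMSEQ wfun_LIMSEQ)
  qed (use gG bound e in blast)+
  moreover have "mean (G (?e n)) = 0" for n using G0 e by blast
  ultimately have "mean (%x. (ddir \<xi> g x + (\<Sum>al\<in>Rp. c al / 2 * (of_real (cot (al \<bullet> x)) * \<Delta> al x))) * of_real (wt x)) = 0"
    using LIMSEQ_unique[OF _ tendsto_const] by fastforce
  then show ?thesis by (simp add: wmean_def cotd_def c_def \<Delta>_def)
qed

lemma wmean_odd:
  assumes a: "al : R" and h: "!!x. h (refl_root al x) = - h x"
  shows "wmean h = 0"
proof -
  have "wmean h = mean (%x. h (refl_root al x) * of_real (wt (refl_root al x)))"
    unfolding wmean_def by (rule mean_weyl[OF weyl_refl[OF a], symmetric])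
  also have "... = mean (%x. (-1) * (h x * of_real (wt x)))"
    by (simp add: h weight_weyl[OF weyl_refl[OF a]])
  also have "... = - wmean h" unfolding mean_scale wmean_def by simp
  finally show ?thesis by simp
qed

lemma wmean_add: "good f ==> good g ==> wmean (%x. f x + g x) = wmean f + wmean g"
  unfolding wmean_def distrib_right by (intro mean_add good_mult good_weight)

lemma wmean_scale: "wmean (%x. c * f x) = c * wmean f"
  unfolding wmean_def mult.assoc by (rule mean_scale)

lemma wmean_diff: "good f ==> good g ==> wmean (%x. f x - g x) = wmean f - wmean g"
  unfolding wmean_def left_diff_distrib by (intro mean_diff good_mult good_weight)

lemma wmean_sum: "(!!i. i : I ==> good (f i)) ==> wmean (%x. \<Sum>i\<in>I. f i x) = (\<Sum>i\<in>I. wmean (f i))"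
  unfolding wmean_def sum_distrib_right by (intro mean_sum good_mult good_weight)

definition regular :: "'a => bool" where "regular x \<longleftrightarrow> aff.regular x"

lemma regular_sin: "regular x ==> a : R ==> sin (a \<bullet> x) ~= 0"
proof
  assume x: "regular x" "a : R" "sin (a \<bullet> x) = 0"
  then obtain k :: int where "a \<bullet> x = of_int k * pi" by (auto simp: sin_zero_iff_int2)
  then have "aff_refl a (of_int k * pi) x = x" using R_nonzero x by (simp add: aff_refl_fixed)
  moreover have "aff_refl a (of_int k * pi) : affT" using x unfolding affT_def by blast
  ultimately show False using x unfolding regular_def aff.regular_def by blast
qed

text \<open>Identities that involve the cotangent hold only off the mirrors, which form a null set;
  this lets them be used under the integral.\<close>

lemma wmean_cong:
  assumes "good f" "good g" "!!x. regular x ==> f x = g x"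
  shows "wmean f = wmean g"
  unfolding wmean_def mean_def
proof (rule sum.cong[OF refl])
  fix w assume w: "w : W"
  obtain ws where ws: "set ws \<subseteq> affT" "aff.wprod ws = w" using weyl_word w by blast
  have "AE x in lebesgue. regular (w x)"
    using AE_completion[OF AE_regular] aff.wprod_regular[OF ws(1)] ws(2) unfolding regular_def by (auto elim!: eventually_mono)
  moreover have "(%x. f (w x) * of_real (wt (w x))) : borel_measurable lebesgue"
    "(%x. g (w x) * of_real (wt (w x))) : borel_measurable lebesgue"
    using good_weyl[OF good_mult[OF assms(1) good_weight] w] good_weyl[OF good_mult[OF assms(2) good_weight] w]
    by (auto simp: good_def intro!: borel_lebesgue)
  ultimately show "(LINT x:A0|lebesgue. f (w x) * of_real (wt (w x))) = (LINT x:A0|lebesgue. g (w x) * of_real (wt (w x)))"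
    using assms(3) by (intro set_lebesgue_integral_cong_AE) (auto elim!: eventually_mono)
qed

end

section \<open>Cherednik operators\<close>

text \<open>Indexes the interior points nu - 2 j al of the root string from nu (j = 0) to its
  reflection (j = n), for either sign of n.\<close>

definition between :: "int => int set" where
  "between n = {j. 0 < j \<and> j < n \<or> n < j \<and> j < 0}"

lemma between_neg: "between (- n) = uminus ` between n"
proof (rule set_eqI)
  fix j show "j : between (- n) \<longleftrightarrow> j : uminus ` between n"
    unfolding between_def image_iff by (auto intro!: exI[of _ "- j"])
qed

lemma cot_geometric_sum:
  fixes q :: complex
  shows "(1 + q) * (1 - q ^ Suc n) = (1 - q) * (1 + q ^ Suc n + 2 * (\<Sum>j\<in>{1..n}. q ^ j))"
proof (induction n)
  case (Suc n)
  have "(\<Sum>j\<in>{1..Suc n}. q ^ j) = (\<Sum>j\<in>{1..n}. q ^ j) + q ^ Suc n" by simp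
  then have "(1 - q) * (1 + q ^ Suc (Suc n) + 2 * (\<Sum>j\<in>{1..Suc n}. q ^ j)) =
      (1 - q) * (1 + q ^ Suc n + 2 * (\<Sum>j\<in>{1..n}. q ^ j)) + (1 - q) * (q ^ Suc (Suc n) + q ^ Suc n)"
    by (simp add: algebra_simps)
  also have "... = (1 + q) * (1 - q ^ Suc n) + (1 - q) * (q ^ Suc (Suc n) + q ^ Suc n)" by (simp only: Suc)
  also have "... = (1 + q) * (1 - q ^ Suc (Suc n))" by (simp add: algebra_simps)
  finally show ?case by simp
qed (simp add: algebra_simps)

text \<open>With q = exp (- 2 i t) one has - i cot t (1 - q) = 1 + q, so the left side is (1 + q)
  times the geometric sum (1 - q^n) / (1 - q).\<close>

lemma cot_string_nat:
  assumes t: "sin t ~= 0" and n: "n > 0"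
  shows "- \<i> * of_real (cot t) * (1 - exp (\<i> * of_real (- 2 * of_int n * t))) =
    1 + exp (\<i> * of_real (- 2 * of_int n * t)) + 2 * (\<Sum>j\<in>between n. exp (\<i> * of_real (- 2 * of_int j * t)))"
proof -
  define q where "q = exp (\<i> * of_real (- 2 * t))"
  define u where "u = exp (\<i> * of_real t)"
  have u0: "u ~= 0" by (simp add: u_def)
  have qu: "q * u * u = 1" by (simp add: q_def u_def exp_add[symmetric])
  have "exp (\<i> * of_real t) - exp (- \<i> * of_real t) = 2 * \<i> * of_real (sin t)"
    "exp (\<i> * of_real t) + exp (- \<i> * of_real t) = 2 * of_real (cos t)"
    by (simp_all add: sin_exp_eq cos_exp_eq flip: sin_of_real cos_of_real)
  moreover have "exp (- \<i> * of_real t) = q * u" by (simp add: q_def u_def exp_add[symmetric])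
  ultimately have su: "u * (1 - q) = 2 * \<i> * of_real (sin t)" and cu: "u * (1 + q) = 2 * of_real (cos t)"
    by (simp_all add: u_def[symmetric] algebra_simps)
  have q1: "1 - q ~= 0" using su t by auto
  have "- \<i> * of_real (cot t) * (2 * \<i> * of_real (sin t)) = 2 * complex_of_real (cos t)"
    using t by (simp add: cot_def)
  then have "u * (- \<i> * of_real (cot t) * (1 - q)) = u * (1 + q)" unfolding cu su[symmetric] by (simp only: mult_ac)
  then have ct: "- \<i> * of_real (cot t) * (1 - q) = 1 + q" using u0 by (simp only: mult_cancel_left) simp
  obtain k where k: "n = int (Suc k)" using n by (metis Suc_pred zero_less_imp_eq_int)
  have qp: "exp (\<i> * of_real (- 2 * of_int (int j) * t)) = q ^ j" for j
    by (simp add: q_def exp_of_nat_mult[symmetric] algebra_simps)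
  have "(\<Sum>j\<in>between n. exp (\<i> * of_real (- 2 * of_int j * t))) = (\<Sum>j\<in>{1..k}. exp (\<i> * of_real (- 2 * of_int (int j) * t)))"
  proof -
    have "between n = int ` {1..k}"
      unfolding between_def k by (auto simp: image_iff) (metis atLeastAtMost_iff int_nat_eq less_Suc_eq_le nat_less_iff of_nat_Suc One_nat_def Suc_leI zero_less_nat_eq order_less_imp_le)
    then show ?thesis by (simp add: sum.reindex)
  qed
  also have "... = (\<Sum>j\<in>{1..k}. q ^ j)" by (simp only: qp)
  finally have sm: "(\<Sum>j\<in>between n. exp (\<i> * of_real (- 2 * of_int j * t))) = (\<Sum>j\<in>{1..k}. q ^ j)" .
  have qn: "exp (\<i> * of_real (- 2 * of_int n * t)) = q ^ Suc k" unfolding k by (rule qp)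
  have "(1 - q) * (- \<i> * of_real (cot t) * (1 - q ^ Suc k)) = (1 + q) * (1 - q ^ Suc k)"
    unfolding ct[symmetric] by (simp only: mult_ac)
  also have "... = (1 - q) * (1 + q ^ Suc k + 2 * (\<Sum>j\<in>{1..k}. q ^ j))" by (rule cot_geometric_sum)
  finally have "- \<i> * of_real (cot t) * (1 - q ^ Suc k) = 1 + q ^ Suc k + 2 * (\<Sum>j\<in>{1..k}. q ^ j)" using q1 by (simp only: mult_cancel_left) simp
  then show ?thesis unfolding sm qn .
qed

lemma cot_string:
  assumes t: "sin t ~= 0"
  shows "- \<i> * of_real (cot t) * (1 - exp (\<i> * of_real (- 2 * of_int n * t))) =
    of_int (sgn n) * (1 + exp (\<i> * of_real (- 2 * of_int n * t)) + 2 * (\<Sum>j\<in>between n. exp (\<i> * of_real (- 2 * of_int j * t))))"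
proof -
  consider "n > 0" | "n = 0" | "- n > 0" by linarith
  then show ?thesis
  proof cases
    case 1 then show ?thesis using cot_string_nat[OF t 1] by simp
  next
    case 2 then show ?thesis by simp
  next
    case 3
    have s: "sin (- t) ~= 0" using t by simp
    have c: "cot (- t) = - cot t" by (simp add: cot_def)
    have e: "- 2 * real_of_int (- k) * - t = - 2 * of_int k * t" for k by simp
    have "(\<Sum>j\<in>between (- n). exp (\<i> * of_real (- 2 * of_int j * - t))) = (\<Sum>j\<in>between n. exp (\<i> * of_real (- 2 * of_int (- j) * - t)))"
      unfolding between_neg by (subst sum.reindex) (auto simp: inj_on_def)
    then have sm: "(\<Sum>j\<in>between (- n). exp (\<i> * of_real (- 2 * of_int j * - t))) = (\<Sum>j\<in>between n. exp (\<i> * of_real (- 2 * of_int j * t)))"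
      unfolding e .
    have "sgn n = -1" using 3 by simp
    then show ?thesis using cot_string_nat[OF s 3] unfolding sm e c by simp
  qed
qed

text \<open>The algebra of \<open>Top_selfadjoint\<close> with opaque letters: S1 and S2 stand for
  the cotangent sums of f and g, S3 and S4 for the reflection sums.\<close>

lemma commutator_identity:
  fixes S1 :: complex
  assumes "S1 * G + F * S2 = X + Y"
  shows "(- \<i> * D - \<i> / 2 * S1 - 1 / 2 * S3) * G - F * (\<i> * D' + \<i> / 2 * S2 - 1 / 2 * S4) =
    (- \<i>) * (F * D' + D * G + 1 / 2 * X) + ((- \<i> / 2) * Y + (- 1 / 2) * (S3 * G - F * S4))"
proof -
  have Y: "Y = S1 * G + F * S2 - X" using assms by simp
  show ?thesis unfolding Y by (simp add: field_simps)
qed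

context heckman_opdam
begin

definition icoeff :: "'a => 'a => int" where "icoeff \<nu> al = \<lfloor>root_coeff \<nu> al\<rfloor>"

lemma icoeff: "n : weights ==> a : R ==> root_coeff n a = of_int (icoeff n a)"
  unfolding weights_def icoeff_def by (auto simp: Ints_def)

lemma icoeff_inner: "n : weights ==> a : R ==> n \<bullet> a = of_int (icoeff n a) * (a \<bullet> a)"
  using icoeff[of n a] R_nonzero[of a] by (simp add: root_coeff_def field_simps)

lemma icoeff_sgn: "n : weights ==> a : R ==> of_int (sgn (icoeff n a)) = sgn (n \<bullet> a)"
  using icoeff_inner[of n a] R_nonzero[of a] by (simp add: sgn_mult) (simp add: sgn_if)

lemma cotd_E:
  assumes x: "regular x" and a: "al : R" and n: "\<nu> : weights"
  shows "- \<i> * cotd al (E \<nu>) x = of_int (sgn (icoeff \<nu> al)) *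
    (E \<nu> x + E (refl_root al \<nu>) x + 2 * (\<Sum>j\<in>between (icoeff \<nu> al). E (\<nu> - (2 * of_int j) *\<^sub>R al) x))"
proof -
  let ?n = "icoeff \<nu> al" and ?t = "al \<bullet> x"
  have e: "E (\<nu> - (2 * of_int j) *\<^sub>R al) x = E \<nu> x * exp (\<i> * of_real (- 2 * of_int j * ?t))" for j
    unfolding E_def exp_add[symmetric] by (simp add: inner_diff_left algebra_simps)
  have r: "E (refl_root al \<nu>) x = E \<nu> x * exp (\<i> * of_real (- 2 * of_int ?n * ?t))"
    unfolding refl_root_coeff icoeff[OF n a] by (rule e)
  have "- \<i> * cotd al (E \<nu>) x = E \<nu> x * (- \<i> * of_real (cot ?t) * (1 - exp (\<i> * of_real (- 2 * of_int ?n * ?t))))"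
    unfolding cotd_def E_refl[OF a] r by (simp add: algebra_simps)
  also have "... = E \<nu> x * (of_int (sgn ?n) * (1 + exp (\<i> * of_real (- 2 * of_int ?n * ?t)) + 2 * (\<Sum>j\<in>between ?n. exp (\<i> * of_real (- 2 * of_int j * ?t)))))"
    unfolding cot_string[OF regular_sin[OF x a]] ..
  also have "... = of_int (sgn ?n) * (E \<nu> x + E (refl_root al \<nu>) x + 2 * (\<Sum>j\<in>between ?n. E (\<nu> - (2 * of_int j) *\<^sub>R al) x))"
    unfolding r e by (simp add: algebra_simps sum_distrib_left)
  finally show ?thesis .
qed

text \<open>A weighted inner product for functions without Weyl symmetry; on invariant functions it
  is \<open>card W\<close> times \<open>ip_m\<close> (\<open>wip_ip_m\<close>).\<close>

definition wip :: "('a => complex) => ('a => complex) => complex" where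
  "wip f g = wmean (%x. f x * cnj (g x))"

lemma wip_cnj: "cnj (wip f g) = wip g f"
  unfolding wip_def wmean_def mean_cnj[symmetric] by (simp add: mult.commute)

lemma good_prod: "good f ==> good g ==> good (%x. f x * cnj (g x))"
  by (intro good_mult good_cnj)

lemma wip_add: "good f ==> good g ==> good h ==> wip (%x. f x + g x) h = wip f h + wip g h"
  unfolding wip_def distrib_right by (intro wmean_add good_prod)

lemma wip_diff: "good f ==> good g ==> good h ==> wip (%x. f x - g x) h = wip f h - wip g h"
  unfolding wip_def left_diff_distrib by (intro wmean_diff good_prod)

lemma wip_scale: "wip (%x. c * f x) h = c * wip f h"
  unfolding wip_def mult.assoc by (rule wmean_scale)

lemma wip_sum: "(!!i. i : I ==> good (f i)) ==> good h ==> wip (%x. \<Sum>i\<in>I. f i x) h = (\<Sum>i\<in>I. wip (f i) h)"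
  unfolding wip_def sum_distrib_right by (intro wmean_sum good_prod)

lemma wip_add_right: "good f ==> good g ==> good h ==> wip h (%x. f x + g x) = wip h f + wip h g"
  using wip_add[of f g h] by (simp flip: wip_cnj[of _ h])

lemma wip_scale_right: "wip h (%x. c * f x) = cnj c * wip h f"
  using wip_scale[of c f h] by (simp flip: wip_cnj[of _ h])

lemma wip_sum_right: "(!!i. i : I ==> good (f i)) ==> good h ==> wip h (%x. \<Sum>i\<in>I. f i x) = (\<Sum>i\<in>I. wip h (f i))"
  using wip_sum[of I f h] by (simp flip: wip_cnj[of _ h])

lemma wip_cong: "good f ==> good g ==> good h ==> (!!x. regular x ==> f x = g x) ==> wip f h = wip g h"
  unfolding wip_def by (intro wmean_cong good_prod) auto

lemma wip_cong_right: "good f ==> good g ==> good h ==> (!!x. regular x ==> f x = g x) ==> wip h f = wip h g"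
  using wip_cong[of f g h] by (simp flip: wip_cnj[of _ h])

lemma weight_nonneg: "wt x \<ge> 0"
  using wfun_nonneg[of 0 x] by (simp add: wfun_zero)

lemma wip_self: "wip f f = of_real (\<Sum>w\<in>W. LINT x:A0|lebesgue. (cmod (f (w x)))^2 * wt (w x))"
proof -
  have "f x * cnj (f x) * of_real (wt x) = of_real ((cmod (f x))^2 * wt x)" for x
    by (simp add: complex_norm_square[symmetric])
  then show ?thesis unfolding wip_def wmean_def mean_def by (simp only: set_integral_complex_of_real of_real_sum)
qed

lemma wip_self_nonneg: "Re (wip f f) \<ge> 0" "Im (wip f f) = 0"
  unfolding wip_self using weight_nonneg
  by (auto simp: set_lebesgue_integral_def intro!: sum_nonneg integral_nonneg_AE)

text \<open>If f has norm zero, the squared norm of g + s f is affine in s. Being nonnegative for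
  all complex s, it has no linear term.\<close>

lemma wip_null:
  assumes f: "good f" and g: "good g" and 0: "wip f f = 0"
  shows "wip f g = 0"
proof -
  have fg: "good (%x. g x + s * f x)" for s by (rule good_add[OF g good_scale[OF f]])
  have "wip (%x. g x + s * f x) (%x. g x + s * f x) = wip g g + s * wip f g + cnj s * wip g f" for s
    using f g by (simp add: wip_add wip_add_right fg good_scale wip_scale wip_scale_right 0 algebra_simps)
  moreover have "cnj s * wip g f = cnj (s * wip f g)" for s by (simp add: wip_cnj)
  ultimately have ge: "0 \<le> Re (wip g g) + 2 * Re (s * wip f g)" for s
    using wip_self_nonneg(1)[of "%x. g x + s * f x"] by simp
  have *: "0 \<le> Re (wip g g) - 2 * r * (cmod (wip f g))^2" for r :: real
  proof -
    have "(- of_real r * cnj (wip f g)) * wip f g = of_real (- (r * (cmod (wip f g))^2))"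
      using complex_norm_square[of "wip f g"] by (simp add: mult_ac)
    then have "Re ((- of_real r * cnj (wip f g)) * wip f g) = - (r * (cmod (wip f g))^2)" by (simp only: Re_complex_of_real)
    then show ?thesis using ge[of "- of_real r * cnj (wip f g)"] by simp
  qed
  show ?thesis
  proof (rule ccontr)
    assume "wip f g ~= 0"
    then have p: "(cmod (wip f g))^2 > 0" by simp
    show False using *[of "(Re (wip g g) + 1) / (2 * (cmod (wip f g))^2)"] p by (simp add: field_simps)
  qed
qed

text \<open>The Cherednik operator. Its usual form is - i d_xi + sum m (al . xi) (1 - s_al) / (1 -
  exp (- 2 i al . x)) - rho . xi. Substituting 1 / (1 - exp (- 2 i t)) = 1/2 - (i/2) cot t makes the
  constant rho . xi cancel.\<close>

definition Top :: "'a => ('a => complex) => 'a => complex" where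
  "Top \<xi> f x = - \<i> * ddir \<xi> f x - (\<i> / 2) * (\<Sum>al\<in>Rp. of_real (m al * (al \<bullet> \<xi>)) * cotd al f x)
      - (1 / 2) * (\<Sum>al\<in>Rp. of_real (m al * (al \<bullet> \<xi>)) * f (refl_root al x))"

lemma good_Top:
  assumes f: "f : tspan weights" shows "good (Top \<xi> f)"
proof -
  have 1: "good (%x. - \<i> * ddir \<xi> f x)" by (rule good_scale[OF good_tspan[OF tspan_ddir[OF f]]])
  have 2: "good (%x. (\<i> / 2) * (\<Sum>a\<in>Rp. of_real (m a * (a \<bullet> \<xi>)) * cotd a f x))"
    by (rule good_scale, rule good_sum, rule good_scale, rule good_cotd[OF Rp_R f])
  have 3: "good (%x. (1 / 2) * (\<Sum>a\<in>Rp. of_real (m a * (a \<bullet> \<xi>)) * f (refl_root a x)))"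
    by (rule good_scale, rule good_sum, rule good_scale, rule good_refl[OF good_tspan[OF f] Rp_R])
  show ?thesis unfolding Top_def by (rule good_diff[OF good_diff[OF 1 2] 3])
qed

text \<open>The difference of the two integrands is a multiple of the integrand of
  \<open>integration_by_parts\<close> for h = f times the conjugate of g, plus terms that are odd
  under a reflection and hence have mean zero.\<close>

lemma Top_selfadjoint:
  assumes f: "f : tspan weights" and g: "g : tspan weights"
  shows "wip (Top \<xi> f) g = wip f (Top \<xi> g)"
proof -
  define c where "c a = complex_of_real (m a * (a \<bullet> \<xi>))" for a
  define h where "h x = f x * cnj (g x)" for x
  have cg: "(%x. cnj (g x)) : tspan weights" using tspan_weights_cnj g .
  have h: "h : tspan weights" unfolding h_def by (rule tspan_weights_mult[OF f cg])
  \<comment> \<open>The defect of the product rule for \<open>cotd\<close>. It is odd under the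
    reflection, since the cotangent and both differences change sign.\<close>
  define H1 where "H1 a x = of_real (cot (a \<bullet> x)) * ((f x - f (refl_root a x)) * cnj (g x - g (refl_root a x)))" for a x
  define H2 where "H2 a x = f (refl_root a x) * cnj (g x) - f x * cnj (g (refl_root a x))" for a x
  have gf: "good f" "good g" using f g good_tspan by auto
  have gH1: "good (H1 a)" if "a : Rp" for a
  proof -
    have "H1 a = (%x. cotd a f x * cnj (g x - g (refl_root a x)))" by (rule ext) (simp add: H1_def cotd_def mult.assoc)
    then show ?thesis
      using good_prod[OF good_cotd[OF Rp_R[OF that] f] good_diff[OF gf(2) good_refl[OF gf(2) Rp_R[OF that]]]] by simp
  qed
  have gH2: "good (H2 a)" if "a : Rp" for a
    unfolding H2_def using gf good_refl[OF _ Rp_R[OF that]] by (intro good_diff good_prod) auto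
  have H1_0: "wmean (H1 a) = 0" if "a : Rp" for a
    using refl_root_refl_root[OF Rp_nonzero[OF that]] inner_refl_root_neg[OF Rp_R[OF that]]
    by (intro wmean_odd[OF Rp_R[OF that]]) (simp add: H1_def cot_def algebra_simps)
  have H2_0: "wmean (H2 a) = 0" if "a : Rp" for a
    using refl_root_refl_root[OF Rp_nonzero[OF that]] by (intro wmean_odd[OF Rp_R[OF that]]) (simp add: H2_def)
  define F where "F x = ddir \<xi> h x + (\<Sum>a\<in>Rp. of_real (m a * (a \<bullet> \<xi>) / 2) * cotd a h x)" for x
  have gF: "good F" unfolding F_def
    by (rule good_add[OF good_tspan[OF tspan_ddir[OF h]]], rule good_sum, rule good_scale, rule good_cotd[OF Rp_R h])
  have F0: "wmean F = 0" unfolding F_def by (rule integration_by_parts[OF h])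
  have pt: "Top \<xi> f x * cnj (g x) - f x * cnj (Top \<xi> g x) =
      (- \<i>) * F x + ((- \<i> / 2) * (\<Sum>a\<in>Rp. c a * H1 a x) + (- 1 / 2) * (\<Sum>a\<in>Rp. c a * H2 a x))" for x
  proof -
    define S1 S2 S3 S4 where "S1 = (\<Sum>a\<in>Rp. c a * cotd a f x)" and "S2 = (\<Sum>a\<in>Rp. c a * cnj (cotd a g x))"
      and "S3 = (\<Sum>a\<in>Rp. c a * f (refl_root a x))" and "S4 = (\<Sum>a\<in>Rp. c a * cnj (g (refl_root a x)))"
    have dh: "ddir \<xi> h x = f x * cnj (ddir \<xi> g x) + ddir \<xi> f x * cnj (g x)"
      unfolding h_def ddir_mult[OF f cg] ddir_cnj[OF g] ..
    have "c a * cotd a f x * cnj (g x) + f x * (c a * cnj (cotd a g x)) = c a * cotd a h x + c a * H1 a x" for a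
      by (simp add: cotd_def H1_def h_def algebra_simps)
    then have s12: "S1 * cnj (g x) + f x * S2 = (\<Sum>a\<in>Rp. c a * cotd a h x) + (\<Sum>a\<in>Rp. c a * H1 a x)"
      by (simp only: S1_def S2_def sum_distrib_right sum_distrib_left sum.distrib[symmetric])
    have "c a * f (refl_root a x) * cnj (g x) - f x * (c a * cnj (g (refl_root a x))) = c a * H2 a x" for a
      by (simp add: H2_def algebra_simps)
    then have s34: "S3 * cnj (g x) - f x * S4 = (\<Sum>a\<in>Rp. c a * H2 a x)"
      by (simp only: S3_def S4_def sum_distrib_right sum_distrib_left sum_subtractf[symmetric])
    have t1: "Top \<xi> f x = - \<i> * ddir \<xi> f x - \<i> / 2 * S1 - 1 / 2 * S3"
      by (simp only: Top_def S1_def S3_def c_def)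
    have t2: "cnj (Top \<xi> g x) = \<i> * cnj (ddir \<xi> g x) + \<i> / 2 * S2 - 1 / 2 * S4"
      by (simp add: Top_def S2_def S4_def c_def cnj_sum)
    have fs: "(\<Sum>a\<in>Rp. of_real (m a * (a \<bullet> \<xi>) / 2) * cotd a h x) = (1 / 2) * (\<Sum>a\<in>Rp. c a * cotd a h x)"
      by (simp add: sum_distrib_left c_def)
    show ?thesis unfolding t1 t2 F_def fs dh s34[symmetric] by (rule commutator_identity[OF s12])
  qed
  have gS: "good (%x. \<Sum>a\<in>Rp. c a * H1 a x)" "good (%x. \<Sum>a\<in>Rp. c a * H2 a x)"
    by (rule good_sum, rule good_scale, erule gH1) (rule good_sum, rule good_scale, erule gH2)
  have "wip (Top \<xi> f) g - wip f (Top \<xi> g) = wmean (%x. Top \<xi> f x * cnj (g x) - f x * cnj (Top \<xi> g x))"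
    unfolding wip_def by (rule wmean_diff[symmetric]) (intro good_prod good_Top f g gf)+
  also have "... = (- \<i>) * wmean F + ((- \<i> / 2) * wmean (%x. \<Sum>a\<in>Rp. c a * H1 a x) + (- 1 / 2) * wmean (%x. \<Sum>a\<in>Rp. c a * H2 a x))"
    unfolding pt wmean_add[OF good_scale[OF gF] good_add[OF good_scale[OF gS(1)] good_scale[OF gS(2)]]]
      wmean_add[OF good_scale[OF gS(1)] good_scale[OF gS(2)]] wmean_scale ..
  also have "wmean (%x. \<Sum>a\<in>Rp. c a * H1 a x) = 0"
    by (subst wmean_sum) (auto intro: good_scale[OF gH1] simp: wmean_scale H1_0)
  also have "wmean (%x. \<Sum>a\<in>Rp. c a * H2 a x) = 0"
    by (subst wmean_sum) (auto intro: good_scale[OF gH2] simp: wmean_scale H2_0)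
  finally show ?thesis using F0 by simp
qed

text \<open>The leading eigenvalue of \<open>Top xi\<close> at E nu is tilde nu . xi. A zero pairing
  counts as -1: then the reflection fixes E nu, the cotangent term vanishes, and only the reflection
  term with its coefficient -1/2 contributes.\<close>

definition tilde :: "'a => 'a" where
  "tilde \<nu> = \<nu> + (1/2) *\<^sub>R (\<Sum>al\<in>Rp. (m al * (if \<nu> \<bullet> al > 0 then 1 else -1)) *\<^sub>R al)"

text \<open>The signs in \<open>tilde\<close> are monotone in the pairings and m is nonnegative, so
  (tilde n - tilde k) . (n - k) is at least |n - k|^2.\<close>

lemma tilde_inj: "tilde n = tilde k ==> n = k"
proof -
  assume eq: "tilde n = tilde k"
  define e where "e n a = (if n \<bullet> a > 0 then 1 else - 1 :: real)" for n a :: 'a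
  have "0 = (tilde n - tilde k) \<bullet> (n - k)" using eq by simp
  also have "... = (n - k) \<bullet> (n - k) + (1/2) * (\<Sum>a\<in>Rp. m a * (e n a - e k a) * (a \<bullet> (n - k)))"
  proof -
    have "tilde n - tilde k = (n - k) + (1/2) *\<^sub>R (\<Sum>a\<in>Rp. (m a * (e n a - e k a)) *\<^sub>R a)"
      unfolding tilde_def e_def[symmetric]
      by (simp add: right_diff_distrib scaleR_left_diff_distrib sum_subtractf scaleR_right_diff_distrib)
    then show ?thesis by (simp only: inner_add_left inner_scaleR_left inner_sum_left)
  qed
  finally have "(n - k) \<bullet> (n - k) + (1/2) * (\<Sum>a\<in>Rp. m a * (e n a - e k a) * (a \<bullet> (n - k))) = 0" by simp
  moreover have "m a * (e n a - e k a) * (a \<bullet> (n - k)) \<ge> 0" if "a : Rp" for a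
  proof -
    have "(e n a - e k a) * (a \<bullet> (n - k)) \<ge> 0"
      by (auto simp: e_def inner_diff_right inner_commute[of a])
    then show ?thesis using m_nonneg[OF Rp_R[OF that]] by (simp add: mult.assoc)
  qed
  then have "(\<Sum>a\<in>Rp. m a * (e n a - e k a) * (a \<bullet> (n - k))) \<ge> 0" by (rule sum_nonneg)
  ultimately have "(n - k) \<bullet> (n - k) \<le> 0" by linarith
  then show ?thesis by (metis inner_gt_zero_iff not_le right_minus_eq)
qed

text \<open>Contains the frequencies other than nu that \<open>Top\<close> produces from E nu. The
  reflected end of a string occurs only for a negative pairing; for a positive one the cotangent and
  reflection terms cancel there.\<close>

definition below :: "'a => 'a set" where
  "below \<nu> = {\<nu> - (2 * of_int j) *\<^sub>R al | j al. al : Rp \<and> j : between (icoeff \<nu> al)}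
     \<union> {refl_root al \<nu> | al. al : Rp \<and> \<nu> \<bullet> al < 0}"

lemma Top_E:
  assumes n: "\<nu> : weights"
  shows "\<exists>h\<in>tspan (below \<nu>). \<forall>x. regular x --> Top \<xi> (E \<nu>) x = of_real (tilde \<nu> \<bullet> \<xi>) * E \<nu> x + h x"
proof -
  define c where "c al = complex_of_real (m al * (al \<bullet> \<xi>))" for al
  define e where "e al = (if \<nu> \<bullet> al > 0 then 1 else - 1 :: real)" for al
  define s where "s al x = (\<Sum>j\<in>between (icoeff \<nu> al). E (\<nu> - (2 * of_int j) *\<^sub>R al) x)" for al x
  define h1 where "h1 al x = of_int (sgn (icoeff \<nu> al)) * s al x - (if \<nu> \<bullet> al < 0 then 1 else 0) * E (refl_root al \<nu>) x" for al x
  have h1: "h1 al : tspan (below \<nu>)" if a: "al : Rp" for al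
  proof -
    have "s al : tspan (below \<nu>)" unfolding s_def
      using a by (intro tspan_sum tspan_E) (auto simp: below_def)
    moreover have "(%x. (if \<nu> \<bullet> al < 0 then 1 else 0) * E (refl_root al \<nu>) x) : tspan (below \<nu>)"
    proof (cases "\<nu> \<bullet> al < 0")
      case True
      then have "refl_root al \<nu> : below \<nu>" using a by (auto simp: below_def)
      then show ?thesis by (rule tspan_scaleE)
    qed (simp add: tspan_zero)
    ultimately show ?thesis unfolding h1_def by (intro tspan_diff[OF tspan_scale])
  qed
  have "Top \<xi> (E \<nu>) x = of_real (tilde \<nu> \<bullet> \<xi>) * E \<nu> x + (\<Sum>al\<in>Rp. c al * h1 al x)" if x: "regular x" for x
  proof -
    have trm: "(1/2) * (c al * (- \<i> * cotd al (E \<nu>) x)) - (1/2) * (c al * E \<nu> (refl_root al x)) = (1/2) * c al * of_real (e al) * E \<nu> x + c al * h1 al x"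
      if a: "al : Rp" for al
    proof -
      have aR: "al : R" using Rp_R a .
      have sg: "complex_of_int (sgn (icoeff \<nu> al)) = of_real (sgn (\<nu> \<bullet> al))"
        using icoeff_sgn[OF n aR] by (metis of_real_of_int_eq)
      consider "\<nu> \<bullet> al > 0" | "\<nu> \<bullet> al = 0" | "\<nu> \<bullet> al < 0" by linarith
      then show ?thesis
      proof cases
        case 2
        then have "refl_root al \<nu> = \<nu>" by (simp add: refl_root_def)
        then show ?thesis unfolding cotd_E[OF x aR n] E_refl[OF aR] sg h1_def using 2 by (simp add: e_def)
      qed (unfold cotd_E[OF x aR n] E_refl[OF aR] h1_def sg s_def[symmetric], simp_all add: e_def algebra_simps)
    qed
    have "Top \<xi> (E \<nu>) x = of_real (\<nu> \<bullet> \<xi>) * E \<nu> x + (\<Sum>al\<in>Rp. (1/2) * (c al * (- \<i> * cotd al (E \<nu>) x)) - (1/2) * (c al * E \<nu> (refl_root al x)))"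
      unfolding Top_def ddir_E c_def[symmetric] by (simp add: sum_subtractf sum_distrib_left sum_negf algebra_simps)
    also have "... = of_real (\<nu> \<bullet> \<xi>) * E \<nu> x + (\<Sum>al\<in>Rp. (1/2) * c al * of_real (e al) * E \<nu> x + c al * h1 al x)"
      using trm by (simp only: cong: sum.cong)
    also have "... = of_real (tilde \<nu> \<bullet> \<xi>) * E \<nu> x + (\<Sum>al\<in>Rp. c al * h1 al x)"
    proof -
      have "tilde \<nu> \<bullet> \<xi> = \<nu> \<bullet> \<xi> + (\<Sum>al\<in>Rp. 1/2 * (m al * (al \<bullet> \<xi>)) * e al)"
        unfolding tilde_def e_def[symmetric] inner_add_left inner_scaleR_left inner_sum_left sum_distrib_left
        by (simp add: algebra_simps)
      then show ?thesis by (simp add: c_def sum.distrib distrib_right sum_distrib_right)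
    qed
    finally show ?thesis .
  qed
  moreover have "(%x. \<Sum>al\<in>Rp. c al * h1 al x) : tspan (below \<nu>)" by (intro tspan_sum tspan_scale h1)
  ultimately show ?thesis by (intro bexI[of _ "%x. \<Sum>al\<in>Rp. c al * h1 al x"]) auto
qed

lemma Top_lin:
  assumes f: "f : tspan weights" and g: "g : tspan weights"
  shows "Top \<xi> (%x. f x + c * g x) x = Top \<xi> f x + c * Top \<xi> g x"
proof -
  have cg: "(%x. c * g x) : tspan weights" using tspan_scale g .
  have "cotd a (%x. f x + c * g x) x = cotd a f x + c * cotd a g x" for a
    by (simp add: cotd_def algebra_simps)
  then show ?thesis
    unfolding Top_def ddir_add[OF f cg] ddir_scale[OF g]
    by (simp add: sum.distrib sum_distrib_left algebra_simps)
qed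

lemma Top_zero: "Top \<xi> (%x. 0) x = 0"
proof -
  have "ddir \<xi> (%x::'a. 0) x = 0" by (rule ddirI) simp
  then show ?thesis by (simp add: Top_def cotd_def)
qed

text \<open>Removes the frequency \<open>n\<^sub>0\<close> at the price of one factor Top - tilde
  \<open>n\<^sub>0\<close> . xi. The remaining frequencies stay in X because X is closed under
  \<open>below\<close>.\<close>

lemma Top_shift:
  assumes X: "X \<subseteq> weights" "!!n. n : X ==> below n \<subseteq> X" and n0: "n\<^sub>0 : weights" "below n\<^sub>0 \<subseteq> X"
    and f: "f : tspan (insert n\<^sub>0 X)"
  shows "\<exists>g\<in>tspan X. \<forall>x. regular x --> Top \<xi> f x = of_real (tilde n\<^sub>0 \<bullet> \<xi>) * f x + g x"
  using f
proof induction
  case tspan_zero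
  then show ?case using tspan.tspan_zero by (intro bexI[of _ "%x. 0"]) (auto simp: Top_zero)
next
  case (tspan_step f n c)
  then obtain g where g: "g : tspan X" "!!x. regular x ==> Top \<xi> f x = of_real (tilde n\<^sub>0 \<bullet> \<xi>) * f x + g x" by blast
  have nw: "n : weights" using tspan_step X n0 by auto
  obtain h where h: "h : tspan (below n)" "!!x. regular x ==> Top \<xi> (E n) x = of_real (tilde n \<bullet> \<xi>) * E n x + h x"
    using Top_E[OF nw] by blast
  have hX: "h : tspan X" by (rule tspan_mono[OF _ h(1)]) (use X n0 tspan_step in auto)
  define k where "k x = c * of_real (tilde n \<bullet> \<xi> - tilde n\<^sub>0 \<bullet> \<xi>) * E n x" for x
  have kX: "k : tspan X"
  proof (cases "n = n\<^sub>0")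
    case True then have "k = (%x. 0)" by (auto simp: k_def)
    then show ?thesis by (simp add: tspan_zero)
  next
    case False
    then have "n : X" using tspan_step by auto
    then show ?thesis unfolding k_def by (rule tspan_scaleE)
  qed
  have fw: "f : tspan weights" by (rule tspan_mono[OF _ tspan_step.hyps(1)]) (use X n0 in auto)
  have Ew: "E n : tspan weights" by (rule tspan_E[OF nw])
  show ?case
  proof (rule bexI[of _ "%x. g x + (c * h x + k x)"], intro allI impI)
    show "(%x. g x + (c * h x + k x)) : tspan X" by (rule tspan_add[OF g(1) tspan_add[OF tspan_scale[OF hX] kX]])
    fix x assume x: "regular x"
    show "Top \<xi> (%x. f x + c * E n x) x = of_real (tilde n\<^sub>0 \<bullet> \<xi>) * (f x + c * E n x) + (g x + (c * h x + k x))"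
      unfolding Top_lin[OF fw Ew] g(2)[OF x] h(2)[OF x] k_def by (simp add: algebra_simps)
  qed
qed

lemma Top_closed:
  assumes X: "X \<subseteq> weights" "!!\<nu>. \<nu> : X ==> below \<nu> \<subseteq> X" and f: "f : tspan X"
  shows "\<exists>g\<in>tspan X. \<forall>x. regular x --> Top \<xi> f x = g x"
proof (cases "X = {}")
  case True
  have "f = (%x. 0)" using f unfolding True by (cases rule: tspan.cases) auto
  then show ?thesis using tspan_zero Top_zero by (intro bexI[of _ "%x. 0"]) auto
next
  case False
  then obtain \<nu> where n: "\<nu> : X" by blast
  then have "insert \<nu> X = X" by blast
  then obtain g where g: "g : tspan X" "!!x. regular x ==> Top \<xi> f x = of_real (tilde \<nu> \<bullet> \<xi>) * f x + g x"
    using Top_shift[OF X, of \<nu> f \<xi>] n X f by auto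
  have "(%x. of_real (tilde \<nu> \<bullet> \<xi>) * f x + g x) : tspan X" by (rule tspan_add[OF tspan_scale[OF f] g(1)])
  then show ?thesis using g(2) by (intro bexI[of _ "%x. of_real (tilde \<nu> \<bullet> \<xi>) * f x + g x"]) auto
qed

text \<open>Since the operators \<open>Top \<xi>\<close> are symmetric, functions killed by disjoint lists are orthogonal.\<close>
inductive killed :: "'a => real list => ('a => complex) => bool" for \<xi> where
  killed_Nil: "f : tspan weights ==> (!!g. g : tspan weights ==> wip f g = 0) ==> killed \<xi> [] f"
| killed_Cons: "f : tspan weights ==> (!!x. regular x ==> Top \<xi> f x = of_real c * f x + f' x) ==>
    killed \<xi> cs f' ==> killed \<xi> (c # cs) f"

lemma killed_tspan: "killed \<xi> cs f ==> f : tspan weights"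
  by (induction rule: killed.induct)

lemma wip_Top:
  assumes "f : tspan weights" "f' : tspan weights" "g : tspan weights"
    and "!!x. regular x ==> Top \<xi> f x = of_real c * f x + f' x"
  shows "wip (Top \<xi> f) g = of_real c * wip f g + wip f' g"
proof -
  have gd: "good f" "good f'" "good g" using assms good_tspan by blast+
  have "wip (Top \<xi> f) g = wip (%x. of_real c * f x + f' x) g"
    using assms gd by (intro wip_cong good_Top good_add good_scale) auto
  then show ?thesis using gd by (simp add: wip_add good_scale wip_scale)
qed

text \<open>Induction on the total length. If both lists are nonempty, the remainders f' and g' drop
  out by the induction hypothesis, and symmetry of \<open>Top\<close> gives c wip f g = d wip f g
  for the distinct heads c and d.\<close>

lemma killed_orthogonal:
  assumes "killed \<xi> cs f" "killed \<xi> ds g" "set cs \<inter> set ds = {}"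
  shows "wip f g = 0"
  using assms
proof (induction "length cs + length ds" arbitrary: cs ds f g rule: less_induct)
  case less
  have fg: "f : tspan weights" "g : tspan weights" using less.prems killed_tspan by blast+
  show ?case
  proof (cases cs)
    case Nil
    then show ?thesis using less.prems(1) fg by (auto elim: killed.cases)
  next
    case (Cons c cs')
    then obtain f' where f': "!!x. regular x ==> Top \<xi> f x = of_real c * f x + f' x" "killed \<xi> cs' f'"
      using less.prems(1) by (auto elim: killed.cases)
    note f't = killed_tspan[OF f'(2)]
    show ?thesis
    proof (cases ds)
      case Nil
      then have "wip g f = 0" using less.prems(2) fg by (auto elim: killed.cases)
      then show ?thesis by (metis wip_cnj complex_cnj_zero)
    next
      case (Cons d ds')
      then obtain g' where g': "!!x. regular x ==> Top \<xi> g x = of_real d * g x + g' x" "killed \<xi> ds' g'"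
        using less.prems(2) by (auto elim: killed.cases)
      note g't = killed_tspan[OF g'(2)]
      have "wip f' g = 0"
        using less.hyps[of cs' ds f' g] f'(2) less.prems \<open>cs = c # cs'\<close> by auto
      then have 1: "wip (Top \<xi> f) g = of_real c * wip f g"
        using wip_Top[OF fg(1) f't fg(2) f'(1)] by simp
      have "wip f g' = 0"
        using less.hyps[of cs ds' f g'] g'(2) less.prems Cons by auto
      then have "wip g' f = 0" by (metis wip_cnj complex_cnj_zero)
      then have "wip (Top \<xi> g) f = of_real d * wip g f"
        using wip_Top[OF fg(2) g't fg(1) g'(1)] by simp
      then have "cnj (wip (Top \<xi> g) f) = of_real d * cnj (wip g f)" by simp
      then have 2: "wip f (Top \<xi> g) = of_real d * wip f g" by (simp add: wip_cnj)
      have "(of_real c - of_real d) * wip f g = 0"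
        using 1 2 Top_selfadjoint[OF fg, of \<xi>] unfolding left_diff_distrib by (simp only: diff_self)
      moreover have "c ~= d" using less.prems(3) Cons \<open>cs = c # cs'\<close> by auto
      ultimately show ?thesis by simp
    qed
  qed
qed

text \<open>The frequencies in vs are removed one by one, the last first. Orthogonality to
  \<open>tspan X\<close> persists because \<open>Top\<close> is symmetric and maps
  \<open>tspan X\<close> to itself almost everywhere. What remains at the end lies in
  \<open>tspan X\<close> and is orthogonal to it, hence null by \<open>wip_null\<close>.\<close>

lemma killedI:
  assumes X: "X \<subseteq> weights" "!!n. n : X ==> below n \<subseteq> X"
    and vs: "set vs \<subseteq> weights" "!!us v ws. vs = us @ v # ws ==> below v \<subseteq> X \<union> set us"
    and f: "f : tspan (X \<union> set vs)" "!!h. h : tspan X ==> wip f h = 0"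
  shows "killed \<xi> (map (%v. tilde v \<bullet> \<xi>) (rev vs)) f"
  using vs f
proof (induction vs arbitrary: f rule: rev_induct)
  case Nil
  have fX: "f : tspan X" using Nil by simp
  have fw: "f : tspan weights" by (rule tspan_mono[OF X(1) fX])
  have "wip f f = 0" using Nil(4) fX by blast
  then have "wip f g = 0" if "g : tspan weights" for g using wip_null good_tspan fw that by blast
  then show ?case using fw by (auto intro: killed_Nil)
next
  case (snoc v us)
  let ?Y = "X \<union> set us"
  have Yw: "?Y \<subseteq> weights" using X snoc.prems(1) by auto
  have Yb: "below n \<subseteq> ?Y" if "n : ?Y" for n
  proof (cases "n : X")
    case False
    then obtain as bs where "us = as @ n # bs" using \<open>n : ?Y\<close> by (metis Un_iff split_list)
    then have "below n \<subseteq> X \<union> set as" using snoc.prems(2)[of as n "bs @ [v]"] by simp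
    then show ?thesis using \<open>us = as @ n # bs\<close> by auto
  qed (use X in auto)
  have vw: "v : weights" "below v \<subseteq> ?Y" using snoc.prems(1) snoc.prems(2)[of us v "[]"] by auto
  have fY: "f : tspan (insert v ?Y)" using snoc.prems(3) by simp
  obtain g where g: "g : tspan ?Y" "!!x. regular x ==> Top \<xi> f x = of_real (tilde v \<bullet> \<xi>) * f x + g x"
    using Top_shift[OF Yw Yb vw fY] by blast
  have fw: "f : tspan weights" by (rule tspan_mono[OF _ fY]) (use Yw vw in auto)
  have gw: "g : tspan weights" by (rule tspan_mono[OF Yw g(1)])
  have "wip g h = 0" if h: "h : tspan X" for h
  proof -
    have hw: "h : tspan weights" by (rule tspan_mono[OF X(1) h])
    obtain h' where h': "h' : tspan X" "!!x. regular x ==> Top \<xi> h x = h' x" using Top_closed[OF X h] by blast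
    have h'w: "h' : tspan weights" by (rule tspan_mono[OF X(1) h'(1)])
    have "wip f (Top \<xi> h) = wip f h'"
      using h'(2) by (intro wip_cong_right good_Top hw good_tspan[OF h'w] good_tspan[OF fw]) auto
    then have "wip (Top \<xi> f) h = 0" using Top_selfadjoint[OF fw hw] snoc.prems(4)[OF h'(1)] by simp
    moreover have "wip (Top \<xi> f) h = of_real (tilde v \<bullet> \<xi>) * wip f h + wip g h"
      by (rule wip_Top[OF fw gw hw g(2)])
    ultimately show ?thesis using snoc.prems(4)[OF h] by simp
  qed
  moreover have "below u \<subseteq> X \<union> set as" if "us = as @ u # bs" for as u bs
    using snoc.prems(2)[of as u "bs @ [v]"] that by simp
  ultimately have "killed \<xi> (map (%v. tilde v \<bullet> \<xi>) (rev us)) g"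
    using snoc.IH[of g] snoc.prems(1) g(1) by auto
  then show ?case using killed_Cons[OF fw g(2)] by simp
qed

end

section \<open>Heckman--Opdam polynomials\<close>

text \<open>The element with least theta enters no equation but its own, so it is removed by
  induction and solved for last. Signs survive because theta l - theta mu > 0 and b >= 0.\<close>

lemma triangular_recursion:
  fixes \<theta> :: "'b => real" and b :: "'b => 'b => real"
  assumes "finite A" "l : A" "!!\<mu>. \<mu> : A ==> \<mu> ~= l ==> \<theta> \<mu> < \<theta> l" "!!k \<mu>. b k \<mu> \<ge> 0"
  shows "\<exists>c. c l = 1 \<and> (\<forall>\<mu>. c \<mu> \<ge> 0) \<and>
    (\<forall>\<mu>\<in>A - {l}. (\<theta> l - \<theta> \<mu>) * c \<mu> = (\<Sum>k\<in>{k\<in>A. \<theta> k > \<theta> \<mu>}. c k * b k \<mu>))"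
  using assms(1-3)
proof (induction "card A" arbitrary: A)
  case 0
  then show ?case by auto
next
  case (Suc n)
  show ?case
  proof (cases "A = {l}")
    case True
    then show ?thesis by (intro exI[of _ "%_. 1"]) auto
  next
    case False
    then have fin: "finite (A - {l})" "A - {l} ~= {}" using Suc.prems by auto
    define \<mu>0 where "\<mu>0 = arg_min_on \<theta> (A - {l})"
    have m0: "\<mu>0 : A" "\<mu>0 ~= l" using arg_min_if_finite(1)[OF fin, of \<theta>] by (auto simp: \<mu>0_def)
    have min: "\<theta> \<mu>0 \<le> \<theta> \<mu>" if "\<mu> : A - {l}" for \<mu>
      using arg_min_if_finite(2)[OF fin, of \<theta>] that unfolding \<mu>0_def by force
    have cardn: "n = card (A - {\<mu>0})" using Suc.hyps(2) m0(1) Suc.prems(1) by simp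
    obtain c where c: "c l = 1" "!!\<mu>. c \<mu> \<ge> 0"
      "!!\<mu>. \<mu> : A - {\<mu>0} - {l} ==> (\<theta> l - \<theta> \<mu>) * c \<mu> = (\<Sum>k\<in>{k\<in>A - {\<mu>0}. \<theta> k > \<theta> \<mu>}. c k * b k \<mu>)"
      using Suc.hyps(1)[OF cardn] Suc.prems m0 by auto
    define S where "S = (\<Sum>k\<in>{k\<in>A. \<theta> k > \<theta> \<mu>0}. c k * b k \<mu>0)"
    have S: "S \<ge> 0" unfolding S_def using c(2) assms(4) by (intro sum_nonneg mult_nonneg_nonneg) auto
    have pos: "\<theta> l - \<theta> \<mu>0 > 0" using Suc.prems(3)[OF m0] by simp
    define c' where "c' = c(\<mu>0 := S / (\<theta> l - \<theta> \<mu>0))"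
    have "(\<theta> l - \<theta> \<mu>) * c' \<mu> = (\<Sum>k\<in>{k\<in>A. \<theta> k > \<theta> \<mu>}. c' k * b k \<mu>)" if mu: "\<mu> : A - {l}" for \<mu>
    proof -
      have eq: "(\<Sum>k\<in>{k\<in>A. \<theta> k > \<theta> \<mu>}. c' k * b k \<mu>) = (\<Sum>k\<in>{k\<in>A. \<theta> k > \<theta> \<mu>}. c k * b k \<mu>)"
        using min[OF mu] by (intro sum.cong) (auto simp: c'_def)
      show ?thesis
      proof (cases "\<mu> = \<mu>0")
        case True
        then show ?thesis unfolding eq using pos by (simp add: c'_def S_def)
      next
        case F: False
        have "{k\<in>A. \<theta> k > \<theta> \<mu>} = {k\<in>A - {\<mu>0}. \<theta> k > \<theta> \<mu>}" using min[OF mu] by auto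
        then show ?thesis unfolding eq using c(3)[of \<mu>] F mu by (simp add: c'_def)
      qed
    qed
    moreover have "c' l = 1" "\<forall>\<mu>. c' \<mu> \<ge> 0" using c m0 S pos by (auto simp: c'_def)
    ultimately show ?thesis by blast
  qed
qed

lemma generic_vector:
  fixes S :: "'a::euclidean_space set"
  assumes "finite S" "0 \<notin> S"
  shows "\<exists>\<xi>. \<forall>v\<in>S. v \<bullet> \<xi> ~= 0"
proof -
  have "negligible (\<Union>v\<in>S. {x. v \<bullet> x = 0})"
    using assms by (intro negligible_Union) (auto intro!: negligible_hyperplane)
  moreover have "\<not> negligible (UNIV :: 'a set)" by (rule open_not_negligible) auto
  ultimately have "(\<Union>v\<in>S. {x. v \<bullet> x = 0}) ~= UNIV" by metis
  then show ?thesis by blast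
qed

context heckman_opdam
begin

subsection \<open>The dominance order\<close>

lemma root_prec_refl: "root_prec Rp \<mu> \<mu>"
  unfolding root_prec_def by (rule exI[of _ "%_. 0"]) simp

lemma root_prec_trans: "root_prec Rp ka \<mu> ==> root_prec Rp \<mu> lam ==> root_prec Rp ka lam"
proof -
  assume "root_prec Rp ka \<mu>" "root_prec Rp \<mu> lam"
  then obtain k l where "\<mu> - ka = (\<Sum>a\<in>Rp. real (k a) *\<^sub>R a)" "lam - \<mu> = (\<Sum>a\<in>Rp. real (l a) *\<^sub>R a)"
    by (auto simp: root_prec_def)
  then have "lam - ka = (\<Sum>a\<in>Rp. real (k a + l a) *\<^sub>R a)"
    by (simp add: scaleR_left_distrib sum.distrib) (metis add.commute diff_add_cancel diff_diff_eq2 add_diff_eq)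
  then show ?thesis unfolding root_prec_def by (rule exI[of _ "%a. k a + l a"])
qed

lemma root_prec_diff: "al : Rp ==> root_prec Rp (\<mu> - real n *\<^sub>R al) \<mu>"
proof -
  assume a: "al : Rp"
  have "(\<Sum>b\<in>Rp. real (if b = al then n else 0) *\<^sub>R b) = (\<Sum>b\<in>Rp. if b = al then real n *\<^sub>R b else 0)"
    by (intro sum.cong) auto
  also have "... = real n *\<^sub>R al" using a finite_Rp by simp
  finally show ?thesis unfolding root_prec_def by (intro exI[of _ "%b. if b = al then n else 0"]) simp
qed

lemma root_prec_int:
  assumes "a : R" "(a : Rp \<and> k \<ge> 0) \<or> (- a : Rp \<and> k \<le> 0)"
  shows "root_prec Rp (\<mu> - of_int k *\<^sub>R a) \<mu>"
  using assms(2)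
proof
  assume "a : Rp \<and> k \<ge> 0"
  then show ?thesis using root_prec_diff[of a \<mu> "nat k"] by simp
next
  assume "- a : Rp \<and> k \<le> 0"
  then show ?thesis using root_prec_diff[of "- a" \<mu> "nat (- k)"] by simp
qed

abbreviation orb :: "'a => 'a set" where "orb \<mu> \<equiv> (%w. w \<mu>) ` W"

lemma finite_orb: "finite (orb \<mu>)" using finite_W by simp

lemma orb_self: "\<mu> : orb \<mu>" using id_W by (auto simp: image_iff intro!: bexI[of _ id])

lemma orb_weyl: "w : W ==> n : orb \<mu> ==> w n : orb \<mu>"
proof -
  assume w: "w : W" and "n : orb \<mu>"
  then obtain v where "v : W" "n = v \<mu>" by auto
  then show ?thesis using weyl_comp[OF w, of v] by (auto simp: image_iff intro!: bexI[of _ "w \<circ> v"])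
qed

lemma orb_weyl_iff: "w : W ==> w n : orb \<mu> \<longleftrightarrow> n : orb \<mu>"
  using orb_weyl[of w] orb_weyl[of "inv w" "w n"] weyl_inv[of w] by auto

lemma orb_sym: "n : orb \<mu> ==> \<mu> : orb n"
proof -
  assume "n : orb \<mu>"
  then obtain w where "w : W" "n = w \<mu>" by auto
  then show ?thesis using weyl_inv[of w] by (auto simp: image_iff intro!: bexI[of _ "inv w"])
qed

lemma orb_norm: "n : orb \<mu> ==> norm n = norm \<mu>" using weyl_norm by auto

lemma orb_weights: "\<mu> : weights ==> orb \<mu> \<subseteq> weights" using weights_weyl by auto

lemma bij_betw_orb: "w : W ==> bij_betw w (orb \<mu>) (orb \<mu>)"
  using orb_weyl weyl_inv by (intro bij_betwI[where g = "inv w"]) auto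

lemma dominant_orb_eq: "\<mu> : Dom ==> n : Dom ==> n : orb \<mu> ==> n = \<mu>"
  using chamber_unique[of _ \<mu>] by (auto simp: dominant_iff inner_commute)

lemma dominant_weights: "\<mu> : Dom ==> \<mu> : weights" by (simp add: dominant_iff)

lemma refl_raises:
  assumes "\<nu> : weights" "a : Rp" "\<nu> \<bullet> a < 0"
  shows "refl_root a \<nu> \<bullet> xi0 > \<nu> \<bullet> xi0" "root_prec Rp \<nu> (refl_root a \<nu>)"
proof -
  have n: "icoeff \<nu> a < 0" using icoeff_inner[OF assms(1) Rp_R[OF assms(2)]] assms(3)
    by (metis inner_ge_zero mult_nonneg_nonneg not_less of_int_0_le_iff)
  have r: "refl_root a \<nu> = \<nu> - of_int (2 * icoeff \<nu> a) *\<^sub>R a"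
    by (simp add: refl_root_coeff icoeff[OF assms(1) Rp_R[OF assms(2)]])
  have "a \<bullet> xi0 > 0" using assms by (simp add: Rp_iff)
  then have "of_int (icoeff \<nu> a) * (a \<bullet> xi0) < 0" using n by (simp add: mult_neg_pos)
  then show "refl_root a \<nu> \<bullet> xi0 > \<nu> \<bullet> xi0" unfolding r by (simp add: inner_diff_left)
  have "\<nu> = refl_root a \<nu> - of_int (- 2 * icoeff \<nu> a) *\<^sub>R a" unfolding r by simp
  moreover have "root_prec Rp (refl_root a \<nu> - of_int (- 2 * icoeff \<nu> a) *\<^sub>R a) (refl_root a \<nu>)"
    using n assms(2) by (intro root_prec_int) (auto simp: Rp_R)
  ultimately show "root_prec Rp \<nu> (refl_root a \<nu>)" by simp
qed

text \<open>An orbit element with maximal pairing with xi0 is dominant, since reflecting at a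
  negative pairing would raise that value.\<close>

lemma dominant_rep: "\<nu> : weights ==> \<exists>w\<in>W. w \<nu> : Dom"
proof -
  assume n: "\<nu> : weights"
  have ne: "orb \<nu> ~= {}" using orb_self by blast
  define ka where "ka = arg_min_on (%ka. - (ka \<bullet> xi0)) (orb \<nu>)"
  have k: "ka : orb \<nu>" unfolding ka_def by (rule arg_min_if_finite(1)[OF finite_orb ne])
  have max: "ka' \<bullet> xi0 \<le> ka \<bullet> xi0" if "ka' : orb \<nu>" for ka'
    using arg_min_if_finite(2)[OF finite_orb ne, of "%ka. - (ka \<bullet> xi0)"] that unfolding ka_def[symmetric] by force
  have kw: "ka : weights" using k orb_weights[OF n] by blast
  have "ka \<bullet> al \<ge> 0" if a: "al : Rp" for al
  proof (rule ccontr)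
    assume "\<not> ka \<bullet> al \<ge> 0"
    then have "refl_root al ka \<bullet> xi0 > ka \<bullet> xi0" using refl_raises(1)[OF kw a] by simp
    moreover have "refl_root al ka : orb \<nu>" using orb_weyl[OF weyl_refl[OF Rp_R[OF a]] k] .
    ultimately show False using max by fastforce
  qed
  then have "ka : Dom" using kw by (simp add: dominant_iff)
  then show ?thesis using k by auto
qed

text \<open>Reflecting repeatedly at negative pairings climbs in the order and raises the pairing
  with xi0. In a finite orbit this stops, at a dominant element, which is mu.\<close>

lemma orb_prec: "\<mu> : Dom ==> n : orb \<mu> ==> root_prec Rp n \<mu>"
proof (induction "card {k : orb \<mu>. k \<bullet> xi0 > n \<bullet> xi0}" arbitrary: n rule: less_induct)
  case less
  have nw: "n : weights" using less.prems orb_weights dominant_weights by blast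
  show ?case
  proof (cases "\<forall>al\<in>Rp. n \<bullet> al \<ge> 0")
    case True
    then have "n : Dom" using nw by (simp add: dominant_iff)
    then have "n = \<mu>" by (rule dominant_orb_eq[OF less.prems(1) _ less.prems(2)])
    then show ?thesis by (simp add: root_prec_refl)
  next
    case False
    then obtain al where a: "al : Rp" "n \<bullet> al < 0" by (auto simp: not_le)
    let ?r = "refl_root al n"
    have r: "?r : orb \<mu>" using orb_weyl[OF weyl_refl[OF Rp_R[OF a(1)]] less.prems(2)] .
    have gt: "?r \<bullet> xi0 > n \<bullet> xi0" "root_prec Rp n ?r" using refl_raises[OF nw a] by auto
    have "card {k : orb \<mu>. k \<bullet> xi0 > ?r \<bullet> xi0} < card {k : orb \<mu>. k \<bullet> xi0 > n \<bullet> xi0}"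
    proof (rule psubset_card_mono)
      show "{k : orb \<mu>. k \<bullet> xi0 > ?r \<bullet> xi0} \<subset> {k : orb \<mu>. k \<bullet> xi0 > n \<bullet> xi0}"
        using gt(1) r by (intro psubsetI) (auto dest: less_trans)
    qed (use finite_orb in auto)
    then have "root_prec Rp ?r \<mu>" using less r by blast
    then show ?thesis using gt root_prec_trans by blast
  qed
qed

text \<open>The saturated set of lam: the union of the orbits of the dominant weights below lam
  (\<open>lower_D\<close>, \<open>D_rep\<close>). Quantifying over the orbit makes its Weyl
  invariance immediate.\<close>

definition D :: "'a => 'a set" where
  "D lam = {\<nu> : weights. \<forall>w\<in>W. root_prec Rp (w \<nu>) lam}"

definition Dlt :: "'a => 'a set" where "Dlt lam = D lam - orb lam"

lemma D_weyl: "w : W ==> \<nu> : D lam ==> w \<nu> : D lam"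
proof -
  assume w: "w : W" and n: "\<nu> : D lam"
  have "root_prec Rp (v (w \<nu>)) lam" if "v : W" for v
    using n weyl_comp[OF that w] by (auto simp: D_def dest!: bspec[of W _ "v \<circ> w"])
  then show ?thesis using w n weights_weyl by (auto simp: D_def)
qed

lemma D_weights: "D lam \<subseteq> weights" and Dlt_weights: "Dlt lam \<subseteq> weights"
  by (auto simp: D_def Dlt_def)

lemma lower_D: "ka : low lam ==> ka : D lam"
proof -
  assume k: "ka : low lam"
  have "root_prec Rp (w ka) lam" if "w : W" for w
    using orb_prec[of ka "w ka"] root_prec_trans[of "w ka" ka lam] k that by (auto simp: lower_set_def)
  then show ?thesis using k dominant_weights by (auto simp: lower_set_def D_def)
qed

lemma lower_self: "lam : Dom ==> lam : low lam"
  by (simp add: lower_set_def root_prec_refl)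

lemma lower_trans: "k : low \<mu> ==> \<mu> : low lam ==> k : low lam"
  using root_prec_trans by (auto simp: lower_set_def)

lemma orb_D: "lam : Dom ==> orb lam \<subseteq> D lam"
  using lower_D[OF lower_self] D_weyl by auto

lemma inner_prec:
  assumes "root_prec Rp ka lam" "!!a. a : Rp ==> y \<bullet> a \<ge> 0"
  shows "y \<bullet> (lam - ka) \<ge> 0"
proof -
  obtain k :: "'a => nat" where "lam - ka = (\<Sum>a\<in>Rp. real (k a) *\<^sub>R a)" using assms(1) by (auto simp: root_prec_def)
  then show ?thesis using assms(2) by (simp add: inner_sum_right sum_nonneg)
qed

lemma lower_norm:
  assumes "ka : low lam" "lam : Dom"
  shows "norm ka \<le> norm lam" "ka ~= lam ==> norm ka < norm lam"
proof -
  have k: "root_prec Rp ka lam" "!!a. a : Rp ==> ka \<bullet> a \<ge> 0" "!!a. a : Rp ==> lam \<bullet> a \<ge> 0"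
    using assms by (auto simp: lower_set_def dominant_iff)
  have ge: "ka \<bullet> (lam - ka) \<ge> 0" "lam \<bullet> (lam - ka) \<ge> 0" using inner_prec k by blast+
  have eq: "(norm lam)^2 - (norm ka)^2 = lam \<bullet> (lam - ka) + ka \<bullet> (lam - ka)"
    by (simp add: power2_norm_eq_inner inner_diff_right inner_commute)
  have "(norm ka)^2 \<le> (norm lam)^2" using ge eq by linarith
  then show "norm ka \<le> norm lam" by (rule power2_le_imp_le) simp
  assume ne: "ka ~= lam"
  have "(norm lam)^2 - (norm ka)^2 ~= 0"
  proof
    assume "(norm lam)^2 - (norm ka)^2 = 0"
    then have "lam \<bullet> (lam - ka) = 0" "ka \<bullet> (lam - ka) = 0" using ge eq by linarith+
    then have "(lam - ka) \<bullet> (lam - ka) = 0" by (simp add: inner_diff_left)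
    then show False using ne by simp
  qed
  then have "norm lam ~= norm ka" by auto
  then show "norm ka < norm lam" using \<open>norm ka \<le> norm lam\<close> by simp
qed

lemma finite_lower: "lam : Dom ==> finite (low lam)"
proof (rule finite_subset[OF _ finite_weights_cball[of "norm lam"]])
  assume "lam : Dom"
  then show "low lam \<subseteq> weights \<inter> cball 0 (norm lam)"
    using lower_norm(1) dominant_weights by (auto simp: lower_set_def)
qed

lemma D_rep:
  assumes "n : D lam"
  shows "\<exists>k\<in>low lam. n : orb k \<and> k : orb n"
proof -
  obtain w where w: "w : W" "w n : Dom" using dominant_rep assms by (auto simp: D_def)
  then have "w n : low lam" using assms by (auto simp: D_def lower_set_def)
  then show ?thesis using w orb_sym by (intro bexI[of _ "w n"]) auto
qed

lemma D_norm: "n : D lam ==> lam : Dom ==> norm n \<le> norm lam"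
  using D_rep lower_norm(1) orb_norm by metis

text \<open>After applying w, an interior point of the string is reached from one of its two ends by
  subtracting multiples of a positive root, and both ends lie below lam. The norm drops because |nu
  - 2 j al|^2 = |nu|^2 - 4 j (n - j) |al|^2 with j (n - j) > 0.\<close>

lemma D_string:
  assumes n: "\<nu> : D lam" and a: "al : R" and j: "j : between (icoeff \<nu> al)"
  shows "\<nu> - (2 * of_int j) *\<^sub>R al : D lam" "norm (\<nu> - (2 * of_int j) *\<^sub>R al) < norm \<nu>"
proof -
  let ?n = "icoeff \<nu> al"
  have nw: "\<nu> : weights" using n D_weights by blast
  have "root_prec Rp (w (\<nu> - (2 * of_int j) *\<^sub>R al)) lam" if w: "w : W" for w
  proof -
    have wa: "w al : R" using weyl_R w a by blast
    have e1: "w (\<nu> - (2 * of_int j) *\<^sub>R al) = w \<nu> - of_int (2 * j) *\<^sub>R w al"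
      using w by (simp add: weyl_diff weyl_scale)
    have "w (refl_root al \<nu>) = w \<nu> - of_int (2 * ?n) *\<^sub>R w al"
      using w by (simp add: refl_root_coeff icoeff[OF nw a] weyl_diff weyl_scale)
    then have e2: "w (\<nu> - (2 * of_int j) *\<^sub>R al) = w (refl_root al \<nu>) - of_int (2 * (j - ?n)) *\<^sub>R w al"
      unfolding e1 by (simp add: algebra_simps)
    have p1: "root_prec Rp (w \<nu>) lam" using n w by (auto simp: D_def)
    have p2: "root_prec Rp (w (refl_root al \<nu>)) lam"
      using D_weyl[OF weyl_refl[OF a] n] w by (auto simp: D_def)
    have jn: "(j > 0 \<and> j - ?n < 0) \<or> (j < 0 \<and> j - ?n > 0)" using j by (auto simp: between_def)
    show ?thesis
    proof (cases "(w al : Rp \<and> 2 * j \<ge> 0) \<or> (- w al : Rp \<and> 2 * j \<le> 0)")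
      case True
      then show ?thesis unfolding e1 using root_prec_int[OF wa] p1 root_prec_trans by blast
    next
      case False
      then have "(w al : Rp \<and> 2 * (j - ?n) \<ge> 0) \<or> (- w al : Rp \<and> 2 * (j - ?n) \<le> 0)"
        using R_cases[OF wa] jn by auto
      then show ?thesis unfolding e2 using root_prec_int[OF wa] p2 root_prec_trans by blast
    qed
  qed
  moreover have "\<nu> - (2 * of_int j) *\<^sub>R al : weights"
    using weights_arith(3)[OF nw weights_of_int[OF two_root_weight[OF a], of j]] by (simp add: mult.commute)
  ultimately show "\<nu> - (2 * of_int j) *\<^sub>R al : D lam" by (simp add: D_def)
  have "(norm (\<nu> - (2 * of_int j) *\<^sub>R al))^2 = (norm \<nu>)^2 - 4 * of_int j * (\<nu> \<bullet> al) + 4 * (of_int j)^2 * (al \<bullet> al)"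
    unfolding power2_norm_eq_inner by (simp add: inner_diff_left inner_diff_right inner_commute algebra_simps power2_eq_square)
  also have "... = (norm \<nu>)^2 - 4 * of_int (j * (?n - j)) * (al \<bullet> al)"
    unfolding icoeff_inner[OF nw a] by (simp add: algebra_simps power2_eq_square)
  also have "... < (norm \<nu>)^2"
  proof -
    have "j * (?n - j) > 0" using j by (auto simp: between_def zero_less_mult_iff)
    then have "real_of_int (j * (?n - j)) > 0" by (simp only: of_int_0_less_iff)
    then show ?thesis using R_nonzero[OF a] by simp
  qed
  finally show "norm (\<nu> - (2 * of_int j) *\<^sub>R al) < norm \<nu>" by (rule power2_less_imp_less) simp
qed

lemma string_Dlt:
  assumes "lam : Dom" "n : D lam" "a : R" "j : between (icoeff n a)"
  shows "n - (2 * of_int j) *\<^sub>R a : Dlt lam"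
  using D_string[OF assms(2-4)] D_norm[OF assms(2,1)] orb_norm unfolding Dlt_def by fastforce

lemma below_Dlt:
  assumes "lam : Dom" "\<nu> : Dlt lam" shows "below \<nu> \<subseteq> Dlt lam"
proof -
  have n: "\<nu> : D lam" "\<nu> \<notin> orb lam" using assms by (auto simp: Dlt_def)
  have "refl_root a \<nu> : Dlt lam" if "a : Rp" for a
    using D_weyl[OF weyl_refl[OF Rp_R[OF that]] n(1)] orb_weyl_iff[OF weyl_refl[OF Rp_R[OF that]]] n(2)
    by (simp add: Dlt_def)
  then show ?thesis using string_Dlt[OF assms(1) n(1) Rp_R] by (auto simp: below_def)
qed

lemma killed_dominant:
  assumes lam: "lam : Dom" and f: "f : tspan (D lam)" "!!h. h : tspan (Dlt lam) ==> wip f h = 0"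
  shows "\<exists>vs. set vs = orb lam \<and> (\<forall>\<xi>. killed \<xi> (map (%v. tilde v \<bullet> \<xi>) vs) f)"
proof -
  obtain xs where xs: "set xs = orb lam" using finite_list[OF finite_orb] by blast
  \<comment> \<open>The orbit is sorted by decreasing pairing with xi0. Reflections at negative
    pairings raise it, so they lead to earlier entries, as \<open>killedI\<close> requires.\<close>
  define k where "k n = - (n \<bullet> xi0)" for n
  define vs where "vs = sort_key k xs"
  have vs: "set vs = orb lam" "sorted (map k vs)" using xs by (simp_all add: vs_def)
  have ow: "orb lam \<subseteq> weights" using orb_weights dominant_weights lam by blast
  have "killed \<xi> (map (%v. tilde v \<bullet> \<xi>) (rev vs)) f" for \<xi>
  proof (rule killedI[OF Dlt_weights])
    show "below n \<subseteq> Dlt lam" if "n : Dlt lam" for n using below_Dlt lam that by blast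
    show "set vs \<subseteq> weights" using vs ow by simp
    show "f : tspan (Dlt lam \<union> set vs)" by (rule tspan_mono[OF _ f(1)]) (auto simp: vs Dlt_def)
    show "wip f h = 0" if "h : tspan (Dlt lam)" for h using f(2) that .
    fix us v ws assume sp: "vs = us @ v # ws"
    have v: "v : orb lam" using vs(1) sp by auto
    have vw: "v : weights" using v ow by blast
    have vD: "v : D lam" using orb_D lam v by blast
    have "refl_root al v : set us" if a: "al : Rp" "v \<bullet> al < 0" for al
    proof -
      have "refl_root al v : set vs" unfolding vs(1) using orb_weyl[OF weyl_refl[OF Rp_R[OF a(1)]] v] .
      moreover have "k (refl_root al v) < k v" using refl_raises(1)[OF vw a] by (simp add: k_def)
      moreover have "k v \<le> k u" if "u : set (v # ws)" for u
        using vs(2) that unfolding sp by (auto simp: sorted_append)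
      ultimately show ?thesis unfolding sp by fastforce
    qed
    then show "below v \<subseteq> Dlt lam \<union> set us"
      using string_Dlt[OF lam vD Rp_R] by (auto simp: below_def)
  qed
  then show ?thesis using vs(1) by (intro exI[of _ "rev vs"]) auto
qed

text \<open>Different dominant weights have disjoint orbits, and \<open>tilde\<close> is injective.
  So some xi avoids finitely many hyperplanes and makes all values tilde v . xi on the two orbits
  different; \<open>killed_orthogonal\<close> then applies.\<close>

theorem dominant_orthogonal:
  assumes lam: "lam : Dom" and f: "f : tspan (D lam)" "!!h. h : tspan (Dlt lam) ==> wip f h = 0"
    and mu: "\<mu> : Dom" and g: "g : tspan (D \<mu>)" "!!h. h : tspan (Dlt \<mu>) ==> wip g h = 0"
    and ne: "lam ~= \<mu>"
  shows "wip f g = 0"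
proof -
  obtain vs where vs: "set vs = orb lam" "!!\<xi>. killed \<xi> (map (%v. tilde v \<bullet> \<xi>) vs) f" using killed_dominant[OF lam f] by blast
  obtain us where us: "set us = orb \<mu>" "!!\<xi>. killed \<xi> (map (%v. tilde v \<bullet> \<xi>) us) g" using killed_dominant[OF mu g] by blast
  define S where "S = (\<Union>v\<in>orb lam. (%u. tilde v - tilde u) ` orb \<mu>)"
  have disj: "v ~= u" if vu: "v : orb lam" "u : orb \<mu>" for v u
  proof
    assume "v = u"
    then obtain w w' where "w : W" "w' : W" "w lam = w' \<mu>" using vu by auto
    then have "w lam : orb \<mu>" by blast
    then have "lam : orb \<mu>" using orb_weyl_iff[OF \<open>w : W\<close>] by blast
    then show False using dominant_orb_eq[OF mu lam] ne by simp
  qed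
  have "0 \<notin> S"
  proof
    assume "0 : S"
    then obtain v where v: "v : orb lam" "0 : (%u. tilde v - tilde u) ` orb \<mu>" unfolding S_def by (rule UN_E)
    from v(2) obtain u where u: "0 = tilde v - tilde u" "u : orb \<mu>" by (rule imageE)
    have vu: "v : orb lam" "u : orb \<mu>" using v u by blast+
    have "tilde v = tilde u" using u(1) by simp
    then have "v = u" by (rule tilde_inj)
    then show False using disj vu by blast
  qed
  moreover have "finite S" unfolding S_def by (intro finite_UN_I finite_orb finite_imageI)
  ultimately have "\<exists>\<xi>. \<forall>v\<in>S. v \<bullet> \<xi> ~= 0" by (intro generic_vector)
  then obtain \<xi> where "\<forall>v\<in>S. v \<bullet> \<xi> ~= 0" by (rule exE)
  then have \<xi>: "v \<bullet> \<xi> ~= 0" if "v : S" for v using that by (rule bspec)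
  have "tilde v \<bullet> \<xi> ~= tilde u \<bullet> \<xi>" if "v : orb lam" "u : orb \<mu>" for v u
  proof -
    have "tilde v - tilde u : S" unfolding S_def by (rule UN_I[OF that(1)], rule imageI[OF that(2)])
    then have "(tilde v - tilde u) \<bullet> \<xi> ~= 0" by (rule \<xi>)
    then show ?thesis by (simp add: inner_diff_left)
  qed
  then have "set (map (%v. tilde v \<bullet> \<xi>) vs) \<inter> set (map (%v. tilde v \<bullet> \<xi>) us) = {}"
    unfolding set_map vs(1) us(1) by fastforce
  then show ?thesis by (rule killed_orthogonal[OF vs(2) us(2)])
qed

subsection \<open>Orbit sums and the Laplacian\<close>

definition winv :: "('a => complex) => bool" where
  "winv f \<longleftrightarrow> (\<forall>w\<in>W. \<forall>x. f (w x) = f x)"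

definition M :: "'a => 'a => complex" where "M \<mu> x = (\<Sum>\<nu>\<in>orb \<mu>. E \<nu> x)"

lemma orbit_sum_M: "orbit_sum R \<mu> (x, 0) = M \<mu> x"
  unfolding orbit_sum_def M_def E_def cinner_def by (simp add: complex_of_real_def)

lemma M_tspan: "M \<mu> : tspan (orb \<mu>)"
  unfolding M_def by (intro tspan_sum tspan_E) auto

lemma M_tspan_weights: "\<mu> : weights ==> M \<mu> : tspan weights"
  using tspan_mono[OF orb_weights M_tspan] .

lemma M_winv: "winv (M \<mu>)"
  unfolding winv_def
proof (intro ballI allI)
  fix w x assume w: "w : W"
  show "M \<mu> (w x) = M \<mu> x"
    unfolding M_def E_weyl[OF w]
    by (rule sum.reindex_bij_betw[OF bij_betw_orb[OF weyl_inv[OF w]], of "%n. E n x"])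
qed

lemma wip_weyl: "w : W ==> wip (%x. f (w x)) (%x. g (w x)) = wip f g"
  unfolding wip_def wmean_def
  using mean_weyl[of w "%x. f x * cnj (g x) * of_real (wt x)"] weight_weyl by simp

lemma wip_E_orb:
  assumes g: "winv g" and "n : orb \<mu>"
  shows "wip (E n) g = wip (E \<mu>) g"
proof -
  obtain w where w: "w : W" "n = w \<mu>" using assms by auto
  have "E n (w x) = E \<mu> x" for x using E_weyl[OF w(1), of n x] w by simp
  moreover have "(%x. g (w x)) = g" using g w by (auto simp: winv_def)
  ultimately show ?thesis using wip_weyl[OF w(1), of "E n" g] by simp
qed

lemma wip_M:
  assumes "winv g" "good g"
  shows "wip (M \<mu>) g = of_nat (card (orb \<mu>)) * wip (E \<mu>) g"
proof -
  have "wip (M \<mu>) g = (\<Sum>n\<in>orb \<mu>. wip (E n) g)"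
    unfolding M_def by (rule wip_sum) (auto intro: good_tspan[OF tspan_E[of _ UNIV]] assms)
  also have "... = (\<Sum>n\<in>orb \<mu>. wip (E \<mu>) g)" using wip_E_orb[OF assms(1)] by (intro sum.cong) auto
  finally show ?thesis by simp
qed

text \<open>Minus the Heckman-Opdam Laplacian on invariant f: there \<open>ddir al f\<close> is odd
  under the reflection in al, so the second term becomes - sum m cot (al . x) d_al f. Writing it
  with \<open>cotd\<close> keeps the result bounded for every trigonometric polynomial.\<close>

definition Lop :: "('a => complex) => 'a => complex" where
  "Lop f x = - (\<Sum>b\<in>Basis. ddir b (ddir b f) x) - (1 / 2) * (\<Sum>al\<in>Rp. of_real (m al) * cotd al (ddir al f) x)"

lemma good_Lop: assumes f: "f : tspan weights" shows "good (Lop f)"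
proof -
  have "good (%x. 0 - (\<Sum>b\<in>Basis. ddir b (ddir b f) x))"
    by (rule good_diff[OF good_const], rule good_sum, rule good_tspan[OF tspan_ddir[OF tspan_ddir[OF f]]])
  moreover have "good (%x. (1 / 2) * (\<Sum>a\<in>Rp. of_real (m a) * cotd a (ddir a f) x))"
    by (rule good_scale, rule good_sum, rule good_scale, rule good_cotd[OF Rp_R tspan_ddir[OF f]])
  ultimately show ?thesis unfolding Lop_def using good_diff by simp
qed

text \<open>\<open>Lop\<close> is the operator of the Dirichlet form, hence symmetric on invariant functions.\<close>
lemma Lop_dirichlet:
  assumes f: "f : tspan weights" and g: "g : tspan weights" "winv g"
  shows "wip (Lop f) g = (\<Sum>b\<in>Basis. wip (ddir b f) (ddir b g))"
proof -
  have cg: "(%x. cnj (g x)) : tspan weights" using tspan_weights_cnj g by blast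
  have df: "ddir b f : tspan weights" "ddir b g : tspan weights" for b using tspan_ddir f g by blast+
  define h where "h b x = ddir b f x * cnj (g x)" for b x
  have h: "h b : tspan weights" for b unfolding h_def by (rule tspan_weights_mult[OF df(1) cg])
  define F where "F b x = ddir b (h b) x + (\<Sum>al\<in>Rp. of_real (m al * (al \<bullet> b) / 2) * cotd al (h b) x)" for b x
  have gF: "good (F b)" for b unfolding F_def
    by (rule good_add[OF good_tspan[OF tspan_ddir[OF h]]], rule good_sum, rule good_scale, rule good_cotd[OF Rp_R h])
  have F0: "wmean (F b) = 0" for b unfolding F_def by (rule integration_by_parts[OF h])
  have gg: "good g" "good f" using good_tspan f g by blast+
  have pt: "(\<Sum>b\<in>Basis. F b x) = (\<Sum>b\<in>Basis. ddir b f x * cnj (ddir b g x)) - Lop f x * cnj (g x)" for x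
  proof -
    have dh: "ddir b (h b) x = ddir b f x * cnj (ddir b g x) + ddir b (ddir b f) x * cnj (g x)" for b
      unfolding h_def ddir_mult[OF df(1) cg] ddir_cnj[OF g(1)] ..
    have gr: "g (refl_root al x) = g x" if "al : Rp" for al using g(2) weyl_refl[OF Rp_R[OF that]] by (simp add: winv_def)
    have "(\<Sum>b\<in>Basis. \<Sum>al\<in>Rp. of_real (m al * (al \<bullet> b) / 2) * cotd al (h b) x) =
        (\<Sum>al\<in>Rp. \<Sum>b\<in>Basis. of_real (m al * (al \<bullet> b) / 2) * cotd al (h b) x)" by (rule sum.swap)
    also have "... = (\<Sum>al\<in>Rp. (1/2) * (of_real (m al) * cotd al (ddir al f) x) * cnj (g x))"
    proof (rule sum.cong[OF refl])
      fix al assume a: "al : Rp"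
      let ?k = "(1/2) * of_real (m al) * of_real (cot (al \<bullet> x)) * cnj (g x)"
      have "(\<Sum>b\<in>Basis. of_real (m al * (al \<bullet> b) / 2) * cotd al (h b) x) =
          (\<Sum>b\<in>Basis. ?k * (of_real (al \<bullet> b) * ddir b f x - of_real (al \<bullet> b) * ddir b f (refl_root al x)))"
        by (intro sum.cong refl) (simp add: cotd_def h_def gr[OF a] field_simps)
      also have "... = ?k * (ddir al f x - ddir al f (refl_root al x))"
        unfolding sum_distrib_left[symmetric] sum_subtractf ddir_sum_Basis[OF f] ..
      also have "... = (1/2) * (of_real (m al) * cotd al (ddir al f) x) * cnj (g x)"
        by (simp add: cotd_def mult_ac)
      finally show "(\<Sum>b\<in>Basis. of_real (m al * (al \<bullet> b) / 2) * cotd al (h b) x) = (1/2) * (of_real (m al) * cotd al (ddir al f) x) * cnj (g x)" .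
    qed
    also have "... = (1/2) * (\<Sum>al\<in>Rp. of_real (m al) * cotd al (ddir al f) x) * cnj (g x)"
      by (simp add: sum_distrib_left sum_distrib_right)
    finally have s: "(\<Sum>b\<in>Basis. \<Sum>al\<in>Rp. of_real (m al * (al \<bullet> b) / 2) * cotd al (h b) x) =
        (1/2) * (\<Sum>al\<in>Rp. of_real (m al) * cotd al (ddir al f) x) * cnj (g x)" .
    show ?thesis unfolding F_def sum.distrib s dh Lop_def
      by (simp add: left_diff_distrib flip: sum_distrib_right)
  qed
  have gp: "good (%x. ddir b f x * cnj (ddir b g x))" for b by (rule good_prod[OF good_tspan[OF df(1)] good_tspan[OF df(2)]])
  have gs: "good (%x. \<Sum>b\<in>Basis. ddir b f x * cnj (ddir b g x))" by (rule good_sum) (rule gp)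
  have "0 = (\<Sum>b\<in>Basis. wmean (F b))" by (simp add: F0)
  also have "... = wmean (%x. \<Sum>b\<in>Basis. F b x)" by (rule wmean_sum[symmetric]) (rule gF)
  also have "... = wmean (%x. \<Sum>b\<in>Basis. ddir b f x * cnj (ddir b g x)) - wmean (%x. Lop f x * cnj (g x))"
    unfolding pt by (rule wmean_diff[OF gs good_prod[OF good_Lop[OF f] gg(1)]])
  also have "wmean (%x. \<Sum>b\<in>Basis. ddir b f x * cnj (ddir b g x)) = (\<Sum>b\<in>Basis. wip (ddir b f) (ddir b g))"
    unfolding wip_def by (rule wmean_sum) (rule gp)
  finally show ?thesis by (simp add: wip_def)
qed

lemma Lop_symmetric:
  assumes "f : tspan weights" "winv f" "g : tspan weights" "winv g"
  shows "wip (Lop f) g = cnj (wip (Lop g) f)"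
  unfolding Lop_dirichlet[OF assms(1,3,4)] Lop_dirichlet[OF assms(3,1,2)] by (simp add: cnj_sum wip_cnj)

lemma Lop_sum:
  assumes f: "!!i. i : I ==> f i : tspan weights"
  shows "Lop (%x. \<Sum>i\<in>I. c i * f i x) x = (\<Sum>i\<in>I. c i * Lop (f i) x)"
proof -
  have d: "ddir b (%x. \<Sum>i\<in>I. c i * h i x) = (%x. \<Sum>i\<in>I. c i * ddir b (h i) x)"
    if h: "!!i. i : I ==> h i : tspan weights" for b h
  proof (rule ext)
    fix x
    have "ddir b (%x. \<Sum>i\<in>I. c i * h i x) x = (\<Sum>i\<in>I. ddir b (%x. c i * h i x) x)"
      by (rule ddir_sum) (rule tspan_scale[OF h])
    also have "... = (\<Sum>i\<in>I. c i * ddir b (h i) x)" by (intro sum.cong refl ddir_scale[OF h])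
    finally show "ddir b (%x. \<Sum>i\<in>I. c i * h i x) x = (\<Sum>i\<in>I. c i * ddir b (h i) x)" .
  qed
  have df: "ddir b (f i) : tspan weights" if "i : I" for i b using tspan_ddir f that by blast
  have 1: "(\<Sum>b\<in>Basis. ddir b (ddir b (%x. \<Sum>i\<in>I. c i * f i x)) x) = (\<Sum>i\<in>I. c i * (\<Sum>b\<in>Basis. ddir b (ddir b (f i)) x))"
  proof -
    have "ddir b (ddir b (%x. \<Sum>i\<in>I. c i * f i x)) x = (\<Sum>i\<in>I. c i * ddir b (ddir b (f i)) x)" for b
      using d[of f b] d[of "%i. ddir b (f i)" b] f df by simp
    then show ?thesis unfolding sum_distrib_left by (simp only:) (rule sum.swap)
  qed
  have "cotd a (%x. \<Sum>i\<in>I. c i * h i x) x = (\<Sum>i\<in>I. c i * cotd a (h i) x)" for a h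
    unfolding cotd_def sum_subtractf[symmetric] sum_distrib_left by (intro sum.cong) (auto simp: algebra_simps)
  then have "(\<Sum>a\<in>Rp. of_real (m a) * cotd a (ddir a (%x. \<Sum>i\<in>I. c i * f i x)) x) = (\<Sum>a\<in>Rp. \<Sum>i\<in>I. c i * (of_real (m a) * cotd a (ddir a (f i)) x))"
    using d[of f] f by (simp add: sum_distrib_left algebra_simps)
  also have "... = (\<Sum>i\<in>I. c i * (\<Sum>a\<in>Rp. of_real (m a) * cotd a (ddir a (f i)) x))"
    unfolding sum_distrib_left by (rule sum.swap)
  finally have 2: "(\<Sum>a\<in>Rp. of_real (m a) * cotd a (ddir a (%x. \<Sum>i\<in>I. c i * f i x)) x) = (\<Sum>i\<in>I. c i * (\<Sum>a\<in>Rp. of_real (m a) * cotd a (ddir a (f i)) x))" .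
  show ?thesis unfolding Lop_def 1 2
    by (simp add: sum_subtractf sum_negf sum_distrib_left right_diff_distrib mult.left_commute)
qed

text \<open>The factor nu . al from the derivative and the sign from \<open>cotd_E\<close> combine
  to |nu . al|. This is the source of all nonnegativity.\<close>

lemma Lop_E:
  assumes x: "regular x" and n: "\<nu> : weights"
  shows "Lop (E \<nu>) x = of_real (\<nu> \<bullet> \<nu>) * E \<nu> x + (\<Sum>al\<in>Rp. of_real (m al * \<bar>\<nu> \<bullet> al\<bar>) *
    ((1/2) * E \<nu> x + (1/2) * E (refl_root al \<nu>) x + (\<Sum>j\<in>between (icoeff \<nu> al). E (\<nu> - (2 * of_int j) *\<^sub>R al) x)))"
proof -
  have dd: "ddir b (E \<nu>) = (%x. (\<i> * of_real (\<nu> \<bullet> b)) * E \<nu> x)" for b by (rule ext) (rule ddir_E)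
  have "ddir b (ddir b (E \<nu>)) x = - of_real ((\<nu> \<bullet> b) * (\<nu> \<bullet> b)) * E \<nu> x" for b
    unfolding dd ddir_scale[OF tspan_E[OF n]] by (simp add: algebra_simps)
  then have "- (\<Sum>b\<in>Basis. ddir b (ddir b (E \<nu>)) x) = of_real (\<Sum>b\<in>Basis. (\<nu> \<bullet> b) * (\<nu> \<bullet> b)) * E \<nu> x"
    by (simp add: sum_negf sum_distrib_right)
  also have "(\<Sum>b\<in>Basis. (\<nu> \<bullet> b) * (\<nu> \<bullet> b)) = \<nu> \<bullet> \<nu>" by (rule euclidean_inner[symmetric])
  finally have 1: "- (\<Sum>b\<in>Basis. ddir b (ddir b (E \<nu>)) x) = of_real (\<nu> \<bullet> \<nu>) * E \<nu> x" .
  have 2: "- ((1/2) * (of_real (m al) * cotd al (ddir al (E \<nu>)) x)) = of_real (m al * \<bar>\<nu> \<bullet> al\<bar>) *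
      ((1/2) * E \<nu> x + (1/2) * E (refl_root al \<nu>) x + (\<Sum>j\<in>between (icoeff \<nu> al). E (\<nu> - (2 * of_int j) *\<^sub>R al) x))"
    if a: "al : Rp" for al
  proof -
    have aR: "al : R" using Rp_R a .
    let ?S = "\<Sum>j\<in>between (icoeff \<nu> al). E (\<nu> - (2 * of_int j) *\<^sub>R al) x"
    have "cotd al (ddir al (E \<nu>)) x = \<i> * of_real (\<nu> \<bullet> al) * cotd al (E \<nu>) x"
      unfolding dd cotd_def by (simp add: algebra_simps)
    then have "- ((1/2) * (of_real (m al) * cotd al (ddir al (E \<nu>)) x)) = (1/2) * of_real (m al * (\<nu> \<bullet> al)) * (- \<i> * cotd al (E \<nu>) x)"
      by simp
    also have "... = (1/2) * of_real (m al * (\<nu> \<bullet> al)) * (of_real (sgn (\<nu> \<bullet> al)) * (E \<nu> x + E (refl_root al \<nu>) x + 2 * ?S))"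
      unfolding cotd_E[OF x aR n] icoeff_sgn[OF n aR, symmetric] by simp
    also have "... = of_real (m al * ((\<nu> \<bullet> al) * sgn (\<nu> \<bullet> al))) * ((1/2) * E \<nu> x + (1/2) * E (refl_root al \<nu>) x + ?S)"
      by (simp add: algebra_simps)
    also have "(\<nu> \<bullet> al) * sgn (\<nu> \<bullet> al) = \<bar>\<nu> \<bullet> al\<bar>" by (simp add: abs_sgn)
    finally show ?thesis .
  qed
  have "- ((1 / 2) * (\<Sum>al\<in>Rp. of_real (m al) * cotd al (ddir al (E \<nu>)) x)) = (\<Sum>al\<in>Rp. - ((1/2) * (of_real (m al) * cotd al (ddir al (E \<nu>)) x)))"
    by (simp add: sum_distrib_left sum_negf)
  also have "... = (\<Sum>al\<in>Rp. of_real (m al * \<bar>\<nu> \<bullet> al\<bar>) *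
    ((1/2) * E \<nu> x + (1/2) * E (refl_root al \<nu>) x + (\<Sum>j\<in>between (icoeff \<nu> al). E (\<nu> - (2 * of_int j) *\<^sub>R al) x)))"
    by (rule sum.cong[OF refl]) (rule 2)
  finally have 3: "- ((1 / 2) * (\<Sum>al\<in>Rp. of_real (m al) * cotd al (ddir al (E \<nu>)) x)) = ..." .
  have "Lop (E \<nu>) x = - (\<Sum>b\<in>Basis. ddir b (ddir b (E \<nu>)) x) + - ((1 / 2) * (\<Sum>al\<in>Rp. of_real (m al) * cotd al (ddir al (E \<nu>)) x))"
    unfolding Lop_def by simp
  then show ?thesis unfolding 1 3 .
qed

lemma abs_sum_weyl:
  assumes w: "w : W"
  shows "(\<Sum>a\<in>Rp. m a * \<bar>w x \<bullet> a\<bar>) = (\<Sum>a\<in>Rp. m a * \<bar>x \<bullet> a\<bar>)"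
proof -
  define f where "f y a = (if a : R then m a * \<bar>y \<bullet> a\<bar> else 0)" for y a
  have fn: "f y (- a) = f y a" for y a using neg_R[of a] neg_R[of "- a"] m_neg[of a] by (auto simp: f_def)
  have eq: "(\<Sum>a\<in>R. f y a) = 2 * (\<Sum>a\<in>Rp. m a * \<bar>y \<bullet> a\<bar>)" for y
  proof -
    have "(\<Sum>a\<in>Rp. f y a) = (\<Sum>a\<in>Rp. m a * \<bar>y \<bullet> a\<bar>)" using Rp_R by (intro sum.cong) (auto simp: f_def)
    then show ?thesis using sum_R[of "f y", OF fn] by simp
  qed
  have iw: "inv w : W" using weyl_inv w .
  have "(\<Sum>a\<in>R. f (w x) a) = (\<Sum>a\<in>R. f x (inv w a))"
    by (intro sum.cong refl) (simp add: f_def weyl_R[OF iw] m_weyl[OF iw] weyl_inner_inv[OF w])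
  also have "... = (\<Sum>a\<in>R. f x a)" by (rule sum.reindex_bij_betw[OF weyl_bij_R[OF iw]])
  finally show ?thesis by (simp add: eq)
qed

lemma rho_inner: "2 * (x \<bullet> rho Rp m) = (\<Sum>a\<in>Rp. m a * (x \<bullet> a))"
  by (simp add: rho_def inner_sum_right)

text \<open>On the orbit of xi0 the pairing with rho is largest at xi0: 2 (x . rho) <= sum m |x .
  b|, the right side is Weyl invariant, and equality holds at xi0. Comparing xi0 with its reflection
  in al gives the sign.\<close>

lemma rho_dominant: assumes a: "al : Rp" shows "rho Rp m \<bullet> al \<ge> 0"
proof -
  have w: "refl_root al : W" using weyl_refl Rp_R a by blast
  have p: "al \<bullet> xi0 > 0" using a by (simp add: Rp_iff)
  have "2 * (refl_root al xi0 \<bullet> rho Rp m) \<le> (\<Sum>b\<in>Rp. m b * \<bar>refl_root al xi0 \<bullet> b\<bar>)"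
    unfolding rho_inner using m_nonneg Rp_R by (intro sum_mono mult_left_mono) auto
  also have "... = (\<Sum>b\<in>Rp. m b * \<bar>xi0 \<bullet> b\<bar>)" by (rule abs_sum_weyl[OF w])
  also have "... = 2 * (xi0 \<bullet> rho Rp m)"
    unfolding rho_inner by (intro sum.cong) (auto simp: Rp_iff inner_commute)
  finally have "(2 * (xi0 \<bullet> al) / (al \<bullet> al)) * (al \<bullet> rho Rp m) \<ge> 0"
    by (simp add: refl_root_def inner_diff_left)
  moreover have "2 * (xi0 \<bullet> al) / (al \<bullet> al) > 0" using p Rp_nonzero[OF a] by (simp add: inner_commute)
  ultimately have "al \<bullet> rho Rp m \<ge> 0" by (metis zero_le_mult_iff not_less)
  then show ?thesis by (simp add: inner_commute)
qed

lemma theta_eq: "eig \<mu> = \<mu> \<bullet> \<mu> + 2 * (\<mu> \<bullet> rho Rp m)"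
  by (simp add: theta_def inner_add_right)

lemma theta_less:
  assumes "k : low lam" "lam : Dom" "k ~= lam"
  shows "eig k < eig lam"
proof -
  have "k \<bullet> k < lam \<bullet> lam" using lower_norm(2)[OF assms] by (simp add: norm_eq_sqrt_inner)
  moreover have "rho Rp m \<bullet> (lam - k) \<ge> 0"
    using inner_prec[of k lam "rho Rp m"] rho_dominant assms by (auto simp: lower_set_def)
  ultimately show ?thesis unfolding theta_eq by (simp add: inner_diff_right inner_commute)
qed

lemma theta_ge: "lam : Dom ==> eig lam \<ge> (norm lam)^2"
proof -
  assume lam: "lam : Dom"
  have "(\<Sum>a\<in>Rp. m a * (lam \<bullet> a)) \<ge> 0"
    using lam m_nonneg Rp_R by (intro sum_nonneg mult_nonneg_nonneg) (auto simp: dominant_iff)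
  then show ?thesis unfolding theta_eq power2_norm_eq_inner rho_inner by simp
qed

text \<open>Tested against invariant functions, f behaves like a nonnegative combination of orbit
  sums strictly below mu. The weak form allows single exponentials, which are not invariant
  themselves.\<close>

definition pcomb :: "'a => ('a => complex) => bool" where
  "pcomb \<mu> f \<longleftrightarrow> f : tspan weights \<and> (\<exists>b. (\<forall>ka. 0 \<le> b ka) \<and> (\<forall>g. g : tspan weights --> winv g -->
     wip f g = (\<Sum>ka\<in>low \<mu> - {\<mu>}. of_real (b ka) * wip (M ka) g)))"

lemma pcomb_zero: "pcomb \<mu> (%x. 0)"
  unfolding pcomb_def using tspan_zero
  by (auto intro!: exI[of _ "%_. 0"] simp: wip_def wmean_def mean_def)

lemma pcomb_add: "pcomb \<mu> f ==> pcomb \<mu> g ==> pcomb \<mu> (%x. f x + g x)"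
proof -
  assume "pcomb \<mu> f" "pcomb \<mu> g"
  then obtain a b where fg: "f : tspan weights" "g : tspan weights"
    and a: "!!k. 0 \<le> a k" "!!h. h : tspan weights ==> winv h ==> wip f h = (\<Sum>k\<in>low \<mu> - {\<mu>}. of_real (a k) * wip (M k) h)"
    and b: "!!k. 0 \<le> b k" "!!h. h : tspan weights ==> winv h ==> wip g h = (\<Sum>k\<in>low \<mu> - {\<mu>}. of_real (b k) * wip (M k) h)"
    unfolding pcomb_def by blast
  have "wip (%x. f x + g x) h = (\<Sum>k\<in>low \<mu> - {\<mu>}. of_real (a k + b k) * wip (M k) h)" if "h : tspan weights" "winv h" for h
    using that by (subst wip_add) (auto intro: good_tspan fg simp: a(2) b(2) sum.distrib distrib_right)
  then show ?thesis unfolding pcomb_def using tspan_add[OF fg] a(1) b(1)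
    by (intro conjI exI[of _ "%k. a k + b k"]) auto
qed

lemma pcomb_scale: "pcomb \<mu> f ==> r \<ge> 0 ==> pcomb \<mu> (%x. of_real r * f x)"
proof -
  assume "pcomb \<mu> f" and r: "r \<ge> 0"
  then obtain a where f: "f : tspan weights"
    and a: "!!k. 0 \<le> a k" "!!h. h : tspan weights ==> winv h ==> wip f h = (\<Sum>k\<in>low \<mu> - {\<mu>}. of_real (a k) * wip (M k) h)"
    unfolding pcomb_def by blast
  have "wip (%x. of_real r * f x) h = (\<Sum>k\<in>low \<mu> - {\<mu>}. of_real (r * a k) * wip (M k) h)" if "h : tspan weights" "winv h" for h
    unfolding wip_scale a(2)[OF that] by (simp add: sum_distrib_left mult.assoc)
  then show ?thesis unfolding pcomb_def using tspan_scale[OF f] a(1) r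
    by (intro conjI exI[of _ "%k. r * a k"]) auto
qed

lemma pcomb_sum: "(!!i. i : I ==> pcomb \<mu> (f i)) ==> pcomb \<mu> (%x. \<Sum>i\<in>I. f i x)"
  by (induction I rule: infinite_finite_induct) (auto intro: pcomb_zero pcomb_add)

text \<open>An invariant function pairs equally with all exponentials of an orbit, hence with E nu
  as with the average of the orbit sum.\<close>

lemma pcomb_E:
  assumes mu: "\<mu> : Dom" and n: "\<nu> : Dlt \<mu>"
  shows "pcomb \<mu> (E \<nu>)"
proof -
  have nw: "\<nu> : weights" using n Dlt_weights by blast
  have "\<nu> : D \<mu>" using n by (simp add: Dlt_def)
  then obtain ka where k: "ka : low \<mu>" "\<nu> : orb ka" using D_rep by blast
  have ne: "ka ~= \<mu>" using k n by (auto simp: Dlt_def)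
  define b where "b \<tau> = (if \<tau> = ka then 1 / real (card (orb ka)) else 0)" for \<tau>
  have c: "real (card (orb ka)) > 0" using finite_orb orb_self by (auto simp: card_gt_0_iff)
  have "wip (E \<nu>) g = (\<Sum>\<tau>\<in>low \<mu> - {\<mu>}. of_real (b \<tau>) * wip (M \<tau>) g)" if g: "g : tspan weights" "winv g" for g
  proof -
    have "(\<Sum>\<tau>\<in>low \<mu> - {\<mu>}. of_real (b \<tau>) * wip (M \<tau>) g) = (\<Sum>\<tau>\<in>low \<mu> - {\<mu>}. if \<tau> = ka then of_real (b ka) * wip (M ka) g else 0)"
      by (intro sum.cong) (auto simp: b_def)
    also have "... = of_real (b ka) * wip (M ka) g" using k ne finite_lower[OF mu] by simp
    also have "... = wip (E ka) g"
      using c unfolding wip_M[OF g(2) good_tspan[OF g(1)]] by (simp add: b_def)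
    also have "... = wip (E \<nu>) g" using wip_E_orb[OF g(2) k(2)] by simp
    finally show ?thesis by simp
  qed
  then show ?thesis unfolding pcomb_def using tspan_E[OF nw] by (intro conjI exI[of _ b]) (auto simp: b_def)
qed

text \<open>Summed over the orbit, the ends of the root strings contribute sum m |nu . al| = 2 (mu .
  rho) to the eigenvalue, while their interior points give lower orbit sums with nonnegative
  coefficients.\<close>

lemma Lop_M:
  assumes mu: "\<mu> : Dom"
  shows "\<exists>b. (\<forall>k. 0 \<le> b k) \<and> (\<forall>g. g : tspan weights --> winv g -->
     wip (Lop (M \<mu>)) g = of_real (eig \<mu>) * wip (M \<mu>) g + (\<Sum>k\<in>low \<mu> - {\<mu>}. of_real (b k) * wip (M k) g))"
proof -
  have mw: "\<mu> : weights" using dominant_weights mu .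
  have ow: "\<nu> : weights" if "\<nu> : orb \<mu>" for \<nu> using orb_weights[OF mw] that by blast
  define S where "S \<nu> al x = (\<Sum>j\<in>between (icoeff \<nu> al). E (\<nu> - (2 * of_int j) *\<^sub>R al) x)" for \<nu> al x
  define rest where "rest x = (\<Sum>\<nu>\<in>orb \<mu>. \<Sum>al\<in>Rp. of_real (m al * \<bar>\<nu> \<bullet> al\<bar>) * S \<nu> al x)" for x
  have pr: "pcomb \<mu> rest"
    unfolding rest_def
  proof (intro pcomb_sum pcomb_scale)
    fix \<nu> al assume n: "\<nu> : orb \<mu>" and a: "al : Rp"
    show "pcomb \<mu> (S \<nu> al)" unfolding S_def
      using orb_D[OF mu] n by (intro pcomb_sum pcomb_E[OF mu] string_Dlt[OF mu _ Rp_R[OF a]]) auto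
    show "0 \<le> m al * \<bar>\<nu> \<bullet> al\<bar>" using m_nonneg Rp_R a by simp
  qed
  have reg: "Lop (M \<mu>) x = of_real (eig \<mu>) * M \<mu> x + rest x" if x: "regular x" for x
  proof -
    \<comment> \<open>The reflection permutes the orbit and preserves |nu . al|, so both half terms
      of \<open>Lop_E\<close> have the same sum.\<close>
    have sw: "(\<Sum>\<nu>\<in>orb \<mu>. of_real \<bar>\<nu> \<bullet> al\<bar> * E (refl_root al \<nu>) x) = (\<Sum>\<nu>\<in>orb \<mu>. of_real \<bar>\<nu> \<bullet> al\<bar> * E \<nu> x)" if a: "al : Rp" for al
    proof -
      have "\<bar>refl_root al \<nu> \<bullet> al\<bar> = \<bar>\<nu> \<bullet> al\<bar>" for \<nu>
        using inner_refl_root_neg[OF Rp_R[OF a], of \<nu>] by (simp add: inner_commute)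
      then have "(\<Sum>\<nu>\<in>orb \<mu>. of_real \<bar>\<nu> \<bullet> al\<bar> * E (refl_root al \<nu>) x) = (\<Sum>\<nu>\<in>orb \<mu>. of_real \<bar>refl_root al \<nu> \<bullet> al\<bar> * E (refl_root al \<nu>) x)"
        by simp
      also have "... = (\<Sum>\<nu>\<in>orb \<mu>. of_real \<bar>\<nu> \<bullet> al\<bar> * E \<nu> x)"
        by (rule sum.reindex_bij_betw[OF bij_betw_orb[OF weyl_refl[OF Rp_R[OF a]]], of "%\<nu>. of_real \<bar>\<nu> \<bullet> al\<bar> * E \<nu> x"])
      finally show ?thesis .
    qed
    have "(\<Sum>\<nu>\<in>orb \<mu>. \<Sum>al\<in>Rp. of_real (m al * \<bar>\<nu> \<bullet> al\<bar>) * ((1/2) * E \<nu> x + (1/2) * E (refl_root al \<nu>) x)) =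
        (\<Sum>al\<in>Rp. \<Sum>\<nu>\<in>orb \<mu>. of_real (m al * \<bar>\<nu> \<bullet> al\<bar>) * ((1/2) * E \<nu> x + (1/2) * E (refl_root al \<nu>) x))"
      by (rule sum.swap)
    also have "... = (\<Sum>al\<in>Rp. \<Sum>\<nu>\<in>orb \<mu>. of_real (m al * \<bar>\<nu> \<bullet> al\<bar>) * E \<nu> x)"
    proof (rule sum.cong[OF refl])
      fix al assume a: "al : Rp"
      have "(\<Sum>\<nu>\<in>orb \<mu>. of_real (m al * \<bar>\<nu> \<bullet> al\<bar>) * ((1/2) * E \<nu> x + (1/2) * E (refl_root al \<nu>) x)) =
          of_real (m al) / 2 * ((\<Sum>\<nu>\<in>orb \<mu>. of_real \<bar>\<nu> \<bullet> al\<bar> * E \<nu> x) + (\<Sum>\<nu>\<in>orb \<mu>. of_real \<bar>\<nu> \<bullet> al\<bar> * E (refl_root al \<nu>) x))"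
        unfolding sum.distrib[symmetric] sum_distrib_left by (intro sum.cong) (auto simp: algebra_simps)
      also have "... = of_real (m al) * (\<Sum>\<nu>\<in>orb \<mu>. of_real \<bar>\<nu> \<bullet> al\<bar> * E \<nu> x)" unfolding sw[OF a] by simp
      finally show "(\<Sum>\<nu>\<in>orb \<mu>. of_real (m al * \<bar>\<nu> \<bullet> al\<bar>) * ((1/2) * E \<nu> x + (1/2) * E (refl_root al \<nu>) x)) = (\<Sum>\<nu>\<in>orb \<mu>. of_real (m al * \<bar>\<nu> \<bullet> al\<bar>) * E \<nu> x)"
        by (simp add: sum_distrib_left mult.assoc)
    qed
    also have "... = (\<Sum>\<nu>\<in>orb \<mu>. of_real (\<Sum>al\<in>Rp. m al * \<bar>\<nu> \<bullet> al\<bar>) * E \<nu> x)"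
      by (subst sum.swap) (simp add: sum_distrib_right)
    also have "... = (\<Sum>\<nu>\<in>orb \<mu>. of_real (2 * (\<mu> \<bullet> rho Rp m)) * E \<nu> x)"
    proof (rule sum.cong[OF refl])
      fix \<nu> assume "\<nu> : orb \<mu>"
      then obtain w where w: "w : W" "\<nu> = w \<mu>" by auto
      have "(\<Sum>al\<in>Rp. m al * \<bar>\<nu> \<bullet> al\<bar>) = (\<Sum>al\<in>Rp. m al * \<bar>\<mu> \<bullet> al\<bar>)" unfolding w(2) by (rule abs_sum_weyl[OF w(1)])
      also have "... = 2 * (\<mu> \<bullet> rho Rp m)" unfolding rho_inner using mu by (intro sum.cong) (auto simp: dominant_iff)
      finally show "of_real (\<Sum>al\<in>Rp. m al * \<bar>\<nu> \<bullet> al\<bar>) * E \<nu> x = of_real (2 * (\<mu> \<bullet> rho Rp m)) * E \<nu> x" by simp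
    qed
    also have "... = of_real (2 * (\<mu> \<bullet> rho Rp m)) * M \<mu> x" by (simp add: M_def sum_distrib_left)
    finally have diag: "(\<Sum>\<nu>\<in>orb \<mu>. \<Sum>al\<in>Rp. of_real (m al * \<bar>\<nu> \<bullet> al\<bar>) * ((1/2) * E \<nu> x + (1/2) * E (refl_root al \<nu>) x)) = of_real (2 * (\<mu> \<bullet> rho Rp m)) * M \<mu> x" .
    have sq: "(\<Sum>\<nu>\<in>orb \<mu>. of_real (\<nu> \<bullet> \<nu>) * E \<nu> x) = of_real (\<mu> \<bullet> \<mu>) * M \<mu> x"
    proof -
      have "\<nu> \<bullet> \<nu> = \<mu> \<bullet> \<mu>" if "\<nu> : orb \<mu>" for \<nu> using that weyl_inner by auto
      then show ?thesis unfolding M_def sum_distrib_left by (intro sum.cong) auto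
    qed
    have "Lop (M \<mu>) x = Lop (%x. \<Sum>\<nu>\<in>orb \<mu>. 1 * E \<nu> x) x" by (simp add: M_def[abs_def])
    also have "... = (\<Sum>\<nu>\<in>orb \<mu>. 1 * Lop (E \<nu>) x)" by (rule Lop_sum) (rule tspan_E[OF ow])
    also have "... = (\<Sum>\<nu>\<in>orb \<mu>. of_real (\<nu> \<bullet> \<nu>) * E \<nu> x + ((\<Sum>al\<in>Rp. of_real (m al * \<bar>\<nu> \<bullet> al\<bar>) * ((1/2) * E \<nu> x + (1/2) * E (refl_root al \<nu>) x)) +
         (\<Sum>al\<in>Rp. of_real (m al * \<bar>\<nu> \<bullet> al\<bar>) * S \<nu> al x)))"
      by (rule sum.cong[OF refl])
         (simp only: Lop_E[OF x ow] S_def[symmetric] mult_1 sum.distrib[symmetric] distrib_left[symmetric])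
    also have "... = of_real (\<mu> \<bullet> \<mu>) * M \<mu> x + (of_real (2 * (\<mu> \<bullet> rho Rp m)) * M \<mu> x + rest x)"
      unfolding sum.distrib sq diag rest_def ..
    finally show ?thesis unfolding theta_eq by (simp add: algebra_simps)
  qed
  have rt: "rest : tspan weights" using pr by (simp add: pcomb_def)
  obtain b where b: "!!k. 0 \<le> b k" "!!g. g : tspan weights ==> winv g ==> wip rest g = (\<Sum>k\<in>low \<mu> - {\<mu>}. of_real (b k) * wip (M k) g)"
    using pr unfolding pcomb_def by blast
  have Mt: "M \<mu> : tspan weights" using M_tspan_weights mw .
  have "wip (Lop (M \<mu>)) g = of_real (eig \<mu>) * wip (M \<mu>) g + (\<Sum>k\<in>low \<mu> - {\<mu>}. of_real (b k) * wip (M k) g)"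
    if g: "g : tspan weights" "winv g" for g
  proof -
    have gd: "good (M \<mu>)" "good rest" "good g" using Mt rt g good_tspan by blast+
    have "wip (Lop (M \<mu>)) g = wip (%x. of_real (eig \<mu>) * M \<mu> x + rest x) g"
      using reg gd by (intro wip_cong good_Lop[OF Mt] good_add good_scale) auto
    also have "... = of_real (eig \<mu>) * wip (M \<mu>) g + wip rest g"
      using gd by (simp add: wip_add good_scale wip_scale)
    finally show ?thesis using b(2)[OF g] by simp
  qed
  then show ?thesis using b(1) by blast
qed


section \<open>Existence of the polynomials with nonnegative coefficients\<close>

lemma winv_lincomb: "(!!i. i : I ==> winv (f i)) ==> winv (%x. \<Sum>i\<in>I. c i * f i x)"
  by (auto simp: winv_def)

lemma lower_dominant: "k : low lam ==> k : Dom"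
  by (simp add: lower_set_def)

lemma lower_weights: "k : low lam ==> k : weights"
  using lower_dominant dominant_weights by blast

text \<open>The coefficients are taken from the triangular eigenvalue problem for
  \<open>Lop\<close>, where \<open>triangular_recursion\<close> shows them to be nonnegative; the
  orthogonality that defines the polynomials is then a consequence of symmetry.\<close>

lemma HO_exists:
  assumes lam: "lam : Dom"
  shows "\<exists>c::'a => real. c lam = 1 \<and> (\<forall>\<mu>. 0 \<le> c \<mu>) \<and> (\<forall>\<mu>. \<mu> \<notin> low lam --> c \<mu> = 0) \<and>
    (\<forall>\<mu>\<in>low lam - {lam}. wip (%x. \<Sum>ka\<in>low lam. of_real (c ka) * M ka x) (M \<mu>) = 0)"
proof -
  let ?A = "low lam" and ?\<theta> = "eig"
  have fin: "finite ?A" using finite_lower lam .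
  have lamA: "lam : ?A" using lower_self lam .
  have "\<forall>\<mu>\<in>Dom. \<exists>b. (\<forall>ka. 0 \<le> b ka) \<and> (\<forall>g. g : tspan weights --> winv g -->
     wip (Lop (M \<mu>)) g = of_real (?\<theta> \<mu>) * wip (M \<mu>) g + (\<Sum>ka\<in>low \<mu> - {\<mu>}. of_real (b ka) * wip (M ka) g))"
    using Lop_M by blast
  from bchoice[OF this] obtain bb where bb0: "\<forall>\<mu>\<in>Dom. (\<forall>ka. 0 \<le> bb \<mu> ka) \<and> (\<forall>g. g : tspan weights --> winv g -->
     wip (Lop (M \<mu>)) g = of_real (?\<theta> \<mu>) * wip (M \<mu>) g + (\<Sum>ka\<in>low \<mu> - {\<mu>}. of_real (bb \<mu> ka) * wip (M ka) g))"
    by (rule exE)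
  have bb: "!!\<mu> ka. \<mu> : Dom ==> 0 \<le> bb \<mu> ka"
    "!!\<mu> g. \<mu> : Dom ==> g : tspan weights ==> winv g ==>
     wip (Lop (M \<mu>)) g = of_real (?\<theta> \<mu>) * wip (M \<mu>) g + (\<Sum>ka\<in>low \<mu> - {\<mu>}. of_real (bb \<mu> ka) * wip (M ka) g)"
    using bspec[OF bb0] by simp_all
  define b where "b ka \<mu> = (if ka : Dom \<and> \<mu> : low ka - {ka} then bb ka \<mu> else 0)" for ka \<mu>
  have th: "?\<theta> \<mu> < ?\<theta> lam" if "\<mu> : ?A" "\<mu> ~= lam" for \<mu> using theta_less[OF that(1) lam that(2)] .
  have bnn: "0 \<le> b ka \<mu>" for ka \<mu> using bb(1) by (simp add: b_def)
  obtain c where c: "c lam = 1" "!!\<mu>. 0 \<le> c \<mu>"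
    "!!\<mu>. \<mu> : ?A - {lam} ==> (?\<theta> lam - ?\<theta> \<mu>) * c \<mu> = (\<Sum>ka\<in>{ka\<in>?A. ?\<theta> ka > ?\<theta> \<mu>}. c ka * b ka \<mu>)"
    using triangular_recursion[of ?A lam ?\<theta> b, OF fin lamA th bnn] by blast
  have eig: "?\<theta> \<mu> * c \<mu> + (\<Sum>ka\<in>?A. c ka * b ka \<mu>) = ?\<theta> lam * c \<mu>" if mu: "\<mu> : ?A" for \<mu>
  proof -
    have "(\<Sum>ka\<in>?A. c ka * b ka \<mu>) = (\<Sum>ka\<in>{ka\<in>?A. ?\<theta> ka > ?\<theta> \<mu>}. c ka * b ka \<mu>)"
      using fin theta_less by (intro sum.mono_neutral_right) (auto simp: b_def)
    also have "... = (?\<theta> lam - ?\<theta> \<mu>) * c \<mu>"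
    proof (cases "\<mu> = lam")
      case True
      have "{ka\<in>?A. ?\<theta> ka > ?\<theta> \<mu>} = {}" using th True by (metis (mono_tags, lifting) Collect_empty_eq order_less_asym)
      then show ?thesis using True by (metis cancel_comm_monoid_add_class.diff_cancel mult_zero_left sum.empty)
    qed (use c(3) mu in auto)
    finally show ?thesis by (simp add: algebra_simps)
  qed
  define P where "P x = (\<Sum>ka\<in>?A. of_real (c ka) * M ka x)" for x
  have Mt: "M ka : tspan weights" if "ka : ?A" for ka using M_tspan_weights lower_weights that by blast
  have Pt: "P : tspan weights" unfolding P_def by (rule tspan_sum) (rule tspan_scale[OF Mt])
  have Pw: "winv P" unfolding P_def by (rule winv_lincomb) (rule M_winv)
  \<comment> \<open>The eigenvalue equation is established only against invariant functions, the
    form in which \<open>Lop_M\<close> describes the operator.\<close>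
  have weak: "wip (Lop P) g = of_real (?\<theta> lam) * wip P g" if g: "g : tspan weights" "winv g" for g
  proof -
    define X where "X \<mu> = wip (M \<mu>) g" for \<mu>
    have gg: "good g" using good_tspan g by blast
    have LP: "Lop P = (%x. \<Sum>ka\<in>?A. of_real (c ka) * Lop (M ka) x)"
      unfolding P_def[abs_def] by (rule ext) (rule Lop_sum[OF Mt])
    have "wip (Lop P) g = (\<Sum>ka\<in>?A. wip (%x. of_real (c ka) * Lop (M ka) x) g)"
      unfolding LP by (rule wip_sum[OF good_scale[OF good_Lop[OF Mt]] gg])
    also have "... = (\<Sum>ka\<in>?A. of_real (c ka) * (of_real (?\<theta> ka) * X ka + (\<Sum>\<mu>\<in>?A. of_real (b ka \<mu>) * X \<mu>)))"
    proof (rule sum.cong[OF refl])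
      fix ka assume k: "ka : ?A"
      have kd: "ka : Dom" using lower_dominant k .
      have "(\<Sum>\<mu>\<in>low ka - {ka}. of_real (bb ka \<mu>) * X \<mu>) = (\<Sum>\<mu>\<in>?A. of_real (b ka \<mu>) * X \<mu>)"
        using fin lower_trans[OF _ k] kd by (intro sum.mono_neutral_cong_left) (auto simp: b_def)
      then show "wip (%x. of_real (c ka) * Lop (M ka) x) g = of_real (c ka) * (of_real (?\<theta> ka) * X ka + (\<Sum>\<mu>\<in>?A. of_real (b ka \<mu>) * X \<mu>))"
        unfolding wip_scale bb(2)[OF kd g] X_def by simp
    qed
    also have "... = (\<Sum>ka\<in>?A. of_real (?\<theta> ka * c ka) * X ka) + (\<Sum>ka\<in>?A. \<Sum>\<mu>\<in>?A. of_real (c ka * b ka \<mu>) * X \<mu>)"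
      unfolding sum.distrib[symmetric] by (intro sum.cong refl) (simp add: distrib_left sum_distrib_left mult_ac)
    also have "(\<Sum>ka\<in>?A. \<Sum>\<mu>\<in>?A. of_real (c ka * b ka \<mu>) * X \<mu>) = (\<Sum>\<mu>\<in>?A. of_real (\<Sum>ka\<in>?A. c ka * b ka \<mu>) * X \<mu>)"
      unfolding of_real_sum sum_distrib_right by (rule sum.swap)
    also have "(\<Sum>ka\<in>?A. of_real (?\<theta> ka * c ka) * X ka) + (\<Sum>\<mu>\<in>?A. of_real (\<Sum>ka\<in>?A. c ka * b ka \<mu>) * X \<mu>) =
        (\<Sum>\<mu>\<in>?A. of_real (?\<theta> \<mu> * c \<mu> + (\<Sum>ka\<in>?A. c ka * b ka \<mu>)) * X \<mu>)"
      unfolding sum.distrib[symmetric] of_real_add distrib_right ..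
    also have "... = (\<Sum>\<mu>\<in>?A. of_real (?\<theta> lam * c \<mu>) * X \<mu>)" using eig by (simp only: cong: sum.cong)
    also have "... = of_real (?\<theta> lam) * (\<Sum>\<mu>\<in>?A. of_real (c \<mu>) * X \<mu>)" by (simp add: sum_distrib_left mult.assoc)
    also have "(\<Sum>\<mu>\<in>?A. of_real (c \<mu>) * X \<mu>) = wip P g"
    proof -
      have "wip P g = (\<Sum>ka\<in>?A. wip (%x. of_real (c ka) * M ka x) g)"
        unfolding P_def[abs_def] by (rule wip_sum[OF good_scale[OF good_tspan[OF Mt]] gg])
      then show ?thesis unfolding wip_scale X_def by simp
    qed
    finally show ?thesis .
  qed
  \<comment> \<open>By induction the orbit sums below mu are already orthogonal to P, so M mu acts
    as an eigenvector against P. Symmetry leaves (theta lam - theta mu) wip P (M mu) = 0.\<close>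
  have orth: "wip P (M \<mu>) = 0" if "\<mu> : ?A - {lam}" for \<mu>
    using that
  proof (induction "card {ka\<in>?A. ?\<theta> ka < ?\<theta> \<mu>}" arbitrary: \<mu> rule: less_induct)
    case less
    have mu: "\<mu> : ?A" "\<mu> ~= lam" "\<mu> : Dom" using less.prems lower_dominant by auto
    have IH: "wip (M ka) P = 0" if k: "ka : low \<mu> - {\<mu>}" for ka
    proof -
      have lt: "?\<theta> ka < ?\<theta> \<mu>" using theta_less k mu by auto
      have kA: "ka : ?A" using lower_trans k mu by blast
      have "ka ~= lam" using lt th[OF mu(1,2)] by auto
      moreover have "card {\<tau>\<in>?A. ?\<theta> \<tau> < ?\<theta> ka} < card {\<tau>\<in>?A. ?\<theta> \<tau> < ?\<theta> \<mu>}"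
        using fin lt kA by (intro psubset_card_mono psubsetI) auto
      ultimately have "wip P (M ka) = 0" using less.hyps kA by blast
      then show ?thesis by (metis wip_cnj complex_cnj_zero)
    qed
    have Mm: "M \<mu> : tspan weights" "winv (M \<mu>)" using Mt mu M_winv by auto
    have "wip (Lop (M \<mu>)) P = of_real (?\<theta> \<mu>) * wip (M \<mu>) P"
      unfolding bb(2)[OF mu(3) Pt Pw] using IH by simp
    then have "cnj (wip (Lop (M \<mu>)) P) = of_real (?\<theta> \<mu>) * wip P (M \<mu>)" by (simp add: wip_cnj)
    then have "of_real (?\<theta> lam) * wip P (M \<mu>) = of_real (?\<theta> \<mu>) * wip P (M \<mu>)"
      using Lop_symmetric[OF Pt Pw Mm] weak[OF Mm] by simp
    then have "of_real (?\<theta> lam - ?\<theta> \<mu>) * wip P (M \<mu>) = 0" unfolding of_real_diff left_diff_distrib by simp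
    moreover have "?\<theta> lam - ?\<theta> \<mu> ~= 0" using th[OF mu(1,2)] by simp
    ultimately show ?case by (metis mult_eq_0_iff of_real_eq_0_iff)
  qed
  define c0 where "c0 \<mu> = (if \<mu> : ?A then c \<mu> else 0)" for \<mu>
  have "(%x. \<Sum>ka\<in>?A. of_real (c0 ka) * M ka x) = P" unfolding P_def c0_def by (intro ext sum.cong) auto
  then show ?thesis using c(1,2) lamA orth by (intro exI[of _ c0]) (auto simp: c0_def)
qed

section \<open>Nondegeneracy of the inner product and uniqueness of the coefficients\<close>

lemma wip_ip_m:
  assumes "winv f" "winv g"
  shows "wip f g = of_nat (card W) * ipm f g"
proof -
  have "f (w x) * cnj (g (w x)) * of_real (wt (w x)) = f x * cnj (g x) * of_real (wt x)" if "w : W" for w x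
    using assms weight_weyl that by (simp add: winv_def)
  then show ?thesis unfolding wip_def wmean_def mean_def ip_m_def by simp
qed

lemma card_W_pos: "card W > 0" using finite_W id_W by (auto simp: card_gt_0_iff)

lemma weight_pos: "regular x ==> wt x > 0"
  unfolding weight_def pow0_def cmod_exp_diff using regular_sin Rp_R by (intro prod_pos) auto

lemma AE_regular_weyl: "w : W ==> AE x in lebesgue. regular (w x)"
proof -
  assume "w : W"
  then obtain ws where ws: "set ws \<subseteq> affT" "aff.wprod ws = w" using weyl_word by blast
  show ?thesis
    using AE_completion[OF AE_regular] aff.wprod_regular[OF ws(1)] ws(2) unfolding regular_def by (auto elim!: eventually_mono)
qed

lemma wip_self_zero:
  assumes f: "good f" and 0: "wip f f = 0" and w: "w : W"
  shows "AE x in lebesgue. x : A0 --> f (w x) = 0"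
proof -
  define F where "F w x = indicator (A0) x *\<^sub>R ((cmod (f (w x)))^2 * wt (w x))" for w x
  have nn: "F w x \<ge> 0" for w x using weight_nonneg by (simp add: F_def)
  have "of_real (\<Sum>w\<in>W. integral\<^sup>L lebesgue (F w)) = (0::complex)"
    using 0 unfolding wip_self F_def set_lebesgue_integral_def .
  then have "(\<Sum>w\<in>W. integral\<^sup>L lebesgue (F w)) = 0" by (simp only: of_real_eq_0_iff)
  moreover have "integral\<^sup>L lebesgue (F w) \<ge> 0" for w using nn by (intro integral_nonneg_AE) auto
  ultimately have "integral\<^sup>L lebesgue (F w) = 0" using w finite_W by (simp add: sum_nonneg_eq_0_iff)
  moreover have "integrable lebesgue (F w)"
  proof -
    have "good (%x. f (w x) * cnj (f (w x)) * of_real (wt (w x)))"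
      using good_weyl[OF good_mult[OF good_prod[OF f f] good_weight] w] .
    then have "good (%x. of_real ((cmod (f (w x)))^2 * wt (w x)))"
      unfolding of_real_mult of_real_power complex_norm_square[symmetric] of_real_power by simp
    then have "set_integrable lebesgue (A0) (%x. complex_of_real ((cmod (f (w x)))^2 * wt (w x)))" by (rule good_integrable)
    then have "integrable lebesgue (%x. complex_of_real (F w x))"
      unfolding set_integrable_def F_def by (simp add: scaleR_conv_of_real)
    then show ?thesis by (simp only: complex_of_real_integrable_eq)
  qed
  ultimately have "AE x in lebesgue. F w x = 0" using nn by (simp add: integral_nonneg_eq_0_iff_AE)
  then show ?thesis using AE_regular_weyl[OF w]
  proof eventually_elim
    case (elim x)
    then show ?case using weight_pos[of "w x"] by (auto simp: F_def)
  qed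
qed

lemma mean_self_zero:
  assumes "good f" "wip f f = 0"
  shows "mean (%x. f x * g x) = 0"
  unfolding mean_def
proof (rule sum.neutral, rule ballI)
  fix w assume "w : W"
  from wip_self_zero[OF assms this]
  show "(LINT x:A0|lebesgue. f (w x) * g (w x)) = 0"
    unfolding set_lebesgue_integral_def by (intro integral_eq_zero_AE) (auto elim!: eventually_mono simp: indicator_def)
qed

lemma open_alcove_ball: "\<exists>r>0. \<forall>y\<in>ball pt0 r. \<forall>a\<in>Rp. 0 < a \<bullet> y \<and> a \<bullet> y < pi"
proof -
  have "open (\<Inter>a\<in>Rp. {y. 0 < a \<bullet> y} \<inter> {y. a \<bullet> y < pi})"
    using finite_Rp by (intro open_INT open_Int ballI open_Collect_less continuous_intros) auto
  moreover have "pt0 : (\<Inter>a\<in>Rp. {y. 0 < a \<bullet> y} \<inter> {y. a \<bullet> y < pi})" using p0 by auto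
  ultimately obtain r where "r > 0" "ball pt0 r \<subseteq> (\<Inter>a\<in>Rp. {y. 0 < a \<bullet> y} \<inter> {y. a \<bullet> y < pi})"
    unfolding open_contains_ball by blast
  then show ?thesis by (intro exI[of _ r]) auto
qed

lemma measure_alcove_pos: "measure lebesgue (A0) > 0"
proof -
  obtain r where r: "r > 0" "\<forall>y\<in>ball pt0 r. \<forall>a\<in>Rp. 0 < a \<bullet> y \<and> a \<bullet> y < pi" using open_alcove_ball by blast
  have "0 < measure lebesgue (ball pt0 r)" using content_ball_pos[OF r(1), of pt0] by simp
  also have "... \<le> measure lebesgue (A0)"
    using r by (intro measure_mono_fmeasurable lmeasurable_compact compact_alcove) (auto simp: alcove_def less_imp_le)
  finally show ?thesis .
qed

lemma mean_one: "mean (%x. 1) ~= 0"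
proof -
  have "mean (%x. 1) = of_nat (card W) * of_real (measure lebesgue (A0))"
    unfolding mean_def set_lebesgue_integral_def by (simp add: scaleR_conv_of_real)
  then show ?thesis using measure_alcove_pos card_W_pos by simp
qed

text \<open>Translation by a vector v with nu . v = pi multiplies E nu by -1 without changing the
  mean.\<close>

lemma mean_E: "\<nu> : weights ==> \<nu> ~= 0 ==> mean (E \<nu>) = 0"
proof -
  assume n: "\<nu> : weights" "\<nu> ~= 0"
  define v where "v = (pi / (\<nu> \<bullet> \<nu>)) *\<^sub>R \<nu>"
  have gE: "good (E \<nu>)" using good_tspan[OF tspan_E[OF n(1)]] .
  have "\<nu> \<bullet> v = pi" using n by (simp add: v_def)
  then have Ev: "E \<nu> v = -1" by (simp add: E_def)
  have "mean (E \<nu>) = mean (%x. E \<nu> (x + v))"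
    by (rule mean_translate[OF gE, symmetric]) (rule E_periodic[OF n(1)])
  also have "... = mean (%x. (-1) * E \<nu> x)" by (simp add: E_simps(5) Ev)
  also have "... = - mean (E \<nu>)" unfolding mean_scale by simp
  finally show ?thesis by simp
qed

lemma mean_M_E:
  assumes "\<mu> : Dom" "k : Dom"
  shows "mean (%x. M \<mu> x * E (- k) x) = (if \<mu> = k then mean (%x. 1) else 0)"
proof -
  have w: "\<nu> - k : weights" if "\<nu> : orb \<mu>" for \<nu>
    using orb_weights[OF dominant_weights[OF assms(1)]] dominant_weights[OF assms(2)] weights_arith(3) that by blast
  have "mean (%x. M \<mu> x * E (- k) x) = mean (%x. \<Sum>\<nu>\<in>orb \<mu>. E (\<nu> - k) x)"
    unfolding M_def sum_distrib_right E_simps(2) by simp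
  also have "... = (\<Sum>\<nu>\<in>orb \<mu>. mean (E (\<nu> - k)))" by (rule mean_sum[OF good_tspan[OF tspan_E[OF w]]])
  also have "... = (\<Sum>\<nu>\<in>orb \<mu>. if \<nu> = k then mean (%x. 1) else 0)"
  proof (rule sum.cong[OF refl])
    fix \<nu> assume n: "\<nu> : orb \<mu>"
    show "mean (E (\<nu> - k)) = (if \<nu> = k then mean (%x. 1) else 0)"
    proof (cases "\<nu> = k")
      case True
      then have "E (\<nu> - k) = (%x. 1)" by (simp add: fun_eq_iff E_simps(1))
      then show ?thesis using True by simp
    next
      case False
      then show ?thesis using mean_E[OF w[OF n]] by simp
    qed
  qed
  also have "... = (if k : orb \<mu> then mean (%x. 1) else 0)" using finite_orb by simp
  also have "k : orb \<mu> \<longleftrightarrow> \<mu> = k" using dominant_orb_eq[OF assms] orb_self[of \<mu>] by auto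
  finally show ?thesis .
qed

text \<open>The weight vanishes only on a null set, so a combination of norm zero vanishes almost
  everywhere on the Weyl images of the alcove. Its unweighted Fourier coefficients, which read off
  d, are then zero.\<close>

lemma M_independent:
  assumes fin: "finite A" "A \<subseteq> Dom" and 0: "wip (%x. \<Sum>\<mu>\<in>A. d \<mu> * M \<mu> x) (%x. \<Sum>\<mu>\<in>A. d \<mu> * M \<mu> x) = 0"
    and k: "ka : A"
  shows "d ka = 0"
proof -
  have Mg: "good (M \<mu>)" if "\<mu> : A" for \<mu> using good_tspan[OF M_tspan_weights] dominant_weights fin that by blast
  have g: "good (%x. \<Sum>\<mu>\<in>A. d \<mu> * M \<mu> x)" by (rule good_sum[OF good_scale[OF Mg]])
  have gE: "good (E (- ka))" using good_tspan[OF tspan_E[of _ UNIV]] by blast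
  have "0 = mean (%x. (\<Sum>\<mu>\<in>A. d \<mu> * M \<mu> x) * E (- ka) x)" by (rule mean_self_zero[OF g 0, symmetric])
  also have "... = mean (%x. \<Sum>\<mu>\<in>A. d \<mu> * (M \<mu> x * E (- ka) x))" by (simp add: sum_distrib_right mult.assoc)
  also have "... = (\<Sum>\<mu>\<in>A. mean (%x. d \<mu> * (M \<mu> x * E (- ka) x)))"
    by (rule mean_sum) (rule good_scale[OF good_mult[OF Mg gE]])
  also have "... = (\<Sum>\<mu>\<in>A. if \<mu> = ka then d ka * mean (%x. 1) else 0)"
  proof (rule sum.cong[OF refl])
    fix \<mu> assume "\<mu> : A"
    then have "\<mu> : Dom" "ka : Dom" using fin k by auto
    then show "mean (%x. d \<mu> * (M \<mu> x * E (- ka) x)) = (if \<mu> = ka then d ka * mean (%x. 1) else 0)"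
      unfolding mean_scale mean_M_E[OF \<open>\<mu> : Dom\<close> \<open>ka : Dom\<close>] by simp
  qed
  also have "... = d ka * mean (%x. 1)" using fin k by simp
  finally show ?thesis using mean_one by simp
qed

text \<open>A choice of the real coefficients from \<open>HO_exists\<close>;
  \<open>HO_coeffs_unique\<close> identifies them with the complex ones that define
  \<open>HO_P\<close>.\<close>

definition hc :: "'a => 'a => real" where
  "hc lam = (SOME c. c lam = 1 \<and> (\<forall>\<mu>. 0 \<le> c \<mu>) \<and> (\<forall>\<mu>. \<mu> \<notin> low lam --> c \<mu> = 0) \<and>
    (\<forall>\<mu>\<in>low lam - {lam}. wip (%x. \<Sum>ka\<in>low lam. of_real (c ka) * M ka x) (M \<mu>) = 0))"

definition P :: "'a => 'a => complex" where
  "P lam x = (\<Sum>ka\<in>low lam. of_real (hc lam ka) * M ka x)"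

lemma hc:
  assumes "lam : Dom"
  shows "hc lam lam = 1" "0 \<le> hc lam \<mu>" "\<mu> \<notin> low lam ==> hc lam \<mu> = 0"
    "\<mu> : low lam ==> \<mu> ~= lam ==> wip (P lam) (M \<mu>) = 0"
proof -
  have *: "hc lam lam = 1 \<and> (\<forall>\<mu>. 0 \<le> hc lam \<mu>) \<and> (\<forall>\<mu>. \<mu> \<notin> low lam --> hc lam \<mu> = 0) \<and>
    (\<forall>\<mu>\<in>low lam - {lam}. wip (%x. \<Sum>k\<in>low lam. of_real (hc lam k) * M k x) (M \<mu>) = 0)"
    unfolding hc_def by (rule someI_ex[OF HO_exists[OF assms]])
  show "hc lam lam = 1" using * by (rule conjunct1)
  show "0 \<le> hc lam \<mu>" using * by blast
  show "\<mu> \<notin> low lam ==> hc lam \<mu> = 0" using * by blast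
  have P_eq: "P lam = (%x. \<Sum>k\<in>low lam. of_real (hc lam k) * M k x)" by (rule ext) (rule P_def)
  show "\<mu> : low lam ==> \<mu> ~= lam ==> wip (P lam) (M \<mu>) = 0" unfolding P_eq using * by blast
qed

lemma P_winv: "winv (P lam)"
  unfolding P_def[abs_def] by (rule winv_lincomb) (rule M_winv)

lemma P_tspan_D: "P lam : tspan (D lam)"
  unfolding P_def[abs_def]
proof (rule tspan_sum, rule tspan_scale)
  fix k assume "k : low lam"
  then have "orb k \<subseteq> D lam" using lower_D D_weyl by blast
  then show "M k : tspan (D lam)" using tspan_mono M_tspan by blast
qed

lemma P_tspan: "P lam : tspan weights"
  using tspan_mono[OF D_weights P_tspan_D] .

text \<open>As P lam is invariant, orthogonality to an orbit sum gives orthogonality to each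
  exponential of that orbit. \<open>dominant_orthogonal\<close> needs this form because its
  operators leave the space of invariant functions.\<close>

lemma P_orth_Dlt:
  assumes lam: "lam : Dom" and h: "h : tspan (Dlt lam)"
  shows "wip (P lam) h = 0"
  using h
proof induction
  case tspan_zero
  then show ?case by (simp add: wip_def wmean_def mean_def)
next
  case (tspan_step f n c)
  have gP: "good (P lam)" using good_tspan[OF P_tspan] .
  have "n : D lam" "n \<notin> orb lam" using tspan_step by (auto simp: Dlt_def)
  then obtain ka where k: "ka : low lam" "n : orb ka" using D_rep by blast
  have "ka ~= lam" using k \<open>n \<notin> orb lam\<close> by blast
  then have "wip (P lam) (M ka) = 0" using hc(4)[OF lam k(1)] by blast
  then have "wip (M ka) (P lam) = 0" by (metis wip_cnj complex_cnj_zero)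
  then have "of_nat (card (orb ka)) * wip (E ka) (P lam) = 0" using wip_M[OF P_winv gP] by metis
  moreover have "card (orb ka) ~= 0" using finite_orb orb_self by (metis card_0_eq empty_iff)
  ultimately have "wip (E ka) (P lam) = 0" by (metis mult_eq_0_iff of_nat_eq_0_iff)
  then have "wip (E n) (P lam) = 0" using wip_E_orb[OF P_winv k(2)] by metis
  then have n0: "wip (P lam) (E n) = 0" by (metis wip_cnj complex_cnj_zero)
  have gE: "good (E n)" "good f" using good_tspan tspan_E[of n UNIV] tspan_step.hyps(1) by blast+
  show ?case unfolding wip_add_right[OF gE(2) good_scale[OF gE(1)] gP] wip_scale_right using tspan_step.IH n0 by simp
qed

theorem P_orthogonal:
  assumes "lam : Dom" "\<mu> : Dom" "lam ~= \<mu>"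
  shows "wip (P lam) (P \<mu>) = 0"
  by (rule dominant_orthogonal[OF assms(1) P_tspan_D P_orth_Dlt[OF assms(1)] assms(2) P_tspan_D P_orth_Dlt[OF assms(2)] assms(3)])

text \<open>The difference of two solutions has coefficient 0 at lam and is orthogonal to all other
  orbit sums that occur in it, hence to itself; \<open>M_independent\<close> finishes.\<close>

lemma HO_coeffs_unique:
  assumes lam: "lam : Dom"
  shows "HO_coeffs R Rp m lam c \<longleftrightarrow> c = (%n. of_real (hc lam n))"
proof -
  let ?A = "low lam"
  have fin: "finite ?A" using finite_lower lam .
  have gM: "good (M \<mu>)" if "\<mu> : ?A" for \<mu> using good_tspan[OF M_tspan_weights[OF lower_weights[OF that]]] .
  have ip: "ipm (%x. \<Sum>n\<in>?A. c n * orbit_sum R n (x, 0)) (%x. orbit_sum R \<mu> (x, 0)) = 0 \<longleftrightarrow>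
      wip (%x. \<Sum>n\<in>?A. c n * M n x) (M \<mu>) = 0" for c \<mu>
  proof -
    have "winv (%x. \<Sum>n\<in>?A. c n * M n x)" by (rule winv_lincomb) (rule M_winv)
    then show ?thesis unfolding orbit_sum_M using wip_ip_m[of "%x. \<Sum>n\<in>?A. c n * M n x" "M \<mu>"] M_winv card_W_pos by simp
  qed
  have ex: "HO_coeffs R Rp m lam (%n. of_real (hc lam n))"
    unfolding HO_coeffs_def ip using hc[OF lam] by (auto simp: P_def[abs_def])
  have "c = (%n. of_real (hc lam n))" if c: "HO_coeffs R Rp m lam c" for c
  proof -
    define d where "d n = c n - of_real (hc lam n)" for n
    define F where "F e x = (\<Sum>n\<in>?A. e n * M n x)" for e x
    have gF: "good (F e)" for e unfolding F_def by (rule good_sum[OF good_scale[OF gM]])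
    have orth: "wip (F c) (M \<mu>) = 0" "wip (F (%n. of_real (hc lam n))) (M \<mu>) = 0" if "\<mu> : ?A" "\<mu> ~= lam" for \<mu>
      using c ex that unfolding HO_coeffs_def ip F_def[abs_def] by blast+
    have Fd: "F d = (%x. F c x - F (%n. of_real (hc lam n)) x)"
      unfolding F_def d_def by (simp add: left_diff_distrib sum_subtractf)
    have "d lam = 0" using c hc(1)[OF lam] by (simp add: d_def HO_coeffs_def)
    have dM: "cnj (d \<mu>) * wip (F d) (M \<mu>) = 0" if "\<mu> : ?A" for \<mu>
    proof (cases "\<mu> = lam")
      case False
      then have "wip (F d) (M \<mu>) = 0" unfolding Fd wip_diff[OF gF gF gM[OF that]] using orth that by simp
      then show ?thesis by simp
    qed (simp add: \<open>d lam = 0\<close>)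
    have "wip (F d) (F d) = (\<Sum>\<mu>\<in>?A. wip (F d) (%x. d \<mu> * M \<mu> x))"
      unfolding F_def[of d, abs_def] by (rule wip_sum_right[OF good_scale[OF gM] gF[of d, unfolded F_def]])
    also have "... = 0" unfolding wip_scale_right by (rule sum.neutral, rule ballI, rule dM)
    finally have z: "wip (F d) (F d) = 0" .
    have "d n = 0" for n
    proof (cases "n : ?A")
      case True
      then show ?thesis using M_independent[OF fin _ z[unfolded F_def[abs_def]]] lower_dominant by blast
    next
      case False
      then show ?thesis using c hc(3)[OF lam False] by (simp add: d_def HO_coeffs_def)
    qed
    then show ?thesis by (auto simp: d_def fun_eq_iff)
  qed
  then show ?thesis using ex by blast
qed

lemma HO_P_eq:
  assumes lam: "lam : Dom"
  shows "HO_P R Rp m lam z = (\<Sum>n\<in>low lam. of_real (hc lam n) * orbit_sum R n z)"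
proof -
  have "(THE c. HO_coeffs R Rp m lam c) = (%n. of_real (hc lam n))"
    unfolding HO_coeffs_unique[OF lam] by (rule the_eq_trivial)
  then show ?thesis unfolding HO_P_def by simp
qed

lemma HO_P_real: "lam : Dom ==> HO_P R Rp m lam (x, 0) = P lam x"
  by (simp add: HO_P_eq P_def orbit_sum_M)

end

section \<open>Entire extensions and growth of the normalized polynomials\<close>

lemma summable_on_norm_bound:
  fixes f :: "'i => 'b::banach"
  assumes "g summable_on I" "!!i. i : I ==> norm (f i) \<le> g i"
  shows "f summable_on I" "norm (infsum f I) \<le> infsum g I"
proof -
  have "(%i. norm (f i)) summable_on I" by (rule summable_on_comparison_test[OF assms(1)]) (use assms(2) in auto)
  then show s: "f summable_on I" by (rule abs_summable_summable)
  show "norm (infsum f I) \<le> infsum g I"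
    by (rule norm_infsum_le[OF has_sum_infsum[OF s] has_sum_infsum[OF assms(1)] assms(2)])
qed

lemma summable_on_infsum_diff:
  fixes f g :: "'i => 'b::real_normed_vector"
  assumes "f summable_on I" "g summable_on I"
  shows "(%i. f i - g i) summable_on I" "infsum (%i. f i - g i) I = infsum f I - infsum g I"
proof -
  have "(%i. - g i) summable_on I" using assms(2) by (simp add: summable_on_uminus)
  then show "(%i. f i - g i) summable_on I" "infsum (%i. f i - g i) I = infsum f I - infsum g I"
    using summable_on_add[OF assms(1), of "%i. - g i"] infsum_add[OF assms(1), of "%i. - g i"] by (simp_all add: infsum_uminus)
qed

lemma norm_exp_minus_linear: "norm (exp w - 1 - w) \<le> (norm w)^2 * exp (norm w)" for w :: complex
proof -
  have "norm (exp w - (\<Sum>k\<le>1. w ^ k / fact k)) \<le> exp \<bar>Re w\<bar> * (norm w) ^ Suc 1 / fact 1" by (rule Taylor_exp)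
  also have "(\<Sum>k\<le>1. w ^ k / fact k) = 1 + w" by simp
  also have "exp \<bar>Re w\<bar> * (norm w) ^ Suc 1 / fact 1 \<le> exp (norm w) * (norm w)^2"
    using abs_Re_le_cmod[of w] by (simp add: power2_eq_square mult_right_mono)
  finally show ?thesis by (simp add: algebra_simps)
qed

text \<open>Here n i bounds the exponential type of \<open>\<phi> i\<close>. The second order
  remainders of the terms add up to a multiple of |h|^2 for |h| <= 1, so the series may be
  differentiated term by term.\<close>

lemma holomorphic_C_series:
  fixes \<phi> :: "'i => 'a::euclidean_space \<times> 'a => complex" and a :: "'i => complex" and n :: "'i => real"
  assumes nn: "!!i. i : I ==> 0 \<le> n i" and sm: "!!c. (%i. norm (a i) * exp (c * n i)) summable_on I"
    and bd: "!!i z. i : I ==> norm (\<phi> i z) \<le> exp (n i * norm z)"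
    and df: "!!i z. i : I ==> \<exists>D. linear D \<and> (\<forall>u v. D (- v, u) = \<i> * D (u, v)) \<and>
      (\<forall>h. norm (D h) \<le> n i * exp (n i * norm z) * norm h) \<and>
      (\<forall>h. norm (\<phi> i (z + h) - \<phi> i z - D h) \<le> exp (n i * norm z) * (n i * norm h)^2 * exp (n i * norm h))"
  shows "holomorphic_C (%z. \<Sum>\<^sub>\<infinity>i\<in>I. a i * \<phi> i z)"
  unfolding holomorphic_C_def
proof
  fix z :: "'a \<times> 'a"
  let ?F = "%z. \<Sum>\<^sub>\<infinity>i\<in>I. a i * \<phi> i z"
  have "\<forall>i\<in>I. \<exists>D. linear D \<and> (\<forall>u v. D (- v, u) = \<i> * D (u, v)) \<and>
      (\<forall>h. norm (D h) \<le> n i * exp (n i * norm z) * norm h) \<and>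
      (\<forall>h. norm (\<phi> i (z + h) - \<phi> i z - D h) \<le> exp (n i * norm z) * (n i * norm h)^2 * exp (n i * norm h))"
    using df by blast
  from bchoice[OF this] obtain d where d: "!!i. i : I ==> linear (d i)"
      "!!i u v. i : I ==> d i (- v, u) = \<i> * d i (u, v)"
      "!!i h. i : I ==> norm (d i h) \<le> n i * exp (n i * norm z) * norm h"
      "!!i h. i : I ==> norm (\<phi> i (z + h) - \<phi> i z - d i h) \<le> exp (n i * norm z) * (n i * norm h)^2 * exp (n i * norm h)"
    by blast
  define D where "D h = (\<Sum>\<^sub>\<infinity>i\<in>I. a i * d i h)" for h
  \<comment> \<open>The summand 2 pays for two factors exp (n i): one from (n i)^2 <= 2 exp (n i),
    one from exp (n i * norm h) with norm h <= 1.\<close>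
  define B where "B i = norm (a i) * exp ((norm z + 2) * n i)" for i
  have smB: "B summable_on I" unfolding B_def by (rule sm)
  have nexp: "n i \<le> exp (n i)" "(n i)^2 \<le> 2 * exp (n i)" if "i : I" for i
    using power_le_fact_exp[OF nn[OF that], of 1] power_le_fact_exp[OF nn[OF that], of 2] by auto
  have F: "(%i. a i * \<phi> i y) summable_on I" for y
    by (rule summable_on_norm_bound(1)[OF sm[of "norm y"]]) (unfold norm_mult mult.commute[of "norm y"], intro mult_left_mono bd norm_ge_zero)
  have db: "norm (a i * d i h) \<le> B i * norm h" if i: "i : I" for i h
  proof -
    have "norm (d i h) \<le> exp (n i) * exp (n i * norm z) * norm h"
      by (rule order_trans[OF d(3)[OF i]]) (intro mult_right_mono nexp(1)[OF i], auto)
    also have "... \<le> exp ((norm z + 2) * n i) * norm h"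
      unfolding exp_add[symmetric] using nn[OF i] by (intro mult_right_mono) (auto simp: algebra_simps)
    finally show ?thesis unfolding B_def norm_mult mult.assoc by (intro mult_left_mono) auto
  qed
  have Ds: "(%i. a i * d i h) summable_on I" for h
    by (rule summable_on_norm_bound(1)[OF summable_on_cmult_left[OF smB] db])
  have Db: "norm (D h) \<le> norm h * infsum B I" for h
    unfolding D_def using summable_on_norm_bound(2)[OF summable_on_cmult_left[OF smB] db, of h]
    by (simp add: infsum_cmult_left' mult.commute)
  have bl: "bounded_linear D"
  proof (rule bounded_linear_intro[of _ "infsum B I"])
    fix h k :: "'a \<times> 'a" and r :: real
    have "D (h + k) = (\<Sum>\<^sub>\<infinity>i\<in>I. a i * d i h + a i * d i k)"
      unfolding D_def by (rule infsum_cong) (simp add: linear_add[OF d(1)] distrib_left)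
    then show "D (h + k) = D h + D k" unfolding infsum_add[OF Ds Ds] D_def .
    have "D (r *\<^sub>R h) = (\<Sum>\<^sub>\<infinity>i\<in>I. of_real r * (a i * d i h))"
      unfolding D_def by (rule infsum_cong) (simp add: linear_scale[OF d(1)] scaleR_conv_of_real)
    then show "D (r *\<^sub>R h) = r *\<^sub>R D h" unfolding infsum_cmult_right' D_def scaleR_conv_of_real .
  qed (rule Db)
  have rem: "norm (?F (z + h) - ?F z - D h) \<le> (norm h)^2 * (2 * infsum B I)" if h: "norm h \<le> 1" for h
  proof -
    have dF: "(%i. a i * \<phi> i (z + h) - a i * \<phi> i z) summable_on I" by (rule summable_on_infsum_diff(1)[OF F F])
    have eq: "?F (z + h) - ?F z - D h = (\<Sum>\<^sub>\<infinity>i\<in>I. a i * \<phi> i (z + h) - a i * \<phi> i z - a i * d i h)"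
      unfolding summable_on_infsum_diff(2)[OF dF Ds] summable_on_infsum_diff(2)[OF F F] D_def ..
    have le: "norm (a i * \<phi> i (z + h) - a i * \<phi> i z - a i * d i h) \<le> B i * (2 * (norm h)^2)" if i: "i : I" for i
    proof -
      have "norm (\<phi> i (z + h) - \<phi> i z - d i h) \<le> exp (n i * norm z) * ((n i)^2 * (norm h)^2) * exp (n i * norm h)"
        using d(4)[OF i, of h] by (simp add: power_mult_distrib)
      also have "... \<le> exp (n i * norm z) * ((2 * exp (n i)) * (norm h)^2) * exp (n i)"
        using h nn[OF i] nexp(2)[OF i] by (intro mult_mono) (auto simp: mult_left_le intro!: mult_nonneg_nonneg mult_right_mono)
      also have "... = exp ((norm z + 2) * n i) * (2 * (norm h)^2)"
      proof -
        have "exp ((norm z + 2) * n i) = exp (n i * norm z) * exp (n i) * exp (n i)"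
          unfolding exp_add[symmetric] by (simp add: algebra_simps)
        then show ?thesis by simp
      qed
      finally have "norm (a i) * norm (\<phi> i (z + h) - \<phi> i z - d i h) \<le> norm (a i) * (exp ((norm z + 2) * n i) * (2 * (norm h)^2))"
        by (intro mult_left_mono) auto
      then show ?thesis unfolding norm_mult[symmetric] B_def by (simp add: algebra_simps)
    qed
    show ?thesis unfolding eq
      using summable_on_norm_bound(2)[OF summable_on_cmult_left[OF smB] le]
      by (simp add: infsum_cmult_left' mult_ac)
  qed
  have "(?F has_derivative D) (at z)"
    unfolding has_derivative_at
  proof (intro conjI bl)
    have "eventually (%h::'a \<times> 'a. norm h \<le> 1 \<and> h ~= 0) (at 0)"
      unfolding eventually_at by (intro exI[of _ 1]) (auto simp: dist_norm)
    then have "eventually (%h. norm (norm (?F (z + h) - ?F z - D h) / norm h) \<le> norm h * (2 * infsum B I)) (at 0)"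
    proof eventually_elim
      case (elim h)
      then show ?case using rem[of h] by (simp add: divide_le_eq power2_eq_square algebra_simps)
    qed
    then show "((%h. norm (?F (z + h) - ?F z - D h) / norm h) \<longlongrightarrow> 0) (at 0)"
      by (rule tendsto_0_le[rotated]) (rule tendsto_ident_at)
  qed
  moreover have "D (- v, u) = \<i> * D (u, v)" for u v
  proof -
    have "D (- v, u) = (\<Sum>\<^sub>\<infinity>i\<in>I. \<i> * (a i * d i (u, v)))" unfolding D_def by (rule infsum_cong) (simp add: d(2))
    then show ?thesis unfolding infsum_cmult_right' D_def .
  qed
  ultimately show "\<exists>D. (?F has_derivative D) (at z) \<and> (\<forall>u v. D (- v, u) = \<i> * D (u, v))" by blast
qed

lemma norm_cinner_le: "norm (cinner k h) \<le> norm k * norm h"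
proof -
  have "(norm (cinner k h))^2 = (k \<bullet> fst h)^2 + (k \<bullet> snd h)^2" by (simp add: cinner_def cmod_power2)
  also have "... \<le> (norm k * norm (fst h))^2 + (norm k * norm (snd h))^2"
    by (intro add_mono) (metis Cauchy_Schwarz_ineq2 abs_ge_zero power2_abs power_mono)+
  also have "... = (norm k * norm h)^2"
    by (simp add: norm_prod_def power_mult_distrib distrib_left)
  finally show ?thesis by (rule power2_le_imp_le) simp
qed

lemma linear_cinner: "linear (cinner k)"
  by (rule linearI) (auto simp: cinner_def complex_eq_iff inner_add_right)

lemma norm_exp_cinner: "norm (exp (\<i> * cinner k z)) = exp (- (k \<bullet> snd z))"
  by (simp add: cinner_def norm_exp_eq_Re)

context heckman_opdam
begin

abbreviation phi :: "'a => 'a \<times> 'a => complex" where "phi lam \<equiv> HO_R R Rp m lam"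
abbreviation "rphi lam x \<equiv> phi lam (x, 0)"

lemma orbit_sum_zero: "orbit_sum R n (0, 0) = of_nat (card (orb n))"
  by (simp add: orbit_sum_def cinner_def complex_of_real_def[symmetric] zero_complex.code[symmetric])

lemma HO_P_zero:
  assumes lam: "lam : Dom"
  shows "\<exists>p>0. HO_P R Rp m lam (0, 0) = of_real p \<and> p = (\<Sum>n\<in>low lam. hc lam n * real (card (orb n)))"
proof -
  let ?p = "\<Sum>n\<in>low lam. hc lam n * real (card (orb n))"
  have "0 < real (card (orb lam))" using finite_orb orb_self by (metis card_gt_0_iff empty_iff of_nat_0_less_iff)
  also have "... = hc lam lam * real (card (orb lam))" using hc(1)[OF lam] by simp
  also have "... \<le> ?p" using lower_self lam finite_lower hc(2)[OF lam] by (intro member_le_sum[of lam "low lam"]) auto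
  finally have "0 < ?p" .
  moreover have "HO_P R Rp m lam (0, 0) = of_real ?p" by (simp add: HO_P_eq[OF lam] orbit_sum_zero)
  ultimately show ?thesis by blast
qed

text \<open>Nonnegativity of the coefficients makes the normalized polynomials averages of exponentials
  with frequencies of length at most that of the highest weight.\<close>
lemma phi_average:
  assumes lam: "lam : Dom"
  obtains S :: "('a \<times> 'a) set" and q :: "'a \<times> 'a => real" where "finite S" "\<forall>i\<in>S. 0 \<le> q i" "sum q S = 1"
    "\<forall>i\<in>S. norm (snd i) \<le> norm lam"
    "\<forall>z. phi lam z = (\<Sum>i\<in>S. of_real (q i) * exp (\<i> * cinner (snd i) z))"
proof -
  obtain p where p: "p > 0" "HO_P R Rp m lam (0, 0) = of_real p" "p = (\<Sum>n\<in>low lam. hc lam n * real (card (orb n)))"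
    using HO_P_zero[OF lam] by blast
  let ?S = "Sigma (low lam) (%n. orb n)" and ?q = "%i::'a \<times> 'a. hc lam (fst i) / p"
  have fin: "finite (low lam)" using finite_lower lam .
  have sum1: "sum ?q ?S = 1"
  proof -
    have "sum ?q ?S = (\<Sum>n\<in>low lam. \<Sum>k\<in>orb n. hc lam n / p)"
      using fin finite_orb by (subst sum.Sigma) (auto simp: case_prod_unfold)
    also have "... = (\<Sum>n\<in>low lam. hc lam n * real (card (orb n))) / p"
      by (simp add: sum_divide_distrib mult.commute)
    finally show ?thesis using p by simp
  qed
  have rep: "phi lam z = (\<Sum>i\<in>?S. of_real (?q i) * exp (\<i> * cinner (snd i) z))" for z
  proof -
    have "phi lam z = (\<Sum>n\<in>low lam. \<Sum>k\<in>orb n. of_real (hc lam n / p) * exp (\<i> * cinner k z))"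
      unfolding HO_R_def[of R Rp m lam z] p(2) unfolding HO_P_eq[OF lam] orbit_sum_def sum_divide_distrib sum_distrib_left by simp
    also have "... = (\<Sum>i\<in>?S. of_real (?q i) * exp (\<i> * cinner (snd i) z))"
      using fin finite_orb by (subst sum.Sigma) (auto simp: case_prod_unfold)
    finally show ?thesis .
  qed
  show thesis
  proof (rule that[OF _ _ sum1])
    show "finite ?S" using fin finite_orb by blast
    show "\<forall>i\<in>?S. 0 \<le> ?q i" using hc(2)[OF lam] p(1) by simp
    show "\<forall>z. phi lam z = (\<Sum>i\<in>?S. of_real (?q i) * exp (\<i> * cinner (snd i) z))" using rep by blast
    show "\<forall>i\<in>?S. norm (snd i) \<le> norm lam"
    proof
    fix i assume i: "i : ?S"
    then have i1: "fst i : low lam" "snd i : orb (fst i)" by (auto simp: mem_Times_iff)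
    show "norm (snd i) \<le> norm lam" using orb_norm[OF i1(2)] lower_norm(1)[OF i1(1) lam] by simp
    qed
  qed
qed

lemma norm_average_le:
  fixes F :: "'i => complex"
  assumes "finite S" "!!i. i : S ==> 0 \<le> q i" "sum q S = 1" "!!i. i : S ==> norm (F i) \<le> B"
  shows "norm (\<Sum>i\<in>S. of_real (q i) * F i) \<le> B"
proof -
  have "norm (\<Sum>i\<in>S. of_real (q i) * F i) \<le> (\<Sum>i\<in>S. q i * B)"
    by (rule order_trans[OF norm_sum sum_mono]) (use assms in \<open>auto simp: norm_mult intro!: mult_left_mono\<close>)
  also have "... = B" unfolding sum_distrib_right[symmetric] assms(3) by simp
  finally show ?thesis .
qed

lemma norm_phi_le:
  assumes lam: "lam : Dom"
  shows "norm (phi lam z) \<le> exp (norm lam * norm (snd z))"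
proof -
  obtain S :: "('a \<times> 'a) set" and q where S': "finite S" "\<forall>i\<in>S. 0 \<le> q i" "sum q S = 1" "\<forall>i\<in>S. norm (snd i) \<le> norm lam"
    "\<forall>z. phi lam z = (\<Sum>i\<in>S. of_real (q i) * exp (\<i> * cinner (snd i) z))" by (rule phi_average[OF lam])
  note S = S'[rule_format]
  show ?thesis unfolding S(5)
  proof (rule norm_average_le[OF S(1-3)])
    fix i assume i: "i : S"
    have "- (snd i \<bullet> snd z) \<le> norm (snd i) * norm (snd z)" using norm_cauchy_schwarz[of "- snd i" "snd z"] by simp
    also have "... \<le> norm lam * norm (snd z)" using S(4)[OF i] by (intro mult_right_mono) auto
    finally show "norm (exp (\<i> * cinner (snd i) z)) \<le> exp (norm lam * norm (snd z))" unfolding norm_exp_cinner by simp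
  qed
qed

lemma norm_phi_le_one: "lam : Dom ==> norm (rphi lam x) \<le> 1"
  using norm_phi_le[of lam "(x, 0)"] by simp

lemma norm_phi_diff_one:
  assumes lam: "lam : Dom"
  shows "norm (rphi lam x - 1) \<le> norm lam * norm x"
proof -
  obtain S :: "('a \<times> 'a) set" and q where S': "finite S" "\<forall>i\<in>S. 0 \<le> q i" "sum q S = 1" "\<forall>i\<in>S. norm (snd i) \<le> norm lam"
    "\<forall>z. phi lam z = (\<Sum>i\<in>S. of_real (q i) * exp (\<i> * cinner (snd i) z))" by (rule phi_average[OF lam])
  note S = S'[rule_format]
  have "rphi lam x - 1 = (\<Sum>i\<in>S. of_real (q i) * (exp (\<i> * cinner (snd i) (x, 0)) - 1))"
    unfolding S(5) right_diff_distrib sum_subtractf using S(3) by (simp flip: of_real_sum)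
  also have "norm ... \<le> norm lam * norm x"
  proof (rule norm_average_le[OF S(1-3)])
    fix i assume i: "i : S"
    have "norm (exp (\<i> * cinner (snd i) (x, 0)) - 1) \<le> \<bar>snd i \<bullet> x\<bar>"
    proof -
      have "norm (exp (\<i> * of_real t) - 1) \<le> \<bar>t\<bar>" for t :: real
      proof -
        have "norm (exp (\<i> * of_real t) - 1) = 2 * \<bar>sin (t / 2)\<bar>" by (simp add: dist_exp_i_1[symmetric] dist_norm)
        also have "... \<le> \<bar>t\<bar>" using abs_sin_x_le_abs_x[of "t/2"] by simp
        finally show ?thesis .
      qed
      moreover have "cinner (snd i) (x, 0) = of_real (snd i \<bullet> x)" by (simp add: cinner_def complex_of_real_def)
      ultimately show ?thesis by simp
    qed
    also have "... \<le> norm (snd i) * norm x" by (rule Cauchy_Schwarz_ineq2)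
    also have "... \<le> norm lam * norm x" using S(4)[OF i] by (intro mult_right_mono) auto
    finally show "norm (exp (\<i> * cinner (snd i) (x, 0)) - 1) \<le> norm lam * norm x" .
  qed
  finally show ?thesis .
qed

lemma phi_minus:
  assumes lam: "lam : Dom"
  shows "phi lam (- x, 0) = cnj (rphi lam x)"
proof -
  obtain S :: "('a \<times> 'a) set" and q where S': "finite S" "\<forall>i\<in>S. 0 \<le> q i" "sum q S = 1" "\<forall>i\<in>S. norm (snd i) \<le> norm lam"
    "\<forall>z. phi lam z = (\<Sum>i\<in>S. of_real (q i) * exp (\<i> * cinner (snd i) z))" by (rule phi_average[OF lam])
  note S = S'[rule_format]
  have "exp (\<i> * cinner k (- x, 0)) = cnj (exp (\<i> * cinner k (x, 0)))" for k :: 'a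
    by (simp add: exp_cnj cinner_def complex_of_real_def[symmetric])
  then show ?thesis unfolding S(5) by (simp add: cnj_sum)
qed

lemma phi_derivative:
  assumes lam: "lam : Dom"
  shows "\<exists>D. linear D \<and> (\<forall>u v. D (- v, u) = \<i> * D (u, v)) \<and>
      (\<forall>h. norm (D h) \<le> norm lam * exp (norm lam * norm z) * norm h) \<and>
      (\<forall>h. norm (phi lam (z + h) - phi lam z - D h) \<le> exp (norm lam * norm z) * (norm lam * norm h)^2 * exp (norm lam * norm h))"
proof -
  obtain S :: "('a \<times> 'a) set" and q where S': "finite S" "\<forall>i\<in>S. 0 \<le> q i" "sum q S = 1" "\<forall>i\<in>S. norm (snd i) \<le> norm lam"
    "\<forall>z. phi lam z = (\<Sum>i\<in>S. of_real (q i) * exp (\<i> * cinner (snd i) z))" by (rule phi_average[OF lam])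
  note S = S'[rule_format]
  let ?e = "%i. exp (\<i> * cinner (snd i) z)"
  define D where "D h = (\<Sum>i\<in>S. of_real (q i) * (?e i * (\<i> * cinner (snd i) h)))" for h
  have c1: "norm (cinner (snd i) h) \<le> norm lam * norm h" if "i : S" for i h
    by (rule order_trans[OF norm_cinner_le]) (use S(4)[OF that] in \<open>auto intro: mult_right_mono\<close>)
  have e1: "norm (?e i) \<le> exp (norm lam * norm z)" if "i : S" for i
  proof -
    have "norm (?e i) \<le> exp (norm (\<i> * cinner (snd i) z))" by (rule norm_exp)
    then show ?thesis using c1[OF that, of z] by (simp add: norm_mult)
  qed
  have "linear D"
    by (rule linearI)
      (simp_all add: D_def linear_add[OF linear_cinner] linear_scale[OF linear_cinner] scaleR_conv_of_real
        sum.distrib[symmetric] sum_distrib_left algebra_simps)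
  moreover have "D (- v, u) = \<i> * D (u, v)" for u v
  proof -
    have "cinner k (- v, u) = \<i> * cinner k (u, v)" for k :: 'a by (simp add: cinner_def complex_eq_iff)
    then show ?thesis unfolding D_def by (simp add: sum_distrib_left algebra_simps)
  qed
  moreover have "norm (D h) \<le> norm lam * exp (norm lam * norm z) * norm h" for h
    unfolding D_def
  proof (rule norm_average_le[OF S(1-3)])
    fix i assume i: "i : S"
    have "norm (?e i * (\<i> * cinner (snd i) h)) \<le> exp (norm lam * norm z) * (norm lam * norm h)"
      unfolding norm_mult[of "?e i"] using e1[OF i] c1[OF i, of h] by (intro mult_mono) (auto simp: norm_mult)
    then show "norm (?e i * (\<i> * cinner (snd i) h)) \<le> norm lam * exp (norm lam * norm z) * norm h" by (simp add: mult_ac)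
  qed
  moreover have "norm (phi lam (z + h) - phi lam z - D h) \<le> exp (norm lam * norm z) * (norm lam * norm h)^2 * exp (norm lam * norm h)" for h
  proof -
    have "phi lam (z + h) - phi lam z - D h = (\<Sum>i\<in>S. of_real (q i) * (?e i * (exp (\<i> * cinner (snd i) h) - 1 - \<i> * cinner (snd i) h)))"
      unfolding S(5) D_def sum_subtractf[symmetric]
      by (intro sum.cong refl) (simp add: linear_add[OF linear_cinner] distrib_left exp_add algebra_simps)
    also have "norm ... \<le> exp (norm lam * norm z) * ((norm lam * norm h)^2 * exp (norm lam * norm h))"
    proof (rule norm_average_le[OF S(1-3)])
      fix i assume i: "i : S"
      let ?w = "\<i> * cinner (snd i) h"
      have w: "norm ?w \<le> norm lam * norm h" using c1[OF i] by (simp add: norm_mult)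
      have "norm (exp ?w - 1 - ?w) \<le> (norm ?w)^2 * exp (norm ?w)" by (rule norm_exp_minus_linear)
      also have "... \<le> (norm lam * norm h)^2 * exp (norm lam * norm h)" using w by (intro mult_mono power_mono) auto
      finally show "norm (?e i * (exp ?w - 1 - ?w)) \<le> exp (norm lam * norm z) * ((norm lam * norm h)^2 * exp (norm lam * norm h))"
        unfolding norm_mult[of "?e i"] using e1[OF i] by (intro mult_mono) auto
    qed
    finally show ?thesis by (simp only: mult.assoc)
  qed
  ultimately show ?thesis by blast
qed

lemma orbit_sum_invariant:
  assumes "n : weights" "w : W" "k : Q"
  shows "orbit_sum R n (w x + pi *\<^sub>R k, w y) = orbit_sum R n (x, y)"
proof -
  have "orbit_sum R n (x, y) = (\<Sum>ka\<in>orb n. exp (\<i> * cinner (inv w ka) (x, y)))"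
    unfolding orbit_sum_def by (rule sum.reindex_bij_betw[OF bij_betw_orb[OF weyl_inv[OF assms(2)]], symmetric])
  also have "... = (\<Sum>ka\<in>orb n. exp (\<i> * cinner ka (w x + pi *\<^sub>R k, w y)))"
  proof (rule sum.cong[OF refl])
    fix ka assume "ka : orb n"
    then have "ka : weights" using orb_weights[OF assms(1)] by blast
    then obtain j :: int where j: "ka \<bullet> k = 2 * of_int j" using weights_inner_Q assms(3) by blast
    have s: "inv w ka \<bullet> u = ka \<bullet> w u" for u using weyl_inner_inv[OF assms(2), of u ka] by (simp add: inner_commute)
    have "cinner ka (w x + pi *\<^sub>R k, w y) = cinner (inv w ka) (x, y) + of_real (2 * of_int j * pi)"
      by (simp add: cinner_def complex_eq_iff inner_add_right s j)
    then have "\<i> * cinner ka (w x + pi *\<^sub>R k, w y) = \<i> * cinner (inv w ka) (x, y) + (2 * of_int j * pi) * \<i>"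
      by (simp add: algebra_simps)
    then show "exp (\<i> * cinner (inv w ka) (x, y)) = exp (\<i> * cinner ka (w x + pi *\<^sub>R k, w y))"
      unfolding exp_eq by (intro exI[of _ "- j"]) (simp add: algebra_simps)
  qed
  finally show ?thesis unfolding orbit_sum_def by simp
qed

lemma phi_invariant:
  assumes lam: "lam : Dom" and w: "w : W" "k : Q"
  shows "phi lam (w x + pi *\<^sub>R k, w y) = phi lam (x, y)"
  unfolding HO_R_def HO_P_eq[OF lam] using orbit_sum_invariant[OF lower_weights w] by (simp cong: sum.cong)

lemma phi_P: "lam : Dom ==> \<exists>p>0. \<forall>x. rphi lam x = P lam x / of_real p"
proof -
  assume lam: "lam : Dom"
  obtain p where p: "p > 0" "HO_P R Rp m lam (0, 0) = of_real p" using HO_P_zero[OF lam] by blast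
  have "\<forall>x. rphi lam x = P lam x / of_real p"
    unfolding HO_R_def p(2) unfolding HO_P_real[OF lam] by blast
  then show ?thesis using p(1) by blast
qed

lemma phi_tspan: "lam : Dom ==> (rphi lam) : tspan weights"
proof -
  assume lam: "lam : Dom"
  then obtain p where p: "!!x. rphi lam x = P lam x / of_real p" using phi_P by blast
  have "(%x. (1 / of_real p) * P lam x) : tspan weights" by (rule tspan_scale[OF P_tspan])
  then show ?thesis using p by (simp add: field_simps)
qed

lemma phi_good: "lam : Dom ==> good (rphi lam)"
  using good_tspan[OF phi_tspan] .

lemma phi_winv: "lam : Dom ==> winv (rphi lam)"
  unfolding winv_def using phi_invariant[of lam _ 0 _ 0, OF _ _ Q_arith(1)] weyl_zero by (metis add.right_neutral scaleR_zero_right)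

lemma phi_orthogonal:
  assumes "lam : Dom" "\<mu> : Dom" "lam ~= \<mu>"
  shows "ipm (rphi lam) (rphi \<mu>) = 0"
proof -
  obtain p q where pq: "!!x. rphi lam x = (1 / of_real p) * P lam x" "!!x. rphi \<mu> x = (1 / of_real q) * P \<mu> x"
    using phi_P assms by (metis mult_1 times_divide_eq_left)
  have "wip (rphi lam) (rphi \<mu>) = 0"
    unfolding pq wip_scale wip_scale_right P_orthogonal[OF assms] by simp
  then show ?thesis using wip_ip_m[OF phi_winv phi_winv] assms card_W_pos by simp
qed

lemma sin_ge_half: "0 \<le> u ==> u \<le> 1 ==> u / 2 \<le> sin u" for u :: real
proof -
  assume u: "0 \<le> u" "u \<le> 1"
  have "\<bar>sin u - (\<Sum>k<2. sin_coeff k * u ^ k)\<bar> \<le> inverse (fact 2) * \<bar>u\<bar> ^ 2" by (rule Maclaurin_sin_bound)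
  moreover have "(\<Sum>k<2. sin_coeff k * u ^ k) = u" by (simp add: numeral_2_eq_2 sin_coeff_def)
  ultimately have "\<bar>sin u - u\<bar> \<le> u^2 / 2" by (simp add: fact_numeral)
  then have "u - u^2 / 2 \<le> sin u" by linarith
  moreover have "u^2 \<le> u" using u by (simp add: power2_eq_square mult_left_le)
  ultimately show ?thesis by linarith
qed

lemma phi_norm_integral:
  assumes lam: "lam : Dom"
  shows "set_integrable lebesgue (A0) (%x. (cmod (rphi lam x))^2 * wt x)"
    "ipm (rphi lam) (rphi lam) = of_real (LINT x:A0|lebesgue. (cmod (rphi lam x))^2 * wt x)"
proof -
  have e: "rphi lam x * cnj (rphi lam x) * of_real (wt x) = of_real ((cmod (rphi lam x))^2 * wt x)" for x
    by (simp add: complex_norm_square[symmetric])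
  have "good (%x. rphi lam x * cnj (rphi lam x) * of_real (wt x))"
    by (rule good_mult[OF good_prod[OF phi_good[OF lam] phi_good[OF lam]] good_weight])
  then have "set_integrable lebesgue (A0) (%x. complex_of_real ((cmod (rphi lam x))^2 * wt x))"
    unfolding e by (rule good_integrable)
  then show "set_integrable lebesgue (A0) (%x. (cmod (rphi lam x))^2 * wt x)"
    unfolding set_integrable_def scaleR_conv_of_real of_real_mult[symmetric] complex_of_real_integrable_eq by simp
  show "ipm (rphi lam) (rphi lam) = of_real (LINT x:A0|lebesgue. (cmod (rphi lam x))^2 * wt x)"
    unfolding ip_m_def e set_integral_complex_of_real ..
qed

text \<open>Rounding the multiplicities up, harmless since u <= 1, produces a natural power of u,
  which \<open>power_le_fact_exp\<close> can compare with an exponential.\<close>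

lemma weight_lower:
  assumes u: "0 < u" "u \<le> 1" and x: "!!al. al : Rp ==> u \<le> al \<bullet> x \<and> al \<bullet> x \<le> 1"
  shows "u ^ (\<Sum>al\<in>Rp. nat \<lceil>m al\<rceil>) \<le> wt x"
  unfolding power_sum weight_def cmod_exp_diff
proof (rule prod_mono)
  fix al assume a: "al : Rp"
  have m: "0 \<le> m al" "m al \<le> real (nat \<lceil>m al\<rceil>)" using m_nonneg Rp_R a by (auto simp: real_nat_ceiling_ge)
  have s: "u \<le> 2 * \<bar>sin (al \<bullet> x)\<bar>" using sin_ge_half[of "al \<bullet> x"] x[OF a] u by linarith
  show "0 \<le> u ^ nat \<lceil>m al\<rceil> \<and> u ^ nat \<lceil>m al\<rceil> \<le> pow0 (2 * \<bar>sin (al \<bullet> x)\<bar>) (m al)"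
  proof (cases "m al = 0")
    case False
    have "u ^ nat \<lceil>m al\<rceil> = u powr real (nat \<lceil>m al\<rceil>)" using u by (simp add: powr_realpow)
    also have "... \<le> u powr m al" using u m by (intro powr_mono') auto
    also have "... \<le> (2 * \<bar>sin (al \<bullet> x)\<bar>) powr m al" using u m s by (intro powr_mono2) auto
    finally show ?thesis using False u by (simp add: pow0_def)
  qed (simp add: pow0_def)
qed

text \<open>On a shrinking copy of a ball inside the alcove, of size inversely proportional to the length of the
  highest weight, the normalized polynomial stays close to 1.\<close>
lemma phi_norm_lower:
  "\<exists>C>0. \<forall>lam\<in>Dom. C * exp (- norm lam) \<le> Re (ipm (rphi lam) (rphi lam))"
proof -
  define b where "b = 1 + (\<Sum>al\<in>Rp. norm al)"
  define ep where "ep = Min (insert 1 ((%al. al \<bullet> pt0) ` Rp))"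
  have b: "1 \<le> b" "!!al. al : Rp ==> norm al \<le> b"
    using finite_Rp member_le_sum[of _ Rp norm] by (force simp: b_def intro: sum_nonneg)+
  have eps: "0 < ep" "ep \<le> 1" "!!al. al : Rp ==> ep \<le> al \<bullet> pt0" using finite_Rp p0 by (auto simp: ep_def)
  \<comment> \<open>Moving by r changes a pairing with a positive root by at most b * r = ep / 2, at
    most half of its value at \<open>pt0\<close>.\<close>
  define r where "r = ep / (2 * b)"
  have r: "0 < r" "b * r = ep / 2" using eps b by (auto simp: r_def)
  \<comment> \<open>Chosen so that with s = 1 / (T * (1 + norm lam)) all x in the ball of radius s r
    about s pt0 satisfy al . x <= 1 and norm lam * norm x <= 1/2.\<close>
  define T where "T = 2 * (1 + b * (norm pt0 + r))"
  have T: "0 < T" "2 * b * (norm pt0 + r) \<le> T" "2 \<le> T"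
  proof -
    have "0 \<le> b * (norm pt0 + r)" using b(1) r(1) by (intro mult_nonneg_nonneg) auto
    then show "0 < T" "2 * b * (norm pt0 + r) \<le> T" "2 \<le> T" by (simp_all add: T_def)
  qed
  have T': "2 * (norm pt0 + r) \<le> T"
    using T(2) mult_right_mono[OF b(1), of "2 * (norm pt0 + r)"] r(1) by (simp add: algebra_simps)
  define k where "k = (\<Sum>al\<in>Rp. nat \<lceil>m al\<rceil>)"
  define c where "c = measure lborel (ball (0::'a) 1)"
  have c: "0 < c" unfolding c_def by (rule content_ball_pos) simp
  define d where "d = DIM('a)"
  \<comment> \<open>On the small ball |R lam|^2 >= 1/4 and the weight is at least u^k, so its
    contribution is a constant over (1 + norm lam)^(k + d). That power is at most fact (k + d) * exp
    (1 + norm lam).\<close>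
  define C where "C = (1/4 * (ep / (2 * T)) ^ k * ((r / T) ^ d * c)) / (fact (k + d) * exp 1)"
  have C0: "0 < C" using eps T r c by (simp add: C_def)
  have "C * exp (- norm lam) \<le> Re (ipm (rphi lam) (rphi lam))" if lam: "lam : Dom" for lam
  proof -
    let ?n = "1 + norm lam"
    define s where "s = 1 / (T * ?n)"
    have n1: "1 \<le> ?n" by simp
    have Tn: "T \<le> T * ?n" using T n1 by simp
    have s: "0 < s" "s * T \<le> 1" "s * T * norm lam \<le> 1"
    proof -
      show "0 < s" using T n1 by (simp add: s_def add_pos_nonneg)
      have "s * T = 1 / ?n" using T by (simp add: s_def)
      then show "s * T \<le> 1" "s * T * norm lam \<le> 1" using n1 by (simp_all add: divide_le_eq add_pos_nonneg)
    qed
    define B where "B = ball (s *\<^sub>R pt0) (s * r)"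
    define u where "u = s * ep / 2"
    have u: "0 < u" "u \<le> 1"
    proof -
      have "s \<le> s * T" using T s by simp
      then have "s \<le> 1" using s(2) by linarith
      then show "u \<le> 1" using eps s mult_mono[of s 1 ep 1] by (simp add: u_def)
      show "0 < u" using s eps by (simp add: u_def)
    qed
    have Bx: "(\<forall>al\<in>Rp. u \<le> al \<bullet> x \<and> al \<bullet> x \<le> 1) \<and> norm lam * norm x \<le> 1/2" if x: "x : B" for x
    proof -
      have dx: "norm (x - s *\<^sub>R pt0) \<le> s * r" using x by (simp add: B_def dist_norm norm_minus_commute)
      have nx: "norm x \<le> s * (norm pt0 + r)"
        using norm_triangle_ineq[of "s *\<^sub>R pt0" "x - s *\<^sub>R pt0"] dx s by (simp add: distrib_left)
      have "norm lam * norm x \<le> norm lam * (s * (T / 2))"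
        by (intro mult_left_mono order_trans[OF nx]) (use s T' in auto)
      also have "... \<le> 1/2" using s(3) by (simp add: mult_ac)
      finally have 1: "norm lam * norm x \<le> 1/2" .
      have "u \<le> al \<bullet> x \<and> al \<bullet> x \<le> 1" if a: "al : Rp" for al
      proof -
        have "\<bar>al \<bullet> (x - s *\<^sub>R pt0)\<bar> \<le> b * (s * r)"
          by (rule order_trans[OF Cauchy_Schwarz_ineq2]) (intro mult_mono b(2)[OF a] dx, use b in auto)
        also have "... = s * ep / 2" using r(2) by (metis mult.left_commute times_divide_eq_right)
        finally have "\<bar>al \<bullet> x - s * (al \<bullet> pt0)\<bar> \<le> s * ep / 2" by (simp add: inner_diff_right)
        moreover have "s * ep \<le> s * (al \<bullet> pt0)" using eps(3)[OF a] s by (intro mult_left_mono) auto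
        ultimately have "u \<le> al \<bullet> x" unfolding u_def by linarith
        moreover have "al \<bullet> x \<le> 1"
        proof -
          have "al \<bullet> x \<le> norm al * norm x" by (rule norm_cauchy_schwarz)
          also have "... \<le> b * (s * (norm pt0 + r))" by (intro mult_mono b(2)[OF a] nx) (use b in auto)
          also have "... = s * (b * (norm pt0 + r))" by simp
          also have "... \<le> s * T"
          proof (rule mult_left_mono)
            have "0 \<le> b * (norm pt0 + r)" using b(1) r(1) by (intro mult_nonneg_nonneg) auto
            moreover have "x \<le> 2 * (1 + x)" if "0 \<le> x" for x :: real using that by simp
            ultimately show "b * (norm pt0 + r) \<le> T" unfolding T_def by blast
          qed (use s in simp)
          finally show ?thesis using s by simp
        qed
        ultimately show ?thesis by blast
      qed
      then show ?thesis using 1 by blast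
    qed
    have BA: "B \<subseteq> A0"
      unfolding alcove_def
    proof (intro subsetI CollectI ballI)
      fix x al assume "x : B" "al : Rp"
      then have "u \<le> al \<bullet> x \<and> al \<bullet> x \<le> 1" using Bx by blast
      then show "0 \<le> al \<bullet> x \<and> al \<bullet> x \<le> pi" using u pi_gt3 by linarith
    qed
    let ?f = "%x. (cmod (rphi lam x))^2 * wt x"
    have ge: "1/4 * u ^ k \<le> ?f x" if x: "x : B" for x
    proof -
      have "norm (rphi lam x - 1) \<le> 1/2" using norm_phi_diff_one[OF lam, of x] Bx[OF x] by linarith
      then have "1/2 \<le> cmod (rphi lam x)" using norm_triangle_ineq2[of 1 "1 - rphi lam x"] by (simp add: norm_minus_commute)
      then have "(1/2)^2 \<le> (cmod (rphi lam x))^2" by (intro power_mono) auto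
      moreover have "u ^ k \<le> wt x" unfolding k_def by (rule weight_lower[OF u]) (use Bx[OF x] in blast)
      ultimately show ?thesis using u by (intro mult_mono) (auto simp: power2_eq_square)
    qed
    have mB: "B : lmeasurable" unfolding B_def by (rule lmeasurable_ball)
    have "(1/4 * u ^ k) * measure lebesgue B = (LINT x|lebesgue. indicator B x *\<^sub>R (1/4 * u ^ k))"
      using mB by (simp add: mult.commute)
    also have "... \<le> (LINT x|lebesgue. indicator (A0) x *\<^sub>R ?f x)"
    proof (rule integral_mono)
      show "integrable lebesgue (%x. indicator B x *\<^sub>R (1/4 * u ^ k))"
        using mB by (intro integrable_scaleR_left) (auto simp: fmeasurable_def)
      show "integrable lebesgue (%x. indicator (A0) x *\<^sub>R ?f x)" using phi_norm_integral(1)[OF lam] unfolding set_integrable_def .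
      show "indicator B x *\<^sub>R (1/4 * u ^ k) \<le> indicator (A0) x *\<^sub>R ?f x" for x
        using ge[of x] BA weight_nonneg[of x] by (auto simp: indicator_def)
    qed
    also have "... = Re (ipm (rphi lam) (rphi lam))"
      unfolding phi_norm_integral(2)[OF lam] by (simp add: set_lebesgue_integral_def)
    finally have L: "(1/4 * u ^ k) * measure lebesgue B \<le> Re (ipm (rphi lam) (rphi lam))" .
    have "measure lebesgue B = (s * r) ^ d * c"
      unfolding B_def c_def d_def using content_ball_conv_unit_ball[of "s * r" "s *\<^sub>R pt0"] s r by simp
    note mB' = this
    have "(1/4 * u ^ k) * measure lebesgue B = (1/4 * (ep / (2 * T)) ^ k * ((r / T) ^ d * c)) / ?n ^ (k + d)"
    proof -
      have *: "(1/4 * (x / ?n) ^ k) * ((y / ?n) ^ d * c) = (1/4 * x ^ k * (y ^ d * c)) / ?n ^ (k + d)" for x y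
        by (simp add: power_divide power_add)
      have us: "u = (ep / (2 * T)) / ?n" "s * r = (r / T) / ?n" by (simp_all add: u_def s_def)
      show ?thesis unfolding mB' us by (rule *)
    qed
    also have "... \<ge> (1/4 * (ep / (2 * T)) ^ k * ((r / T) ^ d * c)) / (fact (k + d) * exp ?n)"
      using power_le_fact_exp[of ?n "k + d"] eps T r c by (intro divide_left_mono) (auto intro!: mult_pos_pos zero_less_power add_pos_nonneg)
    moreover have "(1/4 * (ep / (2 * T)) ^ k * ((r / T) ^ d * c)) / (fact (k + d) * exp ?n) = C * exp (- norm lam)"
      unfolding C_def by (simp add: exp_add exp_minus field_simps)
    ultimately show ?thesis using L by linarith
  qed
  then show ?thesis using C0 by blast
qed

section \<open>Growth of r_lambda and convergence of the heat series\<close>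

lemma phi_norm_pos: "lam : Dom ==> 0 < Re (ipm (rphi lam) (rphi lam))"
  using phi_norm_lower by (meson exp_gt_zero less_le_trans mult_pos_pos)

lemma r_coef_pos: "lam : Dom ==> 0 < rc lam"
  unfolding r_coef_def using phi_norm_pos by simp

lemma r_coef_le: "\<exists>C>0. \<forall>lam\<in>Dom. rc lam \<le> C * exp (norm lam)"
proof -
  obtain C where C: "C > 0" "\<forall>lam\<in>Dom. C * exp (- norm lam) \<le> Re (ipm (rphi lam) (rphi lam))"
    using phi_norm_lower by blast
  have "rc lam \<le> (1 / C) * exp (norm lam)" if lam: "lam : Dom" for lam
  proof -
    have "rc lam \<le> 1 / (C * exp (- norm lam))"
      unfolding r_coef_def using C lam phi_norm_pos[OF lam] by (intro divide_left_mono) auto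
    then show ?thesis using C by (simp add: exp_minus field_simps)
  qed
  then show ?thesis using C(1) by (intro exI[of _ "1 / C"]) simp
qed

lemma summable_heat:
  assumes t: "t > 0"
  shows "(%lam. rc lam * exp (- eig lam * t) * exp (c * norm lam)) summable_on Dom"
proof -
  obtain C where C: "C > 0" "\<forall>lam\<in>Dom. rc lam \<le> C * exp (norm lam)" using r_coef_le by blast
  \<comment> \<open>K is the maximum of (c + 2) n - t n^2 over n. Of the two extra units, one
    absorbs the growth of \<open>rc\<close> and the other leaves exp (- norm lam), which is summable
    over the weights.\<close>
  define K where "K = (c + 2)^2 / (4 * t)"
  have "Dom \<subseteq> weights" using dominant_weights by blast
  then have "(%lam. exp (- 1 * norm lam)) summable_on Dom"
    using summable_on_subset_banach[OF summable_weights[of 1]] by simp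
  then have "(%lam. C * exp K * exp (- 1 * norm lam)) summable_on Dom" by (rule summable_on_cmult_right)
  then show ?thesis
  proof (rule summable_on_comparison_test)
    fix lam assume lam: "lam : Dom"
    let ?n = "norm lam"
    have sq: "?n^2 * t - (c + 2) * ?n + K = t * (?n - (c + 2) / (2 * t))^2"
      unfolding K_def using t by (simp add: power2_eq_square field_simps)
    have "?n^2 * t - (c + 2) * ?n + K \<ge> 0" unfolding sq using t by simp
    moreover have "?n^2 * t \<le> eig lam * t" using theta_ge[OF lam] t by (intro mult_right_mono) auto
    ultimately have e: "?n + (- eig lam * t) + c * ?n \<le> K + (- 1 * ?n)" by (simp add: algebra_simps)
    have "rc lam * exp (- eig lam * t) * exp (c * ?n) \<le> C * exp ?n * exp (- eig lam * t) * exp (c * ?n)"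
      using C(2) lam by (intro mult_right_mono) auto
    also have "... = C * exp (?n + (- eig lam * t) + c * ?n)" unfolding exp_add by (simp only: mult.assoc)
    also have "... \<le> C * exp (K + (- 1 * ?n))" using e C(1) by (intro mult_left_mono) auto
    also have "... = C * exp K * exp (- 1 * ?n)" unfolding exp_add by simp
    finally show "rc lam * exp (- eig lam * t) * exp (c * ?n) \<le> C * exp K * exp (- 1 * ?n)" .
    show "0 \<le> rc lam * exp (- eig lam * t) * exp (c * ?n)" using r_coef_pos[OF lam] by simp
  qed
qed

lemma heat_series:
  assumes t: "t > 0" and a: "!!lam. lam : Dom ==> norm (a lam) \<le> K"
  defines "F \<equiv> %z. \<Sum>\<^sub>\<infinity>lam\<in>Dom. of_real (rc lam * exp (- eig lam * t)) * a lam * phi lam z"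
  shows "holomorphic_C F" "waff_invariant R F"
proof -
  let ?b = "%lam. of_real (rc lam * exp (- eig lam * t)) * a lam"
  show "holomorphic_C F"
    unfolding F_def
  proof (rule holomorphic_C_series[where n = norm])
    fix c
    show "(%lam. norm (?b lam) * exp (c * norm lam)) summable_on Dom"
    proof (rule summable_on_comparison_test[OF summable_on_cmult_left[OF summable_heat[OF t, of c], of K]])
      fix lam assume lam: "lam : Dom"
      have "norm (?b lam) * exp (c * norm lam) = rc lam * exp (- eig lam * t) * exp (c * norm lam) * norm (a lam)"
        using r_coef_pos[OF lam] by (simp add: norm_mult)
      also have "... \<le> rc lam * exp (- eig lam * t) * exp (c * norm lam) * K"
        using a[OF lam] r_coef_pos[OF lam] by (intro mult_left_mono) auto
      finally show "norm (?b lam) * exp (c * norm lam) \<le> rc lam * exp (- eig lam * t) * exp (c * norm lam) * K" .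
    qed simp
    fix lam and z :: "'a \<times> 'a" assume lam: "lam : Dom"
    show "norm (phi lam z) \<le> exp (norm lam * norm z)"
    proof -
      have "norm (snd z) \<le> norm z" using norm_snd_le[of "snd z" "fst z"] by simp
      then show ?thesis using norm_phi_le[OF lam, of z] by (meson exp_le_cancel_iff mult_left_mono norm_ge_zero order_trans)
    qed
    show "\<exists>D. linear D \<and> (\<forall>u v. D (- v, u) = \<i> * D (u, v)) \<and>
      (\<forall>h. norm (D h) \<le> norm lam * exp (norm lam * norm z) * norm h) \<and>
      (\<forall>h. norm (phi lam (z + h) - phi lam z - D h) \<le> exp (norm lam * norm z) * (norm lam * norm h)^2 * exp (norm lam * norm h))"
      by (rule phi_derivative[OF lam])
  qed simp
  show "waff_invariant R F"
    unfolding waff_invariant_def F_def using phi_invariant by (auto intro!: infsum_cong)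
qed

end

section \<open>Complete orthogonal systems on a finite measure space\<close>

definition L2 :: "'a measure => ('a => complex) set" where
  "L2 M = {f : borel_measurable M. integrable M (%x. (cmod (f x))^2)}"

definition l2ip :: "'a measure => ('a => complex) => ('a => complex) => complex" where
  "l2ip M f g = (LINT x|M. f x * cnj (g x))"

definition l2sq :: "'a measure => ('a => complex) => real" where
  "l2sq M f = (LINT x|M. (cmod (f x))^2)"

lemma L2D: "f : L2 M ==> f : borel_measurable M" "f : L2 M ==> integrable M (%x. (cmod (f x))^2)"
  by (auto simp: L2_def)

lemma l2sq_nonneg: "0 \<le> l2sq M f" unfolding l2sq_def by (rule integral_nonneg_AE) auto

lemma l2ip_self: "l2ip M f f = of_real (l2sq M f)"
  unfolding l2ip_def l2sq_def complex_norm_square[symmetric] integral_complex_of_real ..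

lemma L2_add: assumes "f : L2 M" "g : L2 M" shows "(%x. f x + g x) : L2 M"
proof -
  have [measurable]: "f : borel_measurable M" "g : borel_measurable M" using assms L2D by blast+
  have "integrable M (%x. 2 * (cmod (f x))^2 + 2 * (cmod (g x))^2)"
    by (intro Bochner_Integration.integrable_add integrable_mult_right) (use assms L2D in blast)+
  then have "integrable M (%x. (cmod (f x + g x))^2)"
  proof (rule Bochner_Integration.integrable_bound, measurable, intro AE_I2)
    fix x
    have "(cmod (f x + g x))^2 \<le> (cmod (f x) + cmod (g x))^2" by (intro power_mono norm_triangle_ineq) auto
    also have "... \<le> 2 * (cmod (f x))^2 + 2 * (cmod (g x))^2"
      using sum_squares_bound[of "cmod (f x)" "cmod (g x)"] by (simp add: power2_sum)
    finally show "norm ((cmod (f x + g x))^2) \<le> norm (2 * (cmod (f x))^2 + 2 * (cmod (g x))^2)" by simp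
  qed
  then show ?thesis unfolding L2_def by simp
qed

lemma L2_scale: assumes "f : L2 M" shows "(%x. c * f x) : L2 M"
  using assms by (auto simp: L2_def norm_mult power_mult_distrib)

lemma L2_diff: assumes "f : L2 M" "g : L2 M" shows "(%x. f x - g x) : L2 M"
  using L2_add[OF assms(1) L2_scale[OF assms(2), of "-1"]] by simp

lemma L2_zero: "(%x. 0) : L2 M" by (simp add: L2_def)

lemma L2_sum: "(!!i. i : F ==> f i : L2 M) ==> (%x. \<Sum>i\<in>F. f i x) : L2 M"
  by (induction F rule: infinite_finite_induct) (auto simp: L2_zero intro: L2_add)

lemma L2_integrable_mult:
  assumes "f : L2 M" "g : L2 M" shows "integrable M (%x. f x * cnj (g x))"
proof -
  have [measurable]: "f : borel_measurable M" "g : borel_measurable M" using assms L2D by blast+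
  have [measurable]: "(%x. cnj (g x)) : borel_measurable M"
    by (rule measurable_compose[OF \<open>g : borel_measurable M\<close> borel_measurable_continuous_onI]) (intro continuous_intros)
  have "integrable M (%x. (cmod (f x))^2 + (cmod (g x))^2)" by (intro Bochner_Integration.integrable_add) (use assms L2D in blast)+
  then show ?thesis
  proof (rule Bochner_Integration.integrable_bound, measurable, intro AE_I2)
    fix x show "norm (f x * cnj (g x)) \<le> norm ((cmod (f x))^2 + (cmod (g x))^2)"
    proof -
      have "0 \<le> cmod (f x) * cmod (g x)" by simp
      then have "cmod (f x) * cmod (g x) \<le> (cmod (f x))^2 + (cmod (g x))^2"
        using sum_squares_bound[of "cmod (f x)" "cmod (g x)"] by linarith
      then show ?thesis by (simp add: norm_mult)
    qed
  qed
qed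

lemma l2ip_diff_left: "f : L2 M ==> g : L2 M ==> h : L2 M ==> l2ip M (%x. f x - g x) h = l2ip M f h - l2ip M g h"
  unfolding l2ip_def left_diff_distrib by (rule Bochner_Integration.integral_diff) (auto intro: L2_integrable_mult)

lemma l2ip_cnj: "cnj (l2ip M f g) = l2ip M g f"
  unfolding l2ip_def Bochner_Integration.integral_cnj[symmetric, of M "%x. f x * cnj (g x)"] by (simp add: mult.commute)

lemma l2ip_scale_left: "l2ip M (%x. c * f x) g = c * l2ip M f g"
  unfolding l2ip_def by (simp add: mult.assoc)

lemma l2ip_sum_left:
  "(!!i. i : F ==> f i : L2 M) ==> g : L2 M ==> l2ip M (%x. \<Sum>i\<in>F. f i x) g = (\<Sum>i\<in>F. l2ip M (f i) g)"
  unfolding l2ip_def sum_distrib_right by (rule Bochner_Integration.integral_sum) (auto intro: L2_integrable_mult)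

text \<open>Cauchy-Schwarz with a free parameter, from (a - \<delta> b)^2 >= 0; the choice of
  \<delta> takes the place of square roots.\<close>

lemma l2ip_bound:
  assumes "f : L2 M" "g : L2 M" "\<delta> > 0"
  shows "norm (l2ip M f g) \<le> (l2sq M f / \<delta> + \<delta> * l2sq M g) / 2"
proof -
  have i: "integrable M (%x. (cmod (f x))^2)" "integrable M (%x. (cmod (g x))^2)" using assms L2D by blast+
  have "norm (l2ip M f g) \<le> (LINT x|M. norm (f x * cnj (g x)))" unfolding l2ip_def by (rule integral_norm_bound)
  also have "... \<le> (LINT x|M. (1 / (2 * \<delta>)) * (cmod (f x))^2 + (\<delta> / 2) * (cmod (g x))^2)"
  proof (rule integral_mono)
    show "integrable M (%x. norm (f x * cnj (g x)))" using L2_integrable_mult assms by (intro integrable_norm) blast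
    show "integrable M (%x. (1 / (2 * \<delta>)) * (cmod (f x))^2 + (\<delta> / 2) * (cmod (g x))^2)" using i by (intro Bochner_Integration.integrable_add integrable_mult_right)
    fix x
    have "0 \<le> (cmod (f x) - \<delta> * cmod (g x))^2 / (2 * \<delta>)" using assms by simp
    also have "... = (1 / (2 * \<delta>)) * (cmod (f x))^2 + (\<delta> / 2) * (cmod (g x))^2 - cmod (f x) * cmod (g x)"
      using assms by (simp add: power2_eq_square field_simps)
    finally show "norm (f x * cnj (g x)) \<le> (1 / (2 * \<delta>)) * (cmod (f x))^2 + (\<delta> / 2) * (cmod (g x))^2" by (simp add: norm_mult)
  qed
  also have "... = (l2sq M f / \<delta> + \<delta> * l2sq M g) / 2" unfolding l2sq_def using i by (simp add: field_simps)
  finally show ?thesis .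
qed

lemma l2ip_tendsto_0:
  assumes f: "!!k. f k : L2 M" and g: "g : L2 M" and 0: "(%k. l2sq M (f k)) \<longlonglongrightarrow> 0"
  shows "(%k. l2ip M (f k) g) \<longlonglongrightarrow> 0"
proof (rule LIMSEQ_I)
  fix ep :: real assume e: "0 < ep"
  define \<eta> where "\<eta> = ep / (l2sq M g + 1)"
  have G: "0 \<le> l2sq M g" by (rule l2sq_nonneg)
  have eta: "0 < \<eta>" "\<eta> * l2sq M g \<le> ep" using e G by (auto simp: \<eta>_def field_simps)
  have "eventually (%k. l2sq M (f k) < ep * \<eta>) sequentially" using order_tendstoD(2)[OF 0, of "ep * \<eta>"] e eta by simp
  then obtain N where N: "\<forall>k\<ge>N. l2sq M (f k) < ep * \<eta>" unfolding eventually_sequentially by blast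
  have "norm (l2ip M (f k) g - 0) < ep" if "k \<ge> N" for k
  proof -
    have "l2sq M (f k) / \<eta> < ep" using N that eta by (simp add: divide_less_eq)
    then show ?thesis using l2ip_bound[OF f g eta(1), of k] eta(2) by simp
  qed
  then show "\<exists>N. \<forall>k\<ge>N. norm (l2ip M (f k) g - 0) < ep" by blast
qed

lemma (in finite_measure) L1_le_L2:
  assumes "f : L2 M" "\<delta> > 0"
  shows "integrable M (%x. cmod (f x))" "(LINT x|M. cmod (f x)) \<le> (l2sq M f / \<delta> + \<delta> * measure M (space M)) / 2"
proof -
  have f: "f : borel_measurable M" using assms L2D by blast
  have h: "(%x. of_real (cmod (f x))) : L2 M" "(%x. 1) : L2 M" using assms L2D[OF assms(1)] by (auto simp: L2_def)
  have "integrable M (%x. complex_of_real (cmod (f x)))" using L2_integrable_mult[OF h] by simp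
  then show "integrable M (%x. cmod (f x))" unfolding complex_of_real_integrable_eq .
  have "l2ip M (%x. of_real (cmod (f x))) (%x. 1) = of_real (LINT x|M. cmod (f x))"
    unfolding l2ip_def by (simp add: integral_complex_of_real)
  then have "(LINT x|M. cmod (f x)) \<le> norm (l2ip M (%x. of_real (cmod (f x))) (%x. 1))" by simp
  also have "... \<le> (l2sq M (%x. of_real (cmod (f x))) / \<delta> + \<delta> * l2sq M (%x. 1)) / 2" by (rule l2ip_bound[OF h assms(2)])
  also have "... = (l2sq M f / \<delta> + \<delta> * measure M (space M)) / 2" by (simp add: l2sq_def)
  finally show "(LINT x|M. cmod (f x)) \<le> (l2sq M f / \<delta> + \<delta> * measure M (space M)) / 2" .
qed

text \<open>With \<delta> = (1/2)^k the increments have summable L1 norms, so the sequence converges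
  almost everywhere. Fatou's lemma carries the L2 estimates to the limit.\<close>

lemma (in finite_measure) L2_rapid_limit:
  assumes S: "!!k. S k : L2 M" and C: "!!j k. k \<le> j ==> l2sq M (%x. S j x - S k x) \<le> (1/4) ^ k"
  shows "\<exists>f\<in>L2 M. (%k. l2sq M (%x. f x - S k x)) \<longlonglongrightarrow> 0"
proof -
  have Sm[measurable]: "S k : borel_measurable M" for k using S L2D by blast
  define u where "u k x = S (Suc k) x - S k x" for k x
  have uL: "u k : L2 M" for k unfolding u_def by (rule L2_diff[OF S S])
  have um[measurable]: "u k : borel_measurable M" for k using uL L2D by blast
  let ?c = "(1 + measure M (space M)) / 2"
  have u1: "(LINT x|M. cmod (u k x)) \<le> ?c * (1/2) ^ k" for k
  proof -
    have "l2sq M (u k) \<le> (1/4) ^ k" unfolding u_def by (rule C) simp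
    then have "l2sq M (u k) / (1/2) ^ k \<le> (1/4) ^ k / (1/2) ^ k" by (intro divide_right_mono) auto
    also have "... = (1/2) ^ k" unfolding power_divide[symmetric] by simp
    finally have l: "l2sq M (u k) / (1/2) ^ k \<le> (1/2) ^ k" .
    have "(LINT x|M. cmod (u k x)) \<le> (l2sq M (u k) / (1/2) ^ k + (1/2) ^ k * measure M (space M)) / 2"
      by (rule L1_le_L2(2)[OF uL]) simp
    also have "... \<le> ((1/2) ^ k + (1/2) ^ k * measure M (space M)) / 2" by (intro divide_right_mono add_right_mono l) simp
    also have "... = ?c * (1/2) ^ k" by (simp add: algebra_simps add_divide_distrib)
    finally show ?thesis .
  qed
  have "(\<integral>\<^sup>+x. (\<Sum>k. ennreal (cmod (u k x))) \<partial>M) = (\<Sum>k. \<integral>\<^sup>+x. ennreal (cmod (u k x)) \<partial>M)"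
    by (rule nn_integral_suminf) measurable
  also have "... = (\<Sum>k. ennreal (LINT x|M. cmod (u k x)))"
    using L1_le_L2(1)[OF uL, of 1] by (intro suminf_cong nn_integral_eq_integral) auto
  also have "... \<le> (\<Sum>k. ennreal (?c * (1/2) ^ k))" using u1 by (intro suminf_le ennreal_leI) auto
  also have "... < \<infinity>"
  proof -
    have "summable (%k. ?c * (1/2) ^ k)" by (intro summable_mult summable_geometric) simp
    then show ?thesis by (subst suminf_ennreal2) auto
  qed
  finally have "(\<integral>\<^sup>+x. (\<Sum>k. ennreal (cmod (u k x))) \<partial>M) ~= \<infinity>" by simp
  then have "AE x in M. (\<Sum>k. ennreal (cmod (u k x))) ~= \<infinity>" by (intro nn_integral_PInf_AE) measurable
  then have conv: "AE x in M. convergent (%k. S k x)"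
  proof eventually_elim
    case (elim x)
    then have "summable (%k. cmod (u k x))" by (intro summable_suminf_not_top) auto
    then have "summable (%k. u k x)" by (rule summable_norm_cancel)
    then have "convergent (%n. \<Sum>k<n. u k x)" by (simp add: summable_iff_convergent)
    moreover have "(%n. \<Sum>k<n. u k x) = (%n. S n x - S 0 x)"
      unfolding u_def by (intro ext sum_lessThan_telescope)
    ultimately have "convergent (%n. S n x - S 0 x)" by simp
    then show ?case using convergent_diff_const_right_iff by blast
  qed
  define f where "f x = lim (%k. S k x)" for x
  have fm[measurable]: "f : borel_measurable M" unfolding f_def by measurable
  have fat: "(\<integral>\<^sup>+x. ennreal ((cmod (f x - S k x))^2) \<partial>M) \<le> ennreal ((1/4) ^ k)" for k
  proof -
    have "(\<integral>\<^sup>+x. ennreal ((cmod (f x - S k x))^2) \<partial>M) = (\<integral>\<^sup>+x. liminf (%j. ennreal ((cmod (S j x - S k x))^2)) \<partial>M)"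
    proof (rule nn_integral_cong_AE)
      show "AE x in M. ennreal ((cmod (f x - S k x))^2) = liminf (%j. ennreal ((cmod (S j x - S k x))^2))"
        using conv
      proof eventually_elim
        case (elim x)
        then have "(%j. S j x) \<longlonglongrightarrow> f x" by (simp add: f_def convergent_LIMSEQ_iff)
        then have "(%j. (cmod (S j x - S k x))^2) \<longlonglongrightarrow> (cmod (f x - S k x))^2" by (intro tendsto_intros)
        then have "(%j. ennreal ((cmod (S j x - S k x))^2)) \<longlonglongrightarrow> ennreal ((cmod (f x - S k x))^2)" by (rule tendsto_ennrealI)
        then show ?case by (rule lim_imp_Liminf[OF sequentially_bot, symmetric])
      qed
    qed
    also have "... \<le> liminf (%j. \<integral>\<^sup>+x. ennreal ((cmod (S j x - S k x))^2) \<partial>M)"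
      by (rule nn_integral_liminf) measurable
    also have "... \<le> ennreal ((1/4) ^ k)"
    proof (rule Liminf_le)
      show "eventually (%j. (\<integral>\<^sup>+x. ennreal ((cmod (S j x - S k x))^2) \<partial>M) \<le> ennreal ((1/4) ^ k)) sequentially"
        using eventually_ge_at_top[of k]
      proof eventually_elim
        case (elim j)
        have "(\<integral>\<^sup>+x. ennreal ((cmod (S j x - S k x))^2) \<partial>M) = ennreal (l2sq M (%x. S j x - S k x))"
          unfolding l2sq_def using L2D(2)[OF L2_diff[OF S S]] by (intro nn_integral_eq_integral) auto
        then show ?case using C[OF elim] by (simp add: ennreal_leI)
      qed
    qed simp
    finally show ?thesis .
  qed
  have L: "(%x. f x - S k x) : L2 M" for k
  proof -
    have "(\<integral>\<^sup>+x. ennreal (norm ((cmod (f x - S k x))^2)) \<partial>M) < \<infinity>"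
      using le_less_trans[OF fat[of k] ennreal_less_top] by simp
    then have "integrable M (%x. (cmod (f x - S k x))^2)" by (intro integrableI_bounded) measurable
    then show ?thesis unfolding L2_def by simp
  qed
  have sq: "l2sq M (%x. f x - S k x) \<le> (1/4) ^ k" for k
  proof -
    have "ennreal (l2sq M (%x. f x - S k x)) = (\<integral>\<^sup>+x. ennreal ((cmod (f x - S k x))^2) \<partial>M)"
      unfolding l2sq_def using L2D(2)[OF L] by (intro nn_integral_eq_integral[symmetric]) auto
    then have "ennreal (l2sq M (%x. f x - S k x)) \<le> ennreal ((1/4) ^ k)" using fat[of k] by simp
    moreover have "0 \<le> (1/4::real) ^ k" by simp
    ultimately show ?thesis using ennreal_le_iff by blast
  qed
  have "(%k. (1/4::real) ^ k) \<longlonglongrightarrow> 0" by (rule LIMSEQ_power_zero) simp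
  then have "(%k. l2sq M (%x. f x - S k x)) \<longlonglongrightarrow> 0"
    by (rule Lim_null_comparison[rotated]) (rule always_eventually, rule allI, simp add: l2sq_nonneg sq)
  moreover have "f : L2 M" using L2_add[OF L[of 0] S[of 0]] by simp
  ultimately show ?thesis by blast
qed

text \<open>The vectors are not normalized: r i is the reciprocal of the squared norm, matching
  r_lambda. Completeness is expressed as triviality of the orthogonal complement.\<close>

locale orthogonal_system = finite_measure M for M :: "'x measure" +
  fixes I :: "'i set" and e :: "'i => 'x => complex" and r :: "'i => real"
  assumes countable_I: "countable I" and e_L2: "i : I ==> e i : L2 M"
    and r_pos: "i : I ==> 0 < r i"
    and e_orth: "i : I ==> j : I ==> i ~= j ==> l2ip M (e i) (e j) = 0"
    and e_norm: "i : I ==> l2ip M (e i) (e i) = of_real (1 / r i)"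
    and total: "f : L2 M ==> (!!i. i : I ==> l2ip M f (e i) = 0) ==> AE x in M. f x = 0"
begin

definition PS :: "('i => complex) => 'i set => 'x => complex" where
  "PS c F x = (\<Sum>i\<in>F. of_real (r i) * c i * e i x)"

lemma PS_L2: "F \<subseteq> I ==> PS c F : L2 M"
  unfolding PS_def[abs_def] by (rule L2_sum, rule L2_scale, rule e_L2) blast

lemma l2ip_PS:
  assumes "F \<subseteq> I" "g : L2 M"
  shows "l2ip M (PS c F) g = (\<Sum>i\<in>F. of_real (r i) * c i * l2ip M (e i) g)"
proof -
  have "l2ip M (PS c F) g = (\<Sum>i\<in>F. l2ip M (%x. of_real (r i) * c i * e i x) g)"
    unfolding PS_def[abs_def] by (rule l2ip_sum_left[OF L2_scale[OF e_L2] assms(2)]) (use assms in auto)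
  then show ?thesis unfolding l2ip_scale_left .
qed

lemma l2ip_PS_e:
  assumes "finite F" "F \<subseteq> I" "j : I"
  shows "l2ip M (PS c F) (e j) = (if j : F then c j else 0)"
proof -
  have "l2ip M (PS c F) (e j) = (\<Sum>i\<in>F. if i = j then c j else 0)"
    unfolding l2ip_PS[OF assms(2) e_L2[OF assms(3)]]
  proof (rule sum.cong[OF refl])
    fix i assume "i : F"
    then have i: "i : I" using assms by blast
    show "of_real (r i) * c i * l2ip M (e i) (e j) = (if i = j then c j else 0)"
      using e_orth[OF i assms(3)] e_norm[OF i] r_pos[OF i] by (auto simp: field_simps)
  qed
  then show ?thesis using assms by simp
qed

lemma l2sq_PS:
  assumes "finite F" "F \<subseteq> I"
  shows "l2sq M (PS c F) = (\<Sum>i\<in>F. r i * (cmod (c i))^2)"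
proof -
  have "l2ip M (PS c F) (PS c F) = (\<Sum>i\<in>F. of_real (r i) * c i * l2ip M (e i) (PS c F))"
    by (rule l2ip_PS[OF assms(2) PS_L2[OF assms(2)]])
  also have "... = (\<Sum>i\<in>F. of_real (r i * (cmod (c i))^2))"
  proof (rule sum.cong[OF refl])
    fix i assume i: "i : F"
    then have "l2ip M (PS c F) (e i) = c i" using l2ip_PS_e[OF assms, of i] assms by auto
    then have "l2ip M (e i) (PS c F) = cnj (c i)" by (metis l2ip_cnj)
    then show "of_real (r i) * c i * l2ip M (e i) (PS c F) = of_real (r i * (cmod (c i))^2)"
      unfolding of_real_mult complex_norm_square by (simp add: mult.assoc)
  qed
  finally show ?thesis unfolding l2ip_self of_real_sum[symmetric] of_real_eq_iff .
qed

lemma bessel: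
  assumes f: "f : L2 M" and F: "finite F" "F \<subseteq> I"
  shows "(\<Sum>i\<in>F. r i * (cmod (l2ip M f (e i)))^2) \<le> l2sq M f"
proof -
  define c where "c i = l2ip M f (e i)" for i
  let ?S = "PS c F" and ?a = "\<Sum>i\<in>F. r i * (cmod (c i))^2"
  have S: "?S : L2 M" using PS_L2 F by blast
  have "l2ip M ?S f = (\<Sum>i\<in>F. of_real (r i * (cmod (c i))^2))"
    unfolding l2ip_PS[OF F(2) f]
  proof (rule sum.cong[OF refl])
    fix i
    have "l2ip M (e i) f = cnj (c i)" unfolding c_def l2ip_cnj ..
    then show "of_real (r i) * c i * l2ip M (e i) f = of_real (r i * (cmod (c i))^2)" unfolding of_real_mult complex_norm_square by (simp add: mult.assoc)
  qed
  then have Sf: "l2ip M ?S f = of_real ?a" by simp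
  then have fS: "l2ip M f ?S = of_real ?a" by (metis l2ip_cnj complex_cnj_complex_of_real)
  have SS: "l2ip M ?S ?S = of_real ?a" unfolding l2ip_self l2sq_PS[OF F] ..
  have D: "(%x. f x - ?S x) : L2 M" by (rule L2_diff[OF f S])
  have "l2ip M (%x. f x - ?S x) ?S = 0" unfolding l2ip_diff_left[OF f S S] fS SS by simp
  then have z: "l2ip M ?S (%x. f x - ?S x) = 0" by (metis l2ip_cnj complex_cnj_zero)
  have "l2ip M f (%x. f x - ?S x) = cnj (l2ip M (%x. f x - ?S x) f)" unfolding l2ip_cnj ..
  also have "... = of_real (l2sq M f - ?a)" unfolding l2ip_diff_left[OF f S f] l2ip_self Sf by simp
  finally have "of_real (l2sq M (%x. f x - ?S x)) = (of_real (l2sq M f - ?a) :: complex)"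
    unfolding l2ip_self[symmetric] l2ip_diff_left[OF f S D] z by simp
  then have "l2sq M (%x. f x - ?S x) = l2sq M f - ?a" unfolding of_real_eq_iff .
  then show ?thesis using l2sq_nonneg[of M "%x. f x - ?S x"] by (simp add: c_def)
qed

lemma coefficients_summable:
  assumes f: "f : L2 M"
  shows "(%i. r i * (cmod (l2ip M f (e i)))^2) summable_on I"
  using bessel[OF f] r_pos by (intro nonneg_bdd_above_summable_on bdd_aboveI2[where M = "l2sq M f"]) (auto intro!: mult_nonneg_nonneg intro: less_imp_le)

text \<open>A sequence of finite sets is extracted whose partial sums converge at the rate (1/4)^k
  that \<open>L2_rapid_limit\<close> asks for.\<close>

lemma riesz_fischer_sets:
  assumes c: "(%i. r i * (cmod (c i))^2) summable_on I"
  shows "\<exists>f\<in>L2 M. \<exists>T. filterlim T (finite_subsets_at_top I) sequentially \<and> (\<forall>k. finite (T k) \<and> T k \<subseteq> I) \<and>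
    (%k. l2sq M (%x. f x - PS c (T k) x)) \<longlonglongrightarrow> 0"
proof -
  let ?a = "%i. r i * (cmod (c i))^2"
  have ann: "0 \<le> ?a i" if "i : I" for i using r_pos[OF that] by simp
  have "\<exists>X. finite X \<and> X \<subseteq> I \<and> (\<forall>Y. finite Y --> Y \<subseteq> I --> Y \<inter> X = {} --> sum ?a Y \<le> (1/4) ^ k)" for k
  proof -
    have "(sum ?a \<longlongrightarrow> infsum ?a I) (finite_subsets_at_top I)" using has_sum_infsum[OF c] unfolding has_sum_def .
    then have "eventually (%X. infsum ?a I - (1/4) ^ k < sum ?a X) (finite_subsets_at_top I)" by (rule order_tendstoD) simp
    then obtain X where X: "finite X" "X \<subseteq> I" "infsum ?a I - (1/4) ^ k < sum ?a X"
      unfolding eventually_finite_subsets_at_top by blast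
    have "sum ?a Y \<le> (1/4) ^ k" if Y: "finite Y" "Y \<subseteq> I" "Y \<inter> X = {}" for Y
    proof -
      have "sum ?a Y + sum ?a X = sum ?a (Y \<union> X)" using Y X by (intro sum.union_disjoint[symmetric]) auto
      also have "... \<le> infsum ?a I" using Y X ann by (intro finite_sum_le_infsum[OF c]) auto
      finally show ?thesis using X(3) by linarith
    qed
    then show ?thesis using X by blast
  qed
  then have "\<forall>k. \<exists>X. finite X \<and> X \<subseteq> I \<and> (\<forall>Y. finite Y --> Y \<subseteq> I --> Y \<inter> X = {} --> sum ?a Y \<le> (1/4) ^ k)" by (rule allI)
  from choice[OF this] obtain X where X0: "\<forall>k. finite (X k) \<and> X k \<subseteq> I \<and> (\<forall>Y. finite Y --> Y \<subseteq> I --> Y \<inter> X k = {} --> sum ?a Y \<le> (1/4) ^ k)"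
    by (rule exE)
  have X: "!!k. finite (X k)" "!!k. X k \<subseteq> I" "!!k Y. finite Y ==> Y \<subseteq> I ==> Y \<inter> X k = {} ==> sum ?a Y \<le> (1/4) ^ k"
    by (rule X0[THEN spec, THEN conjunct1], rule X0[THEN spec, THEN conjunct2, THEN conjunct1],
        rule X0[THEN spec, THEN conjunct2, THEN conjunct2, rule_format])
  \<comment> \<open>The sets X l give the rate; the second part, from an enumeration of I, makes T
    exhaust I so that every coefficient is eventually included.\<close>
  define T where "T k = (\<Union>l\<le>k. X l) \<union> {i\<in>I. to_nat_on I i < k}" for k
  have fT: "finite (T k)" for k
  proof -
    have "finite {i\<in>I. to_nat_on I i < k}"
    proof (rule finite_imageD[of "to_nat_on I"])
      show "finite (to_nat_on I ` {i\<in>I. to_nat_on I i < k})" by (rule finite_subset[of _ "{..<k}"]) auto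
      show "inj_on (to_nat_on I) {i\<in>I. to_nat_on I i < k}" by (rule inj_on_subset[OF inj_on_to_nat_on[OF countable_I]]) auto
    qed
    then show ?thesis using X(1) by (simp add: T_def)
  qed
  have TI: "T k \<subseteq> I" for k using X(2) by (auto simp: T_def)
  have Tm: "k \<le> j ==> T k \<subseteq> T j" for k j by (force simp: T_def)
  have XT: "X k \<subseteq> T k" for k by (auto simp: T_def)
  have Tlim: "filterlim T (finite_subsets_at_top I) sequentially"
    unfolding filterlim_finite_subsets_at_top
  proof (intro allI impI)
    fix Y assume Y: "finite Y \<and> Y \<subseteq> I"
    then have "finite (to_nat_on I ` Y)" by blast
    then obtain n where n: "\<forall>y\<in>Y. to_nat_on I y < n" using finite_nat_set_iff_bounded by (metis imageI)
    show "eventually (%k. finite (T k) \<and> Y \<subseteq> T k \<and> T k \<subseteq> I) sequentially"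
      using eventually_ge_at_top[of n]
    proof eventually_elim
      case (elim k)
      have "Y \<subseteq> T k" using Y n elim by (force simp: T_def)
      then show ?case using fT TI by blast
    qed
  qed
  have C: "l2sq M (%x. PS c (T j) x - PS c (T k) x) \<le> (1/4) ^ k" if "k \<le> j" for j k
  proof -
    have "(%x. PS c (T j) x - PS c (T k) x) = PS c (T j - T k)"
      unfolding PS_def by (rule ext) (rule sum_diff[OF fT Tm[OF that], symmetric])
    moreover have "l2sq M (PS c (T j - T k)) = sum ?a (T j - T k)" using fT TI by (intro l2sq_PS) auto
    moreover have "sum ?a (T j - T k) \<le> (1/4) ^ k" using fT TI XT[of k] by (intro X(3)) auto
    ultimately show ?thesis by simp
  qed
  obtain f where "f : L2 M" "(%k. l2sq M (%x. f x - PS c (T k) x)) \<longlonglongrightarrow> 0"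
    using L2_rapid_limit[of "%k. PS c (T k)", OF PS_L2[OF TI] C] by blast
  then show ?thesis using Tlim fT TI by blast
qed

lemma limit_ip:
  assumes f: "f : L2 M" and g: "g : L2 M" and T: "!!k. T k \<subseteq> I" and 0: "(%k. l2sq M (%x. f x - PS c (T k) x)) \<longlonglongrightarrow> 0"
  shows "(%k. l2ip M (PS c (T k)) g) \<longlonglongrightarrow> l2ip M f g"
proof -
  have "(%k. l2ip M (%x. f x - PS c (T k) x) g) \<longlonglongrightarrow> 0" by (rule l2ip_tendsto_0[OF L2_diff[OF f PS_L2[OF T]] g 0])
  then have "(%k. l2ip M f g - l2ip M (PS c (T k)) g) \<longlonglongrightarrow> 0" unfolding l2ip_diff_left[OF f PS_L2[OF T] g] .
  from tendsto_diff[OF tendsto_const[of "l2ip M f g"] this] show ?thesis by simp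
qed

lemma limit_coefficient:
  assumes f: "f : L2 M" and T: "!!k. finite (T k) \<and> T k \<subseteq> I" "filterlim T (finite_subsets_at_top I) sequentially"
    and 0: "(%k. l2sq M (%x. f x - PS c (T k) x)) \<longlonglongrightarrow> 0" and j: "j : I"
  shows "l2ip M f (e j) = c j"
proof -
  have T1: "!!k. finite (T k)" "!!k. T k \<subseteq> I" using T(1) by blast+
  have "eventually (%k. finite (T k) \<and> {j} \<subseteq> T k \<and> T k \<subseteq> I) sequentially"
    using T(2) j unfolding filterlim_finite_subsets_at_top by blast
  then have "eventually (%k. l2ip M (PS c (T k)) (e j) = c j) sequentially"
    by eventually_elim (simp add: l2ip_PS_e[OF _ _ j])
  then have "(%k. l2ip M (PS c (T k)) (e j)) \<longlonglongrightarrow> c j" by (rule tendsto_eventually)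
  then show ?thesis using limit_ip[OF f e_L2[OF j] T1(2) 0] LIMSEQ_unique by blast
qed

theorem riesz_fischer:
  assumes "(%i. r i * (cmod (c i))^2) summable_on I"
  shows "\<exists>f\<in>L2 M. \<forall>i\<in>I. l2ip M f (e i) = c i"
proof -
  obtain f T where f: "f : L2 M" "filterlim T (finite_subsets_at_top I) sequentially" "!!k. finite (T k) \<and> T k \<subseteq> I"
    "(%k. l2sq M (%x. f x - PS c (T k) x)) \<longlonglongrightarrow> 0" using riesz_fischer_sets[OF assms] by blast
  then show ?thesis using limit_coefficient[OF f(1) f(3) f(2) f(4)] by blast
qed

text \<open>The function h built by Riesz-Fischer from the coefficients of f equals f almost
  everywhere by totality, so partial sums along T converge to f and their pairings with g
  converge.\<close>

theorem parseval:
  assumes f: "f : L2 M" and g: "g : L2 M"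
  shows "((%i. of_real (r i) * l2ip M f (e i) * cnj (l2ip M g (e i))) has_sum l2ip M f g) I"
proof -
  define c where "c i = l2ip M f (e i)" for i
  have c: "(%i. r i * (cmod (c i))^2) summable_on I" unfolding c_def by (rule coefficients_summable[OF f])
  obtain h T where h: "h : L2 M" "filterlim T (finite_subsets_at_top I) sequentially" "!!k. finite (T k) \<and> T k \<subseteq> I"
    "(%k. l2sq M (%x. h x - PS c (T k) x)) \<longlonglongrightarrow> 0" using riesz_fischer_sets[OF c] by blast
  have T: "!!k. T k \<subseteq> I" using h(3) by blast
  have "AE x in M. h x - f x = 0"
  proof (rule total[OF L2_diff[OF h(1) f]])
    fix i assume i: "i : I"
    show "l2ip M (%x. h x - f x) (e i) = 0"
      unfolding l2ip_diff_left[OF h(1) f e_L2[OF i]] limit_coefficient[OF h(1) h(3) h(2) h(4) i] c_def by simp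
  qed
  then have "AE x in M. h x * cnj (g x) = f x * cnj (g x)" by eventually_elim simp
  moreover have "(%x. h x * cnj (g x)) : borel_measurable M" "(%x. f x * cnj (g x)) : borel_measurable M"
    using L2_integrable_mult[OF h(1) g] L2_integrable_mult[OF f g] borel_measurable_integrable by blast+
  ultimately have hf: "l2ip M h g = l2ip M f g" unfolding l2ip_def by (intro integral_cong_AE)
  let ?s = "%i. of_real (r i) * c i * cnj (l2ip M g (e i))"
  have sm: "?s summable_on I"
  proof (rule summable_on_norm_bound(1)[OF summable_on_add[OF c coefficients_summable[OF g]]])
    fix i assume i: "i : I"
    have "norm (?s i) = r i * (cmod (c i) * cmod (l2ip M g (e i)))" using r_pos[OF i] by (simp add: norm_mult)
    also have "... \<le> r i * ((cmod (c i))^2 + (cmod (l2ip M g (e i)))^2)"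
    proof (rule mult_left_mono)
      have "0 \<le> cmod (c i) * cmod (l2ip M g (e i))" by simp
      then show "cmod (c i) * cmod (l2ip M g (e i)) \<le> (cmod (c i))^2 + (cmod (l2ip M g (e i)))^2"
        using sum_squares_bound[of "cmod (c i)" "cmod (l2ip M g (e i))"] by linarith
    qed (use r_pos[OF i] in simp)
    finally show "norm (?s i) \<le> r i * (cmod (c i))^2 + r i * (cmod (l2ip M g (e i)))^2" by (simp add: distrib_left)
  qed
  have "(%k. sum ?s (T k)) \<longlonglongrightarrow> infsum ?s I"
    using filterlim_compose[OF has_sum_infsum[OF sm, unfolded has_sum_def] h(2)] .
  moreover have "(%k. sum ?s (T k)) \<longlonglongrightarrow> l2ip M f g"
    using limit_ip[OF h(1) g T h(4)] unfolding l2ip_PS[OF T g] hf l2ip_cnj .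
  ultimately have "infsum ?s I = l2ip M f g" by (rule LIMSEQ_unique)
  then show ?thesis using has_sum_infsum[OF sm] unfolding c_def by simp
qed

end

section \<open>Completeness of the Heckman--Opdam polynomials\<close>

context heckman_opdam
begin

definition dens :: "'a => real" where "dens x = indicator (A0) x * wt x"

definition nu :: "'a measure" where "nu = density lebesgue (%x. ennreal (dens x))"

text \<open>Members of \<open>L2_m\<close> are controlled on the alcove only. Cutting off to 0
  outside gives measurability on the whole space and leaves \<open>ip_m\<close> unchanged.\<close>

definition restr :: "('a => complex) => 'a => complex" where "restr f x = indicator (A0) x *\<^sub>R f x"

lemma weight_lebesgue [measurable]: "(%x. wt x) : borel_measurable lebesgue"
proof -
  have "(%x. complex_of_real (wt x)) : borel_measurable lebesgue"
    using good_weight borel_lebesgue unfolding good_def by blast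
  from measurable_compose[OF this borel_measurable_Re] show ?thesis by simp
qed

lemma dens_lebesgue [measurable]: "dens : borel_measurable lebesgue"
  unfolding dens_def[abs_def] by measurable

lemma dens_nonneg: "0 \<le> dens x" using weight_nonneg by (simp add: dens_def)

lemma sets_nu: "sets nu = sets lebesgue" and space_nu: "space nu = UNIV" by (simp_all add: nu_def)

lemma borel_nu: "f : borel_measurable nu \<longleftrightarrow> f : borel_measurable lebesgue"
  using measurable_cong_sets[OF sets_nu refl] by blast

lemma integrable_nu:
  fixes f :: "'a => 'b::{banach, second_countable_topology}"
  assumes "f : borel_measurable lebesgue"
  shows "integrable nu f \<longleftrightarrow> integrable lebesgue (%x. dens x *\<^sub>R f x)"
  unfolding nu_def by (rule integrable_density[OF assms dens_lebesgue]) (simp add: dens_nonneg)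

lemma integral_nu:
  fixes f :: "'a => 'b::{banach, second_countable_topology}"
  assumes "f : borel_measurable lebesgue"
  shows "integral\<^sup>L nu f = integral\<^sup>L lebesgue (%x. dens x *\<^sub>R f x)"
  unfolding nu_def by (rule integral_density[OF assms dens_lebesgue]) (simp add: dens_nonneg)

lemma integrable_dens: "integrable lebesgue dens"
proof -
  have "set_integrable lebesgue (A0) (%x. complex_of_real (wt x))" by (rule good_integrable[OF good_weight])
  then have "integrable lebesgue (%x. complex_of_real (dens x))"
    unfolding set_integrable_def dens_def by (simp add: scaleR_conv_of_real)
  then show ?thesis unfolding complex_of_real_integrable_eq .
qed

sublocale nu: finite_measure nu
proof
  have "emeasure nu (space nu) = (\<integral>\<^sup>+x. ennreal (dens x) \<partial>lebesgue)"
    unfolding nu_def by (subst emeasure_density) auto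
  also have "... = ennreal (integral\<^sup>L lebesgue dens)"
    using integrable_dens dens_nonneg by (intro nn_integral_eq_integral) auto
  finally show "emeasure nu (space nu) ~= \<infinity>" by simp
qed

lemma AE_nu: "(AE x in lebesgue. x : A0 --> S x) ==> AE x in nu. S x"
  unfolding nu_def by (subst AE_density) (auto elim!: eventually_mono simp: dens_def indicator_def)

lemma AE_nu_iff: "(AE x in nu. S x) \<longleftrightarrow> (AE x in lebesgue. x : A0 --> S x)"
proof
  assume "AE x in nu. S x"
  then have "AE x in lebesgue. 0 < ennreal (dens x) --> S x" unfolding nu_def by (subst (asm) AE_density) auto
  moreover have "AE x in lebesgue. regular (id x)" by (rule AE_regular_weyl[OF id_W])
  ultimately show "AE x in lebesgue. x : A0 --> S x"
  proof eventually_elim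
    case (elim x)
    then show ?case using weight_pos[of x] by (auto simp: dens_def)
  qed
qed (rule AE_nu)

lemma dens_ip: "dens x *\<^sub>R (f x * cnj (g x)) = indicator (A0) x *\<^sub>R (f x * cnj (g x) * of_real (wt x))"
  by (simp add: dens_def scaleR_conv_of_real)

lemma l2ip_nu:
  assumes "f : borel_measurable lebesgue" "g : borel_measurable lebesgue"
  shows "l2ip nu f g = ipm f g"
proof -
  have "(%x. cnj (g x)) : borel_measurable lebesgue"
    by (rule measurable_compose[OF assms(2) borel_measurable_continuous_onI]) (intro continuous_intros)
  then have "(%x. f x * cnj (g x)) : borel_measurable lebesgue" using assms(1) by measurable
  then show ?thesis unfolding l2ip_def ip_m_def set_lebesgue_integral_def dens_ip[symmetric] by (rule integral_nu)
qed

lemma ip_m_restr: "ipm (restr f) g = ipm f g" "ipm f (restr g) = ipm f g"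
  unfolding ip_m_def set_lebesgue_integral_def restr_def
  by (auto intro!: Bochner_Integration.integral_cong simp: indicator_def)

lemma L2_nu_iff:
  assumes "f : borel_measurable lebesgue"
  shows "f : L2 nu \<longleftrightarrow> f : L2_m Rp m"
proof -
  have "(%x. (cmod (f x))^2) : borel_measurable lebesgue" using assms by measurable
  then have "integrable nu (%x. (cmod (f x))^2) \<longleftrightarrow> set_integrable lebesgue (A0) (%x. (cmod (f x))^2 * wt x)"
    unfolding set_integrable_def by (subst integrable_nu) (simp_all add: dens_def mult_ac)
  moreover have "set_borel_measurable lebesgue (A0) f"
    unfolding set_borel_measurable_def using assms by measurable
  ultimately show ?thesis using assms unfolding L2_def L2_m_def by (simp add: borel_nu)
qed

lemma restr_lebesgue: "f : L2_m Rp m ==> restr f : borel_measurable lebesgue"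
  unfolding L2_m_def set_borel_measurable_def restr_def[abs_def] by simp

lemma restr_L2: assumes f: "f : L2_m Rp m" shows "restr f : L2 nu"
proof -
  have "set_integrable lebesgue (A0) (%x. (cmod (restr f x))^2 * wt x) \<longleftrightarrow>
    set_integrable lebesgue (A0) (%x. (cmod (f x))^2 * wt x)"
    unfolding set_integrable_def by (intro Bochner_Integration.integrable_cong) (auto simp: restr_def indicator_def)
  moreover have "set_borel_measurable lebesgue (A0) (restr f)"
    unfolding set_borel_measurable_def using restr_lebesgue[OF f] by measurable
  ultimately have "restr f : L2_m Rp m" using f unfolding L2_m_def by simp
  then show ?thesis using L2_nu_iff[OF restr_lebesgue[OF f]] by blast
qed

lemma good_L2: "good f ==> f : L2 nu"
proof -
  assume f: "good f"
  have m: "f : borel_measurable lebesgue" using f borel_lebesgue unfolding good_def by blast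
  obtain K where K: "!!x. cmod (f x) \<le> K" using f unfolding good_def by blast
  have "integrable nu (%x. (cmod (f x))^2)"
  proof (rule nu.integrable_const_bound[of _ "K^2"])
    show "AE x in nu. norm ((cmod (f x))^2) \<le> K^2" using K by (intro AE_I2) (simp add: power_mono)
    show "(%x. (cmod (f x))^2) : borel_measurable nu" unfolding borel_nu using m by measurable
  qed
  then show ?thesis using m by (simp add: L2_def borel_nu)
qed

lemma tspan_L2: "f : tspan X ==> f : L2 nu" by (rule good_L2[OF good_tspan])

section \<open>Totality of the polynomials in the weighted L2 space\<close>

lemma sum_weyl_E:
  assumes n: "\<nu> : weights"
  shows "\<exists>\<mu>\<in>Dom. \<exists>c. \<forall>x. (\<Sum>w\<in>W. E \<nu> (w x)) = c * M \<mu> x"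
proof -
  obtain v where v: "v : W" "v \<nu> : Dom" using dominant_rep[OF n] by blast
  let ?\<mu> = "v \<nu>"
  let ?S = "%k x. \<Sum>w\<in>W. E k (w x)"
  have inv: "?S (u k) x = ?S k x" if u: "u : W" for u k x
  proof -
    have b: "bij_betw (%w. inv u \<circ> w) W W"
      by (rule bij_betwI[where g = "%w. u \<circ> w"]) (use u weyl_inv weyl_comp in \<open>auto simp: fun_eq_iff\<close>)
    have "?S (u k) x = (\<Sum>w\<in>W. E k ((inv u \<circ> w) x))"
    proof (rule sum.cong[OF refl])
      fix w
      have "inv (inv u) = u" using u by (metis inv_inv_eq weyl_bij) 
      then show "E (u k) (w x) = E k ((inv u \<circ> w) x)" using E_weyl[OF weyl_inv[OF u], of k "w x"] by simp
    qed
    also have "... = ?S k x" by (rule sum.reindex_bij_betw[OF b, of "%w. E k (w x)"])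
    finally show ?thesis .
  qed
  have "of_nat (card W) * M ?\<mu> x = of_nat (card (orb ?\<mu>)) * ?S \<nu> x" for x
  proof -
    have "of_nat (card W) * M ?\<mu> x = (\<Sum>w\<in>W. M ?\<mu> (w x))" using M_winv[of ?\<mu>] by (simp add: winv_def)
    also have "... = (\<Sum>k\<in>orb ?\<mu>. ?S k x)" unfolding M_def by (rule sum.swap)
    also have "... = (\<Sum>k\<in>orb ?\<mu>. ?S \<nu> x)"
    proof (rule sum.cong[OF refl])
      fix k assume "k : orb ?\<mu>"
      then obtain u where "u : W" "k = u ?\<mu>" by blast
      then show "?S k x = ?S \<nu> x" using inv[of u ?\<mu> x] inv[OF v(1), of \<nu> x] by simp
    qed
    finally show ?thesis by simp
  qed
  moreover have "card (orb ?\<mu>) ~= 0" using finite_orb orb_self by (metis card_0_eq empty_iff)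
  ultimately have "\<forall>x. ?S \<nu> x = (of_nat (card W) / of_nat (card (orb ?\<mu>))) * M ?\<mu> x" by (simp add: field_simps)
  then show ?thesis using v(2) by blast
qed

text \<open>P lam is unitriangular in the orbit sums, so orthogonality transfers to them by
  induction on the size of the lower set.\<close>

lemma orth_M:
  assumes g: "g : L2 nu" and 0: "!!lam. lam : Dom ==> l2ip nu (rphi lam) g = 0" and lam: "lam : Dom"
  shows "l2ip nu (M lam) g = 0"
  using lam
proof (induction "card (low lam)" arbitrary: lam rule: less_induct)
  case less
  note lam = less.prems
  let ?A = "low lam"
  have MinL2: "M ka : L2 nu" if "ka : ?A" for ka using tspan_L2[OF M_tspan] .
  obtain p where p: "p > 0" "!!x. rphi lam x = P lam x / of_real p" using phi_P[OF lam] by blast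
  have "P lam = (%x. of_real p * rphi lam x)" unfolding p(2) using p(1) by (simp add: fun_eq_iff)
  then have "l2ip nu (P lam) g = 0" unfolding l2ip_scale_left using 0[OF lam] by (simp add: l2ip_scale_left)
  moreover have "l2ip nu (P lam) g = (\<Sum>ka\<in>?A. of_real (hc lam ka) * l2ip nu (M ka) g)"
  proof -
    have "l2ip nu (P lam) g = (\<Sum>ka\<in>?A. l2ip nu (%x. of_real (hc lam ka) * M ka x) g)"
      unfolding P_def[abs_def] by (rule l2ip_sum_left[OF L2_scale[OF MinL2] g])
    then show ?thesis unfolding l2ip_scale_left .
  qed
  moreover have "(\<Sum>ka\<in>?A. of_real (hc lam ka) * l2ip nu (M ka) g) = (\<Sum>ka\<in>?A. if ka = lam then l2ip nu (M lam) g else 0)"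
  proof (rule sum.cong[OF refl])
    fix ka assume k: "ka : ?A"
    show "of_real (hc lam ka) * l2ip nu (M ka) g = (if ka = lam then l2ip nu (M lam) g else 0)"
    proof (cases "ka = lam")
      case False
      have kd: "ka : Dom" using lower_dominant[OF k] .
      have "low ka \<subset> ?A"
      proof (rule psubsetI)
        show "low ka \<subseteq> ?A" using lower_trans[OF _ k] by blast
        have "lam \<notin> low ka" using lower_norm(1)[OF _ kd, of lam] lower_norm(2)[OF k lam False] by auto
        then show "low ka ~= ?A" using lower_self[OF lam] by blast
      qed
      then have "l2ip nu (M ka) g = 0" using less.hyps[OF psubset_card_mono[OF finite_lower[OF lam]] kd] by blast
      then show ?thesis using False by simp
    qed (simp add: hc(1)[OF lam])
  qed
  ultimately show ?case using finite_lower[OF lam] lower_self[OF lam] by simp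
qed

text \<open>\<open>card W\<close> times h is the sum of its Weyl translates, and this symmetrization
  turns each exponential of h into a multiple of an orbit sum.\<close>

lemma orth_winv:
  assumes g: "g : L2 nu" and 0: "!!lam. lam : Dom ==> l2ip nu (M lam) g = 0"
    and h: "h : tspan weights" "winv h"
  shows "l2ip nu h g = 0"
proof -
  have "l2ip nu (%x. \<Sum>w\<in>W. h (w x)) g = 0" using h(1)
  proof induction
    case tspan_zero
    then show ?case by (simp add: l2ip_def)
  next
    case (tspan_step f n c)
    obtain \<mu> d where md: "\<mu> : Dom" "!!x. (\<Sum>w\<in>W. E n (w x)) = d * M \<mu> x" using sum_weyl_E[OF tspan_step.hyps(2)] by blast
    have fL: "(%x. \<Sum>w\<in>W. f (w x)) : L2 nu"
      by (rule L2_sum, rule tspan_L2[of _ weights], rule tspan_weights_weyl[OF _ tspan_step.hyps(1)])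
    have mL: "(%x. - (c * d) * M \<mu> x) : L2 nu" by (rule L2_scale[OF tspan_L2[OF M_tspan]])
    have eq: "(%x. \<Sum>w\<in>W. f (w x) + c * E n (w x)) = (%x. (\<Sum>w\<in>W. f (w x)) - (- (c * d)) * M \<mu> x)"
      by (simp add: sum.distrib sum_distrib_left[symmetric] md(2) mult.assoc)
    show ?case unfolding eq l2ip_diff_left[OF fL mL g] l2ip_scale_left tspan_step.IH 0[OF md(1)] by simp
  qed
  moreover have "(%x. \<Sum>w\<in>W. h (w x)) = (%x. of_nat (card W) * h x)" using h(2) by (simp add: winv_def)
  ultimately show ?thesis using card_W_pos by (simp add: l2ip_scale_left)
qed

definition invpoly :: "('a => real) set" where
  "invpoly = {f. (%x. complex_of_real (f x)) : tspan weights \<and> (\<forall>w\<in>W. \<forall>x. f (w x) = f x)}"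

lemma E_separates:
  assumes "!!\<nu>. \<nu> : weights ==> E \<nu> x = E \<nu> y"
  shows "\<exists>q\<in>Q. y = x + pi *\<^sub>R q"
proof -
  have "\<exists>k::int. \<nu> \<bullet> (y - x) = 2 * of_int k * pi" if n: "\<nu> : weights" for \<nu>
  proof -
    have "exp (\<i> * of_real (\<nu> \<bullet> y)) = exp (\<i> * of_real (\<nu> \<bullet> x))" using assms[OF n] by (simp add: E_def)
    then obtain k :: int where "\<i> * of_real (\<nu> \<bullet> y) = \<i> * of_real (\<nu> \<bullet> x) + of_int (2 * k) * pi * \<i>" unfolding exp_eq by blast
    then have "Im (\<i> * of_real (\<nu> \<bullet> y)) = Im (\<i> * of_real (\<nu> \<bullet> x) + of_int (2 * k) * pi * \<i>)" by (rule arg_cong)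
    then have "\<nu> \<bullet> (y - x) = 2 * of_int k * pi" by (simp add: inner_diff_right)
    then show ?thesis by blast
  qed
  then obtain q where "q : Q" "y - x = pi *\<^sub>R q" using weights_bidual by blast
  then show ?thesis by (intro bexI[of _ q]) (auto simp: algebra_simps)
qed

text \<open>The separating function is a product over the Weyl group of translates of a sum of squares
  that vanishes at \<open>y\<close> but nowhere on the orbit of \<open>x\<close>.\<close>
lemma invpoly_separates:
  assumes xy: "x : A0" "y : A0" "x ~= y"
  shows "\<exists>f\<in>invpoly. f x ~= f y"
proof -
  have "\<exists>\<nu>\<in>weights. E \<nu> (w x) ~= E \<nu> y" if w: "w : W" for w
  proof (rule ccontr)
    assume "\<not> ?thesis"
    then obtain q where q: "q : Q" "y = w x + pi *\<^sub>R q" using E_separates[of "w x" y] by blast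
    then show False using alcove_unique[OF xy(1) w q(1)] xy(2,3) by simp
  qed
  then have "\<forall>w\<in>W. \<exists>\<nu>. \<nu> : weights \<and> E \<nu> (w x) ~= E \<nu> y" by blast
  from bchoice[OF this] obtain n where n: "!!w. w : W ==> n w : weights" "!!w. w : W ==> E (n w) (w x) ~= E (n w) y" by blast
  define U where "U z = (\<Sum>w\<in>W. (cmod (E (n w) z - E (n w) y))^2)" for z
  define f where "f z = (\<Prod>v\<in>W. U (v z))" for z
  have Ut: "(%z. complex_of_real (U z)) : tspan weights"
    unfolding U_def of_real_sum complex_norm_square
  proof (rule tspan_sum)
    fix w assume w: "w : W"
    have c: "(%z. E (n w) z - E (n w) y) : tspan weights"
      using tspan_diff[OF tspan_E[OF n(1)[OF w]] tspan_scaleE[OF weights_arith(1), of "E (n w) y"]] by (simp add: E_simps(1))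
    show "(%z. (E (n w) z - E (n w) y) * cnj (E (n w) z - E (n w) y)) : tspan weights"
      by (rule tspan_weights_mult[OF c tspan_weights_cnj[OF c]])
  qed
  have "(%z. \<Prod>v\<in>F. complex_of_real (U (v z))) : tspan weights" if "finite F" "F \<subseteq> W" for F
    using that
  proof (induction F rule: finite_induct)
    case empty
    then show ?case using tspan_scaleE[OF weights_arith(1), of 1] by (simp add: E_simps(1))
  next
    case (insert v F)
    then show ?case using tspan_weights_mult[OF tspan_weights_weyl[OF _ Ut, of v]] by simp
  qed
  from this[OF finite_W subset_refl] have ft: "(%z. complex_of_real (f z)) : tspan weights" by (simp add: f_def)
  have fw: "f (w z) = f z" if w: "w : W" for w z
  proof -
    have b: "bij_betw (%v. v \<circ> w) W W"
      by (rule bij_betwI[where g = "%v. v \<circ> inv w"]) (use w weyl_inv weyl_comp in \<open>auto simp: fun_eq_iff\<close>)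
    have "f (w z) = (\<Prod>v\<in>W. U ((v \<circ> w) z))" by (simp add: f_def)
    also have "... = f z" unfolding f_def by (rule prod.reindex_bij_betw[OF b, of "%v. U (v z)"])
    finally show ?thesis .
  qed
  have "U (id y) = 0" by (simp add: U_def)
  then have "f y = 0" unfolding f_def by (intro prod_zero finite_W bexI[of _ id] id_W)
  moreover have "f x ~= 0"
  proof -
    have "U (v x) ~= 0" if v: "v : W" for v
    proof -
      have "0 < (cmod (E (n v) (v x) - E (n v) y))^2" using n(2)[OF v] by simp
      also have "... \<le> U (v x)" unfolding U_def using finite_W v by (intro member_le_sum) auto
      finally show ?thesis by simp
    qed
    then show ?thesis unfolding f_def using finite_W by simp
  qed
  ultimately show ?thesis using ft fw by (intro bexI[of _ f]) (auto simp: invpoly_def)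
qed

lemma invpoly_ring: "function_ring_on invpoly (A0)"
proof
  show "compact (A0)" by (rule compact_alcove)
  show "continuous_on (A0) f" if "f : invpoly" for f
  proof -
    have "(%x. complex_of_real (f x)) : tspan weights" using that unfolding invpoly_def by blast
    then have "continuous_on (A0) (%x. complex_of_real (f x))" by (rule tspan_continuous)
    from continuous_on_Re[OF this] show ?thesis by simp
  qed
  show "(%x. f x + g x) : invpoly" "(%x. f x * g x) : invpoly" if "f : invpoly" "g : invpoly" for f g
    using that tspan_add[of "%x. complex_of_real (f x)" weights "%x. complex_of_real (g x)"]
      tspan_weights_mult[of "%x. complex_of_real (f x)" "%x. complex_of_real (g x)"] by (auto simp: invpoly_def)
  show "(%_. c) : invpoly" for c
    using tspan_scaleE[OF weights_arith(1), of "complex_of_real c"] by (simp add: invpoly_def E_simps(1))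
  show "\<exists>f\<in>invpoly. f x ~= f y" if "x : A0" "y : A0" "x ~= y" for x y using invpoly_separates that .
qed

text \<open>An invariant polynomial approximates F uniformly on the alcove and is orthogonal to g.
  Since nu lives on the alcove and g is integrable, the pairing with F is arbitrarily small.\<close>

lemma orth_continuous:
  assumes g: "g : L2 nu" and 0: "!!lam. lam : Dom ==> l2ip nu (M lam) g = 0"
    and F: "continuous_on UNIV F" "!!x. \<bar>F x\<bar> \<le> (1::real)"
  shows "l2ip nu (%x. of_real (F x)) g = 0"
proof (rule ccontr)
  assume nz: "l2ip nu (%x. of_real (F x)) g ~= 0"
  interpret ring: function_ring_on invpoly "A0" by (rule invpoly_ring)
  have FL: "(%x. complex_of_real (F x)) : L2 nu"
  proof (rule good_L2, rule goodI)
    have "continuous_on UNIV (%x. complex_of_real (F x))" using F(1) by (intro continuous_intros)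
    then show "(%x. complex_of_real (F x)) : borel_measurable borel" by (rule borel_measurable_continuous_onI)
    show "norm (complex_of_real (F x)) \<le> 1" for x using F(2) by simp
  qed
  define G where "G = (LINT x|nu. cmod (g x))"
  have gi: "integrable nu (%x. cmod (g x))" by (rule nu.L1_le_L2(1)[OF g zero_less_one])
  have G0: "0 \<le> G" unfolding G_def by (rule integral_nonneg_AE) auto
  define ep where "ep = cmod (l2ip nu (%x. of_real (F x)) g) / (G + 1)"
  have e: "0 < ep" using nz G0 by (simp add: ep_def)
  obtain f where f: "f : invpoly" "!!x. x : A0 ==> \<bar>F x - f x\<bar> < ep"
    using ring.Stone_Weierstrass_basic[OF continuous_on_subset[OF F(1)] e] by blast
  have ft: "(%x. complex_of_real (f x)) : tspan weights" "winv (%x. complex_of_real (f x))" using f(1) by (auto simp: invpoly_def winv_def)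
  have fL: "(%x. complex_of_real (f x)) : L2 nu" using tspan_L2 ft(1) by blast
  have dL: "(%x. complex_of_real (F x) - complex_of_real (f x)) : L2 nu" by (rule L2_diff[OF FL fL])
  have f0: "l2ip nu (%x. complex_of_real (f x)) g = 0" by (rule orth_winv[OF g _ ft]) (rule 0)
  have "l2ip nu (%x. of_real (F x)) g = l2ip nu (%x. of_real (F x) - of_real (f x)) g"
    unfolding l2ip_diff_left[OF FL fL g] f0 by simp
  also have "cmod ... \<le> (LINT x|nu. cmod ((of_real (F x) - of_real (f x)) * cnj (g x)))" unfolding l2ip_def by (rule integral_norm_bound)
  also have "... \<le> (LINT x|nu. ep * cmod (g x))"
  proof (rule integral_mono_AE)
    show "integrable nu (%x. cmod ((of_real (F x) - of_real (f x)) * cnj (g x)))" by (rule integrable_norm[OF L2_integrable_mult[OF dL g]])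
    show "integrable nu (%x. ep * cmod (g x))" using gi by simp
    show "AE x in nu. cmod ((of_real (F x) - of_real (f x)) * cnj (g x)) \<le> ep * cmod (g x)"
    proof (rule AE_nu, rule AE_I2, rule impI)
      fix x assume "x : A0"
      then have "\<bar>F x - f x\<bar> \<le> ep" using f(2) less_imp_le by blast
      then have "cmod (of_real (F x) - of_real (f x)) \<le> ep" by (metis norm_of_real of_real_diff)
      then show "cmod ((of_real (F x) - of_real (f x)) * cnj (g x)) \<le> ep * cmod (g x)"
        unfolding norm_mult complex_mod_cnj by (rule mult_right_mono) simp
    qed
  qed
  also have "... = ep * G" unfolding G_def using gi by simp
  also have "... < ep * (G + 1)" using e by simp
  also have "... = cmod (l2ip nu (%x. of_real (F x)) g)" using G0 by (simp add: ep_def)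
  finally show False by simp
qed

text \<open>The continuous functions max 0 (1 - n dist (x, C)) are bounded by 1 and tend to the
  indicator of C pointwise, as C is closed.\<close>

lemma orth_closed:
  assumes g: "g : L2 nu" and 0: "!!lam. lam : Dom ==> l2ip nu (M lam) g = 0" and C: "closed C"
  shows "(LINT x:C|nu. cnj (g x)) = 0"
proof (cases "C = {}")
  case False
  define F where "F n x = max 0 (1 - real n * infdist x C)" for n x
  have Fc: "continuous_on UNIV (F n)" for n unfolding F_def by (intro continuous_intros)
  have Fb: "\<bar>F n x\<bar> \<le> 1" for n x using infdist_nonneg[of x C] by (auto simp: F_def abs_if max_def)
  have z: "(LINT x|nu. of_real (F n x) * cnj (g x)) = 0" for n
    using orth_continuous[OF g 0 Fc Fb] unfolding l2ip_def .
  have gi: "integrable nu (%x. cmod (g x))" by (rule nu.L1_le_L2(1)[OF g zero_less_one])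
  have gm: "(%x. cnj (g x)) : borel_measurable nu"
    by (rule measurable_compose[OF L2D(1)[OF g] borel_measurable_continuous_onI]) (intro continuous_intros)
  have Cs: "C : sets nu" unfolding sets_nu using C by (simp add: lebesgue_closedin)
  have "(%n. LINT x|nu. of_real (F n x) * cnj (g x)) \<longlonglongrightarrow> (LINT x|nu. indicator C x *\<^sub>R cnj (g x))"
  proof (rule integral_dominated_convergence[where w = "%x. cmod (g x)"])
    show "(%x. indicator C x *\<^sub>R cnj (g x)) : borel_measurable nu" using gm Cs by measurable
    show "(%x. of_real (F n x) * cnj (g x)) : borel_measurable nu" for n
    proof -
      have "F n : borel_measurable nu" unfolding borel_nu by (rule borel_lebesgue[OF borel_measurable_continuous_onI[OF Fc]])
      then show ?thesis using gm by measurable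
    qed
    show "AE x in nu. cmod (of_real (F n x) * cnj (g x)) \<le> cmod (g x)" for n
      using Fb[of n] by (intro AE_I2) (simp add: norm_mult mult_left_le_one_le)
    show "AE x in nu. (%n. of_real (F n x) * cnj (g x)) \<longlonglongrightarrow> indicator C x *\<^sub>R cnj (g x)"
    proof (rule AE_I2)
      fix x
      have "(%n. F n x) \<longlonglongrightarrow> indicator C x"
      proof (cases "x : C")
        case True
        then show ?thesis by (simp add: F_def)
      next
        case x: False
        then have d: "infdist x C > 0" using in_closed_iff_infdist_zero[OF C False] infdist_nonneg[of x C] by (metis less_eq_real_def)
        obtain N :: nat where N: "1 / infdist x C < real N" using reals_Archimedean2 by blast
        have "F n x = 0" if "n \<ge> N" for n
        proof -
          have "1 / infdist x C < real n" using N that by simp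
          then have "1 < real n * infdist x C" using d by (simp add: field_simps)
          then show ?thesis by (simp add: F_def)
        qed
        then have "eventually (%n. F n x = 0) sequentially" unfolding eventually_sequentially by blast
        then show ?thesis using x by (simp add: tendsto_eventually)
      qed
      then have "(%n. complex_of_real (F n x) * cnj (g x)) \<longlonglongrightarrow> complex_of_real (indicator C x) * cnj (g x)"
        by (intro tendsto_mult tendsto_of_real tendsto_const)
      then show "(%n. of_real (F n x) * cnj (g x)) \<longlonglongrightarrow> indicator C x *\<^sub>R cnj (g x)" by (simp add: scaleR_conv_of_real)
    qed
  qed (rule gi)
  then have "(%n. 0) \<longlonglongrightarrow> (LINT x|nu. indicator C x *\<^sub>R cnj (g x))" unfolding z .
  then show ?thesis unfolding set_lebesgue_integral_def using LIMSEQ_const_iff by metis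
qed (simp add: set_lebesgue_integral_def)

text \<open>A Lebesgue set is, up to a null set, a countable union of closed sets. So the integrals
  of the conjugate of g vanish over all measurable sets once they vanish over closed ones.\<close>

lemma nu_total:
  assumes g: "g : L2 nu" and 0: "!!lam. lam : Dom ==> l2ip nu g (rphi lam) = 0"
  shows "AE x in nu. g x = 0"
proof -
  have c0: "l2ip nu (rphi lam) g = 0" if "lam : Dom" for lam
    using 0[OF that] by (metis l2ip_cnj complex_cnj_zero)
  have M0: "l2ip nu (M lam) g = 0" if "lam : Dom" for lam by (rule orth_M[OF g c0 that])
  have gm: "(%x. cnj (g x)) : borel_measurable nu"
    by (rule measurable_compose[OF L2D(1)[OF g] borel_measurable_continuous_onI]) (intro continuous_intros)
  have gi: "integrable nu (%x. cnj (g x))"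
    by (rule Bochner_Integration.integrable_bound[OF nu.L1_le_L2(1)[OF g zero_less_one] gm]) simp
  have "AE x in nu. cnj (g x) = 0"
  proof (rule nu.density_zero[OF gi])
    fix A assume "A : sets nu"
    then have A: "A : sets lebesgue" by (simp add: sets_nu)
    obtain C T where CT: "fsigma C" "T : null_sets lebesgue" "C \<union> T = A" "disjnt C T" using lebesgue_set_almost_fsigma[OF A] by blast
    obtain K :: "nat => 'a set" where K: "!!n. closed (K n)" "C = (\<Union>n. K n)" using CT(1) by (auto elim: fsigma.cases)
    define B where "B n = (\<Union>i\<le>n. K i)" for n
    have Bc: "closed (B n)" for n unfolding B_def using K by (intro closed_UN) auto
    have BC: "(\<Union>n. B n) = C" unfolding B_def K(2) by blast
    have Bs: "B n : sets nu" for n using Bc by (simp add: sets_nu lebesgue_closedin)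
    have "incseq B" unfolding B_def incseq_def by force
    moreover have "set_integrable nu (\<Union>n. B n) (%x. cnj (g x))"
      unfolding set_integrable_def by (rule integrable_mult_indicator[OF _ gi]) (use Bs in blast)
    ultimately have "(%n. LINT x:B n|nu. cnj (g x)) \<longlonglongrightarrow> (LINT x:(\<Union>n. B n)|nu. cnj (g x))"
      by (intro set_integral_cont_up Bs)
    moreover have "(LINT x:B n|nu. cnj (g x)) = 0" for n by (rule orth_closed[OF g _ Bc]) (rule M0)
    ultimately have "(%n. 0) \<longlonglongrightarrow> (LINT x:C|nu. cnj (g x))" unfolding BC by simp
    then have C0: "(LINT x:C|nu. cnj (g x)) = 0" using LIMSEQ_const_iff by metis
    have Cs: "C : sets nu" using Bs BC by blast
    have "AE x in lebesgue. x \<notin> T" by (rule AE_not_in[OF CT(2)])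
    then have "AE x in nu. x \<notin> T" by (intro AE_nu) (auto elim!: eventually_mono)
    then have "AE x in nu. indicator A x *\<^sub>R cnj (g x) = indicator C x *\<^sub>R cnj (g x)"
      by eventually_elim (use CT(3) in \<open>auto simp: indicator_def\<close>)
    then have "(LINT x:A|nu. cnj (g x)) = (LINT x:C|nu. cnj (g x))"
      unfolding set_lebesgue_integral_def using gm Cs \<open>A : sets nu\<close>
      by (intro integral_cong_AE borel_measurable_scaleR borel_measurable_indicator)
    then show "(LINT x:A|nu. cnj (g x)) = 0" using C0 by simp
  qed
  then show ?thesis by simp
qed

lemma phi_L2: "lam : Dom ==> (rphi lam) : L2 nu" by (rule good_L2[OF phi_good])

lemma phi_lebesgue: "lam : Dom ==> (rphi lam) : borel_measurable lebesgue"
  using L2D(1)[OF phi_L2] by (simp add: borel_nu)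

sublocale HO: orthogonal_system nu "Dom" "rphi" "rc"
proof
  show "countable (Dom)" using countable_subset[OF _ countable_weights] dominant_weights by blast
  show "l2ip nu (rphi i) (rphi j) = 0" if "i : Dom" "j : Dom" "i ~= j" for i j
    using phi_orthogonal[OF that] l2ip_nu[OF phi_lebesgue phi_lebesgue] that by simp
  show "l2ip nu (rphi i) (rphi i) = of_real (1 / rc i)" if i: "i : Dom" for i
    unfolding l2ip_nu[OF phi_lebesgue[OF i] phi_lebesgue[OF i]] r_coef_def phi_norm_integral(2)[OF i] by simp
  show "AE x in nu. f x = 0" if "f : L2 nu" "!!i. i : Dom ==> l2ip nu f (rphi i) = 0" for f
    using nu_total that .
qed (use phi_L2 r_coef_pos in auto)

end

section \<open>The identity principle on the complexification\<close>

lemma entire_zero_on_real_interval: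
  assumes k: "k holomorphic_on UNIV" and e: "ep > 0" and 0: "!!s. \<bar>s\<bar> < ep ==> k (of_real s) = 0"
  shows "k \<zeta> = 0"
proof -
  have lp: "(0::complex) islimpt of_real ` {-ep<..<ep}"
    unfolding islimpt_approachable
  proof (intro allI impI)
    fix d :: real assume d: "0 < d"
    define s where "s = min ep d / 2"
    have s: "0 < s" "s < ep" "s < d" using e d by (auto simp: s_def)
    show "\<exists>x'\<in>of_real ` {-ep<..<ep}. x' ~= (0::complex) \<and> dist x' 0 < d"
      using s by (intro bexI[of _ "of_real s"]) (auto simp: dist_norm)
  qed
  show ?thesis
    by (rule analytic_continuation[OF k open_UNIV connected_UNIV _ _ lp]) (use 0 in \<open>auto simp: abs_less_iff\<close>)
qed

text \<open>Reduces several variables to one: along p + zeta v with p and v real, D (0, v) = i D (v,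
  0) turns the real derivative into multiplication by D (v, 0).\<close>

lemma holomorphic_C_line:
  fixes K :: "'a::euclidean_space \<times> 'a => complex"
  assumes K: "holomorphic_C K"
  shows "(%\<zeta>. K (p + Re \<zeta> *\<^sub>R v, Im \<zeta> *\<^sub>R v)) holomorphic_on UNIV"
  unfolding holomorphic_on_def
proof
  fix \<zeta> :: complex
  let ?L = "%\<zeta>. (p + Re \<zeta> *\<^sub>R v, Im \<zeta> *\<^sub>R v)"
  obtain D where D: "(K has_derivative D) (at (?L \<zeta>))" "!!u w. D (- w, u) = \<i> * D (u, w)"
    using K unfolding holomorphic_C_def by blast
  have L: "(?L has_derivative (%h. (Re h *\<^sub>R v, Im h *\<^sub>R v))) (at \<zeta>)"
  proof (rule has_derivative_Pair)
    have "((%\<zeta>. p + Re \<zeta> *\<^sub>R v) has_derivative (%h. 0 + Re h *\<^sub>R v)) (at \<zeta>)"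
      by (intro has_derivative_add has_derivative_const has_derivative_scaleR_left bounded_linear_imp_has_derivative bounded_linear_Re)
    then show "((%\<zeta>. p + Re \<zeta> *\<^sub>R v) has_derivative (%h. Re h *\<^sub>R v)) (at \<zeta>)" by simp
    show "((%\<zeta>. Im \<zeta> *\<^sub>R v) has_derivative (%h. Im h *\<^sub>R v)) (at \<zeta>)"
      by (intro has_derivative_scaleR_left bounded_linear_imp_has_derivative bounded_linear_Im)
  qed
  have lin: "linear D" using D(1) has_derivative_linear by blast
  have "D (Re h *\<^sub>R v, Im h *\<^sub>R v) = D (v, 0) * h" for h
  proof -
    have "(Re h *\<^sub>R v, Im h *\<^sub>R v) = Re h *\<^sub>R (v, 0) + Im h *\<^sub>R (0, v)" by simp
    then have "D (Re h *\<^sub>R v, Im h *\<^sub>R v) = Re h *\<^sub>R D (v, 0) + Im h *\<^sub>R D (0, v)"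
      by (simp only: linear_add[OF lin] linear_scale[OF lin])
    also have "D (0, v) = \<i> * D (v, 0)" using D(2)[of 0 v] by simp
    finally show ?thesis by (simp add: scaleR_conv_of_real complex_eq_iff algebra_simps)
  qed
  then have "((%\<zeta>. K (?L \<zeta>)) has_derivative (%h. D (v, 0) * h)) (at \<zeta>)"
    using has_derivative_compose[OF L D(1)] by simp
  then have "((%\<zeta>. K (?L \<zeta>)) has_field_derivative D (v, 0)) (at \<zeta>)" unfolding has_field_derivative_def .
  then show "(%\<zeta>. K (?L \<zeta>)) field_differentiable at \<zeta> within UNIV" by (simp add: field_differentiable_def) blast
qed

text \<open>One-variable continuation is used twice: along the line from p through a real point x,
  evaluated at 1, and then along x + zeta y, evaluated at i.\<close>

lemma holomorphic_C_identity:
  fixes K :: "'a::euclidean_space \<times> 'a => complex"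
  assumes K: "holomorphic_C K" and r: "r > 0" and 0: "!!x. x : ball p r ==> K (x, 0) = 0"
  shows "K (x, y) = 0"
proof -
  have real0: "K (x, 0) = 0" for x
  proof -
    define ep where "ep = r / (norm (x - p) + 1)"
    have e: "ep > 0" using r by (simp add: ep_def add_nonneg_pos)
    have "K (p + Re 1 *\<^sub>R (x - p), Im 1 *\<^sub>R (x - p)) = 0"
    proof (rule entire_zero_on_real_interval[OF holomorphic_C_line[OF K] e])
      fix s :: real assume s: "\<bar>s\<bar> < ep"
      have "\<bar>s\<bar> * norm (x - p) \<le> ep * norm (x - p)" using s by (intro mult_right_mono) auto
      also have "... < ep * (norm (x - p) + 1)" using e by simp
      also have "... = r" by (simp add: ep_def add_nonneg_eq_0_iff)
      finally have "p + s *\<^sub>R (x - p) : ball p r" by (simp add: dist_norm)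
      then show "K (p + Re (of_real s) *\<^sub>R (x - p), Im (of_real s) *\<^sub>R (x - p)) = 0" using 0 by simp
    qed
    then show ?thesis by simp
  qed
  have "K (x + Re \<i> *\<^sub>R y, Im \<i> *\<^sub>R y) = 0"
    by (rule entire_zero_on_real_interval[OF holomorphic_C_line[OF K] zero_less_one]) (simp add: real0)
  then show ?thesis by simp
qed

lemma holomorphic_C_diff:
  assumes "holomorphic_C F" "holomorphic_C G"
  shows "holomorphic_C (%z. F z - G z)"
  unfolding holomorphic_C_def
proof
  fix z
  obtain D where D: "(F has_derivative D) (at z)" "!!u v. D (- v, u) = \<i> * D (u, v)" using assms(1) unfolding holomorphic_C_def by blast
  obtain D' where D': "(G has_derivative D') (at z)" "!!u v. D' (- v, u) = \<i> * D' (u, v)" using assms(2) unfolding holomorphic_C_def by blast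
  show "\<exists>D. ((%z. F z - G z) has_derivative D) (at z) \<and> (\<forall>u v. D (- v, u) = \<i> * D (u, v))"
    using has_derivative_diff[OF D(1) D'(1)] by (intro exI[of _ "%h. D h - D' h"]) (simp add: D(2) D'(2) algebra_simps)
qed

lemma holomorphic_C_continuous:
  assumes "holomorphic_C F"
  shows "continuous_on UNIV (%x. F (x, 0))"
proof -
  have "continuous (at z) F" for z
    using assms has_derivative_continuous unfolding holomorphic_C_def by blast
  then have "continuous_on UNIV F" by (simp add: continuous_at_imp_continuous_on)
  then show ?thesis by (rule continuous_on_compose2) (auto intro!: continuous_intros)
qed

section \<open>The Segal--Bargmann transform\<close>

context heckman_opdam
begin

lemma fourier_ip: "lam : Dom ==> FT f lam = ipm f (rphi lam)"
  unfolding fourier_def ip_m_def using phi_minus by simp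

lemma fourier_restr:
  assumes f: "restr f : borel_measurable lebesgue" and lam: "lam : Dom"
  shows "FT f lam = l2ip nu (restr f) (rphi lam)"
  unfolding fourier_ip[OF lam] l2ip_nu[OF f phi_lebesgue[OF lam]] ip_m_restr ..

lemma l2ip_phi_le:
  assumes f: "f : L2 nu" and lam: "lam : Dom"
  shows "norm (l2ip nu f (rphi lam)) \<le> (LINT x|nu. cmod (f x))"
proof -
  have "norm (l2ip nu f (rphi lam)) \<le> (LINT x|nu. norm (f x * cnj (rphi lam x)))"
    unfolding l2ip_def by (rule integral_norm_bound)
  also have "... \<le> (LINT x|nu. cmod (f x))"
  proof (rule integral_mono)
    show "integrable nu (%x. norm (f x * cnj (rphi lam x)))" by (rule integrable_norm[OF L2_integrable_mult[OF f phi_L2[OF lam]]])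
    show "integrable nu (%x. cmod (f x))" by (rule nu.L1_le_L2(1)[OF f zero_less_one])
    show "norm (f x * cnj (rphi lam x)) \<le> cmod (f x)" for x
      using norm_phi_le_one[OF lam, of x] by (simp add: norm_mult mult_left_le)
  qed
  finally show ?thesis .
qed

text \<open>As |R lam| <= 1 on real points, the series converges uniformly. A finite part containing
  mu has the exact coefficient, and the rest contributes at most its supremum times the total mass
  of nu.\<close>

lemma series_coefficient:
  assumes c: "(%lam. rc lam * norm (c lam)) summable_on Dom"
    and G: "G : L2 nu" "!!x. G x = (\<Sum>\<^sub>\<infinity>lam\<in>Dom. of_real (rc lam) * c lam * rphi lam x)"
    and mu: "\<mu> : Dom"
  shows "l2ip nu G (rphi \<mu>) = c \<mu>"
proof (rule ccontr)
  assume "l2ip nu G (rphi \<mu>) ~= c \<mu>"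
  let ?a = "%lam. rc lam * norm (c lam)" and ?I = "Dom"
  define N where "N = measure nu (space nu) + 1"
  have N: "0 < N" by (simp add: N_def add_nonneg_pos)
  define ep where "ep = norm (l2ip nu G (rphi \<mu>) - c \<mu>) / N"
  have e: "0 < ep" using \<open>_ ~= c \<mu>\<close> N by (simp add: ep_def)
  have "(sum ?a \<longlongrightarrow> infsum ?a ?I) (finite_subsets_at_top ?I)" using has_sum_infsum[OF c] unfolding has_sum_def .
  then have "eventually (%T. infsum ?a ?I - ep < sum ?a T) (finite_subsets_at_top ?I)" by (rule order_tendstoD) (use e in simp)
  from this[unfolded eventually_finite_subsets_at_top]
  obtain T0 where T0: "finite T0 \<and> T0 \<subseteq> ?I \<and> (\<forall>T. finite T \<and> T0 \<subseteq> T \<and> T \<subseteq> ?I --> infsum ?a ?I - ep < sum ?a T)"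
    by (rule exE)
  define T where "T = insert \<mu> T0"
  have T: "finite T" "T \<subseteq> ?I" "infsum ?a ?I - ep < sum ?a T" "\<mu> : T"
    proof -
    show TT: "finite T" "T \<subseteq> ?I" "\<mu> : T" using T0[THEN conjunct1] T0[THEN conjunct2, THEN conjunct1] mu by (simp_all add: T_def)
    have "T0 \<subseteq> T" by (auto simp: T_def)
    with TT show "infsum ?a ?I - ep < sum ?a T" by (intro T0[THEN conjunct2, THEN conjunct2, rule_format] conjI)
  qed
  have PL: "HO.PS c T : L2 nu" by (rule HO.PS_L2[OF T(2)])
  have bd: "norm (G x - HO.PS c T x) \<le> ep" for x
  proof -
    let ?s = "%lam. of_real (rc lam) * c lam * rphi lam x"
    have nb: "norm (?s lam) \<le> ?a lam" if lam: "lam : ?I" for lam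
    proof -
      have "norm (?s lam) = ?a lam * norm (rphi lam x)" using r_coef_pos[OF lam] by (simp add: norm_mult)
      also have "... \<le> ?a lam * 1" using norm_phi_le_one[OF lam] r_coef_pos[OF lam] by (intro mult_left_mono) auto
      finally show ?thesis by simp
    qed
    have sI: "?s summable_on ?I" by (rule summable_on_norm_bound(1)[OF c nb])
    have sT: "?s summable_on T" "?a summable_on T" using T(1) by (auto intro: summable_on_finite)
    have aD: "?a summable_on (?I - T)" by (rule summable_on_subset_banach[OF c]) auto
    have "G x - HO.PS c T x = infsum ?s (?I - T)"
      unfolding G(2) HO.PS_def infsum_Diff[OF sI sT(1) T(2)] using T(1) by simp
    also have "norm ... \<le> infsum ?a (?I - T)" by (rule summable_on_norm_bound(2)[OF aD]) (use nb in blast)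
    also have "... = infsum ?a ?I - sum ?a T" unfolding infsum_Diff[OF c sT(2) T(2)] using T(1) by simp
    also have "... \<le> ep" using T(3) by simp
    finally show ?thesis .
  qed
  have DL: "(%x. G x - HO.PS c T x) : L2 nu" by (rule L2_diff[OF G(1) PL])
  have "l2ip nu G (rphi \<mu>) - c \<mu> = l2ip nu (%x. G x - HO.PS c T x) (rphi \<mu>)"
    unfolding l2ip_diff_left[OF G(1) PL phi_L2[OF mu]] HO.l2ip_PS_e[OF T(1,2) mu] using T(4) by simp
  also have "norm ... \<le> (LINT x|nu. cmod (G x - HO.PS c T x))" by (rule l2ip_phi_le[OF DL mu])
  also have "... \<le> (LINT x|nu. ep)"
    using bd by (intro integral_mono nu.L1_le_L2(1)[OF DL zero_less_one]) auto
  also have "... < ep * N" using e by (simp add: N_def algebra_simps)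
  also have "... = norm (l2ip nu G (rphi \<mu>) - c \<mu>)" using N by (simp add: ep_def)
  finally show False by simp
qed

lemma restr_continuous:
  assumes "continuous_on UNIV F"
  shows "F : borel_measurable lebesgue" "restr F : borel_measurable lebesgue" "restr F : L2 nu"
proof -
  have b: "F : borel_measurable borel" by (rule borel_measurable_continuous_onI[OF assms])
  then show "F : borel_measurable lebesgue" by (rule borel_lebesgue)
  have A: "A0 : sets borel" using closed_alcove by (rule borel_closed)
  have rb: "restr F : borel_measurable borel"
    unfolding restr_def[abs_def] using b A by (intro borel_measurable_scaleR borel_measurable_indicator)
  then show "restr F : borel_measurable lebesgue" by (rule borel_lebesgue)
  have "compact (F ` A0)" by (rule compact_continuous_image[OF continuous_on_subset[OF assms] compact_alcove]) simp
  from compact_imp_bounded[OF this, unfolded bounded_iff] obtain K where K: "\<forall>y\<in>F ` A0. norm y \<le> K" by (rule exE)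
  show "restr F : L2 nu"
  proof (rule good_L2, rule goodI[OF rb])
    show "norm (restr F x) \<le> max K 0" for x 
    proof (cases "x : A0")
      case True
      then have "norm (F x) \<le> K" using K by blast
      then show ?thesis using True by (simp add: restr_def)
    qed (simp add: restr_def)
  qed
qed

lemma segal_bargmann_entire:
  assumes t: "t > 0" and f: "f : L2_m Rp m"
  shows "holomorphic_C (SB t f)" "waff_invariant R (SB t f)"
proof -
  have b: "norm (FT f lam) \<le> (LINT x|nu. cmod (restr f x))" if "lam : Dom" for lam
    unfolding fourier_restr[OF restr_lebesgue[OF f] that] by (rule l2ip_phi_le[OF restr_L2[OF f] that])
  have eq: "SB t f = (%z. \<Sum>\<^sub>\<infinity>lam\<in>Dom. of_real (rc lam * exp (- eig lam * t)) * FT f lam * phi lam z)"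
    by (rule ext) (rule segal_bargmann_def)
  show "holomorphic_C (SB t f)" unfolding eq by (rule heat_series(1)[OF t b])
  show "waff_invariant R (SB t f)" unfolding eq by (rule heat_series(2)[OF t b])
qed

lemma fourier_segal_bargmann:
  assumes t: "t > 0" and f: "f : L2_m Rp m" and mu: "\<mu> : Dom"
  shows "FT (%x. SB t f (x, 0)) \<mu> = of_real (exp (- eig \<mu> * t)) * FT f \<mu>"
proof -
  let ?G = "%x. SB t f (x, 0)" and ?r = "rc"
  define K where "K = (LINT x|nu. cmod (restr f x))"
  define c where "c lam = of_real (exp (- eig lam * t)) * FT f lam" for lam
  have b: "norm (FT f lam) \<le> K" if "lam : Dom" for lam
    unfolding fourier_restr[OF restr_lebesgue[OF f] that] K_def by (rule l2ip_phi_le[OF restr_L2[OF f] that])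
  have cont: "continuous_on UNIV ?G" by (rule holomorphic_C_continuous[OF segal_bargmann_entire(1)[OF t f]])
  have "(%lam. ?r lam * exp (- eig lam * t)) summable_on Dom" using summable_heat[OF t, of 0] by simp
  from summable_on_cmult_left[OF this, of K]
  have sm: "(%lam. ?r lam * norm (c lam)) summable_on Dom"
  proof (rule summable_on_comparison_test)
    fix lam assume lam: "lam : Dom"
    have "?r lam * norm (c lam) = ?r lam * exp (- eig lam * t) * norm (FT f lam)" by (simp add: c_def norm_mult)
    also have "... \<le> ?r lam * exp (- eig lam * t) * K" using b[OF lam] r_coef_pos[OF lam] by (intro mult_left_mono) auto
    finally show "?r lam * norm (c lam) \<le> ?r lam * exp (- eig lam * t) * K" .
    show "0 \<le> ?r lam * norm (c lam)" using r_coef_pos[OF lam] by simp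
  qed
  have Geq: "?G x = (\<Sum>\<^sub>\<infinity>lam\<in>Dom. of_real (?r lam) * c lam * rphi lam x)" for x
    unfolding segal_bargmann_def c_def by (intro infsum_cong) (simp add: mult.assoc)
  have GL: "?G : L2 nu"
  proof (rule good_L2, rule goodI)
    show "?G : borel_measurable borel" by (rule borel_measurable_continuous_onI[OF cont])
    show "norm (?G x) \<le> infsum (%lam. ?r lam * norm (c lam)) (Dom)" for x
      unfolding Geq
    proof (rule summable_on_norm_bound(2)[OF sm])
      fix lam assume lam: "lam : Dom"
      have "norm (of_real (?r lam) * c lam * rphi lam x) = ?r lam * norm (c lam) * norm (rphi lam x)" using r_coef_pos[OF lam] by (simp add: norm_mult)
      also have "... \<le> ?r lam * norm (c lam) * 1" using norm_phi_le_one[OF lam] r_coef_pos[OF lam] by (intro mult_left_mono) auto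
      finally show "norm (of_real (?r lam) * c lam * rphi lam x) \<le> ?r lam * norm (c lam)" by simp
    qed
  qed
  have "l2ip nu ?G (rphi \<mu>) = c \<mu>" by (rule series_coefficient[OF sm GL Geq mu])
  then show ?thesis unfolding fourier_ip[OF mu] l2ip_nu[OF restr_continuous(1)[OF cont] phi_lebesgue[OF mu], symmetric] c_def fourier_ip[OF mu] .
qed

lemma exp_cancel: "(cmod (of_real (exp (- th * t)) * z))^2 * exp (2 * t * th) = (cmod z)^2"
proof -
  have "(exp (- th * t))^2 * exp (2 * t * th) = 1" by (simp add: power2_eq_square exp_add[symmetric])
  then show ?thesis by (simp add: norm_mult power_mult_distrib mult.assoc mult.commute mult.left_commute)
qed

lemma exp_cancel2: "of_real r * (of_real (exp (- th * t)) * z) * cnj (of_real (exp (- th * t)) * w) * of_real (exp (2 * t * th)) = of_real r * z * cnj w" for r th t :: real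
proof -
  have "exp (- th * t) * exp (- th * t) * exp (2 * t * th) = 1" by (simp add: exp_add[symmetric])
  then have "complex_of_real (exp (- th * t)) * of_real (exp (- th * t)) * of_real (exp (2 * t * th)) = 1" by (metis of_real_mult of_real_1)
  moreover have "of_real r * (of_real (exp (- th * t)) * z) * cnj (of_real (exp (- th * t)) * w) * of_real (exp (2 * t * th)) =
     (of_real (exp (- th * t)) * of_real (exp (- th * t)) * of_real (exp (2 * t * th))) * (of_real r * z * cnj w)" by simp
  ultimately show ?thesis by simp
qed

lemma segal_bargmann_Ht:
  assumes t: "t > 0" and f: "f : L2_m Rp m"
  shows "SB t f : Ht_space R Rp m t"
proof -
  have "(%lam. rc lam * (cmod (l2ip nu (restr f) (rphi lam)))^2) summable_on Dom"
    by (rule HO.coefficients_summable[OF restr_L2[OF f]])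
  then have "(%lam. rc lam * (cmod (FT (%x. SB t f (x, 0)) lam))^2 * exp (2 * t * eig lam))
        summable_on Dom"
  proof (rule summable_on_cong[THEN iffD1, rotated])
    fix lam assume lam: "lam : Dom"
    show "rc lam * (cmod (l2ip nu (restr f) (rphi lam)))^2 =
      rc lam * (cmod (FT (%x. SB t f (x, 0)) lam))^2 * exp (2 * t * eig lam)"
      unfolding mult.assoc[of "rc lam"] fourier_segal_bargmann[OF t f lam] exp_cancel fourier_restr[OF restr_lebesgue[OF f] lam] ..
  qed
  then show ?thesis unfolding Ht_space_def using segal_bargmann_entire[OF t f] by blast
qed

lemma segal_bargmann_isometry:
  assumes t: "t > 0" and f: "f : L2_m Rp m" and g: "g : L2_m Rp m"
  shows "Ht_inner R Rp m t (SB t f) (SB t g) = ipm f g"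
proof -
  have "Ht_inner R Rp m t (SB t f) (SB t g) =
    (\<Sum>\<^sub>\<infinity>lam\<in>Dom. of_real (rc lam) * l2ip nu (restr f) (rphi lam) * cnj (l2ip nu (restr g) (rphi lam)))"
    unfolding Ht_inner_def
  proof (rule infsum_cong)
    fix lam assume lam: "lam : Dom"
    show "of_real (rc lam) * FT (%x. SB t f (x, 0)) lam *
      cnj (FT (%x. SB t g (x, 0)) lam) * of_real (exp (2 * t * eig lam)) =
      of_real (rc lam) * l2ip nu (restr f) (rphi lam) * cnj (l2ip nu (restr g) (rphi lam))"
      unfolding fourier_segal_bargmann[OF t f lam] fourier_segal_bargmann[OF t g lam] exp_cancel2
        fourier_restr[OF restr_lebesgue[OF f] lam] fourier_restr[OF restr_lebesgue[OF g] lam] ..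
  qed
  also have "... = l2ip nu (restr f) (restr g)" by (rule infsumI[OF HO.parseval[OF restr_L2[OF f] restr_L2[OF g]]])
  also have "... = ipm f g" unfolding l2ip_nu[OF restr_lebesgue[OF f] restr_lebesgue[OF g]] ip_m_restr ..
  finally show ?thesis .
qed

text \<open>Totality gives equality almost everywhere on the alcove, continuity gives it on a whole
  ball about \<open>pt0\<close>, and the identity principle extends it to the
  complexification.\<close>

lemma fourier_unique:
  assumes F: "holomorphic_C F" and G: "holomorphic_C G"
    and eq: "!!lam. lam : Dom ==> FT (%x. F (x, 0)) lam = FT (%x. G (x, 0)) lam"
  shows "F = G"
proof -
  let ?F = "%x. F (x, 0)" and ?G = "%x. G (x, 0)"
  note cF = holomorphic_C_continuous[OF F] and cG = holomorphic_C_continuous[OF G]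
  have "AE x in nu. restr ?F x - restr ?G x = 0"
  proof (rule nu_total[OF L2_diff[OF restr_continuous(3)[OF cF] restr_continuous(3)[OF cG]]])
    fix lam assume lam: "lam : Dom"
    show "l2ip nu (%x. restr ?F x - restr ?G x) (rphi lam) = 0"
      unfolding l2ip_diff_left[OF restr_continuous(3)[OF cF] restr_continuous(3)[OF cG] phi_L2[OF lam]]
        fourier_restr[OF restr_continuous(2)[OF cF] lam, symmetric] fourier_restr[OF restr_continuous(2)[OF cG] lam, symmetric] eq[OF lam] by simp
  qed
  then have AE: "AE x in lebesgue. x : A0 --> restr ?F x - restr ?G x = 0" unfolding AE_nu_iff .
  obtain r where r: "r > 0" "\<forall>y\<in>ball pt0 r. \<forall>a\<in>Rp. 0 < a \<bullet> y \<and> a \<bullet> y < pi" using open_alcove_ball by blast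
  have BA: "ball pt0 r \<subseteq> A0" using r(2) by (auto simp: alcove_def less_imp_le)
  define U where "U = ball pt0 r \<inter> (%x. F (x, 0) - G (x, 0)) -` (- {0})"
  have cD: "continuous_on (ball pt0 r) (%x. F (x, 0) - G (x, 0))"
    by (rule continuous_on_subset[OF continuous_on_diff[OF cF cG]]) simp
  have "open U" unfolding U_def by (rule continuous_open_preimage[OF cD]) auto
  have "AE x in lebesgue. x \<notin> U"
    using AE by eventually_elim (use BA in \<open>auto simp: U_def restr_def\<close>)
  then have "U : null_sets lebesgue" using \<open>open U\<close> by (subst (asm) AE_iff_null_sets[symmetric]) (auto simp: lebesgue_openin)
  then have "negligible U" by (simp add: negligible_iff_null_sets)
  then have "U = {}" using open_not_negligible[OF \<open>open U\<close>] by blast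
  then have "F (x, 0) - G (x, 0) = 0" if "x : ball pt0 r" for x using that by (auto simp: U_def)
  then have "F (x, y) - G (x, y) = 0" for x y by (rule holomorphic_C_identity[OF holomorphic_C_diff[OF F G] r(1)])
  then show ?thesis by (auto simp: fun_eq_iff)
qed

lemma segal_bargmann_surj:
  assumes t: "t > 0" and F: "F : Ht_space R Rp m t"
  shows "\<exists>f\<in>L2_m Rp m. SB t f = F"
proof -
  let ?F = "%x. F (x, 0)"
  have hF: "holomorphic_C F" and sF: "(%lam. rc lam * (cmod (FT ?F lam))^2 * exp (2 * t * eig lam)) summable_on Dom"
    using F unfolding Ht_space_def by blast+
  \<comment> \<open>Undoing the heat multiplier: membership in \<open>Ht_space\<close> says that
    these coefficients are square summable with weights \<open>rc\<close>.\<close>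
  define c where "c lam = of_real (exp (eig lam * t)) * FT ?F lam" for lam
  have eq: "rc lam * (cmod (c lam))^2 = rc lam * (cmod (FT ?F lam))^2 * exp (2 * t * eig lam)" for lam
  proof -
    have "(exp (eig lam * t))^2 = exp (2 * t * eig lam)" by (simp add: power2_eq_square exp_add[symmetric])
    then show ?thesis by (simp add: c_def norm_mult power_mult_distrib)
  qed
  have "(%lam. rc lam * (cmod (c lam))^2) summable_on Dom" unfolding eq by (rule sF)
  then obtain f where f: "f : L2 nu" "\<forall>lam\<in>Dom. l2ip nu f (rphi lam) = c lam" using HO.riesz_fischer by blast
  have fm: "f : borel_measurable lebesgue" using L2D(1)[OF f(1)] by (simp add: borel_nu)
  have fL: "f : L2_m Rp m" using L2_nu_iff[OF fm] f(1) by blast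
  have "FT (%x. SB t f (x, 0)) lam = FT ?F lam" if lam: "lam : Dom" for lam
  proof -
    have "FT f lam = c lam" unfolding fourier_ip[OF lam] l2ip_nu[OF fm phi_lebesgue[OF lam], symmetric] using f(2) lam by blast
    moreover have "complex_of_real (exp (- eig lam * t)) * of_real (exp (eig lam * t)) = 1"
      unfolding of_real_mult[symmetric] exp_add[symmetric] by simp
    ultimately show ?thesis unfolding fourier_segal_bargmann[OF t fL lam] c_def by (simp add: mult.assoc[symmetric])
  qed
  then have "SB t f = F" by (rule fourier_unique[OF segal_bargmann_entire(1)[OF t fL] hF])
  then show ?thesis using fL by blast
qed

end

theorem theorem4p10:
  fixes R Rp :: "'a::euclidean_space set" and m :: "'a \<Rightarrow> real" and t :: real
  assumes "root_system R"
    and "positive_subsystem R Rp"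
    and "\<forall>\<alpha>\<in>R. 0 \<le> m \<alpha>"
    and "\<forall>w\<in>weyl_group R. \<forall>\<alpha>\<in>R. m (w \<alpha>) = m \<alpha>"
    and "t > 0"
  shows "(\<forall>f\<in>L2_m Rp m. \<forall>g\<in>L2_m Rp m.
            segal_bargmann R Rp m t f \<in> Ht_space R Rp m t \<and>
            Ht_inner R Rp m t (segal_bargmann R Rp m t f) (segal_bargmann R Rp m t g) = ip_m Rp m f g)
       \<and> (\<forall>F\<in>Ht_space R Rp m t. \<exists>f\<in>L2_m Rp m. segal_bargmann R Rp m t f = F)"
proof -
  interpret heckman_opdam R Rp m
    by unfold_locales (use assms in auto)
  show ?thesis
    using segal_bargmann_Ht[OF assms(5)] segal_bargmann_isometry[OF assms(5)] segal_bargmann_surj[OF assms(5)] by blast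
qed

end
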